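(* Let $n\ge3$, $2\le m\le n-1$, $1<p<\infty$, $0<\sigma<\min\{1,\frac np\}$, and let $K$ be a cone in $\mathbb{R}^m$. If $p>m$ and $\sigma\le\frac{n(p-m)}{p(n-m)}$, suppose in addition that $K\neq\mathbb{R}^m$. Put $\Omega=K\times\mathbb{R}^{n-m}$. Then the sharp constant $\mathcal{N}(p,\sigma,\Omega)$ in the inequality $$\big\||y|^{\sigma-1}v\big\|_{p^*_\sigma,\Omega}\le\mathcal{N}(p,\sigma,\Omega)\,\|\nabla v\|_{p,\Omega},\qquad v\in\dot W^1_p(\Omega),$$ is attained, i.e. there exists a function $V\in\dot W^1_p(\Omega)$, $V>0$ in $\Omega$, for which this inequality becomes an equality.
   Context: Points of $\mathbb{R}^n=\mathbb{R}^m\times\mathbb{R}^{n-m}$ are written $x=(y;z)$ with $y\in\mathbb{R}^m$, $z\in\mathbb{R}^{n-m}$. A cone in $\mathbb{R}^m$ is a nonempty open connected set invariant under $y\mapsto ty$ for all $t>0$ (the whole space $\mathbb{R}^m$ counts as a cone). $p^*_\sigma=\frac{np}{n-\sigma p}$. For a domain $\Omega\subset\mathbb{R}^n$, $\dot W^1_p(\Omega)$ is the closure of $C_0^\infty(\Omega)$ with respect to the norm $\|\nabla v\|_{p,\Omega}=\|\nabla v\|_{L_p(\Omega)}$; $\|\cdot\|_{q,\Omega}$ is the norm of $L_q(\Omega)$. The sharp constant is the smallest constant for which the inequality holds for all $v\in\dot W^1_p(\Omega)$. *)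

theory Defs
  imports "HOL-Analysis.Analysis"
begin

text \<open>All function spaces are over an open set \<open>\<Omega>\<close> of a Euclidean space; functions are total and only
  their values on \<open>\<Omega>\<close> matter. Measurability and integration are with respect to Lebesgue measure.
  The space \<open>R^m \<times> R^{n-m}\<close> is rendered as a product type, whose norm is the Euclidean one.\<close>

text \<open>The library's \<^const>\<open>cone\<close> and \<^const>\<open>conic\<close> allow multiplication by \<open>0\<close> and are not used here.\<close>

definition open_cone :: "'a::euclidean_space set \<Rightarrow> bool" where
  "open_cone K \<longleftrightarrow> K \<noteq> {} \<and> open K \<and> connected K \<and> (\<forall>y\<in>K. \<forall>t>0. t *\<^sub>R y \<in> K)"

definition partial_deriv :: "'a::euclidean_space \<Rightarrow> ('a \<Rightarrow> real) \<Rightarrow> 'a \<Rightarrow> real" where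
  "partial_deriv b f x = frechet_derivative f (at x) b"

definition gradient :: "('a::euclidean_space \<Rightarrow> real) \<Rightarrow> 'a \<Rightarrow> 'a" where
  "gradient f x = (\<Sum>b\<in>Basis. partial_deriv b f x *\<^sub>R b)"

primrec C_class :: "nat \<Rightarrow> ('a::euclidean_space \<Rightarrow> real) \<Rightarrow> bool" where
  "C_class 0 f \<longleftrightarrow> continuous_on UNIV f"
| "C_class (Suc k) f \<longleftrightarrow> f differentiable_on UNIV \<and> (\<forall>b\<in>Basis. C_class k (partial_deriv b f))"

text \<open>\<open>C\<^sub>0\<^sup>\<infinity>(\<Omega>)\<close>, the functions being extended by zero outside \<open>\<Omega>\<close>.\<close>

definition test_functions :: "'a::euclidean_space set \<Rightarrow> ('a \<Rightarrow> real) set" where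
  "test_functions \<Omega> =
     {\<phi>. (\<forall>k. C_class k \<phi>) \<and> compact (closure {x. \<phi> x \<noteq> 0}) \<and> closure {x. \<phi> x \<noteq> 0} \<subseteq> \<Omega>}"

definition locally_integrable ::
    "'a::euclidean_space set \<Rightarrow> ('a \<Rightarrow> 'b::euclidean_space) \<Rightarrow> bool" where
  "locally_integrable \<Omega> f \<longleftrightarrow> (\<forall>C. compact C \<and> C \<subseteq> \<Omega> \<longrightarrow> set_integrable lebesgue C f)"

definition in_Lp :: "real \<Rightarrow> 'a::euclidean_space set \<Rightarrow> ('a \<Rightarrow> 'b::euclidean_space) \<Rightarrow> bool" where
  "in_Lp p \<Omega> f \<longleftrightarrow> set_borel_measurable lebesgue \<Omega> f \<and>
     set_integrable lebesgue \<Omega> (\<lambda>x. norm (f x) powr p)"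

text \<open>Only meaningful together with \<open>in_Lp\<close>, since the integral is \<open>0\<close> for non-integrable functions.\<close>

definition Lp_norm :: "real \<Rightarrow> 'a::euclidean_space set \<Rightarrow> ('a \<Rightarrow> 'b::euclidean_space) \<Rightarrow> real" where
  "Lp_norm p \<Omega> f = (LINT x:\<Omega>|lebesgue. norm (f x) powr p) powr (1 / p)"

definition has_weak_gradient ::
    "'a::euclidean_space set \<Rightarrow> ('a \<Rightarrow> real) \<Rightarrow> ('a \<Rightarrow> 'a) \<Rightarrow> bool" where
  "has_weak_gradient \<Omega> v G \<longleftrightarrow> locally_integrable \<Omega> v \<and> locally_integrable \<Omega> G \<and>
     (\<forall>\<phi>\<in>test_functions \<Omega>. \<forall>b\<in>Basis.
        (LINT x:\<Omega>|lebesgue. v x * partial_deriv b \<phi> x) = - (LINT x:\<Omega>|lebesgue. (G x \<bullet> b) * \<phi> x))"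

text \<open>A representative of \<open>\<nabla>v\<close>; it is determined up to a null set in \<open>\<Omega>\<close>.\<close>

definition weak_gradient :: "'a::euclidean_space set \<Rightarrow> ('a \<Rightarrow> real) \<Rightarrow> 'a \<Rightarrow> 'a" where
  "weak_gradient \<Omega> v = (SOME G. has_weak_gradient \<Omega> v G)"

text \<open>The closure of \<open>C\<^sub>0\<^sup>\<infinity>(\<Omega>)\<close> in the norm \<open>\<parallel>\<nabla>v\<parallel>\<^sub>p\<close>, realised as a space of functions. The gradient
  determines a limit only up to a constant, so local \<open>L\<^sub>1\<close> convergence is required as well; without it
  nonzero constants would be limits of the zero sequence. When the inequality below holds with
  \<open>\<sigma> < 1\<close>, every gradient-Cauchy sequence of test functions converges locally in \<open>L\<^sub>1\<close>, because
  \<open>|y|^(\<sigma>-1)\<close> is bounded below on bounded sets, and the space is the completion of \<open>C\<^sub>0\<^sup>\<infinity>(\<Omega>)\<close>.\<close>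

definition homogeneous_sobolev :: "real \<Rightarrow> 'a::euclidean_space set \<Rightarrow> ('a \<Rightarrow> real) set" where
  "homogeneous_sobolev p \<Omega> =
     {v. (\<exists>G. has_weak_gradient \<Omega> v G) \<and> in_Lp p \<Omega> (weak_gradient \<Omega> v) \<and>
         (\<exists>\<phi> :: nat \<Rightarrow> 'a \<Rightarrow> real.
            (\<forall>k. \<phi> k \<in> test_functions \<Omega>) \<and>
            (\<lambda>k. Lp_norm p \<Omega> (\<lambda>x. gradient (\<phi> k) x - weak_gradient \<Omega> v x)) \<longlonglongrightarrow> 0 \<and>
            (\<forall>C. compact C \<and> C \<subseteq> \<Omega> \<longrightarrow>
               (\<lambda>k. LINT x:C|lebesgue. \<bar>\<phi> k x - v x\<bar>) \<longlonglongrightarrow> 0))}"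

definition critical_exponent :: "nat \<Rightarrow> real \<Rightarrow> real \<Rightarrow> real" where
  "critical_exponent n p \<sigma> = real n * p / (real n - \<sigma> * p)"

text \<open>The function \<open>|y|^(\<sigma>-1) v\<close> of \<open>x = (y; z)\<close>. Its value on the null set \<open>y = 0\<close> is irrelevant.\<close>

definition hs_weighted ::
    "real \<Rightarrow> ('a::euclidean_space \<times> 'b::euclidean_space \<Rightarrow> real) \<Rightarrow> 'a \<times> 'b \<Rightarrow> real" where
  "hs_weighted \<sigma> v x = norm (fst x) powr (\<sigma> - 1) * v x"

text \<open>Finiteness of the left-hand norm is part of the inequality.\<close>

definition hardy_sobolev_inequality ::
    "nat \<Rightarrow> real \<Rightarrow> real \<Rightarrow> ('a::euclidean_space \<times> 'b::euclidean_space) set \<Rightarrow> real \<Rightarrow> bool" where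
  "hardy_sobolev_inequality n p \<sigma> \<Omega> N \<longleftrightarrow>
     (\<forall>v\<in>homogeneous_sobolev p \<Omega>.
        in_Lp (critical_exponent n p \<sigma>) \<Omega> (hs_weighted \<sigma> v) \<and>
        Lp_norm (critical_exponent n p \<sigma>) \<Omega> (hs_weighted \<sigma> v)
          \<le> N * Lp_norm p \<Omega> (weak_gradient \<Omega> v))"

definition is_sharp_constant ::
    "nat \<Rightarrow> real \<Rightarrow> real \<Rightarrow> ('a::euclidean_space \<times> 'b::euclidean_space) set \<Rightarrow> real \<Rightarrow> bool" where
  "is_sharp_constant n p \<sigma> \<Omega> N \<longleftrightarrow>
     hardy_sobolev_inequality n p \<sigma> \<Omega> N \<and>
     (\<forall>N'. hardy_sobolev_inequality n p \<sigma> \<Omega> N' \<longrightarrow> N \<le> N')"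

end

theory Submission
 imports Defs "HOL-Analysis.Radon_Nikodym" "HOL-Library.Diagonal_Subsequence"
begin

text \<open>The weighted inequality comes from a local Sobolev inequality on balls comparable to the distance from the
plane \<open>y = 0\<close>, applied to \<open>u (2y, z) - u (y, z)\<close>: the dilation multiplies the weighted integral by a power
of 2 that differs from 1 unless \<open>\<beta> = m\<close>, a case recovered by interpolation between exponents.

A maximising sequence is normalised by dilations and by translations along the plane, so that the unit ball at the
origin carries at least half of the mass and no ball of radius \<open>1/2\<close> centred on the plane does. Since \<open>q > p\<close>, a near-maximiser
cannot be split by a cutoff into two parts that both carry mass; this gives tightness and excludes concentration
at the plane. Away from the plane \<open>q\<close> is subcritical because \<open>\<sigma> < 1\<close>, and Rellich's theorem applies. Hence the
sequence is Cauchy in the weighted norm, and by uniform convexity its gradients are Cauchy in \<open>L\<^sub>p\<close>.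

For positivity, near-maximality of \<open>u\<close> against \<open>u + t \<theta> (u + \<epsilon>) powr (1 - p)\<close> bounds the gradient of \<open>ln (u + \<epsilon>)\<close> in
\<open>L\<^sub>p\<close> on a ball uniformly in \<open>\<epsilon>\<close>. So on each ball the limit is either positive or zero almost everywhere, and
connectedness of \<open>\<Omega>\<close> excludes the second case.\<close>

text \<open>For \<open>\<beta> \<ge> m\<close> the weight is not integrable near the plane, so a
  continuous function must vanish on the plane to have finite mass; hence the exceptional hypothesis
  \<open>K \<noteq> UNIV\<close>. The dilation difference is used because it is an integral of the
  gradient over a segment of length \<open>\<bar>y\<bar>\<close>: Hardy's bound holds for it at
  every \<open>p\<close>, also at \<open>p = m\<close>, where it fails for \<open>u\<close> itself.

  No weak limits occur. The midpoint of two late members of the maximising sequence has nearly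
  maximal mass, hence nearly full energy, and that is the input of uniform convexity. The
  maximisation is carried out among test functions; the closure is reached only at the end, by
  completeness.

  The derivative of \<open>(u + \<epsilon>) powr (1 - p)\<close> contains
  \<open>(u + \<epsilon>) powr (- p)\<close>, so the perturbation lowers the energy by a multiple of
  a local energy of \<open>ln (u + \<epsilon>)\<close> while the mass does not decrease. A
  near-maximiser admits only a small net drop, and a step \<open>t\<close> of order
  \<open>\<epsilon> powr p\<close> leaves a bound that in the limit does not depend on
  \<open>\<epsilon>\<close>.\<close>

abbreviation (input) Borel :: "('a::topological_space \<Rightarrow> 'b::topological_space) set" where
 "Borel \<equiv> borel_measurable borel"

text \<open>Integrals without a measure are over Lebesgue measure and take values in \<^typ>\<open>ennreal\<close>, also for real integrands.\<close>

syntax "_lnn" :: "pttrn \<Rightarrow> real \<Rightarrow> ennreal" ("(2\<integral>_./ _)" [0, 10] 10)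
 "_lnn_set" :: "pttrn \<Rightarrow> 'a set \<Rightarrow> real \<Rightarrow> ennreal" ("(2\<integral>_\<in>_./ _)" [0, 0, 10] 10)
 "_lnn_ennreal" :: "pttrn \<Rightarrow> ennreal \<Rightarrow> ennreal" ("(2\<integral>\<^sup>+_./ _)" [0, 10] 10)
 "_lnn_ennreal_set" :: "pttrn \<Rightarrow> 'a set \<Rightarrow> ennreal \<Rightarrow> ennreal" ("(2\<integral>\<^sup>+_\<in>_./ _)" [0, 0, 10] 10)
translations "\<integral>x. f" \<rightharpoonup> "CONST nn_integral CONST lborel (\<lambda>x. CONST ennreal f)"
 "\<integral>x\<in>S. f" \<rightharpoonup> "CONST nn_integral CONST lborel (\<lambda>x. CONST ennreal f * CONST indicator S x)"
 "\<integral>\<^sup>+x. f" \<rightharpoonup> "CONST nn_integral CONST lborel (\<lambda>x. f)"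
 "\<integral>\<^sup>+x\<in>S. f" \<rightharpoonup> "CONST nn_integral CONST lborel (\<lambda>x. f * CONST indicator S x)"

lemmas LINT_def = set_lebesgue_integral_def

abbreviation (input) dil :: "real \<Rightarrow> 'a::real_vector \<times> 'b \<Rightarrow> 'a \<times> 'b" where "dil c x \<equiv> (c *\<^sub>R fst x, snd x)"

abbreviation (input) grad_powr :: "real \<Rightarrow> ('a::euclidean_space \<Rightarrow> real) \<Rightarrow> 'a \<Rightarrow> real" where
 "grad_powr p f x \<equiv> norm (gradient f x) powr p"

section \<open>Gradients and smooth functions\<close>

lemma partial_deriv_eq:
 assumes "(f has_derivative D) (at x)"
 shows "partial_deriv b f x = D b"
 using frechet_derivative_at[OF assms] by (simp add: partial_deriv_def)

lemma gradient_eqI: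
 assumes "(f has_derivative (\<lambda>h. g \<bullet> h)) (at x)"
 shows "gradient f x = g"
 unfolding gradient_def partial_deriv_eq[OF assms] by (rule euclidean_representation)

lemma has_derivative_gradient:
 assumes "f differentiable (at x)"
 shows "(f has_derivative (\<lambda>h. gradient f x \<bullet> h)) (at x)"
proof -
 let ?D = "frechet_derivative f (at x)"
 have D: "(f has_derivative ?D) (at x)" using assms by (rule frechet_derivative_works[THEN iffD1])
 then interpret linear ?D by (rule has_derivative_linear)
 have "?D h = gradient f x \<bullet> h" for h
 proof -
  have "?D h = ?D (\<Sum>b\<in>Basis. (h \<bullet> b) *\<^sub>R b)" by (simp add: euclidean_representation)
  also have "... = (\<Sum>b\<in>Basis. (h \<bullet> b) * ?D b)" by (simp add: sum scale)
  also have "... = gradient f x \<bullet> h" unfolding gradient_def partial_deriv_def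
   by (simp add: inner_sum_left inner_commute[of h] mult.commute)
  finally show ?thesis .
 qed
 then have "?D = (\<lambda>h. gradient f x \<bullet> h)" by auto
 then show ?thesis using D by simp
qed

lemma partial_deriv_inner: "f differentiable (at x) \<Longrightarrow> partial_deriv b f x = gradient f x \<bullet> b"
 by (rule partial_deriv_eq[OF has_derivative_gradient])

section \<open>Closure properties of the classes \<open>C_class k\<close>\<close>

lemma C_class_SucD: "C_class (Suc k) f \<Longrightarrow> C_class k f"
 by (induction k arbitrary: f) (auto intro: differentiable_imp_continuous_on)

lemma C_class_antimono: "j \<le> k \<Longrightarrow> C_class k f \<Longrightarrow> C_class j f"
 by (induction k) (auto simp: le_Suc_eq simp del: C_class.simps dest: C_class_SucD)

lemma C_class_differentiable: "C_class (Suc k) f \<Longrightarrow> f differentiable (at x)"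
 by (simp add: differentiable_on_def)

lemma C_class_continuous: "C_class k f \<Longrightarrow> continuous_on UNIV f"
 using C_class_antimono[of 0 k f] by simp

lemma C_class_const: "C_class k (\<lambda>x. c)"
proof (induction k arbitrary: c)
 case (Suc k)
 have "partial_deriv b (\<lambda>x. c) = (\<lambda>x. 0)" for b :: 'a
  by (rule ext, rule partial_deriv_eq) (rule has_derivative_const)
 then show ?case using Suc by (simp add: differentiable_on_def)
qed simp

lemma C_class_inner: "C_class k (\<lambda>x. x \<bullet> a)"
proof (cases k)
 case (Suc j)
 have "partial_deriv b (\<lambda>x. x \<bullet> a) = (\<lambda>x. b \<bullet> a)" for b :: 'a
  by (rule ext, rule partial_deriv_eq) (auto intro!: derivative_eq_intros)
 then show ?thesis using Suc by (auto simp: C_class_const differentiable_on_def intro!: derivative_intros)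
qed (auto intro!: continuous_intros)

lemma C_class_add:
 "C_class k f \<Longrightarrow> C_class k g \<Longrightarrow> C_class k (\<lambda>x. f x + g x)"
proof (induction k arbitrary: f g)
 case (Suc k)
 have *: "f differentiable (at x)" "g differentiable (at x)" for x
  using Suc.prems by (auto simp: differentiable_on_def)
 have "partial_deriv b (\<lambda>x. f x + g x) = (\<lambda>x. partial_deriv b f x + partial_deriv b g x)" for b
  by (rule ext, rule partial_deriv_eq)
   (auto intro!: derivative_eq_intros has_derivative_gradient * simp: partial_deriv_inner * inner_add_left)
 then show ?case using Suc by (auto simp: differentiable_on_def intro!: derivative_intros)
qed (auto intro!: continuous_intros)

lemma C_class_mult:
 "C_class k f \<Longrightarrow> C_class k g \<Longrightarrow> C_class k (\<lambda>x. f x * g x)"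
proof (induction k arbitrary: f g)
 case (Suc k)
 have *: "f differentiable (at x)" "g differentiable (at x)" for x
  using Suc.prems by (auto simp: differentiable_on_def)
 have "partial_deriv b (\<lambda>x. f x * g x) = (\<lambda>x. f x * partial_deriv b g x + partial_deriv b f x * g x)" for b
  by (rule ext, rule partial_deriv_eq)
   (auto intro!: derivative_eq_intros has_derivative_gradient * simp: partial_deriv_inner * algebra_simps)
 moreover have "C_class k f" "C_class k g" using Suc.prems by (auto intro: C_class_SucD)
 ultimately show ?case using Suc * by (auto simp: differentiable_on_def intro!: C_class_add)
qed (auto intro!: continuous_intros)

lemma C_class_cmult: "C_class k f \<Longrightarrow> C_class k (\<lambda>x. c * f x)"
 by (intro C_class_mult C_class_const)

lemma C_class_diff: "C_class k f \<Longrightarrow> C_class k g \<Longrightarrow> C_class k (\<lambda>x. f x - g x)"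
 using C_class_add[of k f "\<lambda>x. (-1) * g x"] C_class_cmult[of k g "-1"] by simp

lemma C_class_sum: "finite I \<Longrightarrow> (\<And>i. i \<in> I \<Longrightarrow> C_class k (f i)) \<Longrightarrow> C_class k (\<lambda>x. \<Sum>i\<in>I. f i x)"
 by (induction rule: finite_induct) (auto intro!: C_class_const C_class_add)

lemma C_class_prod: "finite I \<Longrightarrow> (\<And>i. i \<in> I \<Longrightarrow> C_class k (f i)) \<Longrightarrow> C_class k (\<lambda>x. \<Prod>i\<in>I. f i x)"
 by (induction rule: finite_induct) (auto intro!: C_class_const C_class_mult)

lemma C_class_power: "C_class k f \<Longrightarrow> C_class k (\<lambda>x. f x ^ n)"
 by (induction n) (auto intro!: C_class_const C_class_mult)

lemma C_class_affine:
 assumes "C_class k f" shows "C_class k (\<lambda>x. f (a + c *\<^sub>R x))"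
 using assms
proof (induction k arbitrary: f)
 case 0
 then show ?case by (auto intro!: continuous_on_compose2[of UNIV f] continuous_intros)
next
 case (Suc k)
 have *: "f differentiable (at x)" for x using Suc.prems by (auto simp: differentiable_on_def)
 have D: "((\<lambda>x. f (a + c *\<^sub>R x)) has_derivative (\<lambda>h. gradient f (a + c *\<^sub>R x) \<bullet> (c *\<^sub>R h))) (at x)" for x
  by (rule has_derivative_compose[of "\<lambda>x. a + c *\<^sub>R x", OF _ has_derivative_gradient[OF *]])
   (auto intro!: derivative_eq_intros)
 have "partial_deriv b (\<lambda>x. f (a + c *\<^sub>R x)) = (\<lambda>x. c * partial_deriv b f (a + c *\<^sub>R x))" for b
  by (rule ext, subst partial_deriv_eq[OF D]) (simp add: partial_deriv_inner *)
 then show ?case using Suc D by (auto simp: differentiable_on_def differentiable_def intro!: C_class_cmult)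
qed

text \<open>The induction replaces \<open>g\<close> by its derivative, so it needs a family
  \<open>P\<close> that contains a derivative of each of its members. Derivatives are required only
  on \<open>S\<close>, a set containing all values of \<open>s\<close>; this admits functions that
  are smooth only on the positive half-line, such as real powers.\<close>

lemma C_class_compose:
 assumes P: "\<And>g. g \<in> P \<Longrightarrow> \<exists>g'\<in>P. \<forall>t\<in>S. (g has_real_derivative g' t) (at t)"
  and "g \<in> P" "C_class k s" "\<And>x. s x \<in> S" shows "C_class k (\<lambda>x. g (s x))" using assms(2,3)
proof (induction k arbitrary: g)
 case 0
 obtain g' where "\<forall>t\<in>S. (g has_real_derivative g' t) (at t)" using P[OF 0(1)] by blast
 then have "continuous_on S g" by (meson DERIV_isCont continuous_at_imp_continuous_on)
 then show ?case using 0 assms(4) by (auto intro!: continuous_on_compose2[of S g])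
next
 case (Suc k)
 obtain g' where g': "g' \<in> P" "\<forall>t\<in>S. (g has_real_derivative g' t) (at t)" using P[OF Suc(2)] by blast
 have *: "s differentiable (at x)" for x using Suc.prems by (auto simp: differentiable_on_def)
 have D: "((\<lambda>x. g (s x)) has_derivative (\<lambda>h. (gradient s x \<bullet> h) * g' (s x))) (at x)" for x
  by (rule DERIV_compose_FDERIV[OF _ has_derivative_gradient[OF *]]) (use g' assms(4) in auto)
 have "partial_deriv b (\<lambda>x. g (s x)) = (\<lambda>x. partial_deriv b s x * g' (s x))" for b
  by (rule ext, subst partial_deriv_eq[OF D]) (simp add: partial_deriv_inner *)
 moreover have "C_class k (\<lambda>x. g' (s x))" using Suc.IH[OF g'(1)] Suc.prems(2) C_class_SucD by blast
 ultimately show ?case using Suc.prems D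
  by (auto simp: differentiable_on_def differentiable_def intro!: C_class_mult)
qed

lemma C_class_powr:
 assumes "C_class k s" "\<And>x. s x > (0::real)"
 shows "C_class k (\<lambda>x. s x powr a)"
proof -
 \<comment> \<open>The free coefficient \<open>c\<close> makes the family closed under
   differentiation: it collects the factors that the exponents produce.\<close>
 let ?P = "{\<lambda>t::real. c * t powr a |c a. True}"
 have "(\<lambda>t. t powr a) \<in> ?P" by (force intro: exI[of _ 1])
 moreover have "\<exists>g'\<in>?P. \<forall>t\<in>{0<..}. (g has_real_derivative g' t) (at t)" if "g \<in> ?P" for g
 proof -
  obtain c a where g: "g = (\<lambda>t. c * t powr a)" using \<open>g \<in> ?P\<close> by auto
  have "\<forall>t\<in>{0<..}. (g has_real_derivative (c * a) * t powr (a - 1)) (at t)"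
   unfolding g by (auto intro!: derivative_eq_intros)
  moreover have "(\<lambda>t. (c * a) * t powr (a - 1)) \<in> ?P" by blast
  ultimately show ?thesis by (rule bexI)
 qed
 ultimately show ?thesis using C_class_compose[of ?P "{0<..}" "\<lambda>t. t powr a" k s] assms by auto
qed

text \<open>One derivative turns the logarithm into \<open>powr (-1)\<close>, to which
  \<open>C_class_powr\<close> applies.\<close>

lemma C_class_ln:
 assumes "C_class k s" "\<And>x. s x > (0::real)"
 shows "C_class k (\<lambda>x. ln (s x))"
proof (cases k)
 case 0
 then show ?thesis using assms by (auto intro!: continuous_intros simp: less_imp_neq[symmetric])
next
 case (Suc j)
 have *: "s differentiable (at x)" for x using assms Suc by (auto simp: differentiable_on_def)
 have D: "((\<lambda>x. ln (s x)) has_derivative (\<lambda>h. (gradient s x \<bullet> h) * s x powr (-1))) (at x)" for x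
  using assms(2)[of x] by (auto intro!: derivative_eq_intros has_derivative_gradient[OF *] simp: powr_minus field_simps)
 have "partial_deriv b (\<lambda>x. ln (s x)) = (\<lambda>x. partial_deriv b s x * s x powr (-1))" for b
  by (rule ext, subst partial_deriv_eq[OF D]) (simp add: partial_deriv_inner *)
 moreover have "C_class j s" using assms Suc C_class_SucD by blast
 moreover have "C_class j (partial_deriv b s)" if "b \<in> Basis" for b using assms Suc that by auto
 ultimately have "\<forall>b\<in>Basis. C_class j (partial_deriv b (\<lambda>x. ln (s x)))"
  using assms(2) by (simp only:) (intro ballI C_class_mult C_class_powr; blast)
 then show ?thesis unfolding Suc using D by (simp only: C_class.simps differentiable_on_def differentiable_def) blast
qed

section \<open>Flat functions and the smooth cutoff\<close>

definition exp_poly :: "real poly \<Rightarrow> real \<Rightarrow> real" where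
 "exp_poly r t = (if t > 0 then poly r (1 / t) * exp (- (1 / t)) else 0)"

lemma tendsto_poly_exp: "((\<lambda>x. poly r x * exp (- x)) \<longlongrightarrow> (0::real)) at_top"
proof -
 have "((\<lambda>x. \<Sum>i\<le>degree r. coeff r i * (x ^ i / exp x)) \<longlongrightarrow> (\<Sum>i\<le>degree r. coeff r i * 0)) at_top"
  by (intro tendsto_intros tendsto_power_div_exp_0)
 then show ?thesis by (simp add: poly_altdef sum_distrib_right exp_minus divide_inverse mult.assoc)
qed

text \<open>Every derivative of the flat function \<open>exp (- (1 / t))\<close> is a polynomial in
  \<open>1 / t\<close> times that function, so the family \<open>exp_poly\<close> is closed under
  differentiation. The inner derivatives of \<open>1 / t\<close> and \<open>- (1 / t)\<close> supply
  the common factor of degree two and the opposite signs of \<open>r\<close> and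
  \<open>pderiv r\<close>.\<close>

lemma exp_poly_has_derivative:
 "(exp_poly r has_real_derivative exp_poly (monom 1 2 * (r - pderiv r)) t) (at t)"
proof -
 consider "t > 0" | "t < 0" | "t = 0" by linarith
 then show ?thesis
 proof cases
  case 1
  have "((\<lambda>t. poly r (1 / t) * exp (- (1 / t))) has_real_derivative
   poly (monom 1 2 * (r - pderiv r)) (1 / t) * exp (- (1 / t))) (at t)"
   using 1 by (auto intro!: derivative_eq_intros poly_DERIV[THEN DERIV_chain2]
     simp: poly_monom field_simps power2_eq_square)
  moreover have "\<forall>\<^sub>F x in nhds t. x > 0" using 1 eventually_nhds_in_open[of "{0<..}" t] by auto
  ultimately show ?thesis
   using 1 by (subst DERIV_cong_ev[OF refl _ refl, of _ "\<lambda>t. poly r (1 / t) * exp (- (1 / t))"])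
    (auto simp: exp_poly_def elim: eventually_mono)
 next
  case 2
  have "\<forall>\<^sub>F x in nhds t. x < 0" using 2 eventually_nhds_in_open[of "{..<0}" t] by auto
  then show ?thesis using 2 by (subst DERIV_cong_ev[OF refl _ refl, of _ "\<lambda>t. 0"])
    (auto simp: exp_poly_def elim: eventually_mono)
 next
  \<comment> \<open>At the origin the difference quotient from the right has the same form, with
    \<open>r\<close> multiplied by the monomial of degree one, and tends to 0 because the
    exponential beats every polynomial.\<close>
  case 3
  let ?A = "(\<lambda>t. exp_poly r t / t) \<longlongrightarrow> 0"
  have R: "?A (at_right 0)"
  proof -
   have "((\<lambda>t::real. poly (monom 1 1 * r) (inverse t) * exp (- inverse t)) \<longlongrightarrow> 0) (at_right 0)"
    by (rule filterlim_compose[OF tendsto_poly_exp filterlim_inverse_at_top_right])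
   then show ?thesis by (rule Lim_transform_eventually)
     (auto simp: eventually_at_filter exp_poly_def poly_monom divide_inverse)
  qed
  have L: "?A (at_left 0)"
   by (rule Lim_transform_eventually[of "\<lambda>_. 0"]) (auto simp: eventually_at_filter exp_poly_def)
  have "?A (at 0)" using L R by (simp add: filterlim_split_at)
  then show ?thesis using 3 by (simp add: DERIV_def exp_poly_def)
 qed
qed

lemma C_class_exp_poly:
 assumes "C_class k s" shows "C_class k (\<lambda>x. exp_poly r (s x))"
 by (rule C_class_compose[of "range exp_poly" UNIV]) (use assms exp_poly_has_derivative in auto)

definition flat_step :: "real \<Rightarrow> real" where
 "flat_step t = exp_poly 1 t"

lemma flat_step_eq: "flat_step t = (if t > 0 then exp (- (1 / t)) else 0)"
 by (simp add: flat_step_def exp_poly_def)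

lemma C_class_flat_step: "C_class k s \<Longrightarrow> C_class k (\<lambda>x. flat_step (s x))"
 unfolding flat_step_def by (rule C_class_exp_poly)

lemma C_class_inner_self: "C_class k (\<lambda>x::'a::euclidean_space. x \<bullet> x)"
proof -
 have "(\<lambda>x::'a. x \<bullet> x) = (\<lambda>x. \<Sum>b\<in>Basis. (x \<bullet> b) * (x \<bullet> b))" by (rule ext, subst euclidean_inner) simp
 then show ?thesis by (auto intro!: C_class_sum C_class_mult C_class_inner)
qed

text \<open>A quotient of flat functions that is 1 where \<open>x \<bullet> x \<le> 1\<close> and 0
  where \<open>x \<bullet> x \<ge> 4\<close>. The denominator never vanishes, since
  \<open>4 - x \<bullet> x\<close> and \<open>x \<bullet> x - 1\<close> are never both nonpositive.
  It is written as a power so that \<open>C_class_powr\<close> gives smoothness.\<close>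

definition cutoff :: "'a::euclidean_space \<Rightarrow> real" where
 "cutoff x = flat_step (4 - x \<bullet> x) * (flat_step (4 - x \<bullet> x) + flat_step (x \<bullet> x - 1)) powr (-1)"

lemma C_class_cutoff: "C_class k cutoff"
proof -
 have "flat_step (4 - x \<bullet> x) + flat_step (x \<bullet> x - 1) > 0" for x :: 'a
  by (auto simp: flat_step_eq add_pos_nonneg add_nonneg_pos)
 then show ?thesis unfolding cutoff_def
  by (intro C_class_mult C_class_powr C_class_add C_class_flat_step C_class_diff C_class_const C_class_inner_self)
qed

lemma cutoff_eq: "cutoff x = flat_step (4 - x \<bullet> x) / (flat_step (4 - x \<bullet> x) + flat_step (x \<bullet> x - 1))"
 by (auto simp: cutoff_def powr_minus divide_inverse flat_step_eq)

lemma cutoff_range: "0 \<le> cutoff x" "cutoff x \<le> 1"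
 by (auto simp: cutoff_eq flat_step_eq field_simps add_pos_nonneg add_nonneg_pos)

lemma cutoff_1: "norm x \<le> 1 \<Longrightarrow> cutoff x = 1"
 using power_mono[of "norm x" 1 2] by (auto simp: cutoff_eq flat_step_eq dot_square_norm)

lemma cutoff_0: "norm x \<ge> 2 \<Longrightarrow> cutoff x = 0"
 using power_mono[of 2 "norm x" 2] by (auto simp: cutoff_eq flat_step_eq dot_square_norm)

section \<open>Functions of class one with bounded support, and their energy\<close>

definition C1c :: "('a::euclidean_space \<Rightarrow> real) \<Rightarrow> bool" where
 "C1c f \<longleftrightarrow> C_class (Suc 0) f \<and> bounded {x. f x \<noteq> 0}"

lemma gradient_add:
 assumes "f differentiable (at x)" "g differentiable (at x)"
 shows "gradient (\<lambda>x. f x + g x) x = gradient f x + gradient g x"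
 by (rule gradient_eqI) (auto intro!: derivative_eq_intros has_derivative_gradient assms simp: inner_add_left)

lemma gradient_diff:
 assumes "f differentiable (at x)" "g differentiable (at x)"
 shows "gradient (\<lambda>x. f x - g x) x = gradient f x - gradient g x"
 by (rule gradient_eqI) (auto intro!: derivative_eq_intros has_derivative_gradient assms simp: inner_diff_left)

lemma gradient_mult:
 assumes "f differentiable (at x)" "g differentiable (at x)"
 shows "gradient (\<lambda>x. f x * g x) x = f x *\<^sub>R gradient g x + g x *\<^sub>R gradient f x"
 by (rule gradient_eqI) (auto intro!: derivative_eq_intros has_derivative_gradient assms simp: inner_add_left)

lemma gradient_const: "gradient (\<lambda>x. c) x = 0"
 by (rule gradient_eqI) (auto intro!: derivative_eq_intros)

lemma gradient_cmult:
 assumes "f differentiable (at x)"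
 shows "gradient (\<lambda>x. c * f x) x = c *\<^sub>R gradient f x"
 by (rule gradient_eqI) (auto intro!: derivative_eq_intros has_derivative_gradient assms)

lemma gradient_affine:
 assumes "f differentiable (at (a + c *\<^sub>R x))"
 shows "gradient (\<lambda>x. f (a + c *\<^sub>R x)) x = c *\<^sub>R gradient f (a + c *\<^sub>R x)"
proof (rule gradient_eqI)
 have "((\<lambda>x. f (a + c *\<^sub>R x)) has_derivative (\<lambda>h. gradient f (a + c *\<^sub>R x) \<bullet> (c *\<^sub>R h))) (at x)"
  by (rule has_derivative_compose[of "\<lambda>x. a + c *\<^sub>R x", OF _ has_derivative_gradient[OF assms]])
   (auto intro!: derivative_eq_intros)
 then show "((\<lambda>x. f (a + c *\<^sub>R x)) has_derivative (\<lambda>h. (c *\<^sub>R gradient f (a + c *\<^sub>R x)) \<bullet> h)) (at x)" by simp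
qed

lemma gradient_compose:
 assumes "f differentiable (at x)" "(g has_real_derivative D) (at (f x))"
 shows "gradient (\<lambda>x. g (f x)) x = D *\<^sub>R gradient f x"
 by (rule gradient_eqI, rule has_derivative_eq_rhs,
   rule DERIV_compose_FDERIV[OF assms(2) has_derivative_gradient[OF assms(1)]]) (simp add: mult.commute)

lemma continuous_on_gradient: "C_class (Suc 0) f \<Longrightarrow> continuous_on UNIV (gradient f)"
 unfolding gradient_def by (auto intro!: continuous_intros)

lemma gradient_cong_open:
 assumes "open S" "x \<in> S" "\<And>y. y \<in> S \<Longrightarrow> f y = g y"
 shows "gradient f x = gradient g x"
proof -
 have "(f has_derivative D) (at x) \<longleftrightarrow> (g has_derivative D) (at x)" for D
  by (metis assms has_derivative_transform_within_open)
 then show ?thesis by (simp add: gradient_def partial_deriv_def frechet_derivative_def)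
qed

lemma gradient_zero_outside:
 assumes "x \<notin> closure {x. f x \<noteq> 0}" shows "gradient f x = 0"
proof -
 have "gradient f x = gradient (\<lambda>x. 0) x" by (rule gradient_cong_open[of "- closure {x. f x \<noteq> 0}"])
   (use assms closure_subset[of "{x. f x \<noteq> 0}"] in auto)
 then show ?thesis by (simp add: gradient_const)
qed

lemma C1c_differentiable: "C1c f \<Longrightarrow> f differentiable (at x)"
 by (auto simp: C1c_def differentiable_on_def)

lemma C1c_continuous: "C1c f \<Longrightarrow> continuous_on UNIV f"
 unfolding C1c_def using C_class_continuous by blast

lemma C1c_continuous_gradient: "C1c f \<Longrightarrow> continuous_on UNIV (gradient f)"
 unfolding C1c_def using continuous_on_gradient by blast

lemma C1c_bounded_support: "C1c f \<Longrightarrow> bounded {x. f x \<noteq> 0}"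
 by (simp add: C1c_def)

lemma C1c_bounded_support_gradient: "C1c f \<Longrightarrow> bounded {x. gradient f x \<noteq> 0}"
 by (rule bounded_subset[of "closure {x. f x \<noteq> 0}"]) (auto simp: C1c_def intro: gradient_zero_outside)

lemma borel_measurable_C1c: "C1c f \<Longrightarrow> f \<in> Borel"
 by (intro borel_measurable_continuous_onI C1c_continuous)

lemma borel_measurable_gradient: "C1c f \<Longrightarrow> gradient f \<in> Borel"
 by (intro borel_measurable_continuous_onI C1c_continuous_gradient)

lemma integrable_continuous_bounded_support:
 fixes f :: "'a::euclidean_space \<Rightarrow> 'b::{banach, second_countable_topology}"
 assumes "continuous_on UNIV f" "bounded {x. f x \<noteq> 0}"
 shows "integrable lborel f"
proof -
 have "compact (closure {x. f x \<noteq> 0})" using assms by simp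
 then have "integrable lborel (\<lambda>x. indicator (closure {x. f x \<noteq> 0}) x *\<^sub>R f x)"
  by (rule borel_integrable_compact) (use assms continuous_on_subset in blast)
 also have "(\<lambda>x. indicator (closure {x. f x \<noteq> 0}) x *\<^sub>R f x) = f"
  using closure_subset[of "{x. f x \<noteq> 0}"] by (auto simp: indicator_def fun_eq_iff)
 finally show ?thesis .
qed

lemma C1cI: "C_class (Suc 0) f \<Longrightarrow> {x. f x \<noteq> 0} \<subseteq> S \<Longrightarrow> bounded S \<Longrightarrow> C1c f"
 unfolding C1c_def using bounded_subset by blast

lemma C1c_add: "C1c f \<Longrightarrow> C1c g \<Longrightarrow> C1c (\<lambda>x. f x + g x)"
 by (rule C1cI[of _ "{x. f x \<noteq> 0} \<union> {x. g x \<noteq> 0}"]) (auto simp: C1c_def simp del: C_class.simps intro: C_class_add)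

lemma C1c_cmult: "C1c f \<Longrightarrow> C1c (\<lambda>x. c * f x)"
 by (rule C1cI[of _ "{x. f x \<noteq> 0}"]) (auto simp: C1c_def simp del: C_class.simps intro: C_class_cmult)

lemma C1c_diff: "C1c f \<Longrightarrow> C1c g \<Longrightarrow> C1c (\<lambda>x. f x - g x)"
 using C1c_add[of f "\<lambda>x. (-1) * g x"] C1c_cmult[of g "-1"] by simp

lemma C1c_mult: "C_class (Suc 0) f \<Longrightarrow> C1c g \<Longrightarrow> C1c (\<lambda>x. f x * g x)"
 by (rule C1cI[of _ "{x. g x \<noteq> 0}"]) (auto simp: C1c_def simp del: C_class.simps intro: C_class_mult)

lemma integrable_norm_powr_bounded_support:
 fixes f :: "'a::euclidean_space \<Rightarrow> 'b::euclidean_space"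
 assumes "continuous_on UNIV f" "bounded {x. f x \<noteq> 0}" "p > 0"
 shows "integrable lborel (\<lambda>x. norm (f x) powr p)"
proof (rule integrable_continuous_bounded_support)
 show "continuous_on UNIV (\<lambda>x. norm (f x) powr p)"
  by (rule continuous_on_powr') (use assms in \<open>auto intro: continuous_on_norm\<close>)
 show "bounded {x. norm (f x) powr p \<noteq> 0}" using assms by simp
qed

lemma integrable_powr_C1c:
 assumes "C1c f" "p > 0" shows "integrable lborel (\<lambda>x. \<bar>f x\<bar> powr p)"
 using integrable_norm_powr_bounded_support[OF C1c_continuous C1c_bounded_support] assms by simp

lemma integrable_powr_gradient:
 assumes "C1c f" "p > 0" shows "integrable lborel (\<lambda>x. grad_powr p f x)"
 using integrable_norm_powr_bounded_support[OF C1c_continuous_gradient[of f] C1c_bounded_support_gradient[of f]] assms by simp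

definition energy :: "real \<Rightarrow> ('a::euclidean_space \<Rightarrow> real) \<Rightarrow> real" where
 "energy p f = (LINT x|lborel. grad_powr p f x)"

lemma energy_nonneg: "energy p f \<ge> 0"
 by (simp add: energy_def)

lemma nn_integral_energy:
 assumes "C1c f" "p > 0"
 shows "(\<integral>x. grad_powr p f x) = ennreal (energy p f)"
 unfolding energy_def by (rule nn_integral_eq_integral) (use integrable_powr_gradient assms in auto)

text \<open>The reparametrisation \<open>\<theta>\<close> of the segment is free, so that it can later absorb a singularity.\<close>

lemma abs_diff_le_nn_integral_segment:
 fixes f :: "'a::euclidean_space \<Rightarrow> real" and \<theta> \<theta>' :: "real \<Rightarrow> real"
 assumes f: "C_class (Suc 0) f"
  and \<theta>: "continuous_on {0..1} \<theta>" "\<theta> 0 = 0" "\<theta> 1 = 1" "continuous_on {0..1} \<theta>'"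
   "\<And>t. 0 < t \<Longrightarrow> t < 1 \<Longrightarrow> (\<theta> has_real_derivative \<theta>' t) (at t)" shows "ennreal \<bar>f (x + h) - f x\<bar>
  \<le> (\<integral>t\<in>{0..1}. \<bar>\<theta>' t\<bar> * \<bar>gradient f (x + \<theta> t *\<^sub>R h) \<bullet> h\<bar>)"
proof -
 let ?g = "\<lambda>t. f (x + \<theta> t *\<^sub>R h)" and ?g' = "\<lambda>t. \<theta>' t * (gradient f (x + \<theta> t *\<^sub>R h) \<bullet> h)"
 have fd: "f differentiable (at y)" for y using f by (rule C_class_differentiable)
 have line: "continuous_on {0..1} (\<lambda>t. x + \<theta> t *\<^sub>R h)" by (intro continuous_intros \<theta>(1))
 have cont: "continuous_on {0..1} ?g" by (rule continuous_on_compose2[OF C_class_continuous[OF f] line]) simp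
 have cont': "continuous_on {0..1} ?g'" by (intro continuous_on_mult continuous_on_inner continuous_on_const \<theta>(4)
    continuous_on_compose2[OF continuous_on_gradient[OF f] line]) simp
 have "(?g' has_integral (?g 1 - ?g 0)) {0..1}"
 \<comment> \<open>The version with interior derivatives leaves room for a \<open>\<theta>\<close>
   such as a real power, whose derivative is at hand only for positive \<open>t\<close>.\<close>
 proof (rule fundamental_theorem_of_calculus_interior[OF _ cont])
  fix t :: real assume t: "t \<in> {0<..<1}"
  have 1: "((\<lambda>t. x + \<theta> t *\<^sub>R h) has_derivative (\<lambda>s. (\<theta>' t * s) *\<^sub>R h)) (at t)"
   using \<theta>(5)[of t] t by (auto intro!: derivative_eq_intros simp: has_field_derivative_def mult_ac)
  have "(?g has_derivative (\<lambda>s. gradient f (x + \<theta> t *\<^sub>R h) \<bullet> ((\<theta>' t * s) *\<^sub>R h))) (at t)"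
   by (rule has_derivative_compose[OF 1 has_derivative_gradient[OF fd]])
  then show "(?g has_vector_derivative ?g' t) (at t)" by (simp add: has_vector_derivative_def mult_ac)
 qed simp
 moreover have int: "set_integrable lborel {0..1} ?g'"
  unfolding set_integrable_def by (rule borel_integrable_compact[OF _ cont']) simp
 ultimately have "?g 1 - ?g 0 = (LINT t:{0..1}|lborel. ?g' t)"
  by (metis set_borel_integral_eq_integral(2) integral_unique)
 then have "\<bar>f (x + h) - f x\<bar> = norm (LINT t|lborel. indicator {0..1} t *\<^sub>R ?g' t)" using \<theta> by (simp add: LINT_def)
 then have "ennreal \<bar>f (x + h) - f x\<bar> \<le> (\<integral>\<^sup>+t. norm (indicator {0..1} t *\<^sub>R ?g' t))"
  using integral_norm_bound_ennreal[of lborel "\<lambda>t. indicator {0..1} t *\<^sub>R ?g' t"] int[unfolded set_integrable_def] by simp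
 also have "... = (\<integral>t\<in>{0..1}. \<bar>\<theta>' t\<bar> * \<bar>gradient f (x + \<theta> t *\<^sub>R h) \<bullet> h\<bar>)"
  by (intro nn_integral_cong) (auto simp: indicator_def abs_mult)
 finally show ?thesis .
qed

lemma abs_diff_le_nn_integral:
 fixes f :: "'a::euclidean_space \<Rightarrow> real"
 assumes "C_class (Suc 0) f"
 shows "ennreal \<bar>f (x + h) - f x\<bar>
  \<le> (\<integral>t\<in>{0..1}. norm h * norm (gradient f (x + t *\<^sub>R h)))"
proof -
 have "ennreal \<bar>f (x + h) - f x\<bar> \<le> (\<integral>t\<in>{0..1}. \<bar>1\<bar> * \<bar>gradient f (x + t *\<^sub>R h) \<bullet> h\<bar>)"
  by (rule abs_diff_le_nn_integral_segment[OF assms, of "\<lambda>t. t" "\<lambda>t. 1"]) (auto intro!: continuous_intros)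
 also have "... \<le> (\<integral>t\<in>{0..1}. norm h * norm (gradient f (x + t *\<^sub>R h)))" using Cauchy_Schwarz_ineq2[of _ h]
  by (intro nn_integral_mono mult_right_mono ennreal_leI) (auto simp: mult.commute[of "norm h"])
 finally show ?thesis .
qed

lemma nn_integral_affine:
 fixes f :: "'a::euclidean_space \<Rightarrow> ennreal"
 assumes [measurable]: "f \<in> Borel" and c: "c \<noteq> 0"
 shows "(\<integral>\<^sup>+x. f (t + c *\<^sub>R x)) = ennreal (1 / \<bar>c\<bar> ^ DIM('a)) * (\<integral>\<^sup>+x. f x)"
proof -
 have "(\<integral>\<^sup>+x. f x) = ennreal (\<bar>c\<bar> ^ DIM('a)) * (\<integral>\<^sup>+x. f (t + c *\<^sub>R x))" by (subst lborel_affine[OF c, of t])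
  (simp add: nn_integral_density nn_integral_distr nn_integral_cmult)
 then show ?thesis using c by (simp add: mult.assoc[symmetric] ennreal_mult[symmetric])
qed

lemma nn_integral_translate:
 fixes f :: "'a::euclidean_space \<Rightarrow> ennreal"
 assumes "f \<in> Borel"
 shows "(\<integral>\<^sup>+x. f (t + x)) = (\<integral>\<^sup>+x. f x)"
 using nn_integral_affine[OF assms, of 1 t] by simp

section \<open>The weighted inequality\<close>

text \<open>Convexity of the power at the points \<open>a / (1 - s)\<close> and \<open>b / s\<close>
  with weights \<open>1 - s\<close> and \<open>s\<close>. The use of the free parameter is that the
  factor of \<open>a powr q\<close> tends to 1 as \<open>s\<close> tends to 0, so that a small
  perturbation \<open>b\<close> costs almost nothing in the leading term; this serves in place of
  Minkowski's inequality.\<close>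

lemma convex_powr_add:
 fixes a b s q :: real
 assumes "0 \<le> a" "0 \<le> b" "0 < s" "s < 1" "1 \<le> q"
 shows "(a + b) powr q \<le> (1 - s) powr (1 - q) * a powr q + s powr (1 - q) * b powr q"
proof -
 have ge1: "1 \<le> t powr (1 - q)" if "0 < t" "t < 1" for t
  using powr_mono_both'[of 0 "q - 1" t 1] that assms by (simp add: powr_minus field_simps powr_diff)
 consider "a = 0" | "b = 0" | "a > 0" "b > 0" using assms by linarith
 then show ?thesis
 proof cases
  case 1
  then show ?thesis using ge1[of s] assms mult_right_mono[of 1 "s powr (1 - q)" "b powr q"] by simp
 next
  case 2
  then show ?thesis using ge1[of "1 - s"] assms mult_right_mono[of 1 "(1 - s) powr (1 - q)" "a powr q"] by simp
 next
  case 3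
  from convex_onD[OF powr_convex[OF assms(5)], of s "a / (1 - s)" "b / s"]
  have "((1 - s) * (a / (1 - s)) + s * (b / s)) powr q \<le> (1 - s) * (a / (1 - s)) powr q + s * (b / s) powr q"
   using assms 3 by simp
  moreover have "(1 - s) * (a / (1 - s)) powr q = (1 - s) powr (1 - q) * a powr q"
   using assms by (simp add: powr_divide powr_diff)
  moreover have "s * (b / s) powr q = s powr (1 - q) * b powr q" using assms by (simp add: powr_divide powr_diff)
  ultimately show ?thesis using assms by simp
 qed
qed

lemma powr_add_le:
 fixes a b q :: real
 assumes "0 \<le> a" "0 \<le> b" "1 \<le> q"
 shows "(a + b) powr q \<le> 2 powr q * (a powr q + b powr q)"
proof -
 have "(1/2::real) powr (1 - q) = 2 powr (q - 1)" by (simp add: powr_divide powr_minus_divide[symmetric])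
 moreover have "(2::real) powr (q - 1) \<le> 2 powr q" by simp
 ultimately show ?thesis using convex_powr_add[OF assms(1,2) _ _ assms(3), of "1/2"]
   mult_right_mono[of "2 powr (q - 1)" "2 powr q" "a powr q + b powr q"] by (simp add: distrib_left)
qed

text \<open>Young's inequality for \<open>f / A\<close> and \<open>g / B\<close>. Real bounds take
  the place of the two integrals, so finiteness is built in; if a bound is 0, the product vanishes
  almost everywhere.\<close>

lemma nn_integral_Holder:
 fixes f g :: "'a \<Rightarrow> real"
 assumes [measurable]: "f \<in> borel_measurable M" "g \<in> borel_measurable M"
  and nn: "\<And>x. f x \<ge> 0" "\<And>x. g x \<ge> 0"
  and a: "0 < a" "a < 1"
  and A: "(\<integral>\<^sup>+x. f x \<partial>M) \<le> ennreal A" "0 \<le> A"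
  and B: "(\<integral>\<^sup>+x. g x \<partial>M) \<le> ennreal B" "0 \<le> B"
 shows "(\<integral>\<^sup>+x. f x powr a * g x powr (1 - a) \<partial>M) \<le> ennreal (A powr a * B powr (1 - a))"
proof -
 consider "A = 0" | "B = 0" | "A > 0" "B > 0" using A B by linarith
 then show ?thesis
 proof cases
  case 1
  then have "AE x in M. f x = 0" using A nn by (auto simp: nn_integral_0_iff_AE)
  then have "(\<integral>\<^sup>+x. f x powr a * g x powr (1 - a) \<partial>M) = (\<integral>\<^sup>+x. 0 \<partial>M)" by (intro nn_integral_cong_AE) auto
  then show ?thesis by simp
 next
  case 2
  then have "AE x in M. g x = 0" using B nn by (auto simp: nn_integral_0_iff_AE)
  then have "(\<integral>\<^sup>+x. f x powr a * g x powr (1 - a) \<partial>M) = (\<integral>\<^sup>+x. 0 \<partial>M)" by (intro nn_integral_cong_AE) auto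
  then show ?thesis by simp
 next
  case 3
  let ?D = "A powr a * B powr (1 - a)"
  have young: "u powr a * v powr (1 - a) \<le> a * u + (1 - a) * v" if "u \<ge> 0" "v \<ge> 0" for u v :: real
   using Youngs_inequality_0[of a "1 - a" u v] a that by (cases "u = 0 \<or> v = 0") auto
  have "f x powr a * g x powr (1 - a) \<le> (?D * a / A) * f x + (?D * (1 - a) / B) * g x" for x
  proof -
   have "f x powr a * g x powr (1 - a) = ?D * ((f x / A) powr a * (g x / B) powr (1 - a))"
    using 3 nn by (simp add: powr_divide)
   also have "... \<le> ?D * (a * (f x / A) + (1 - a) * (g x / B))" using 3 nn by (intro mult_left_mono young) auto
   finally show ?thesis by (simp add: algebra_simps)
  qed
  then have "(\<integral>\<^sup>+x. f x powr a * g x powr (1 - a) \<partial>M)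
    \<le> (\<integral>\<^sup>+x. ennreal (?D * a / A) * ennreal (f x) + ennreal (?D * (1 - a) / B) * ennreal (g x) \<partial>M)"
   using 3 a nn by (intro nn_integral_mono) (simp add: ennreal_mult[symmetric] ennreal_plus[symmetric] ennreal_leI del: ennreal_plus)
  also have "... = ennreal (?D * a / A) * (\<integral>\<^sup>+x. f x \<partial>M) + ennreal (?D * (1 - a) / B) * (\<integral>\<^sup>+x. g x \<partial>M)"
   by (simp add: nn_integral_add nn_integral_cmult)
  also have "... \<le> ennreal (?D * a / A) * ennreal A + ennreal (?D * (1 - a) / B) * ennreal B"
   using A B by (intro add_mono mult_left_mono) auto
  also have "... = ennreal (?D * a + ?D * (1 - a))"
   using 3 a by (simp add: ennreal_mult[symmetric] ennreal_plus[symmetric] del: ennreal_plus)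
  also have "?D * a + ?D * (1 - a) = ?D" by (simp add: algebra_simps)
  finally show ?thesis .
 qed
qed

lemma nn_integral_Jensen:
 fixes f :: "'a \<Rightarrow> real"
 assumes [measurable]: "f \<in> borel_measurable M" "S \<in> sets M"
  and nn: "\<And>x. f x \<ge> 0" and p: "p \<ge> 1"
  and A: "(\<integral>\<^sup>+x\<in>S. ennreal (f x powr p) \<partial>M) \<le> ennreal A" "0 \<le> A"
  and W: "emeasure M S = ennreal W" "0 \<le> W"
 shows "(\<integral>\<^sup>+x\<in>S. ennreal (f x) \<partial>M) \<le> ennreal (A powr (1/p) * W powr (1 - 1/p))"
proof (cases "p = 1")
 case True
 show ?thesis
 \<comment> \<open>For \<open>p = 1\<close> the factor \<open>W powr (1 - 1/p)\<close> is
   \<open>W powr 0\<close>, which is 1 for positive \<open>W\<close> but 0 for \<open>W = 0\<close>.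
   In the latter case the integral itself must be shown to vanish.\<close>
 proof (cases "W = 0")
  case True
  then have "AE x in M. x \<notin> S" using W by (auto simp: AE_iff_measurable[OF assms(2)] intro!: AE_not_in)
  then have "(\<integral>\<^sup>+x\<in>S. ennreal (f x) \<partial>M) = (\<integral>\<^sup>+x. 0 \<partial>M)" by (intro nn_integral_cong_AE) auto
  then show ?thesis by simp
 qed (use A nn W \<open>p = 1\<close> in auto)
next
 case False
 have "(\<integral>\<^sup>+x. ((f x powr p * indicator S x) powr (1/p) * indicator S x powr (1 - 1/p)) \<partial>M)
  \<le> ennreal (A powr (1/p) * W powr (1 - 1/p))" using False p A W
  by (intro nn_integral_Holder) (auto simp: ennreal_mult' ennreal_indicator)
 moreover have "ennreal ((f x powr p * indicator S x) powr (1/p) * indicator S x powr (1 - 1/p))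
  = ennreal (f x) * indicator S x" for x using nn[of x] p by (auto simp: indicator_def powr_powr)
 ultimately show ?thesis by simp
qed

section \<open>Averages over balls comparable to the distance from the plane\<close>

definition rad :: "'a::euclidean_space \<times> 'b::euclidean_space \<Rightarrow> real" where
 "rad x = norm (fst x)"

lemma rad_nonneg [simp]: "rad x \<ge> 0"
 by (simp add: rad_def)

lemma continuous_on_rad [continuous_intros]: "continuous_on S f \<Longrightarrow> continuous_on S (\<lambda>x. rad (f x))"
 unfolding rad_def by (intro continuous_intros)

lemma rad_measurable [measurable]: "rad \<in> Borel"
 by (intro borel_measurable_continuous_onI continuous_intros)

lemma ball_borel [measurable]: "ball (c::'a::metric_space) r \<in> sets borel"
 and cball_borel [measurable]: "cball (c::'a::metric_space) r \<in> sets borel" by auto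

text \<open>On the plane a negative power of \<open>rad x\<close> has the default value 0; this
  makes that value invisible to integrals.\<close>

lemma AE_rad_pos: "AE x in lborel. rad (x :: 'a::euclidean_space \<times> 'b::euclidean_space) > 0"
proof -
 have "emeasure (lborel \<Otimes>\<^sub>M lborel) ({0::'a} \<times> (UNIV :: 'b set)) = 0"
  by (subst lborel.emeasure_pair_measure_Times) auto
 then have "emeasure lborel ({0::'a} \<times> (UNIV :: 'b set)) = 0" by (simp add: lborel_prod)
 moreover have "{0::'a} \<times> (UNIV :: 'b set) \<in> sets lborel" by (simp add: closed_Times borel_closed)
 ultimately have "AE x in lborel. x \<notin> {0::'a} \<times> (UNIV :: 'b set)" by (intro AE_not_in null_setsI)
 then show ?thesis by eventually_elim (auto simp: rad_def)
qed

lemma emeasure_lborel_ball: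
 fixes c :: "'a::euclidean_space"
 assumes "r \<ge> 0"
 shows "emeasure lborel (ball c r) = ennreal (r ^ DIM('a) * measure lborel (ball (0::'a) 1))"
 using emeasure_lborel_ball_finite[of c r] content_ball_conv_unit_ball[OF assms, of c]
 by (subst emeasure_eq_ennreal_measure) auto

text \<open>Up to the volume of the unit ball this is the mean of \<open>g\<close> over the ball of
  radius \<open>s * rad x / 2\<close> about \<open>x\<close>. The radius is proportional to the
  distance from the plane, so for \<open>s \<le> 1\<close> the weight is comparable to a constant on
  the ball. The parameter \<open>s\<close> will run through shrinking balls when a function is
  represented by its gradient.\<close>

definition ball_avg ::
 "real \<Rightarrow> ('a::euclidean_space \<times> 'b::euclidean_space \<Rightarrow> real) \<Rightarrow> 'a \<times> 'b \<Rightarrow> ennreal" where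
 "ball_avg s g x = (\<integral>h\<in>ball 0 1. g (x + (s * rad x / 2) *\<^sub>R h))"

lemma ball_avg_measurable [measurable]:
 assumes [measurable]: "g \<in> Borel" "s \<in> borel_measurable M" "f \<in> M \<rightarrow>\<^sub>M borel"
 shows "(\<lambda>w. ball_avg (s w) g (f w)) \<in> borel_measurable M"
 unfolding ball_avg_def by measurable

lemma ball_avg_eq:
 fixes x :: "'a::euclidean_space \<times> 'b::euclidean_space"
 assumes [measurable]: "g \<in> Borel" and \<rho>: "\<rho> = s * rad x / 2" "\<rho> > 0"
 shows "ball_avg s g x = ennreal (1 / \<rho> ^ DIM('a \<times> 'b)) * (\<integral>\<^sup>+\<xi>. ennreal (g \<xi>) * indicator (ball x \<rho>) \<xi>)"
proof -
 have "ball_avg s g x = (\<integral>\<^sup>+h. ennreal (g (x + \<rho> *\<^sub>R h)) * indicator (ball x \<rho>) (x + \<rho> *\<^sub>R h))"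
  unfolding ball_avg_def \<rho>(1)[symmetric] using \<rho>(2) by (intro nn_integral_cong) (auto simp: indicator_def dist_norm)
 also have "... = ennreal (1 / \<bar>\<rho>\<bar> ^ DIM('a \<times> 'b)) * (\<integral>\<^sup>+\<xi>. ennreal (g \<xi>) * indicator (ball x \<rho>) \<xi>)"
  using \<rho>(2) by (subst nn_integral_affine[symmetric]) auto
 finally show ?thesis using \<rho>(2) by simp
qed

text \<open>\<open>rad\<close> is Lipschitz with constant 1 and
  \<open>\<rho> \<le> rad x / 2\<close>.\<close>

lemma rad_comparable:
 fixes x \<xi> :: "'a::euclidean_space \<times> 'b::euclidean_space"
 assumes "dist x \<xi> < \<rho>" "\<rho> = s * rad x / 2" "0 < s" "s \<le> 1"
 shows "rad x \<le> 2 * rad \<xi>" "rad \<xi> \<le> 3 / 2 * rad x"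
  "rad \<xi> > 0" "s * rad \<xi> / 3 \<le> \<rho>" "\<rho> \<le> s * rad \<xi>"
proof -
 let ?A = "\<bar>rad x - rad \<xi>\<bar>"
 have "?A \<le> norm (fst x - fst \<xi>)" unfolding rad_def by (rule norm_triangle_ineq3)
 also have "... \<le> dist x \<xi>" unfolding dist_norm fst_diff[symmetric] by (metis norm_fst_le prod.collapse)
 finally have d: "?A < \<rho>" using assms by simp
 have "\<rho> \<le> rad x / 2" using assms by (simp add: mult_left_le_one_le)
 with d have 1: "?A < rad x / 2" by simp
 show 2: "rad x \<le> 2 * rad \<xi>" and 3: "rad \<xi> \<le> 3 / 2 * rad x" using 1 by linarith+
 show "rad \<xi> > 0" using 1 rad_nonneg[of \<xi>] by linarith
 show "s * rad \<xi> / 3 \<le> \<rho>" "\<rho> \<le> s * rad \<xi>"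
  using mult_left_mono[OF 2 less_imp_le[OF assms(3)]] mult_left_mono[OF 3 less_imp_le[OF assms(3)]]
  unfolding assms(2) by argo+
qed

text \<open>After Fubini, a fixed \<open>\<xi>\<close> is seen only from points \<open>x\<close>
  within distance \<open>s * rad \<xi>\<close>, with a kernel of at most
  \<open>(3 / (s * rad \<xi>)) ^ DIM('a \<times> 'b)\<close>. Volume and kernel cancel, which makes
  the constant independent of \<open>s\<close>.\<close>

lemma nn_integral_ball_avg:
 fixes g :: "'a::euclidean_space \<times> 'b::euclidean_space \<Rightarrow> real"
 assumes g[measurable]: "g \<in> Borel" and s: "0 < s" "s \<le> 1"
 shows "(\<integral>\<^sup>+x. ball_avg s g x)
  \<le> ennreal (3 ^ DIM('a \<times> 'b) * measure lborel (ball (0::'a \<times> 'b) 1)) * (\<integral>x. g x)"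
proof -
 let ?n = "DIM('a \<times> 'b)" and ?\<rho> = "\<lambda>x::'a \<times> 'b. s * rad x / 2"
 define k where "k x \<xi> = ennreal (1 / ?\<rho> x ^ ?n) * (if dist x \<xi> < ?\<rho> x then 1 else 0)" for x \<xi>
 have [measurable]: "(\<lambda>(x, \<xi>). k x \<xi>) \<in> borel_measurable (borel \<Otimes>\<^sub>M borel)" unfolding k_def by measurable
 let ?A = "3 ^ ?n * measure lborel (ball (0::'a \<times> 'b) 1)"
 have "(\<integral>\<^sup>+x. ball_avg s g x) = (\<integral>\<^sup>+x. (\<integral>\<^sup>+\<xi>. k x \<xi> * ennreal (g \<xi>)))"
 proof (rule nn_integral_cong_AE, use AE_rad_pos in eventually_elim)
  fix x :: "'a \<times> 'b" assume "rad x > 0"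
  then have "?\<rho> x > 0" using s by simp
  then show "ball_avg s g x = (\<integral>\<^sup>+\<xi>. k x \<xi> * ennreal (g \<xi>))" by (subst ball_avg_eq[OF g refl])
    (auto simp: k_def nn_integral_cmult[symmetric] indicator_def mult_ac intro!: nn_integral_cong)
 qed
 also have "... = (\<integral>\<^sup>+\<xi>. (\<integral>\<^sup>+x. k x \<xi> * ennreal (g \<xi>)))" by (rule lborel_pair.Fubini') measurable
 also have "... = (\<integral>\<^sup>+\<xi>. (\<integral>\<^sup>+x. k x \<xi>) * ennreal (g \<xi>))" by (intro nn_integral_cong nn_integral_multc) measurable
 also have "... \<le> (\<integral>\<^sup>+\<xi>. ennreal ?A * ennreal (g \<xi>))"
 proof (intro nn_integral_mono mult_right_mono)
  fix \<xi> :: "'a \<times> 'b"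
  show "(\<integral>\<^sup>+x. k x \<xi>) \<le> ennreal ?A"
  proof (cases "rad \<xi> = 0")
   case True
   then have "k x \<xi> = 0" for x using rad_comparable(3)[OF _ refl s, of x \<xi>] by (auto simp: k_def)
   then show ?thesis by simp
  next
   case False
   let ?R = "s * rad \<xi>"
   have R: "?R > 0" using False s rad_nonneg[of \<xi>] by (simp add: less_le)
   have "(\<integral>\<^sup>+x. k x \<xi>) \<le> (\<integral>\<^sup>+x. ennreal ((3 / ?R) ^ ?n) * indicator (ball \<xi> ?R) x)"
   proof (intro nn_integral_mono)
    fix x
    show "k x \<xi> \<le> ennreal ((3 / ?R) ^ ?n) * indicator (ball \<xi> ?R) x"
    proof (cases "dist x \<xi> < ?\<rho> x")
     case True
     note c = rad_comparable[OF True refl s]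
     have "1 / ?\<rho> x ^ ?n \<le> (3 / ?R) ^ ?n"
      using c(4) R le_imp_inverse_le[OF c(4)] unfolding power_one_over[symmetric]
      by (intro power_mono) (simp_all add: inverse_eq_divide)
     moreover have "x \<in> ball \<xi> ?R" using True c(5) by (simp add: dist_commute)
     ultimately show ?thesis using True by (simp add: k_def ennreal_leI)
    qed (simp add: k_def)
   qed
   also have "... = ennreal ((3 / ?R) ^ ?n) * emeasure lborel (ball \<xi> ?R)" by (simp add: nn_integral_cmult_indicator)
   also have "... = ennreal ?A"
    using R by (subst emeasure_lborel_ball) (auto simp: ennreal_mult[symmetric] power_divide)
   finally show ?thesis .
  qed
 qed simp
 finally show ?thesis by (simp add: nn_integral_cmult)
qed

text \<open>Jensen's inequality bounds the average by a power \<open>1/p\<close> of the local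
  integral \<open>j\<close> of \<open>g powr p\<close>. Of the resulting
  \<open>j powr (q/p)\<close>, the excess \<open>j powr (q/p - 1)\<close> is estimated by the total
  bound \<open>e\<close> over the volume of the ball, and one factor \<open>j\<close> stays local,
  ready to be integrated in \<open>x\<close>. The power of \<open>rad x\<close> undoes the volume
  factor.\<close>

lemma ball_avg_powr_pointwise:
 fixes g :: "'a::euclidean_space \<times> 'b::euclidean_space \<Rightarrow> real"
 defines "n \<equiv> real DIM('a \<times> 'b)" and "\<omega> \<equiv> measure lborel (ball (0::'a \<times> 'b) 1)"
 assumes g[measurable]: "g \<in> Borel" and nn: "\<And>x. g x \<ge> 0"
  and p: "1 \<le> p" "p < q" and s: "0 < s" "s \<le> 1"
  and e: "(\<integral>x. g x powr p) \<le> ennreal e" "0 \<le> e"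
  and x: "rad x > 0" shows "ball_avg s g x < \<infinity>"
  "ennreal (rad x powr (n * (q/p - 1)) * enn2real (ball_avg s g x) powr q)
   \<le> ennreal (\<omega> powr (q - q/p) * (s/2) powr (- (n * (q/p - 1))) * e powr (q/p - 1))
     * ball_avg s (\<lambda>x. g x powr p) x"
proof -
 define \<rho> where "\<rho> = s * rad x / 2"
 have \<rho>: "\<rho> > 0" using s x by (simp add: \<rho>_def)
 have \<omega>: "\<omega> \<ge> 0" by (simp add: \<omega>_def)
 have W: "emeasure lborel (ball (0::'a \<times> 'b) 1) = ennreal \<omega>"
  unfolding \<omega>_def using emeasure_lborel_ball[of 1 "0::'a \<times> 'b"] by simp
 let ?C = "\<rho> powr (-n) * e"
 let ?E = "ball_avg s (\<lambda>x. g x powr p) x"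
 let ?F = "1 / \<rho> ^ DIM('a \<times> 'b)"
 have "ball_avg s (\<lambda>x. g x powr p) x
   = ennreal ?F * (\<integral>\<^sup>+\<xi>. ennreal (g \<xi> powr p) * indicator (ball x \<rho>) \<xi>)"
  by (rule ball_avg_eq[OF _ \<rho>_def \<rho>]) measurable
 also have "... \<le> ennreal ?F * (\<integral>\<xi>. g \<xi> powr p)"
  by (intro mult_left_mono nn_integral_mono) (auto simp: indicator_def)
 also have "... \<le> ennreal ?F * ennreal e" using e by (intro mult_left_mono) auto
 also have "... = ennreal ?C"
  using \<rho> e by (simp add: ennreal_mult[symmetric] powr_minus n_def powr_realpow divide_inverse del: DIM_prod)
 finally have Jle: "?E \<le> ennreal ?C" .
 then obtain j where j: "?E = ennreal j" "0 \<le> j" by (cases "?E") (auto simp: top_unique)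
 with Jle \<rho> e have jle: "j \<le> ?C" by (simp add: ennreal_le_iff)
 let ?D = "j powr (1/p) * \<omega> powr (1 - 1/p)"
 have "ball_avg s g x \<le> ennreal ?D" unfolding ball_avg_def
  by (rule nn_integral_Jensen) (use j nn p W \<omega> in \<open>auto simp: ball_avg_def\<close>)
 then obtain i where i: "ball_avg s g x = ennreal i" "0 \<le> i" "i \<le> ?D"
  by (cases "ball_avg s g x") (auto simp: top_unique ennreal_le_iff)
 show "ball_avg s g x < \<infinity>" using i by simp
 let ?A = "- (n * (q/p - 1))"
 let ?B = "(s/2) powr ?A * rad x powr ?A * e powr (q/p - 1)"
 let ?G = "\<omega> powr (q - q/p) * (s/2) powr ?A * e powr (q/p - 1) * j"
 have "i powr q \<le> ?D powr q" using i p by (intro powr_mono2) auto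
 also have "... = \<omega> powr (q - q/p) * j powr (q/p)" using p \<omega> j by (simp add: powr_mult powr_powr algebra_simps)
 also have "j powr (q/p) = j powr (q/p - 1) * j" using j p by (cases "j = 0") (auto simp: powr_diff)
 also have "j powr (q/p - 1) \<le> ?C powr (q/p - 1)" using j jle p by (intro powr_mono2) auto
 also have "?C powr (q/p - 1) = ?B" using s x e by (simp add: \<rho>_def powr_mult powr_powr powr_divide)
 finally have "i powr q \<le> \<omega> powr (q - q/p) * (?B * j)" using j by (simp add: mult_left_mono mult_right_mono)
 then have "rad x powr (n * (q/p - 1)) * i powr q \<le> rad x powr (n * (q/p - 1)) * (\<omega> powr (q - q/p) * (?B * j))"
  by (intro mult_left_mono) auto
 also have "... = (rad x powr (n * (q/p - 1)) * rad x powr ?A) * ?G"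
  by (simp only: mult_ac)
 also have "rad x powr (n * (q/p - 1)) * rad x powr ?A = 1" using x by (simp add: powr_add[symmetric])
 finally have "rad x powr (n * (q/p - 1)) * i powr q \<le> ?G"
  by simp
 then show "ennreal (rad x powr (n * (q/p - 1)) * enn2real (ball_avg s g x) powr q)
   \<le> ennreal (\<omega> powr (q - q/p) * (s/2) powr ?A * e powr (q/p - 1)) * ball_avg s (\<lambda>x. g x powr p) x"
  using i j by (simp add: ennreal_mult[symmetric] ennreal_leI)
qed

text \<open>The only loss as \<open>s\<close> tends to 0 is the explicit power of \<open>s\<close>,
  because \<open>nn_integral_ball_avg\<close> is uniform in \<open>s\<close>.\<close>

lemma ball_avg_powr_integral:
 fixes p q :: real
 defines "n \<equiv> real DIM('a::euclidean_space \<times> 'b::euclidean_space)"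
 assumes p: "1 \<le> p" "p < q"
 obtains C where "C \<ge> 0"
  "\<And>(g :: 'a \<times> 'b \<Rightarrow> real) e s. \<lbrakk>g \<in> Borel; \<And>x. g x \<ge> 0; (\<integral>x. g x powr p) \<le> ennreal e; 0 \<le> e; 0 < s; s \<le> 1\<rbrakk> \<Longrightarrow>
   (\<integral>x. rad x powr (n * (q/p - 1)) * enn2real (ball_avg s g x) powr q)
    \<le> ennreal (C * s powr (- (n * (q/p - 1))) * e powr (q/p))"
proof -
 define \<omega> where "\<omega> = measure lborel (ball (0::'a \<times> 'b) 1)"
 define C where "C = \<omega> powr (q - q/p) * 2 powr (n * (q/p - 1)) * (3 ^ DIM('a \<times> 'b) * \<omega>)"
 have \<omega>: "\<omega> \<ge> 0" by (simp add: \<omega>_def)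
 have C: "C \<ge> 0" using \<omega> by (simp add: C_def)
 let ?A = "- (n * (q/p - 1))"
 have "(\<integral>x. rad x powr (n * (q/p - 1)) * enn2real (ball_avg s g x) powr q) \<le> ennreal (C * s powr ?A * e powr (q/p))"
  if g[measurable]: "g \<in> Borel" and nn: "\<And>x. g x \<ge> 0"
   and e: "(\<integral>x. g x powr p) \<le> ennreal e" "0 \<le> e" and s: "0 < s" "s \<le> 1" for g :: "'a \<times> 'b \<Rightarrow> real" and e s
 proof -
  let ?c = "\<omega> powr (q - q/p) * (s/2) powr ?A * e powr (q/p - 1)"
  have c: "?c \<ge> 0" by simp
  have "(\<integral>x. rad x powr (n * (q/p - 1)) * enn2real (ball_avg s g x) powr q)
    \<le> (\<integral>\<^sup>+x. ennreal ?c * ball_avg s (\<lambda>x. g x powr p) x)"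
  proof (rule nn_integral_mono_AE, use AE_rad_pos in eventually_elim)
   fix x :: "'a \<times> 'b" assume "rad x > 0"
   from ball_avg_powr_pointwise(2)[OF g nn p s e this]
   show "ennreal (rad x powr (n * (q/p - 1)) * enn2real (ball_avg s g x) powr q)
    \<le> ennreal ?c * ball_avg s (\<lambda>x. g x powr p) x" by (simp add: n_def \<omega>_def)
  qed
  also have "... = ennreal ?c * (\<integral>\<^sup>+x. ball_avg s (\<lambda>x. g x powr p) x)" by (rule nn_integral_cmult) measurable
  also have "... \<le> ennreal ?c * (ennreal (3 ^ DIM('a \<times> 'b) * \<omega>) * ennreal e)" unfolding \<omega>_def
   by (intro mult_left_mono order.trans[OF nn_integral_ball_avg[OF _ s]] e) auto
  also have "... = ennreal (?c * (3 ^ DIM('a \<times> 'b) * \<omega> * e))" using c \<omega> e(2) by (simp add: ennreal_mult[symmetric])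
  also have "?c * (3 ^ DIM('a \<times> 'b) * \<omega> * e) = C * s powr ?A * (e powr (q/p - 1) * e)"
  proof -
   have "(s/2) powr ?A = s powr ?A * 2 powr (n * (q/p - 1))"
    using s by (simp only: powr_divide powr_minus[of 2]) (simp add: divide_inverse)
   then show ?thesis by (simp only: C_def mult_ac)
  qed
  also have "e powr (q/p - 1) * e = e powr (q/p)" using e p by (cases "e = 0") (auto simp: powr_diff)
  finally show ?thesis .
 qed
 then show ?thesis using that C by blast
qed

lemma nn_integral_Jensen':
 fixes f :: "'a \<Rightarrow> real"
 assumes "f \<in> borel_measurable M" "S \<in> sets M" "\<And>x. f x \<ge> 0" "q \<ge> 1"
  and "emeasure M S = 1" "ennreal a \<le> (\<integral>\<^sup>+x\<in>S. ennreal (f x) \<partial>M)" "0 \<le> a"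
 shows "ennreal (a powr q) \<le> (\<integral>\<^sup>+x\<in>S. ennreal (f x powr q) \<partial>M)"
proof (cases "(\<integral>\<^sup>+x\<in>S. ennreal (f x powr q) \<partial>M)")
 case (real B)
 have "(\<integral>\<^sup>+x\<in>S. ennreal (f x) \<partial>M) \<le> ennreal (B powr (1/q) * 1 powr (1 - 1/q))"
  by (rule nn_integral_Jensen) (use assms real in auto)
 with assms(6) have "ennreal a \<le> ennreal (B powr (1/q))" by (auto dest: order.trans)
 then have "a \<le> B powr (1/q)" by (subst (asm) ennreal_le_iff) auto
 then have "a powr q \<le> (B powr (1/q)) powr q" using assms by (intro powr_mono2) auto
 then show ?thesis using real assms by (simp add: powr_powr ennreal_leI)
qed simp

text \<open>Integration along the segments from \<open>x\<close> to the points of its ball, then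
  over the ball, with the order exchanged: the gradient enters through averages over balls of
  relative size \<open>\<tau> powr \<kappa>\<close>. Parametrising the segments by a power supplies
  the factor \<open>\<tau> powr (\<kappa> - 1)\<close>, which vanishes as the balls shrink.\<close>

lemma local_pointwise:
 fixes f :: "'a::euclidean_space \<times> 'b::euclidean_space \<Rightarrow> real"
 assumes f: "C_class (Suc 0) f" and \<kappa>: "\<kappa> > 1"
 shows "ennreal (measure lborel (ball (0::'a \<times> 'b) 1) * \<bar>f x\<bar>) \<le> ball_avg 1 (\<lambda>x. \<bar>f x\<bar>) x +
  (\<integral>\<^sup>+\<tau>\<in>{0..1}. ennreal (\<kappa> * \<tau> powr (\<kappa> - 1) * (rad x / 2)) * ball_avg (\<tau> powr \<kappa>) (\<lambda>x. norm (gradient f x)) x)"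
proof -
 let ?U = "ball (0::'a \<times> 'b) 1" and ?r = "rad x / 2"
 have [measurable]: "f \<in> Borel" "gradient f \<in> Borel"
  using f C_class_continuous continuous_on_gradient by (blast intro: borel_measurable_continuous_onI)+
 let ?G = "\<lambda>\<tau> h. ennreal (\<kappa> * \<tau> powr (\<kappa> - 1) * ?r * norm (gradient f (x + (\<tau> powr \<kappa> * rad x / 2) *\<^sub>R h)))"
 have key: "ennreal \<bar>f x\<bar> \<le> ennreal \<bar>f (x + (1 * rad x / 2) *\<^sub>R h)\<bar> + (\<integral>\<^sup>+\<tau>\<in>{0..1}. ?G \<tau> h)" if h: "h \<in> ?U" for h
 proof -
  let ?A = "?r *\<^sub>R h"
  let ?C = "(\<integral>\<^sup>+\<tau>\<in>{0..1}. ?G \<tau> h)"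
  have "ennreal \<bar>f (x + ?A) - f x\<bar> \<le> (\<integral>\<^sup>+\<tau>\<in>{0..1}.
    ennreal (\<bar>\<kappa> * \<tau> powr (\<kappa> - 1)\<bar> * \<bar>gradient f (x + (\<tau> powr \<kappa>) *\<^sub>R ?A) \<bullet> ?A\<bar>) \<partial>lborel)"
   using \<kappa> by (intro abs_diff_le_nn_integral_segment[OF f] continuous_on_mult continuous_on_powr'
     continuous_on_const continuous_on_id) (auto intro!: derivative_eq_intros)
  also have "... \<le> ?C"
  proof (intro nn_integral_mono mult_right_mono ennreal_leI)
   fix \<tau> :: real
   let ?g = "gradient f (x + (\<tau> powr \<kappa> * rad x / 2) *\<^sub>R h)"
   have "\<bar>?g \<bullet> ?A\<bar> \<le> norm ?g * norm ?A" by (rule Cauchy_Schwarz_ineq2)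
   also have "norm ?A \<le> ?r" using h by (simp add: mult_left_le)
   finally have "\<bar>?g \<bullet> ?A\<bar> \<le> norm ?g * ?r" by (simp add: mult_left_mono)
   then have "\<bar>\<kappa> * \<tau> powr (\<kappa> - 1)\<bar> * \<bar>?g \<bullet> ?A\<bar> \<le> (\<kappa> * \<tau> powr (\<kappa> - 1)) * (norm ?g * ?r)"
    using \<kappa> by (intro mult_mono) (auto simp: abs_mult)
   then show "\<bar>\<kappa> * \<tau> powr (\<kappa> - 1)\<bar> * \<bar>gradient f (x + (\<tau> powr \<kappa>) *\<^sub>R ?A) \<bullet> ?A\<bar> \<le> \<kappa> * \<tau> powr (\<kappa> - 1) * ?r * norm ?g"
    by (simp add: mult_ac)
  qed simp
  finally have 1: "ennreal \<bar>f (x + ?A) - f x\<bar> \<le> ?C" .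
  have "ennreal \<bar>f x\<bar> \<le> ennreal \<bar>f (x + ?A)\<bar> + ennreal \<bar>f (x + ?A) - f x\<bar>"
   using ennreal_leI[of "\<bar>f x\<bar>" "\<bar>f (x + ?A)\<bar> + \<bar>f (x + ?A) - f x\<bar>"] by simp
  also have "... \<le> ennreal \<bar>f (x + ?A)\<bar> + ?C" using 1 by (rule add_left_mono)
  finally show ?thesis by simp
 qed
 have "ennreal (measure lborel ?U * \<bar>f x\<bar>) = (\<integral>h\<in>?U. \<bar>f x\<bar>)" using emeasure_lborel_ball[of 1 "0::'a \<times> 'b"]
  by (simp add: nn_integral_cmult_indicator ennreal_mult mult.commute)
 also have "... \<le> (\<integral>\<^sup>+h. ennreal \<bar>f (x + (1 * rad x / 2) *\<^sub>R h)\<bar> * indicator ?U h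
   + (\<integral>\<^sup>+\<tau>. ?G \<tau> h * indicator {0..1} \<tau> * indicator ?U h))"
 proof (rule nn_integral_mono)
  fix h
  show "ennreal \<bar>f x\<bar> * indicator ?U h \<le> ennreal \<bar>f (x + (1 * rad x / 2) *\<^sub>R h)\<bar> * indicator ?U h
   + (\<integral>\<^sup>+\<tau>. ?G \<tau> h * indicator {0..1} \<tau> * indicator ?U h)" using key[of h] by (cases "h \<in> ?U") auto
 qed
 also have "... = ball_avg 1 (\<lambda>x. \<bar>f x\<bar>) x + (\<integral>\<^sup>+h. (\<integral>\<^sup>+\<tau>. ?G \<tau> h * indicator {0..1} \<tau> * indicator ?U h))"
  unfolding ball_avg_def by (rule nn_integral_add) measurable
 also have "(\<integral>\<^sup>+h. (\<integral>\<^sup>+\<tau>. ?G \<tau> h * indicator {0..1} \<tau> * indicator ?U h))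
   = (\<integral>\<^sup>+\<tau>. (\<integral>\<^sup>+h. ?G \<tau> h * indicator {0..1} \<tau> * indicator ?U h))" by (rule lborel_pair.Fubini') measurable
 also have "... = (\<integral>\<^sup>+\<tau>\<in>{0..1}. ennreal (\<kappa> * \<tau> powr (\<kappa> - 1) * ?r) * ball_avg (\<tau> powr \<kappa>) (\<lambda>x. norm (gradient f x)) x)"
 proof (rule nn_integral_cong)
  fix \<tau> :: real
  let ?B = "\<kappa> * \<tau> powr (\<kappa> - 1) * ?r"
  let ?D = "ennreal ?B * indicator {0..1} \<tau>"
  have "(\<integral>\<^sup>+h. ?G \<tau> h * indicator {0..1} \<tau> * indicator ?U h)
   = (\<integral>\<^sup>+h. ?D * (ennreal (norm (gradient f (x + (\<tau> powr \<kappa> * rad x / 2) *\<^sub>R h))) * indicator ?U h))"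
  proof (rule nn_integral_cong)
   fix h :: "'a \<times> 'b"
   let ?E = "norm (gradient f (x + (\<tau> powr \<kappa> * rad x / 2) *\<^sub>R h))"
   have "?G \<tau> h = ennreal ?B * ennreal ?E" using \<kappa> by (intro ennreal_mult) auto
   then show "?G \<tau> h * indicator {0..1} \<tau> * indicator ?U h = ?D * (ennreal ?E * indicator ?U h)"
    by (simp only: mult_ac)
  qed
  also have "... = ?D * ball_avg (\<tau> powr \<kappa>) (\<lambda>x. norm (gradient f x)) x"
   unfolding ball_avg_def by (rule nn_integral_cmult) measurable
  finally show "(\<integral>\<^sup>+h. ?G \<tau> h * indicator {0..1} \<tau> * indicator ?U h)
   = ennreal ?B * ball_avg (\<tau> powr \<kappa>) (\<lambda>x. norm (gradient f x)) x * indicator {0..1} \<tau>" by (simp add: mult_ac)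
 qed
 finally show ?thesis .
qed

text \<open>The hypothesis \<open>\<nu> < q\<close> is subcriticality of \<open>q\<close>, that is
  \<open>n / p - n / q < 1\<close> with \<open>n\<close> the full dimension. On a ball of radius
  comparable to \<open>rad x\<close> the Sobolev inequality has a term of order zero, which by
  scaling is \<open>\<bar>f x\<bar> / rad x\<close>.\<close>

lemma local_weighted_inequality:
 fixes p q :: real
 defines "\<nu> \<equiv> real DIM('a::euclidean_space \<times> 'b::euclidean_space) * (q/p - 1)"
 assumes p: "1 \<le> p" "p < q" and \<nu>: "\<nu> < q"
 obtains C where "C \<ge> 0"
  "\<And>(f :: 'a \<times> 'b \<Rightarrow> real) e0 e1. \<lbrakk>C_class (Suc 0) f; (\<integral>x. (\<bar>f x\<bar> / rad x) powr p) \<le> ennreal e0; 0 \<le> e0;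
   (\<integral>x. grad_powr p f x) \<le> ennreal e1; 0 \<le> e1\<rbrakk> \<Longrightarrow> (\<integral>x. rad x powr (\<nu> - q) * \<bar>f x\<bar> powr q)
    \<le> ennreal (C * (e0 powr (q/p) + e1 powr (q/p)))"
proof -
 obtain C0 where C0: "C0 \<ge> 0" and avg: "\<And>(g :: 'a \<times> 'b \<Rightarrow> real) e s. \<lbrakk>g \<in> Borel; \<And>x. g x \<ge> 0;
   (\<integral>x. g x powr p) \<le> ennreal e; 0 \<le> e; 0 < s; s \<le> 1\<rbrakk> \<Longrightarrow> (\<integral>x. rad x powr \<nu> * enn2real (ball_avg s g x) powr q)
    \<le> ennreal (C0 * s powr (- \<nu>) * e powr (q/p))"
  using ball_avg_powr_integral[OF p, where 'a='a and 'b='b] unfolding \<nu>_def by blast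
 define \<omega> where "\<omega> = measure lborel (ball (0::'a \<times> 'b) 1)"
 have \<omega>: "\<omega> > 0" unfolding \<omega>_def by (rule content_ball_pos) simp
 have "\<nu> > 0" unfolding \<nu>_def using p by (intro mult_pos_pos) (auto simp: add_pos_pos)
 \<comment> \<open>Averages over balls of relative size \<open>\<tau> powr \<kappa>\<close> cost
   \<open>\<tau> powr (- \<kappa> * \<nu>)\<close>, while the factor
   \<open>\<tau> powr (\<kappa> - 1)\<close>, raised to the power \<open>q\<close>, gains
   \<open>\<tau> powr ((\<kappa> - 1) * q)\<close>. For this \<open>\<kappa>\<close> the product is
   1 and the integral over \<open>\<tau>\<close> is harmless; it is available because
   \<open>\<nu> < q\<close>.\<close>
 define \<kappa> where "\<kappa> = q / (q - \<nu>)"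
 have \<kappa>: "\<kappa> > 1" using \<open>\<nu> > 0\<close> \<nu> by (simp add: \<kappa>_def)
 have \<kappa>\<nu>: "(\<kappa> - 1) * q - \<kappa> * \<nu> = 0" using \<nu> p by (simp add: \<kappa>_def field_simps)
 define C where "C = (3 powr q + \<kappa> powr q) * C0 / \<omega> powr q"
 have C: "C \<ge> 0" using C0 by (simp add: C_def)
 have "(\<integral>x. rad x powr (\<nu> - q) * \<bar>f x\<bar> powr q) \<le> ennreal (C * (e0 powr (q/p) + e1 powr (q/p)))"
  if f: "C_class (Suc 0) f"
   and e0: "(\<integral>x. (\<bar>f x\<bar> / rad x) powr p) \<le> ennreal e0" "0 \<le> e0"
   and e1: "(\<integral>x. grad_powr p f x) \<le> ennreal e1" "0 \<le> e1" for f :: "'a \<times> 'b \<Rightarrow> real" and e0 e1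
 proof -
  have [measurable]: "f \<in> Borel" "gradient f \<in> Borel"
   using f C_class_continuous continuous_on_gradient by (blast intro: borel_measurable_continuous_onI)+
  define g0 where "g0 x = \<bar>f x\<bar> / rad x" for x
  define g1 where "g1 x = norm (gradient f x)" for x
  have [measurable]: "g0 \<in> Borel" "g1 \<in> Borel" unfolding g0_def g1_def by measurable
  have g_nn: "g0 x \<ge> 0" "g1 x \<ge> 0" for x by (simp_all add: g0_def g1_def)
  define i0 where "i0 x = enn2real (ball_avg 1 g0 x)" for x
  define i1 where "i1 \<tau> x = enn2real (ball_avg (\<tau> powr \<kappa>) g1 x)" for \<tau> x
  have [measurable]: "i0 \<in> Borel" unfolding i0_def by measurable
  have [measurable]: "(\<lambda>w. i1 (fst w) (snd w)) \<in> borel_measurable (borel \<Otimes>\<^sub>M borel)"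
   "i1 \<tau> \<in> Borel" "(\<lambda>\<tau>. i1 \<tau> x) \<in> Borel" for \<tau> x unfolding i1_def by measurable
  have nn: "i0 x \<ge> 0" "i1 \<tau> x \<ge> 0" for x \<tau> by (simp_all add: i0_def i1_def)
  note e0' = e0(1)[folded g0_def] and e1' = e1(1)[folded g1_def]
  \<comment> \<open>Both terms of \<open>local_pointwise\<close> with the common factor
    \<open>rad x\<close> taken out; the 3 comes from \<open>rad \<xi> \<le> 3 / 2 * rad x\<close> on
    the ball.\<close>
  define b where "b x \<tau> = (3 * i0 x + \<kappa> * \<tau> powr (\<kappa> - 1) * i1 \<tau> x) / 2" for x \<tau>
  have b_nn: "b x \<tau> \<ge> 0" for x \<tau> using \<kappa> nn by (simp add: b_def)
  have [measurable]: "b x \<in> Borel" for x unfolding b_def by measurable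
  define B where "B x \<tau> = ennreal (rad x powr \<nu> * ((3 * i0 x) powr q + (\<kappa> * \<tau> powr (\<kappa> - 1) * i1 \<tau> x) powr q)) * indicator {0..1::real} \<tau>" for x \<tau>
  have [measurable]: "(\<lambda>(x, \<tau>). B x \<tau>) \<in> borel_measurable (borel \<Otimes>\<^sub>M borel)" "(\<lambda>x. B x \<tau>) \<in> Borel" for \<tau>
   unfolding B_def i1_def by measurable
  have pt: "ennreal (rad x powr (\<nu> - q) * (\<omega> * \<bar>f x\<bar>) powr q) \<le> (\<integral>\<^sup>+\<tau>. B x \<tau>)" if x: "rad x > 0" for x
  proof -
   have fin0: "ball_avg 1 g0 x = ennreal (i0 x)"
    using ball_avg_powr_pointwise(1)[OF _ _ p _ _ e0' e0(2) x, of 1] g_nn by (simp add: i0_def)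
   have fin1: "ball_avg (\<tau> powr \<kappa>) g1 x = ennreal (i1 \<tau> x)" if "0 < \<tau>" "\<tau> \<le> 1" for \<tau>
    using ball_avg_powr_pointwise(1)[OF _ _ p _ _ e1' e1(2) x, of "\<tau> powr \<kappa>"] g_nn that \<kappa>
    by (simp add: i1_def powr_le1)
   let ?D = "ball_avg 1 (\<lambda>x. \<bar>f x\<bar>) x"
   have "?D \<le> (\<integral>\<^sup>+h\<in>ball 0 1. ennreal (3/2 * rad x) * ennreal (g0 (x + (1 * rad x / 2) *\<^sub>R h)))"
    unfolding ball_avg_def
   proof (intro nn_integral_mono)
    fix h :: "'a \<times> 'b"
    let ?\<xi> = "x + (1 * rad x / 2) *\<^sub>R h"
    show "ennreal \<bar>f ?\<xi>\<bar> * indicator (ball 0 1) h \<le> ennreal (3/2 * rad x) * ennreal (g0 ?\<xi>) * indicator (ball 0 1) h"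
    proof (cases "h \<in> ball 0 1")
     case True
     then have "dist x ?\<xi> < 1 * rad x / 2" using x by (simp add: dist_norm)
     from rad_comparable(2,3)[OF this refl] have c: "rad ?\<xi> \<le> 3/2 * rad x" "rad ?\<xi> > 0" by auto
     then have "\<bar>f ?\<xi>\<bar> = rad ?\<xi> * g0 ?\<xi>" by (simp add: g0_def)
     also have "... \<le> 3/2 * rad x * g0 ?\<xi>" using c g_nn by (intro mult_right_mono) auto
     finally show ?thesis using x g_nn True by (simp add: ennreal_mult[symmetric] ennreal_leI)
    qed simp
   qed
   also have "... = ennreal (3/2 * rad x) * ball_avg 1 g0 x"
    unfolding ball_avg_def by (subst nn_integral_cmult[symmetric]) (auto simp: mult_ac)
   finally have 1: "?D \<le> ennreal (3/2 * rad x * i0 x)" unfolding fin0 by (subst ennreal_mult) (use x nn in auto)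
   let ?B = "(\<integral>\<tau>\<in>{0..1}. rad x * b x \<tau>)"
   let ?C = "\<omega> * \<bar>f x\<bar>"
   let ?F = "rad x powr (\<nu> - q)"
   have "ennreal ?C \<le> ?D + (\<integral>\<^sup>+\<tau>\<in>{0..1}. ennreal (\<kappa> * \<tau> powr (\<kappa> - 1) * (rad x / 2)) * ball_avg (\<tau> powr \<kappa>) g1 x)"
    using local_pointwise[OF f \<kappa>, of x] by (simp add: \<omega>_def g1_def[abs_def])
   also have "... \<le> ennreal (3/2 * rad x * i0 x) + (\<integral>\<tau>\<in>{0..1}. \<kappa> * \<tau> powr (\<kappa> - 1) * (rad x / 2) * i1 \<tau> x)"
   proof (intro add_mono 1 nn_integral_mono)
    fix \<tau> :: real
    show "ennreal (\<kappa> * \<tau> powr (\<kappa> - 1) * (rad x / 2)) * ball_avg (\<tau> powr \<kappa>) g1 x * indicator {0..1} \<tau>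
      \<le> ennreal (\<kappa> * \<tau> powr (\<kappa> - 1) * (rad x / 2) * i1 \<tau> x) * indicator {0..1} \<tau>"
     using fin1[of \<tau>] \<kappa> x nn by (cases "\<tau> = 0") (auto simp: indicator_def simp flip: ennreal_mult')
   qed
   also have "... = (\<integral>\<^sup>+\<tau>. ennreal (3/2 * rad x * i0 x) * indicator {0..1} \<tau> +
    ennreal (\<kappa> * \<tau> powr (\<kappa> - 1) * (rad x / 2) * i1 \<tau> x) * indicator {0..1::real} \<tau>)"
    by (subst nn_integral_add) (auto simp: nn_integral_cmult_indicator)
   also have "... = ?B" using \<kappa> x nn by (intro nn_integral_cong)
     (auto simp: indicator_def b_def field_simps simp flip: ennreal_plus)
   finally have "ennreal ?C \<le> ?B" .
   then have "ennreal (?C powr q) \<le> (\<integral>\<tau>\<in>{0..1}. (rad x * b x \<tau>) powr q)"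
    using \<omega> p b_nn x by (intro nn_integral_Jensen') auto
   then have "ennreal ?F * ennreal (?C powr q) \<le> ennreal ?F * (\<integral>\<tau>\<in>{0..1}. (rad x * b x \<tau>) powr q)"
    by (rule mult_left_mono) simp
   also have "... = (\<integral>\<^sup>+\<tau>. ennreal ?F * (ennreal ((rad x * b x \<tau>) powr q) * indicator {0..1} \<tau>))"
    by (rule nn_integral_cmult[symmetric]) measurable
   also have "... \<le> (\<integral>\<^sup>+\<tau>. B x \<tau>)"
   proof (rule nn_integral_mono)
    fix \<tau> :: real
    let ?v = "\<kappa> * \<tau> powr (\<kappa> - 1) * i1 \<tau> x"
    have "b x \<tau> powr q = (3 * i0 x + ?v) powr q / 2 powr q" using \<kappa> nn by (simp add: b_def powr_divide)
    also have "... \<le> (3 * i0 x) powr q + ?v powr q"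
     using powr_add_le[of "3 * i0 x" ?v q] \<kappa> nn p by (simp add: field_simps)
    finally have "rad x powr \<nu> * b x \<tau> powr q \<le> rad x powr \<nu> * ((3 * i0 x) powr q + ?v powr q)"
     by (rule mult_left_mono) simp
    moreover have "rad x powr (\<nu> - q) * (rad x * b x \<tau>) powr q = rad x powr \<nu> * b x \<tau> powr q"
     using x b_nn by (simp add: powr_mult powr_diff)
    ultimately show "ennreal ?F * (ennreal ((rad x * b x \<tau>) powr q) * indicator {0..1} \<tau>) \<le> B x \<tau>"
     by (auto simp: B_def indicator_def ennreal_mult[symmetric] ennreal_leI)
   qed
   finally show ?thesis by (simp add: ennreal_mult)
  qed
  let ?A = "(3 powr q + \<kappa> powr q) * C0 * (e0 powr (q/p) + e1 powr (q/p))"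
  have inner: "(\<integral>\<^sup>+x. B x \<tau>) \<le> ennreal ?A * indicator {0..1} \<tau>" if \<tau>: "0 \<noteq> \<tau>" for \<tau> :: real
  proof (cases "\<tau> \<in> {0..1}")
   case True
   with \<tau> have \<tau>: "0 < \<tau>" "\<tau> \<le> 1" by auto
   let ?c = "\<kappa> powr q * \<tau> powr ((\<kappa> - 1) * q)"
   let ?E = "\<tau> powr ((\<kappa> - 1) * q) * (\<tau> powr \<kappa>) powr (- \<nu>)"
   have "(\<integral>\<^sup>+x. B x \<tau>) = (\<integral>\<^sup>+x. ennreal (3 powr q) * ennreal (rad x powr \<nu> * i0 x powr q)
     + ennreal ?c * ennreal (rad x powr \<nu> * i1 \<tau> x powr q))" using True \<kappa> nn \<tau> by (intro nn_integral_cong)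
     (simp add: B_def powr_mult powr_powr algebra_simps flip: ennreal_mult ennreal_plus)
   also have "... = ennreal (3 powr q) * (\<integral>x. rad x powr \<nu> * i0 x powr q)
     + ennreal ?c * (\<integral>x. rad x powr \<nu> * i1 \<tau> x powr q)" by (simp add: nn_integral_add nn_integral_cmult)
   also have "... \<le> ennreal (3 powr q) * ennreal (C0 * 1 powr (- \<nu>) * e0 powr (q/p))
     + ennreal ?c * ennreal (C0 * (\<tau> powr \<kappa>) powr (- \<nu>) * e1 powr (q/p))" unfolding i0_def i1_def
    by (intro add_mono mult_left_mono avg g_nn e0' e1' e0(2) e1(2)) (use \<tau> \<kappa> in \<open>auto simp: powr_le1\<close>)
   also have "... = ennreal (3 powr q * C0 * e0 powr (q/p) + \<kappa> powr q * C0 * ?E * e1 powr (q/p))"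
    using C0 by (simp add: ennreal_mult[symmetric] mult_ac flip: ennreal_plus)
   also have "?E = \<tau> powr ((\<kappa> - 1) * q - \<kappa> * \<nu>)"
    using \<tau> by (simp add: powr_powr powr_diff powr_minus divide_inverse)
   also have "... = 1" unfolding \<kappa>\<nu> using \<tau> by simp
   also have "3 powr q * C0 * e0 powr (q/p) + \<kappa> powr q * C0 * 1 * e1 powr (q/p) \<le> ?A"
    using C0 by (simp add: algebra_simps)
   finally show ?thesis using True by (simp add: ennreal_leI)
  qed (simp add: B_def)
  have "(\<integral>x. rad x powr (\<nu> - q) * (\<omega> * \<bar>f x\<bar>) powr q) \<le> (\<integral>\<^sup>+x. (\<integral>\<^sup>+\<tau>. B x \<tau>))"
   by (rule nn_integral_mono_AE, use AE_rad_pos in eventually_elim) (rule pt)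
  also have "... = (\<integral>\<^sup>+\<tau>. (\<integral>\<^sup>+x. B x \<tau>))" by (rule lborel_pair.Fubini'[symmetric]) measurable
  also have "... \<le> (\<integral>\<^sup>+\<tau>. ennreal ?A * indicator {0..1::real} \<tau>)"
   by (rule nn_integral_mono_AE, use AE_lborel_singleton[of "0::real"] in eventually_elim) (use inner in auto)
  also have "... = ennreal ?A" by (simp add: nn_integral_cmult_indicator)
  finally have "ennreal (1 / \<omega> powr q) * (\<integral>x. rad x powr (\<nu> - q) * (\<omega> * \<bar>f x\<bar>) powr q)
   \<le> ennreal (1 / \<omega> powr q) * ennreal ?A" by (rule mult_left_mono) simp
  also have "ennreal (1 / \<omega> powr q) * (\<integral>x. rad x powr (\<nu> - q) * (\<omega> * \<bar>f x\<bar>) powr q)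
   = (\<integral>x. rad x powr (\<nu> - q) * \<bar>f x\<bar> powr q)"
   using \<omega> by (subst nn_integral_cmult[symmetric]) (auto simp: powr_mult simp flip: ennreal_mult)
  finally show ?thesis using C0 \<omega> by (simp add: C_def flip: ennreal_mult)
 qed
 then show ?thesis using that C by blast
qed

section \<open>Dilations in \<open>y\<close> and the global weighted inequality\<close>

lemma nn_integral_dilate_fst:
 fixes G :: "'a::euclidean_space \<times> 'b::euclidean_space \<Rightarrow> ennreal"
 assumes [measurable]: "G \<in> Borel" and c: "c > 0"
 shows "(\<integral>\<^sup>+x. G (dil c x)) = ennreal (1 / c ^ DIM('a)) * (\<integral>\<^sup>+x. G x)"
proof -
 have [measurable]: "G \<in> borel_measurable (borel \<Otimes>\<^sub>M borel)" using assms(1) by (simp add: borel_prod)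
 have "(\<integral>\<^sup>+x. G (dil c x)) = (\<integral>\<^sup>+x. G (dil c x) \<partial>(lborel \<Otimes>\<^sub>M lborel))" by (simp add: lborel_prod)
 also have "... = (\<integral>\<^sup>+z. (\<integral>\<^sup>+y. G (c *\<^sub>R y, z)))" by (subst lborel_pair.nn_integral_snd[symmetric]) auto
 also have "... = (\<integral>\<^sup>+z. ennreal (1 / c ^ DIM('a)) * (\<integral>\<^sup>+y. G (y, z)))"
 proof (rule nn_integral_cong)
  fix z
  show "(\<integral>\<^sup>+y. G (c *\<^sub>R y, z)) = ennreal (1 / c ^ DIM('a)) * (\<integral>\<^sup>+y. G (y, z))"
   using nn_integral_affine[of "\<lambda>y. G (y, z)" c 0] c by simp
 qed
 also have "... = ennreal (1 / c ^ DIM('a)) * (\<integral>\<^sup>+z. (\<integral>\<^sup>+y. G (y, z)))" by (rule nn_integral_cmult) measurable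
 also have "(\<integral>\<^sup>+z. (\<integral>\<^sup>+y. G (y, z))) = (\<integral>\<^sup>+x. G x)" by (subst lborel_pair.nn_integral_snd) (auto simp: lborel_prod)
 finally show ?thesis .
qed

lemma C_class_dilate_fst:
 fixes u :: "'a::euclidean_space \<times> 'b::euclidean_space \<Rightarrow> real"
 assumes u: "C_class (Suc 0) u"
 shows "C_class (Suc 0) (\<lambda>x. u (dil c x))"
  "gradient (\<lambda>x. u (dil c x)) x = (c *\<^sub>R fst (gradient u (dil c x)), snd (gradient u (dil c x)))"
proof -
 have D: "((\<lambda>x. u (dil c x)) has_derivative (\<lambda>h. gradient u (dil c x) \<bullet> (dil c h))) (at x)" for x
  by (rule has_derivative_compose[of "\<lambda>x. (dil c x)", OF _ has_derivative_gradient[OF C_class_differentiable[OF u]]])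
   (auto intro!: derivative_eq_intros)
 have "continuous_on UNIV (partial_deriv b (\<lambda>x. u (dil c x)))" for b unfolding partial_deriv_eq[OF D, abs_def]
  by (intro continuous_on_inner continuous_on_compose2[OF continuous_on_gradient[OF u]] continuous_intros) auto
 moreover have "(\<lambda>x. u (dil c x)) differentiable (at x)" for x using D[of x] unfolding differentiable_def by blast
 ultimately show "C_class (Suc 0) (\<lambda>x. u (dil c x))" by (simp add: differentiable_on_def)
 show "gradient (\<lambda>x. u (dil c x)) x = (c *\<^sub>R fst (gradient u (dil c x)), snd (gradient u (dil c x)))"
  by (rule gradient_eqI, rule has_derivative_eq_rhs[OF D]) (auto simp: inner_prod_def)
qed

text \<open>\<open>f\<close> is an integral of the gradient along the segment from
  \<open>(y, z)\<close> to \<open>(2 y, z)\<close>. Its length is \<open>rad x\<close> and cancels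
  the denominator at once. Jensen's inequality and the substitution of \<open>(1 + t) y\<close> for
  \<open>y\<close>, which can only decrease the integral, then give the constant 1 in the first
  bound.\<close>

lemma dilation_difference:
 fixes u :: "'a::euclidean_space \<times> 'b::euclidean_space \<Rightarrow> real"
 assumes u: "C1c u" and p: "p \<ge> 1"
 defines "f \<equiv> \<lambda>x. u (dil 2 x) - u x" shows "C_class (Suc 0) f" "(\<integral>x. (\<bar>f x\<bar> / rad x) powr p) \<le> ennreal (energy p u)"
  "(\<integral>x. grad_powr p f x) \<le> ennreal (2 * 4 powr p * energy p u)"
proof -
 have u1: "C_class (Suc 0) u" using u by (simp add: C1c_def)
 have [measurable]: "u \<in> Borel" "gradient u \<in> Borel"
  using u by (simp_all add: borel_measurable_C1c borel_measurable_gradient)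
 note dil = C_class_dilate_fst[OF u1, of 2]
 show f1: "C_class (Suc 0) f" unfolding f_def by (intro C_class_diff dil u1)
 have [measurable]: "f \<in> Borel" "gradient f \<in> Borel"
  using f1 C_class_continuous continuous_on_gradient by (blast intro: borel_measurable_continuous_onI)+
 let ?E = "\<lambda>x. ennreal (grad_powr p u x)"
 have E: "(\<integral>\<^sup>+x. ?E x) = ennreal (energy p u)" using u p by (intro nn_integral_energy) auto
 have [measurable]: "(\<lambda>x. (dil c x)) \<in> borel \<rightarrow>\<^sub>M (borel :: ('a \<times> 'b) measure)" for c
  by (intro borel_measurable_continuous_onI continuous_intros)
 have [measurable]: "(\<lambda>w. ((1 + snd w) *\<^sub>R fst (fst w), snd (fst w))) \<in> borel \<Otimes>\<^sub>M borel \<rightarrow>\<^sub>M (borel :: ('a \<times> 'b) measure)"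
  unfolding borel_prod by (intro borel_measurable_continuous_onI continuous_intros)
 have pt: "ennreal ((\<bar>f x\<bar> / rad x) powr p) \<le> (\<integral>\<^sup>+t\<in>{0..1}. ?E (dil (1 + t) x))" if x: "rad x > 0" for x
 proof -
  let ?h = "(fst x, 0::'b)"
  have 1: "x + t *\<^sub>R ?h = (dil (1 + t) x)" for t by (simp add: prod_eq_iff scaleR_add_left)
  have 2: "x + ?h = (dil 2 x)" by (simp add: prod_eq_iff scaleR_2)
  have "ennreal \<bar>u (x + ?h) - u x\<bar> \<le> (\<integral>t\<in>{0..1}. norm ?h * norm (gradient u (x + t *\<^sub>R ?h)))"
   by (rule abs_diff_le_nn_integral[OF u1])
  then have "ennreal \<bar>f x\<bar> \<le> (\<integral>t\<in>{0..1}. rad x * norm (gradient u (dil (1 + t) x)))"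
   using 2 unfolding 1 by (simp add: f_def rad_def)
  then have "ennreal (\<bar>f x\<bar> powr p) \<le> (\<integral>t\<in>{0..1}. (rad x * norm (gradient u (dil (1 + t) x))) powr p)"
   using p by (intro nn_integral_Jensen') auto
  then have "ennreal (1 / rad x powr p) * ennreal (\<bar>f x\<bar> powr p) \<le> ennreal (1 / rad x powr p) *
   (\<integral>t\<in>{0..1}. (rad x * norm (gradient u (dil (1 + t) x))) powr p)" by (rule mult_left_mono) simp
  also have "... = (\<integral>\<^sup>+t\<in>{0..1}. ?E (dil (1 + t) x))" using x by (subst nn_integral_cmult[symmetric])
    (auto simp: powr_mult mult.assoc[symmetric] simp flip: ennreal_mult)
  finally show ?thesis using x by (simp add: powr_divide flip: ennreal_mult)
 qed
 have "(\<integral>x. (\<bar>f x\<bar> / rad x) powr p) \<le> (\<integral>\<^sup>+x. (\<integral>\<^sup>+t\<in>{0..1}. ?E (dil (1 + t) x)))"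
  by (rule nn_integral_mono_AE, use AE_rad_pos in eventually_elim) (rule pt)
 also have "... = (\<integral>\<^sup>+t. (\<integral>\<^sup>+x. ?E (dil (1 + t) x) * indicator {0..1} t))"
  by (rule lborel_pair.Fubini'[symmetric]) measurable
 also have "... \<le> (\<integral>\<^sup>+t. ennreal (energy p u) * indicator {0..1::real} t)"
 proof (rule nn_integral_mono)
  fix t :: real
  show "(\<integral>\<^sup>+x. ?E (dil (1 + t) x) * indicator {0..1} t) \<le> ennreal (energy p u) * indicator {0..1} t"
  proof (cases "t \<in> {0..1}")
   case True
   have "(\<integral>\<^sup>+x. ?E (dil (1 + t) x)) = ennreal (1 / (1 + t) ^ DIM('a)) * ennreal (energy p u)"
    using True by (subst nn_integral_dilate_fst) (auto simp: E)
   also have "... \<le> ennreal 1 * ennreal (energy p u)"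
    using True by (intro mult_right_mono ennreal_leI) (auto simp: divide_le_eq)
   finally show ?thesis using True by simp
  qed simp
 qed
 also have "... = ennreal (energy p u)" by (simp add: nn_integral_cmult_indicator)
 finally show "(\<integral>x. (\<bar>f x\<bar> / rad x) powr p) \<le> ennreal (energy p u)" .
 have "grad_powr p f x \<le> 4 powr p * grad_powr p u (dil 2 x) + 4 powr p * grad_powr p u x" for x
 proof -
  let ?g = "gradient u (dil 2 x)"
  have "gradient f x = (2 *\<^sub>R fst ?g, snd ?g) - gradient u x"
   unfolding f_def by (subst gradient_diff) (auto intro: C_class_differentiable dil u1 simp: dil(2))
  moreover have "norm (2 *\<^sub>R fst ?g, snd ?g) \<le> 2 * norm ?g"
  proof -
   have "(2 *\<^sub>R fst ?g, snd ?g) = ?g + (fst ?g, 0)" by (simp add: prod_eq_iff scaleR_2)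
   moreover have "norm (fst ?g, 0::'b) \<le> norm ?g" using norm_fst_le[of "fst ?g" "snd ?g"] by simp
   ultimately show ?thesis using norm_triangle_ineq[of ?g "(fst ?g, 0)"] by simp
  qed
  ultimately have "norm (gradient f x) \<le> 2 * norm ?g + norm (gradient u x)"
   using norm_triangle_ineq4[of "(2 *\<^sub>R fst ?g, snd ?g)" "gradient u x"] by simp
  then have "grad_powr p f x \<le> (2 * norm ?g + norm (gradient u x)) powr p" using p by (intro powr_mono2) auto
  also have "... \<le> 2 powr p * ((2 * norm ?g) powr p + grad_powr p u x)" using p by (intro powr_add_le) auto
  also have "... = 4 powr p * norm ?g powr p + 2 powr p * grad_powr p u x"
   using powr_mult[of 2 2 p] by (simp add: powr_mult distrib_left)
  also have "... \<le> 4 powr p * norm ?g powr p + 4 powr p * grad_powr p u x"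
   using p by (intro add_left_mono mult_right_mono powr_mono2) auto
  finally show ?thesis .
 qed
 then have "(\<integral>x. grad_powr p f x) \<le> (\<integral>\<^sup>+x. ennreal (4 powr p) * ?E (dil 2 x) + ennreal (4 powr p) * ?E x)"
  by (intro nn_integral_mono) (simp add: ennreal_leI flip: ennreal_mult ennreal_plus)
 also have "... = ennreal (4 powr p) * (ennreal (1 / 2 ^ DIM('a)) * ennreal (energy p u)) + ennreal (4 powr p) * ennreal (energy p u)"
  by (subst nn_integral_add, measurable, subst (1 2) nn_integral_cmult, measurable)
   (subst nn_integral_dilate_fst, auto simp: E)
 also have "... \<le> ennreal (4 powr p) * (ennreal 1 * ennreal (energy p u)) + ennreal (4 powr p) * ennreal (energy p u)"
  by (intro add_mono mult_left_mono mult_right_mono ennreal_leI) (auto simp: divide_le_eq)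
 also have "... = ennreal (2 * 4 powr p * energy p u)" by (simp add: energy_nonneg flip: ennreal_mult ennreal_plus)
 finally show "(\<integral>x. grad_powr p f x) \<le> ennreal (2 * 4 powr p * energy p u)" .
qed

definition vanishes_near_plane :: "('a::euclidean_space \<times> 'b::euclidean_space \<Rightarrow> real) \<Rightarrow> bool" where
 "vanishes_near_plane u \<longleftrightarrow> (\<exists>\<tau>>0. \<forall>x. rad x < \<tau> \<longrightarrow> u x = 0)"

text \<open>\<open>convex_powr_add\<close> with \<open>s\<close> solved from
  \<open>(1 - s) powr (1 - q) = \<theta>\<close>.\<close>

lemma convex_powr_split:
 fixes q \<theta> :: real
 assumes "q > 1" "\<theta> > 1"
 obtains A where "A \<ge> 0" "\<And>a b. 0 \<le> a \<Longrightarrow> 0 \<le> b \<Longrightarrow> (a + b) powr q \<le> \<theta> * a powr q + A * b powr q"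
proof -
 define s where "s = 1 - \<theta> powr (- 1 / (q - 1))"
 have "\<theta> powr (- 1 / (q - 1)) < \<theta> powr 0" using assms by (intro powr_less_mono) auto
 then have s: "0 < s" "s < 1" using assms by (auto simp: s_def)
 have "(1 - s) powr (1 - q) = \<theta> powr ((- 1 / (q - 1)) * (1 - q))" by (simp add: s_def powr_powr)
 also have "(- 1 / (q - 1)) * (1 - q) = 1" using assms by (simp add: field_simps)
 finally have "(1 - s) powr (1 - q) = \<theta>" using assms by simp
 then show ?thesis using that[of "s powr (1 - q)"] convex_powr_add[of _ _ s q] s assms by auto
qed

lemma nn_integral_finite_real:
 fixes w u :: "'a::euclidean_space \<Rightarrow> real"
 assumes "continuous_on UNIV w" "\<And>x. w x \<ge> 0" "C1c u" "q > 0"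
 obtains N where "N \<ge> 0" "(\<integral>x. w x * \<bar>u x\<bar> powr q) = ennreal N"
proof -
 have "continuous_on UNIV (\<lambda>x. \<bar>u x\<bar> powr q)"
  by (rule continuous_on_powr') (use assms C1c_continuous[OF assms(3)] in \<open>auto intro: continuous_on_rabs\<close>)
 then have "integrable lborel (\<lambda>x. w x * \<bar>u x\<bar> powr q)"
  by (intro integrable_continuous_bounded_support continuous_on_mult assms
    bounded_subset[OF C1c_bounded_support[OF assms(3)]]) auto
 then show ?thesis using that[of "LINT x|lborel. w x * \<bar>u x\<bar> powr q"] assms(2) by (simp add: nn_integral_eq_integral)
qed

lemma weighted_dilation_difference:
 fixes p q :: real
 defines "\<beta> \<equiv> q - real DIM('a::euclidean_space \<times> 'b::euclidean_space) * (q/p - 1)"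
 assumes p: "1 \<le> p" "p < q" and \<beta>: "0 < \<beta>"
 shows "\<exists>D\<ge>0. \<forall>u :: 'a \<times> 'b \<Rightarrow> real. C1c u \<longrightarrow>
  (\<integral>x. rad x powr (- \<beta>) * \<bar>u (dil 2 x) - u x\<bar> powr q) \<le> ennreal (D * energy p u powr (q/p))"
proof -
 have \<nu>: "real DIM('a \<times> 'b) * (q/p - 1) < q" using \<beta> by (simp add: \<beta>_def)
 have eq: "- \<beta> = real DIM('a \<times> 'b) * (q/p - 1) - q" by (simp add: \<beta>_def)
 obtain C0 where C0: "C0 \<ge> 0" and loc: "\<And>(f :: 'a \<times> 'b \<Rightarrow> real) e0 e1. \<lbrakk>C_class (Suc 0) f;
   (\<integral>x. (\<bar>f x\<bar> / rad x) powr p) \<le> ennreal e0; 0 \<le> e0; (\<integral>x. grad_powr p f x) \<le> ennreal e1; 0 \<le> e1\<rbrakk> \<Longrightarrow>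
   (\<integral>x. rad x powr (- \<beta>) * \<bar>f x\<bar> powr q) \<le> ennreal (C0 * (e0 powr (q/p) + e1 powr (q/p)))"
  using local_weighted_inequality[where 'a='a and 'b='b, OF p \<nu>] unfolding eq by blast
 define D where "D = C0 * (1 + (2 * 4 powr p) powr (q/p))"
 have "(\<integral>x. rad x powr (- \<beta>) * \<bar>u (dil 2 x) - u x\<bar> powr q) \<le> ennreal (D * energy p u powr (q/p))"
  if u: "C1c u" for u :: "'a \<times> 'b \<Rightarrow> real"
 proof -
  let ?E = "energy p u"
  have "(\<integral>x. rad x powr (- \<beta>) * \<bar>u (dil 2 x) - u x\<bar> powr q) \<le> ennreal (C0 * (?E powr (q/p) + (2 * 4 powr p * ?E) powr (q/p)))"
   using energy_nonneg[of p u] by (intro loc dilation_difference[OF u p(1)]) auto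
  also have "C0 * (?E powr (q/p) + (2 * 4 powr p * ?E) powr (q/p)) = D * ?E powr (q/p)"
   using powr_mult[of "2 * 4 powr p" ?E "q/p"] energy_nonneg[of p u] by (simp add: D_def algebra_simps)
  finally show ?thesis .
 qed
 then show ?thesis using C0 by (intro exI[of _ D]) (simp add: D_def)
qed

abbreviation (input) weighted_bound :: "real \<Rightarrow> real \<Rightarrow> real \<Rightarrow> real \<Rightarrow> ('a::euclidean_space \<times> 'b::euclidean_space \<Rightarrow> real) \<Rightarrow> bool" where
 "weighted_bound p q \<beta> C u \<equiv> (\<integral>x. rad x powr (- \<beta>) * \<bar>u x\<bar> powr q) \<le> ennreal (C * energy p u powr (q/p))"

text \<open>Dilation by 2 multiplies the weighted integral by
  \<open>2 powr (\<beta> - m) < 1\<close>. Writing \<open>u (y, z)\<close> as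
  \<open>u (2 y, z)\<close> minus the difference therefore bounds the integral by a fraction of
  itself plus a contribution that the energy controls.\<close>

lemma weighted_inequality_subcritical_weight:
 fixes p q :: real
 defines "\<beta> \<equiv> q - real DIM('a::euclidean_space \<times> 'b::euclidean_space) * (q/p - 1)"
 assumes p: "1 \<le> p" "p < q" and \<beta>: "0 < \<beta>" "\<beta> < real DIM('a)"
 obtains C where "C \<ge> 0"
  "\<And>u :: 'a \<times> 'b \<Rightarrow> real. C1c u \<Longrightarrow> weighted_bound p q \<beta> C u"
proof -
 define m where "m = real DIM('a)"
 obtain D where D: "D \<ge> 0" and diff: "\<And>u :: 'a \<times> 'b \<Rightarrow> real. C1c u \<Longrightarrow>
   (\<integral>x. rad x powr (- \<beta>) * \<bar>u (dil 2 x) - u x\<bar> powr q) \<le> ennreal (D * energy p u powr (q/p))"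
  using weighted_dilation_difference[where 'a='a and 'b='b, OF p] \<beta>(1) unfolding \<beta>_def by blast
 \<comment> \<open>Half of the gain in the exponent pays for the constant of
   \<open>convex_powr_split\<close>; the other half remains as the contraction factor
   \<open>1 / \<theta>\<close>.\<close>
 define \<theta> where "\<theta> = 2 powr ((m - \<beta>) / 2)"
 have \<theta>: "\<theta> > 1" using \<beta> by (auto simp: \<theta>_def m_def)
 obtain A where A: "A \<ge> 0" "\<And>a b. 0 \<le> a \<Longrightarrow> 0 \<le> b \<Longrightarrow> (a + b) powr q \<le> \<theta> * a powr q + A * b powr q"
  using convex_powr_split[of q \<theta>] \<theta> p by auto
 have \<theta>2: "\<theta> * 2 powr (\<beta> - m) = 1 / \<theta>" by (simp add: \<theta>_def field_simps flip: powr_add)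
 define C where "C = A * D / (1 - 1 / \<theta>)"
 have C: "C \<ge> 0" using A D \<theta> by (auto simp: C_def)
 have "weighted_bound p q \<beta> C u" if u: "C1c u" for u :: "'a \<times> 'b \<Rightarrow> real"
 proof -
  define E where "E = energy p u"
  have E: "E \<ge> 0" by (simp add: E_def energy_nonneg)
  have [measurable]: "u \<in> Borel" using u by (rule borel_measurable_C1c)
  define f where "f x = u (dil 2 x) - u x" for x
  note fle = diff[OF u, folded f_def E_def]
  have dil_m [measurable]: "(\<lambda>x. (dil c x)) \<in> borel \<rightarrow>\<^sub>M (borel :: ('a \<times> 'b) measure)" for c
   by (intro borel_measurable_continuous_onI continuous_intros)
  have [measurable]: "f \<in> Borel" unfolding f_def by measurable
  \<comment> \<open>Absorbing \<open>1 / \<theta> * N\<close> on the left is legitimate only for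
    finite \<open>N\<close>. The truncated weight is continuous, which ensures finiteness, and still
    loses at most \<open>2 powr \<beta>\<close> under the dilation. Fatou's lemma removes the
    truncation afterwards.\<close>
  have trunc: "(\<integral>x. max (rad x) \<tau> powr (- \<beta>) * \<bar>u x\<bar> powr q) \<le> ennreal (C * E powr (q/p))" if \<tau>: "\<tau> > 0" for \<tau>
  proof -
   define w where "w x = max (rad x) \<tau> powr (- \<beta>)" for x :: "'a \<times> 'b"
   have wc: "continuous_on UNIV w" unfolding w_def
    using \<tau> by (intro continuous_on_powr continuous_on_max continuous_intros) auto
   have [measurable]: "w \<in> Borel" using wc by (rule borel_measurable_continuous_onI)
   have w0: "w x \<ge> 0" for x by (simp add: w_def)
   obtain N where N: "N \<ge> 0" "(\<integral>x. w x * \<bar>u x\<bar> powr q) = ennreal N"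
    using nn_integral_finite_real[OF wc w0 u, of q] p by auto
   have "w x \<le> 2 powr \<beta> * w (dil 2 x)" for x
   proof -
    have "max (rad x) \<tau> \<ge> max (2 * rad x) \<tau> / 2" using \<tau> rad_nonneg[of x] by (auto simp: max_def)
    then have "max (rad x) \<tau> powr (- \<beta>) \<le> (max (2 * rad x) \<tau> / 2) powr (- \<beta>)"
     using \<beta> \<tau> by (intro powr_mono2') auto
    also have "... = 2 powr \<beta> * max (2 * rad x) \<tau> powr (- \<beta>)" by (simp add: powr_divide powr_minus field_simps)
    finally show ?thesis by (simp add: w_def rad_def)
   qed
   then have "(\<integral>x. w x * \<bar>u (dil 2 x)\<bar> powr q)
    \<le> (\<integral>\<^sup>+x. ennreal (2 powr \<beta>) * ennreal (w (dil 2 x) * \<bar>u (dil 2 x)\<bar> powr q))" by (intro nn_integral_mono)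
     (simp add: ennreal_leI mult_right_mono mult.assoc[symmetric] w0 flip: ennreal_mult)
   also have "... = ennreal (2 powr \<beta>) * (\<integral>x. w (dil 2 x) * \<bar>u (dil 2 x)\<bar> powr q)"
    by (rule nn_integral_cmult) measurable
   also have "... = ennreal (2 powr \<beta>) * (ennreal (1 / 2 ^ DIM('a)) * ennreal N)"
    by (subst nn_integral_dilate_fst[where G="\<lambda>x. ennreal (w x * \<bar>u x\<bar> powr q)"]) (auto simp: N)
   also have "... = ennreal (2 powr (\<beta> - m) * N)"
    using N by (simp add: m_def powr_diff powr_realpow flip: ennreal_mult)
   finally have 1: "(\<integral>x. w x * \<bar>u (dil 2 x)\<bar> powr q) \<le> ennreal (2 powr (\<beta> - m) * N)" .
   let ?B = "(\<integral>x. w x * \<bar>f x\<bar> powr q)"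
   have "?B \<le> (\<integral>x. rad x powr (- \<beta>) * \<bar>f x\<bar> powr q)"
   proof (rule nn_integral_mono_AE, use AE_rad_pos in eventually_elim)
    fix x :: "'a \<times> 'b" assume "rad x > 0"
    then have "w x \<le> rad x powr (- \<beta>)" unfolding w_def using \<beta> by (intro powr_mono2') auto
    then show "ennreal (w x * \<bar>f x\<bar> powr q) \<le> ennreal (rad x powr (- \<beta>) * \<bar>f x\<bar> powr q)"
     by (intro ennreal_leI mult_right_mono) auto
   qed
   with fle have 2: "?B \<le> ennreal (D * E powr (q/p))" by (rule order.trans[rotated])
   have "\<bar>u x\<bar> powr q \<le> \<theta> * \<bar>u (dil 2 x)\<bar> powr q + A * \<bar>f x\<bar> powr q" for x
   proof -
    have "\<bar>u x\<bar> powr q \<le> (\<bar>u (dil 2 x)\<bar> + \<bar>f x\<bar>) powr q" using p by (intro powr_mono2) (auto simp: f_def)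
    also have "... \<le> \<theta> * \<bar>u (dil 2 x)\<bar> powr q + A * \<bar>f x\<bar> powr q" by (intro A) auto
    finally show ?thesis .
   qed
   then have "w x * \<bar>u x\<bar> powr q \<le> w x * (\<theta> * \<bar>u (dil 2 x)\<bar> powr q + A * \<bar>f x\<bar> powr q)" for x
    by (intro mult_left_mono w0)
   then have "ennreal N \<le> (\<integral>\<^sup>+x. ennreal \<theta> * ennreal (w x * \<bar>u (dil 2 x)\<bar> powr q)
     + ennreal A * ennreal (w x * \<bar>f x\<bar> powr q))" unfolding N(2)[symmetric] using \<theta> A(1) w0
    by (intro nn_integral_mono) (simp add: ennreal_leI algebra_simps flip: ennreal_mult ennreal_plus)
   also have "... = ennreal \<theta> * (\<integral>x. w x * \<bar>u (dil 2 x)\<bar> powr q) + ennreal A * (\<integral>x. w x * \<bar>f x\<bar> powr q)"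
    by (subst nn_integral_add, measurable, subst (1 2) nn_integral_cmult, measurable)
   also have "... \<le> ennreal \<theta> * ennreal (2 powr (\<beta> - m) * N) + ennreal A * ennreal (D * E powr (q/p))"
    by (intro add_mono mult_left_mono 1 2) auto
   also have "... = ennreal (1 / \<theta> * N + A * D * E powr (q/p))"
    using \<theta> A D N by (simp add: mult.assoc[symmetric] \<theta>2 flip: ennreal_mult ennreal_plus)
   finally have "N \<le> 1 / \<theta> * N + A * D * E powr (q/p)" using \<theta> A D N by (subst (asm) ennreal_le_iff) auto
   then have "N * (1 - 1 / \<theta>) \<le> A * D * E powr (q/p)" by (simp add: algebra_simps)
   then have "N \<le> C * E powr (q/p)" using \<theta> by (simp add: C_def pos_le_divide_eq)
   then show ?thesis using N unfolding w_def by (simp add: ennreal_leI)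
  qed
  have "(\<integral>x. rad x powr (- \<beta>) * \<bar>u x\<bar> powr q)
   \<le> (\<integral>\<^sup>+x. liminf (\<lambda>k. ennreal (max (rad x) (1 / real (Suc k)) powr (- \<beta>) * \<bar>u x\<bar> powr q)))"
  proof (rule nn_integral_mono_AE, use AE_rad_pos in eventually_elim)
   fix x :: "'a \<times> 'b" assume "rad x > 0"
   then have "\<forall>\<^sub>F k in sequentially. 1 / real (Suc k) < rad x"
    using LIMSEQ_inverse_real_of_nat by (auto simp: inverse_eq_divide dest: order_tendstoD(2))
   then have "\<forall>\<^sub>F k in sequentially. ennreal (rad x powr (- \<beta>) * \<bar>u x\<bar> powr q) \<le>
    ennreal (max (rad x) (1 / real (Suc k)) powr (- \<beta>) * \<bar>u x\<bar> powr q)" by eventually_elim (simp add: max_def)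
   then show "ennreal (rad x powr (- \<beta>) * \<bar>u x\<bar> powr q)
    \<le> liminf (\<lambda>k. ennreal (max (rad x) (1 / real (Suc k)) powr (- \<beta>) * \<bar>u x\<bar> powr q))" by (rule Liminf_bounded)
  qed
  also have "... \<le> liminf (\<lambda>k. (\<integral>x. max (rad x) (1 / real (Suc k)) powr (- \<beta>) * \<bar>u x\<bar> powr q))"
   by (rule nn_integral_liminf) measurable
  also have "... \<le> liminf (\<lambda>k. ennreal (C * E powr (q/p)))" by (intro Liminf_mono always_eventually allI trunc) simp
  also have "... = ennreal (C * E powr (q/p))" by (simp add: Liminf_const)
  finally show ?thesis by (simp add: E_def)
 qed
 then show ?thesis using that C by blast
qed

text \<open>The factor \<open>2 powr (\<beta> - m)\<close> now exceeds 1 and the roles are reversed: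
  the integral of \<open>u (2 y, z)\<close> is the large one and is estimated by that of
  \<open>u (y, z)\<close>. Vanishing near the plane makes the integrals finite; the constant does
  not depend on the width \<open>\<tau>\<close> of the strip.\<close>

lemma weighted_inequality_supercritical_weight:
 fixes p q :: real
 defines "\<beta> \<equiv> q - real DIM('a::euclidean_space \<times> 'b::euclidean_space) * (q/p - 1)"
 assumes p: "1 \<le> p" "p < q" and \<beta>: "\<beta> > real DIM('a)"
 obtains C where "C \<ge> 0"
  "\<And>u :: 'a \<times> 'b \<Rightarrow> real. C1c u \<Longrightarrow> vanishes_near_plane u \<Longrightarrow>
   weighted_bound p q \<beta> C u"
proof -
 define m where "m = real DIM('a)"
 have \<beta>0: "\<beta> > 0" using \<beta> by (meson less_trans of_nat_0_less_iff DIM_positive)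
 obtain D where D: "D \<ge> 0" and diff: "\<And>u :: 'a \<times> 'b \<Rightarrow> real. C1c u \<Longrightarrow>
   (\<integral>x. rad x powr (- \<beta>) * \<bar>u (dil 2 x) - u x\<bar> powr q) \<le> ennreal (D * energy p u powr (q/p))"
  using weighted_dilation_difference[where 'a='a and 'b='b, OF p] \<beta>0 unfolding \<beta>_def by blast
 define \<theta> where "\<theta> = 2 powr ((\<beta> - m) / 2)"
 have \<theta>: "\<theta> > 1" using \<beta> by (auto simp: \<theta>_def m_def)
 obtain A where A: "A \<ge> 0" "\<And>a b. 0 \<le> a \<Longrightarrow> 0 \<le> b \<Longrightarrow> (a + b) powr q \<le> \<theta> * a powr q + A * b powr q"
  using convex_powr_split[of q \<theta>] \<theta> p by auto
 have \<theta>2: "2 powr (\<beta> - m) = \<theta> * \<theta>" by (simp add: \<theta>_def flip: powr_add)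
 define C where "C = A * D / (\<theta> * (\<theta> - 1))"
 have C: "C \<ge> 0" using A D \<theta> by (auto simp: C_def)
 have "weighted_bound p q \<beta> C u" if u: "C1c u" and v: "vanishes_near_plane u" for u :: "'a \<times> 'b \<Rightarrow> real"
 proof -
  define E where "E = energy p u"
  have E: "E \<ge> 0" by (simp add: E_def energy_nonneg)
  have [measurable]: "u \<in> Borel" using u by (rule borel_measurable_C1c)
  define f where "f x = u (dil 2 x) - u x" for x
  note fle = diff[OF u, folded f_def E_def]
  have dil_m [measurable]: "(\<lambda>x. (dil c x)) \<in> borel \<rightarrow>\<^sub>M (borel :: ('a \<times> 'b) measure)" for c
   by (intro borel_measurable_continuous_onI continuous_intros)
  have [measurable]: "f \<in> Borel" unfolding f_def by measurable
  obtain \<tau> where \<tau>: "\<tau> > 0" "\<And>x. rad x < \<tau> \<Longrightarrow> u x = 0" using v by (auto simp: vanishes_near_plane_def)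
  have wc: "continuous_on UNIV (\<lambda>x :: 'a \<times> 'b. max (rad x) \<tau> powr (- \<beta>))"
   using \<tau> by (intro continuous_on_powr continuous_on_max continuous_intros) auto
  have "max (rad x) \<tau> powr (- \<beta>) * \<bar>u x\<bar> powr q = rad x powr (- \<beta>) * \<bar>u x\<bar> powr q" for x
   using \<tau> by (cases "rad x < \<tau>") (auto simp: max_def)
  then have w_eq: "(\<lambda>x. ennreal (rad x powr (- \<beta>) * \<bar>u x\<bar> powr q)) = (\<lambda>x. ennreal (max (rad x) \<tau> powr (- \<beta>) * \<bar>u x\<bar> powr q))"
   by (simp only:)
  obtain N where N: "N \<ge> 0" "(\<integral>x. rad x powr (- \<beta>) * \<bar>u x\<bar> powr q) = ennreal N"
   unfolding w_eq by (rule nn_integral_finite_real[OF wc _ u, of q]) (use p in auto)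
  have wd: "rad x powr (- \<beta>) = 2 powr \<beta> * rad (dil 2 x) powr (- \<beta>)" for x :: "'a \<times> 'b"
  proof -
   have "rad (dil 2 x) = 2 * rad x" by (simp add: rad_def)
   then have "2 powr \<beta> * rad (dil 2 x) powr (- \<beta>) = (2 powr \<beta> * 2 powr (- \<beta>)) * rad x powr (- \<beta>)"
    by (simp add: powr_mult)
   also have "2 powr \<beta> * 2 powr (- \<beta>) = (1::real)" by (simp flip: powr_add)
   finally show ?thesis by simp
  qed
  let ?A = "ennreal (2 powr (\<beta> - m) * N)"
  have "(\<integral>x. rad x powr (- \<beta>) * \<bar>u (dil 2 x)\<bar> powr q)
   = (\<integral>\<^sup>+x. ennreal (2 powr \<beta>) * ennreal (rad (dil 2 x) powr (- \<beta>) * \<bar>u (dil 2 x)\<bar> powr q))"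
   by (intro nn_integral_cong, subst wd) (simp add: mult.assoc flip: ennreal_mult)
  also have "... = ennreal (2 powr \<beta>) * (\<integral>x. rad (dil 2 x) powr (- \<beta>) * \<bar>u (dil 2 x)\<bar> powr q)"
   by (rule nn_integral_cmult) measurable
  also have "... = ennreal (2 powr \<beta>) * (ennreal (1 / 2 ^ DIM('a)) * ennreal N)"
   by (subst nn_integral_dilate_fst[where G="\<lambda>x. ennreal (rad x powr (- \<beta>) * \<bar>u x\<bar> powr q)"]) (auto simp: N)
  also have "... = ?A" using N by (simp add: m_def powr_diff powr_realpow flip: ennreal_mult)
  finally have 1: "?A = (\<integral>x. rad x powr (- \<beta>) * \<bar>u (dil 2 x)\<bar> powr q)" by simp
  have "\<bar>u (dil 2 x)\<bar> powr q \<le> \<theta> * \<bar>u x\<bar> powr q + A * \<bar>f x\<bar> powr q" for x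
  proof -
   have "\<bar>u (dil 2 x)\<bar> powr q \<le> (\<bar>u x\<bar> + \<bar>f x\<bar>) powr q" using p by (intro powr_mono2) (auto simp: f_def)
   also have "... \<le> \<theta> * \<bar>u x\<bar> powr q + A * \<bar>f x\<bar> powr q" by (intro A) auto
   finally show ?thesis .
  qed
  then have "rad x powr (- \<beta>) * \<bar>u (dil 2 x)\<bar> powr q \<le> rad x powr (- \<beta>) * (\<theta> * \<bar>u x\<bar> powr q + A * \<bar>f x\<bar> powr q)" for x
   by (intro mult_left_mono) auto
  then have "?A \<le> (\<integral>\<^sup>+x. ennreal \<theta> * ennreal (rad x powr (- \<beta>) * \<bar>u x\<bar> powr q)
    + ennreal A * ennreal (rad x powr (- \<beta>) * \<bar>f x\<bar> powr q))" unfolding 1 using \<theta> A(1)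
   by (intro nn_integral_mono) (simp add: ennreal_leI algebra_simps flip: ennreal_mult ennreal_plus)
  also have "... = ennreal \<theta> * (\<integral>x. rad x powr (- \<beta>) * \<bar>u x\<bar> powr q)
    + ennreal A * (\<integral>x. rad x powr (- \<beta>) * \<bar>f x\<bar> powr q)"
   by (subst nn_integral_add, measurable, subst (1 2) nn_integral_cmult, measurable)
  also have "... \<le> ennreal \<theta> * ennreal N + ennreal A * ennreal (D * E powr (q/p))"
   unfolding N(2) by (intro add_mono mult_left_mono fle) auto
  also have "... = ennreal (\<theta> * N + A * D * E powr (q/p))"
   using \<theta> A D N by (simp add: mult.assoc flip: ennreal_mult ennreal_plus)
  finally have "\<theta> * \<theta> * N \<le> \<theta> * N + A * D * E powr (q/p)"
   using \<theta> A D N unfolding \<theta>2 by (subst (asm) ennreal_le_iff) auto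
  then have "N * (\<theta> * (\<theta> - 1)) \<le> A * D * E powr (q/p)" by (simp add: algebra_simps)
  then have "N \<le> C * E powr (q/p)" using \<theta> by (simp add: C_def pos_le_divide_eq)
  then show ?thesis using N by (simp add: ennreal_leI E_def)
 qed
 then show ?thesis using that C by blast
qed

lemma weighted_inequality:
 fixes p q :: real
 defines "\<beta> \<equiv> q - real DIM('a::euclidean_space \<times> 'b::euclidean_space) * (q/p - 1)"
 assumes p: "1 \<le> p" "p < q" and \<beta>: "0 < \<beta>"
 obtains C where "C \<ge> 0"
  "\<And>u :: 'a \<times> 'b \<Rightarrow> real. C1c u \<Longrightarrow> \<beta> < real DIM('a) \<or> vanishes_near_plane u \<Longrightarrow>
   weighted_bound p q \<beta> C u"
proof -
 let ?m = "real DIM('a)" and ?n = "real DIM('a \<times> 'b)"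
 consider "\<beta> < ?m" | "\<beta> > ?m" | "\<beta> = ?m" by linarith
 then show ?thesis
 proof cases
  case 1
  obtain C where C: "C \<ge> 0" "\<And>u :: 'a \<times> 'b \<Rightarrow> real. C1c u \<Longrightarrow>
   weighted_bound p q \<beta> C u"
   using weighted_inequality_subcritical_weight[OF p \<beta>[unfolded \<beta>_def] 1[unfolded \<beta>_def]] unfolding \<beta>_def by blast
  show ?thesis by (rule that[OF C(1)]) (rule C(2))
 next
  case 2
  obtain C where C: "C \<ge> 0" "\<And>u :: 'a \<times> 'b \<Rightarrow> real. C1c u \<Longrightarrow> vanishes_near_plane u \<Longrightarrow>
   weighted_bound p q \<beta> C u"
   using weighted_inequality_supercritical_weight[OF p 2[unfolded \<beta>_def]] unfolding \<beta>_def by blast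
  show ?thesis by (rule that[OF C(1)]) (intro C(2); use 2 in auto)
 next
  \<comment> \<open>Here dilation leaves the integral unchanged and gives nothing. The exponent
    \<open>b\<close> is affine and decreasing in \<open>q\<close>, so a smaller and a larger
    exponent fall under the two previous lemmas; Hoelder's inequality between them returns to
    \<open>q\<close>, and since \<open>b\<close> is affine the weights match as well.\<close>
  case 3
  define b where "b q = q - ?n * (q/p - 1)" for q
  have b: "b q = ?n - q * (?n / p - 1)" for q by (simp add: b_def algebra_simps del: DIM_prod)
  have m: "?m \<ge> 1" "?m + 1 \<le> ?n" using DIM_positive[where 'a='a] DIM_positive[where 'a='b]
   by (simp_all add: Suc_le_eq)
  have bq: "b q = ?m" using 3 by (simp add: \<beta>_def b_def)
  define \<mu> where "\<mu> = ?n / p - 1"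
  have "q * \<mu> = ?n - ?m" using bq by (simp add: b \<mu>_def del: DIM_prod)
  then have "0 < q * \<mu>" using m by linarith
  then have \<mu>: "\<mu> > 0" using p by (simp add: zero_less_mult_iff)
  define q0 where "q0 = (p + q) / 2"
  \<comment> \<open>At \<open>q1\<close> the exponent \<open>b\<close> has dropped to half of
    \<open>DIM('a)\<close>, which lies inside the subcritical range.\<close>
  define q1 where "q1 = q + ?m / (2 * \<mu>)"
  have q01: "p < q0" "q0 < q" "q < q1" using p m \<mu> by (auto simp: q0_def q1_def)
  have "b q0 = ?m + (q - q0) * \<mu>" using bq unfolding b \<mu>_def[symmetric] by (simp add: algebra_simps del: DIM_prod)
  then have b0: "b q0 > ?m" using q01 \<mu> by simp
  have "b q1 = ?m / 2" using bq \<mu> unfolding b \<mu>_def[symmetric] q1_def by (simp add: algebra_simps del: DIM_prod)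
  then have b1': "0 < b q1" "b q1 < ?m" using m by linarith+
  obtain C0 where C0: "C0 \<ge> 0" "\<And>u :: 'a \<times> 'b \<Rightarrow> real. C1c u \<Longrightarrow> vanishes_near_plane u \<Longrightarrow>
   weighted_bound p q0 (b q0) C0 u"
   using weighted_inequality_supercritical_weight[OF p(1) q01(1) b0[unfolded b_def]] unfolding b_def by blast
  obtain C1 where C1: "C1 \<ge> 0" "\<And>u :: 'a \<times> 'b \<Rightarrow> real. C1c u \<Longrightarrow>
   weighted_bound p q1 (b q1) C1 u"
   using weighted_inequality_subcritical_weight[OF p(1) less_trans[OF p(2) q01(3)] b1'[unfolded b_def]]
   unfolding b_def by blast
  define a where "a = (q1 - q) / (q1 - q0)"
  have a: "0 < a" "a < 1" using q01 by (auto simp: a_def)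
  have aq: "q0 * a + q1 * (1 - a) = q"
  proof -
   have "a * (q1 - q0) = q1 - q" using q01 by (simp add: a_def)
   then show ?thesis by (simp add: algebra_simps)
  qed
  have ab: "b q0 * a + b q1 * (1 - a) = \<beta>"
  proof -
   have "b q0 * a + b q1 * (1 - a) = ?n - (q0 * a + q1 * (1 - a)) * \<mu>"
    unfolding b \<mu>_def[symmetric] by (simp add: algebra_simps del: DIM_prod)
   also have "... = b q" unfolding aq b \<mu>_def ..
   finally show ?thesis using bq 3 by simp
  qed
  show ?thesis
  proof (rule that)
   show "C0 powr a * C1 powr (1 - a) \<ge> 0" by simp
   fix u :: "'a \<times> 'b \<Rightarrow> real"
   assume u: "C1c u" and "\<beta> < ?m \<or> vanishes_near_plane u"
   then have v: "vanishes_near_plane u" using 3 by simp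
   have [measurable]: "u \<in> Borel" using u by (rule borel_measurable_C1c)
   have split: "rad x powr (- \<beta>) * \<bar>u x\<bar> powr q
    = (rad x powr (- b q0) * \<bar>u x\<bar> powr q0) powr a * (rad x powr (- b q1) * \<bar>u x\<bar> powr q1) powr (1 - a)" for x
   proof -
    have "- b q0 * a + - b q1 * (1 - a) = - \<beta>" using ab by linarith
    moreover have "(rad x powr (- b q0) * \<bar>u x\<bar> powr q0) powr a * (rad x powr (- b q1) * \<bar>u x\<bar> powr q1) powr (1 - a)
     = (rad x powr (- b q0 * a) * rad x powr (- b q1 * (1 - a))) * (\<bar>u x\<bar> powr (q0 * a) * \<bar>u x\<bar> powr (q1 * (1 - a)))"
     by (simp only: powr_mult powr_powr mult_ac powr_ge_zero)
    ultimately show ?thesis unfolding powr_add[symmetric] aq by (simp only:)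
   qed
   have "(\<integral>x. rad x powr (- \<beta>) * \<bar>u x\<bar> powr q)
    \<le> ennreal ((C0 * energy p u powr (q0/p)) powr a * (C1 * energy p u powr (q1/p)) powr (1 - a))"
    unfolding split by (rule nn_integral_Holder[OF _ _ _ _ a C0(2)[OF u v] _ C1(2)[OF u]])
     (use C0(1) C1(1) in \<open>auto simp: energy_nonneg\<close>)
   also have "(C0 * energy p u powr (q0/p)) powr a * (C1 * energy p u powr (q1/p)) powr (1 - a)
    = C0 powr a * C1 powr (1 - a) * energy p u powr (q/p)"
   proof -
    have "q0 / p * a + q1 / p * (1 - a) = q / p" unfolding aq[symmetric] by (simp add: add_divide_distrib)
    then have "energy p u powr (q/p) = energy p u powr (q0 / p * a) * energy p u powr (q1 / p * (1 - a))"
     by (simp add: powr_add[symmetric])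
    then show ?thesis using C0(1) C1(1) by (simp add: powr_mult powr_powr energy_nonneg mult_ac)
   qed
   finally show "weighted_bound p q \<beta> (C0 powr a * C1 powr (1 - a)) u" .
  qed
 qed
qed

section \<open>The maximisation problem\<close>

lemma test_functionsI:
 assumes "\<And>k. C_class k \<phi>" "compact C" "C \<subseteq> \<Omega>" "\<And>x. x \<notin> C \<Longrightarrow> \<phi> x = 0"
 shows "\<phi> \<in> test_functions \<Omega>"
proof -
 have "closure {x. \<phi> x \<noteq> 0} \<subseteq> C" using assms by (intro closure_minimal) (auto simp: compact_imp_closed)
 moreover from this have "compact (closure {x. \<phi> x \<noteq> 0})"
  using assms(2) by (metis closed_closure compact_Int_closed inf.absorb_iff2)
 ultimately show ?thesis using assms by (auto simp: test_functions_def)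
qed

lemma test_functions_compact_support:
 assumes "\<phi> \<in> test_functions \<Omega>"
 shows "\<exists>C. compact C \<and> C \<subseteq> \<Omega> \<and> (\<forall>x. x \<notin> C \<longrightarrow> \<phi> x = 0)"
 using assms closure_subset[of "{x. \<phi> x \<noteq> 0}"]
 by (intro exI[of _ "closure {x. \<phi> x \<noteq> 0}"]) (auto simp: test_functions_def)

lemma test_functions_smooth: "\<phi> \<in> test_functions \<Omega> \<Longrightarrow> C_class k \<phi>"
 by (auto simp: test_functions_def)

lemma test_functions_C1c:
 assumes "\<phi> \<in> test_functions \<Omega>" shows "C1c \<phi>"
proof -
 obtain C where C: "compact C" "\<And>x. x \<notin> C \<Longrightarrow> \<phi> x = 0" "\<And>k. C_class k \<phi>"
  using test_functions_compact_support[OF assms] test_functions_smooth[OF assms] by metis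
 show ?thesis by (rule C1cI[OF C(3) _ compact_imp_bounded[OF C(1)]]) (use C(2) in blast)
qed

lemma test_functions_mult:
 assumes "\<And>k. C_class k g" "u \<in> test_functions \<Omega>"
 shows "(\<lambda>x. g x * u x) \<in> test_functions \<Omega>"
proof -
 obtain C where C: "compact C" "C \<subseteq> \<Omega>" "\<And>x. x \<notin> C \<Longrightarrow> u x = 0" "\<And>k. C_class k u"
  using test_functions_compact_support[OF assms(2)] test_functions_smooth[OF assms(2)] by metis
 show ?thesis by (rule test_functionsI[OF C_class_mult[OF assms(1) C(4)] C(1,2)]) (simp add: C(3))
qed

lemma test_functions_cmult: "u \<in> test_functions \<Omega> \<Longrightarrow> (\<lambda>x. c * u x) \<in> test_functions \<Omega>"
 by (rule test_functions_mult) (rule C_class_const)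

lemma test_functions_add:
 assumes "u \<in> test_functions \<Omega>" "v \<in> test_functions \<Omega>"
 shows "(\<lambda>x. u x + v x) \<in> test_functions \<Omega>"
proof -
 obtain C where C: "compact C" "C \<subseteq> \<Omega>" "\<And>x. x \<notin> C \<Longrightarrow> u x = 0" "\<And>k. C_class k u"
  using test_functions_compact_support[OF assms(1)] test_functions_smooth[OF assms(1)] by metis
 obtain D where D: "compact D" "D \<subseteq> \<Omega>" "\<And>x. x \<notin> D \<Longrightarrow> v x = 0" "\<And>k. C_class k v"
  using test_functions_compact_support[OF assms(2)] test_functions_smooth[OF assms(2)] by metis
 show ?thesis by (rule test_functionsI[of _ "C \<union> D"]) (use C D in \<open>auto intro: C_class_add\<close>)
qed

lemma test_functions_diff:
 assumes "u \<in> test_functions \<Omega>" "v \<in> test_functions \<Omega>"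
 shows "(\<lambda>x. u x - v x) \<in> test_functions \<Omega>"
 using test_functions_add[OF assms(1) test_functions_cmult[OF assms(2), of "-1"]] by simp

text \<open>In terms of the paper, \<open>q = p\<^sup>*\<^sub>\<sigma>\<close> and \<open>\<beta> = (1 - \<sigma>) q\<close>.\<close>

locale hs_problem =
 fixes K :: "'a::euclidean_space set" and \<Omega> :: "('a \<times> 'b::euclidean_space) set" and p q n \<beta> :: real
 assumes cone: "open_cone K" and \<Omega>_eq: "\<Omega> = K \<times> UNIV"
  and n_eq: "n = real DIM('a \<times> 'b)" and p1: "1 < p" and pq: "p < q"
  and \<beta>_eq: "\<beta> = q - n * (q/p - 1)" and \<beta>_pos: "0 < \<beta>"
  and admissible: "\<beta> < real DIM('a) \<or> K \<noteq> UNIV"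
begin

abbreviation T :: "('a \<times> 'b \<Rightarrow> real) set" where "T \<equiv> test_functions \<Omega>"

definition wt :: "'a \<times> 'b \<Rightarrow> real" where "wt x = rad x powr (- \<beta>)"

abbreviation (input) dens :: "'a \<times> 'b \<Rightarrow> real \<Rightarrow> real" where "dens x a \<equiv> wt x * \<bar>a\<bar> powr q"

definition mass :: "('a \<times> 'b) set \<Rightarrow> ('a \<times> 'b \<Rightarrow> real) \<Rightarrow> real" where
 "mass S u = (LINT x:S|lborel. dens x (u x))"

definition energy_on :: "('a \<times> 'b) set \<Rightarrow> ('a \<times> 'b \<Rightarrow> real) \<Rightarrow> real" where
 "energy_on S u = (LINT x:S|lborel. grad_powr p u x)"

lemma p0: "p > 0" and q0: "q > 0" and q1: "q > 1" and n0: "n > 0"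
 using p1 pq by (auto simp: n_eq add_pos_pos)

lemma wt_nonneg [simp]: "wt x \<ge> 0" by (simp add: wt_def)

lemma wt_measurable [measurable]: "wt \<in> Borel"
 unfolding wt_def[abs_def] by measurable

lemma open_K: "open K" and connected_K: "connected K" and K_ne: "K \<noteq> {}"
 and K_cone: "y \<in> K \<Longrightarrow> t > 0 \<Longrightarrow> t *\<^sub>R y \<in> K" using cone by (auto simp: open_cone_def)

lemma open_\<Omega>: "open \<Omega>" unfolding \<Omega>_eq using open_K by (intro open_Times) auto

text \<open>An open set around the origin contains a ball, and dilations spread the ball over the
  whole space.\<close>

lemma K_zero: "0 \<in> K \<Longrightarrow> K = UNIV"
proof -
 assume "0 \<in> K"
 then obtain e where e: "e > 0" "ball 0 e \<subseteq> K" using open_K open_contains_ball by blast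
 have "y \<in> K" for y
 proof (cases "y = 0")
  case False
  then have "(e / (2 * norm y)) *\<^sub>R y \<in> K" using e by (intro subsetD[OF e(2)]) simp
  from K_cone[OF this, of "2 * norm y / e"] show ?thesis using False e by simp
 qed (use \<open>0 \<in> K\<close> in simp)
 then show ?thesis by auto
qed

lemma T_C1c: "u \<in> T \<Longrightarrow> C1c u"
 by (rule test_functions_C1c)

lemma T_measurable: "u \<in> T \<Longrightarrow> u \<in> Borel"
 by (intro borel_measurable_C1c T_C1c)

lemma T_gradient_measurable: "u \<in> T \<Longrightarrow> gradient u \<in> Borel"
 by (intro borel_measurable_gradient T_C1c)

lemma T_differentiable: "u \<in> T \<Longrightarrow> u differentiable (at x)"
 by (intro C1c_differentiable T_C1c)

text \<open>If \<open>K\<close> omits the origin, the projection of the compact support to the first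
  factor is a closed set without 0, hence at positive distance from 0. This is where
  \<open>K \<noteq> UNIV\<close> takes effect.\<close>

lemma T_admissible: "u \<in> T \<Longrightarrow> \<beta> < real DIM('a) \<or> vanishes_near_plane u"
proof (cases "K = UNIV")
 case False
 assume "u \<in> T"
 then obtain C where C: "compact C" "C \<subseteq> \<Omega>" "\<And>x. x \<notin> C \<Longrightarrow> u x = 0" using test_functions_compact_support by metis
 have "0 \<notin> fst ` C" using C(2) K_zero False by (auto simp: \<Omega>_eq)
 moreover have "closed (fst ` C)" using C(1) by (intro compact_imp_closed compact_continuous_image continuous_intros)
 ultimately obtain d where d: "d > 0" "\<And>y. y \<in> fst ` C \<Longrightarrow> d \<le> dist 0 y" using separate_point_closed by metis
 then have "u x = 0" if "rad x < d" for x using C(3)[of x] that by (force simp: rad_def)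
 then show ?thesis using d(1) by (auto simp: vanishes_near_plane_def)
qed (use admissible in simp)

lemma mass_bound:
 obtains C where "C \<ge> 0"
  "\<And>u. u \<in> T \<Longrightarrow> (\<integral>x. dens x (u x)) \<le> ennreal (C * energy p u powr (q/p))"
proof -
 have eq: "q - real DIM('a \<times> 'b) * (q/p - 1) = \<beta>" by (simp only: \<beta>_eq n_eq)
 obtain C where C: "C \<ge> 0" "\<And>u :: 'a \<times> 'b \<Rightarrow> real. C1c u \<Longrightarrow> \<beta> < real DIM('a) \<or> vanishes_near_plane u \<Longrightarrow>
   weighted_bound p q \<beta> C u"
  using weighted_inequality[where 'a='a and 'b='b, OF less_imp_le[OF p1] pq, unfolded eq, OF \<beta>_pos] by blast
 show ?thesis by (rule that[OF C(1)]) (unfold wt_def, intro C(2) T_C1c T_admissible)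
qed

lemma integrable_mass: "u \<in> T \<Longrightarrow> integrable lborel (\<lambda>x. dens x (u x))"
proof -
 assume u: "u \<in> T"
 obtain C where "C \<ge> 0" and C: "\<And>u. u \<in> T \<Longrightarrow> (\<integral>x. dens x (u x)) \<le> ennreal (C * energy p u powr (q/p))"
  using mass_bound by blast
 have [measurable]: "u \<in> Borel" using u by (rule T_measurable)
 show ?thesis by (rule integrableI_nonneg) (auto intro!: le_less_trans[OF C[OF u]])
qed

lemma integrable_energy: "u \<in> T \<Longrightarrow> integrable lborel (\<lambda>x. grad_powr p u x)"
 using integrable_powr_gradient T_C1c p0 by blast

lemma set_integrable_mass: "u \<in> T \<Longrightarrow> S \<in> sets borel \<Longrightarrow> set_integrable lborel S (\<lambda>x. dens x (u x))"
 unfolding set_integrable_def by (rule integrable_mult_indicator) (auto intro: integrable_mass)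

lemma set_integrable_energy: "u \<in> T \<Longrightarrow> S \<in> sets borel \<Longrightarrow> set_integrable lborel S (\<lambda>x. grad_powr p u x)"
 unfolding set_integrable_def by (rule integrable_mult_indicator) (auto intro: integrable_energy)

lemma mass_nonneg: "mass S u \<ge> 0"
 unfolding mass_def LINT_def by (intro integral_nonneg_AE) auto

lemma energy_on_nonneg: "energy_on S u \<ge> 0"
 unfolding energy_on_def LINT_def by (intro integral_nonneg_AE) auto

lemma energy_on_UNIV: "energy_on UNIV u = energy p u"
 by (simp add: energy_on_def energy_def LINT_def)

lemma nn_integral_mass:
 assumes "u \<in> T" "S \<in> sets borel"
 shows "(\<integral>x\<in>S. dens x (u x)) = ennreal (mass S u)"
proof -
 have "(\<integral>x\<in>S. dens x (u x)) = (\<integral>x. indicator S x *\<^sub>R (dens x (u x)))"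
  by (intro nn_integral_cong) (auto simp: indicator_def)
 also have "... = ennreal (mass S u)" unfolding mass_def LINT_def
  using set_integrable_mass[OF assms] by (intro nn_integral_eq_integral) (auto simp: set_integrable_def)
 finally show ?thesis .
qed

lemma nn_integral_energy_on:
 assumes "u \<in> T" "S \<in> sets borel"
 shows "(\<integral>x\<in>S. grad_powr p u x) = ennreal (energy_on S u)"
proof -
 have "(\<integral>x\<in>S. grad_powr p u x) = (\<integral>x. indicator S x *\<^sub>R (grad_powr p u x))"
  by (intro nn_integral_cong) (auto simp: indicator_def)
 also have "... = ennreal (energy_on S u)" unfolding energy_on_def LINT_def
  using set_integrable_energy[OF assms] by (intro nn_integral_eq_integral) (auto simp: set_integrable_def)
 finally show ?thesis .
qed

lemma mass_mono:
 assumes "u \<in> T" "S \<in> sets borel" "S' \<in> sets borel" "S \<subseteq> S'"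
 shows "mass S u \<le> mass S' u"
 unfolding mass_def LINT_def
 by (rule integral_mono) (use assms set_integrable_mass in \<open>auto simp: set_integrable_def indicator_def\<close>)

lemma energy_on_mono:
 assumes "u \<in> T" "S \<in> sets borel" "S' \<in> sets borel" "S \<subseteq> S'"
 shows "energy_on S u \<le> energy_on S' u"
 unfolding energy_on_def LINT_def
 by (rule integral_mono) (use assms set_integrable_energy in \<open>auto simp: set_integrable_def indicator_def\<close>)

lemma mass_Un:
 assumes "u \<in> T" "S \<in> sets borel" "S' \<in> sets borel"
 shows "mass (S \<union> S') u \<le> mass S u + mass S' u"
proof -
 note i = set_integrable_mass[OF assms(1), unfolded set_integrable_def]
 have "mass (S \<union> S') u \<le> (LINT x|lborel. indicator S x *\<^sub>R (dens x (u x)) + indicator S' x *\<^sub>R (dens x (u x)))"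
  unfolding mass_def LINT_def
  by (rule integral_mono[OF i Bochner_Integration.integrable_add[OF i i]]) (use assms in \<open>auto simp: indicator_def\<close>)
 also have "... = mass S u + mass S' u"
  unfolding mass_def LINT_def by (rule Bochner_Integration.integral_add) (use assms i in auto)
 finally show ?thesis .
qed

lemma mass_cong:
 assumes "\<And>x. x \<in> S \<Longrightarrow> u x = v x" shows "mass S u = mass S v"
 unfolding mass_def LINT_def by (intro Bochner_Integration.integral_cong) (auto simp: indicator_def assms)

lemma energy_on_cong:
 assumes "open U" "S \<subseteq> U" "\<And>x. x \<in> U \<Longrightarrow> u x = v x" shows "energy_on S u = energy_on S v"
 unfolding energy_on_def LINT_def using gradient_cong_open[of U _ u v] assms
 by (intro Bochner_Integration.integral_cong) (auto simp: indicator_def)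

lemma mass_le_energy:
 obtains C where "C \<ge> 0" "\<And>u. u \<in> T \<Longrightarrow> mass UNIV u \<le> C * energy p u powr (q/p)"
proof -
 obtain C where C: "C \<ge> 0" "\<And>u. u \<in> T \<Longrightarrow> (\<integral>x. dens x (u x)) \<le> ennreal (C * energy p u powr (q/p))"
  using mass_bound by blast
 have "mass UNIV u \<le> C * energy p u powr (q/p)" if "u \<in> T" for u
  using C(2)[OF that] nn_integral_mass[OF that, of UNIV] C(1) by (simp add: ennreal_le_iff)
 then show ?thesis using that C(1) by blast
qed

lemma mass_cmult: "mass S (\<lambda>x. c * u x) = \<bar>c\<bar> powr q * mass S u"
 unfolding mass_def LINT_def by (simp add: abs_mult powr_mult mult.left_commute flip: integral_mult_right_zero)

lemma energy_cmult:
 assumes "u \<in> T" shows "energy p (\<lambda>x. c * u x) = \<bar>c\<bar> powr p * energy p u"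
 unfolding energy_def
 by (simp add: gradient_cmult T_differentiable[OF assms] powr_mult flip: integral_mult_right_zero)

text \<open>The mass is the \<open>q\<close>-th power of the weighted norm, so the constant of the
  theorem will be \<open>sharp powr (1/q)\<close>. The supremum is over test functions only; the
  closure is treated at the end.\<close>

definition sharp :: real where
 "sharp = (SUP u\<in>{u\<in>T. energy p u \<le> 1}. mass UNIV u)"

lemma T_zero: "(\<lambda>x. 0) \<in> T"
 by (rule test_functionsI[of _ "{}"]) (auto intro: C_class_const)

lemma bdd_sharp: "bdd_above (mass UNIV ` {u\<in>T. energy p u \<le> 1})"
proof -
 obtain C where C: "C \<ge> 0" "\<And>u. u \<in> T \<Longrightarrow> mass UNIV u \<le> C * energy p u powr (q/p)" using mass_le_energy by blast
 have "mass UNIV u \<le> C" if "u \<in> T" "energy p u \<le> 1" for u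
 proof -
  have "energy p u powr (q/p) \<le> 1 powr (q/p)" using that energy_nonneg p0 q0 by (intro powr_mono2) auto
  then have "C * energy p u powr (q/p) \<le> C * 1" using C(1) by (intro mult_left_mono) auto
  then show ?thesis using C(2)[OF that(1)] by simp
 qed
 then show ?thesis by (intro bdd_aboveI2) auto
qed

lemma mass_le_sharp: "u \<in> T \<Longrightarrow> energy p u \<le> 1 \<Longrightarrow> mass UNIV u \<le> sharp"
 unfolding sharp_def by (rule cSUP_upper) (auto intro: bdd_sharp)

lemma energy_zero_mass_zero: "u \<in> T \<Longrightarrow> energy p u = 0 \<Longrightarrow> mass UNIV u = 0"
proof -
 assume u: "u \<in> T" "energy p u = 0"
 obtain C where C: "C \<ge> 0" "\<And>u. u \<in> T \<Longrightarrow> mass UNIV u \<le> C * energy p u powr (q/p)" using mass_le_energy by blast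
 from C(2)[OF u(1)] u(2) mass_nonneg[of UNIV u] show ?thesis by simp
qed

text \<open>Under multiplication by constants the mass has degree \<open>q\<close> and the energy
  degree \<open>p\<close>; normalising the energy to 1 produces the power
  \<open>q/p\<close>.\<close>

lemma mass_le: "u \<in> T \<Longrightarrow> mass UNIV u \<le> sharp * energy p u powr (q/p)"
proof (cases "energy p u = 0")
 case False
 assume u: "u \<in> T"
 define e where "e = energy p u"
 have e: "e > 0" using False energy_nonneg[of p u] by (simp add: e_def)
 let ?c = "e powr (- 1 / p)"
 have "?c powr p = 1 / e" unfolding powr_powr using e p0 by (simp add: powr_minus_divide)
 then have "energy p (\<lambda>x. ?c * u x) = 1" using e by (simp add: energy_cmult[OF u] e_def[symmetric])
 then have "mass UNIV (\<lambda>x. ?c * u x) \<le> sharp" by (intro mass_le_sharp test_functions_cmult u) simp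
 then have "e powr (- (q / p)) * mass UNIV u \<le> sharp" by (simp add: mass_cmult powr_powr)
 then have "e powr (q/p) * (e powr (- (q / p)) * mass UNIV u) \<le> e powr (q/p) * sharp" by (intro mult_left_mono) auto
 then show ?thesis using e by (simp add: e_def[symmetric] mult_ac powr_minus)
qed (simp add: energy_zero_mass_zero)

lemma T_nontrivial: obtains u where "u \<in> T" "\<And>x. u x \<ge> 0" "mass UNIV u > 0"
proof -
 obtain y where "y \<in> K" using K_ne by auto
 then have "(y, 0) \<in> \<Omega>" by (simp add: \<Omega>_eq)
 define c where "c = (y, 0::'b)"
 with \<open>(y, 0) \<in> \<Omega>\<close> obtain e where e: "e > 0" "cball c e \<subseteq> \<Omega>" using open_\<Omega> open_contains_cball by metis
 define u where "u x = cutoff ((- 2 / e) *\<^sub>R c + (2 / e) *\<^sub>R x)" for x :: "'a \<times> 'b"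
 have ux: "(- 2 / e) *\<^sub>R c + (2 / e) *\<^sub>R x = (2 / e) *\<^sub>R (x - c)" for x :: "'a \<times> 'b" by (simp add: algebra_simps)
 have u0: "u x = 0" if "x \<notin> cball c e" for x unfolding u_def ux norm_scaleR using that e(1)
  by (intro cutoff_0, unfold norm_scaleR) (simp add: dist_norm norm_minus_commute field_simps)
 have u1: "u x = 1" if "x \<in> ball c (e / 2)" for x unfolding u_def ux using that e(1)
  by (intro cutoff_1, unfold norm_scaleR) (simp add: dist_norm norm_minus_commute field_simps)
 have uT: "u \<in> T" by (rule test_functionsI[OF _ compact_cball e(2) u0])
   (auto simp only: u_def[abs_def] intro: C_class_affine[OF C_class_cutoff])
 have "mass UNIV u \<noteq> 0"
 proof
  assume "mass UNIV u = 0"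
  then have "AE x in lborel. dens x (u x) = 0"
   using integral_nonneg_eq_0_iff_AE[OF integrable_mass[OF uT]] by (simp add: mass_def LINT_def)
  then have "AE x in lborel. x \<notin> ball c (e / 2)" using AE_rad_pos by eventually_elim (auto simp: wt_def u1)
  then have "emeasure lborel (ball c (e / 2)) = 0" by (subst (asm) AE_iff_measurable[where N="ball c (e / 2)"]) auto
  moreover have "measure lborel (ball c (e / 2)) > 0" using e(1) by (intro content_ball_pos) simp
  ultimately show False by (simp add: measure_def)
 qed
 then have "mass UNIV u > 0" using mass_nonneg[of UNIV u] by simp
 moreover have "u x \<ge> 0" for x unfolding u_def by (rule cutoff_range)
 ultimately show ?thesis using that[OF uT] by blast
qed

lemma sharp_pos: "sharp > 0"
proof -
 obtain u where u: "u \<in> T" "\<And>x. u x \<ge> 0" "mass UNIV u > 0" using T_nontrivial by blast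
 from mass_le[OF u(1)] u(3) have "0 < sharp * energy p u powr (q/p)" by simp
 then show ?thesis by (simp add: zero_less_mult_iff)
qed

text \<open>The power \<open>R powr p\<close> is dictated by scaling and makes this form useful:
  against the factor \<open>R powr (- p)\<close> that a cutoff of width \<open>R\<close> produces,
  it leaves an error independent of the scale.\<close>

lemma local_Holder:
 assumes u: "u \<in> T" and S: "S \<in> sets borel" "S \<subseteq> ball \<zeta> R" and \<zeta>: "rad \<zeta> = 0" and R: "R > 0"
 shows "(LINT x:S|lborel. \<bar>u x\<bar> powr p)
  \<le> measure lborel (ball (0::'a \<times> 'b) 1) powr (1 - p/q) * R powr p * mass S u powr (p/q)"
proof -
 define \<omega> where "\<omega> = measure lborel (ball (0::'a \<times> 'b) 1)"
 have \<omega>: "\<omega> \<ge> 0" by (simp add: \<omega>_def)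
 have [measurable]: "u \<in> Borel" "S \<in> sets borel" using u S by (auto intro: T_measurable)
 let ?f = "\<lambda>x. indicator S x * (dens x (u x))"
 \<comment> \<open>This power of \<open>rad\<close> cancels the \<open>p/q\<close>-th power of the
   weight in Hoelder's inequality. Being positive, it is bounded on a ball centred on the
   plane.\<close>
 let ?A = "\<beta> * p / (q - p)"
 let ?g = "\<lambda>x. indicator S x * rad x powr ?A"
 have rad_le: "rad x \<le> R" if "x \<in> ball \<zeta> R" for x
 proof -
  have "rad x = norm (fst (x - \<zeta>))" using \<zeta> by (simp add: rad_def)
  also have "... \<le> norm (x - \<zeta>)" by (metis norm_fst_le prod.collapse)
  finally show ?thesis using that by (simp add: dist_norm norm_minus_commute)
 qed
 have f: "(\<integral>x. ?f x) \<le> ennreal (mass S u)"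
  using nn_integral_mass[OF u S(1)] by (simp add: ennreal_mult' ennreal_indicator mult_ac)
 let ?B = "R powr ?A * (R powr n * \<omega>)"
 have "(\<integral>x. ?g x) \<le> (\<integral>\<^sup>+x. ennreal (R powr ?A) * indicator (ball \<zeta> R) x)"
  using S rad_le \<beta>_pos p0 pq by (intro nn_integral_mono) (auto simp: indicator_def intro!: ennreal_leI powr_mono2)
 also have "... = ennreal ?B" using R emeasure_lborel_ball[of R \<zeta>]
  by (simp add: nn_integral_cmult_indicator \<omega>_def n_eq powr_realpow ennreal_mult del: DIM_prod)
 finally have g: "(\<integral>x. ?g x) \<le> ennreal ?B" .
 let ?E = "\<beta> * p / (q - p) * (1 - p/q)"
 have split: "indicator S x * \<bar>u x\<bar> powr p = ?f x powr (p/q) * ?g x powr (1 - p/q)" if "rad x > 0" for x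
 proof (cases "x \<in> S")
  case True
  have e: "- \<beta> * (p/q) + ?E = 0" using pq q0 by (simp add: field_simps)
  have "?f x powr (p/q) * ?g x powr (1 - p/q) = (rad x powr (- \<beta> * (p/q)) * rad x powr ?E) * \<bar>u x\<bar> powr p"
   using True q0 by (simp add: wt_def powr_mult powr_powr)
  also have "... = \<bar>u x\<bar> powr p" unfolding powr_add[symmetric] e using that by simp
  finally show ?thesis using True by simp
 qed simp
 let ?C = "(\<integral>x. indicator S x * \<bar>u x\<bar> powr p)"
 let ?D = "\<omega> powr (1 - p/q) * R powr p"
 have "?C = (\<integral>x. ?f x powr (p/q) * ?g x powr (1 - p/q))"
  by (rule nn_integral_cong_AE, use AE_rad_pos in eventually_elim) (simp only: split)
 also have "... \<le> ennreal (mass S u powr (p/q) * ?B powr (1 - p/q))"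
  by (rule nn_integral_Holder[OF _ _ _ _ _ _ f _ g]) (use p0 pq \<omega> in \<open>auto simp: mass_nonneg\<close>)
 also have "?B powr (1 - p/q) = ?D"
 proof -
  have "\<beta> * p = q * p - n * (q - p)" unfolding \<beta>_eq using p0 by (simp add: field_simps)
  then have "(?A + n) * (q - p) = q * p" using pq by (simp add: distrib_right)
  moreover have "(?A + n) * (1 - p/q) = (?A + n) * (q - p) / q" using q0 by (simp add: field_simps)
  ultimately have "(?A + n) * (1 - p/q) = p" using q0 by simp
  then have "R powr ?E * R powr (n * (1 - p/q)) = R powr p" by (simp add: distrib_right flip: powr_add)
  then show ?thesis using \<omega> by (simp add: powr_mult powr_powr mult_ac)
 qed
 finally have le: "?C \<le> ennreal (mass S u powr (p/q) * ?D)" .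
 have "integrable lborel (\<lambda>x. indicator S x * \<bar>u x\<bar> powr p)"
  using integrable_mult_indicator[OF _ integrable_powr_C1c[OF T_C1c[OF u] p0], of S] S by simp
 then have "ennreal (LINT x|lborel. indicator S x * \<bar>u x\<bar> powr p) \<le> ennreal (mass S u powr (p/q) * ?D)"
  using le by (subst (asm) nn_integral_eq_integral) auto
 then show ?thesis unfolding LINT_def \<omega>_def[symmetric] by (subst (asm) ennreal_le_iff) (auto simp: mult_ac)
qed

end

section \<open>Splitting and normalisation\<close>

lemma bounded_gradient_cutoff:
 obtains c where "c \<ge> 0" "\<And>x :: 'a::euclidean_space. norm (gradient cutoff x) \<le> c"
proof -
 let ?S = "cball (0::'a) 2"
 have C: "C1c (cutoff :: 'a \<Rightarrow> real)" by (rule C1cI[OF C_class_cutoff, of ?S]) (use cutoff_0 in \<open>force simp: not_le\<close>)+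
 have "compact (gradient cutoff ` ?S)"
  by (intro compact_continuous_image continuous_on_subset[OF C1c_continuous_gradient[OF C]]) auto
 then obtain c where c: "c > 0" "\<And>y. y \<in> gradient cutoff ` ?S \<Longrightarrow> norm y \<le> c"
  using compact_imp_bounded bounded_pos by metis
 have "norm (gradient cutoff x) \<le> c" for x :: 'a
 proof (cases "x \<in> ?S")
  case False
  have "gradient cutoff x = gradient (\<lambda>x. 0) x"
   by (rule gradient_cong_open[of "- ?S"]) (use False in \<open>auto intro!: cutoff_0 simp: not_le\<close>)
  then show ?thesis using c(1) by (simp add: gradient_const)
 qed (use c(2) in auto)
 then show ?thesis using that[of c] c(1) by simp
qed

definition cutoff_at :: "'a::euclidean_space \<Rightarrow> real \<Rightarrow> 'a \<Rightarrow> real" where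
 "cutoff_at c r x = cutoff ((- (1 / r)) *\<^sub>R c + (1 / r) *\<^sub>R x)"

lemma cutoff_at_arg: "(- (1 / r)) *\<^sub>R c + (1 / r) *\<^sub>R x = (1 / r) *\<^sub>R (x - c)"
 for c :: "'a::euclidean_space" by (simp only: scaleR_diff_right scaleR_minus_left) simp

lemma C_class_cutoff_at: "C_class k (cutoff_at c r)"
 unfolding cutoff_at_def[abs_def] by (intro C_class_affine C_class_cutoff)

lemma cutoff_at_range: "0 \<le> cutoff_at c r x" "cutoff_at c r x \<le> 1"
 unfolding cutoff_at_def by (rule cutoff_range)+

lemma cutoff_at_1: "r > 0 \<Longrightarrow> dist c x \<le> r \<Longrightarrow> cutoff_at c r x = 1"
 unfolding cutoff_at_def cutoff_at_arg
 by (intro cutoff_1, unfold norm_scaleR) (simp add: dist_norm norm_minus_commute field_simps)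

lemma cutoff_at_0: "r > 0 \<Longrightarrow> dist c x \<ge> 2 * r \<Longrightarrow> cutoff_at c r x = 0"
 unfolding cutoff_at_def cutoff_at_arg
 by (intro cutoff_0, unfold norm_scaleR) (simp add: dist_norm norm_minus_commute field_simps)

lemma gradient_cutoff_at_le:
 assumes "\<And>x :: 'a::euclidean_space. norm (gradient cutoff x) \<le> b" "r > 0"
 shows "norm (gradient (cutoff_at (c::'a) r) x) \<le> b / r"
proof -
 have "gradient (cutoff_at c r) x = (1 / r) *\<^sub>R gradient cutoff ((- (1 / r)) *\<^sub>R c + (1 / r) *\<^sub>R x)"
  unfolding cutoff_at_def[abs_def] by (rule gradient_affine) (rule C_class_differentiable[OF C_class_cutoff])
 then have "norm (gradient (cutoff_at c r) x) = (1 / r) * norm (gradient cutoff ((- (1 / r)) *\<^sub>R c + (1 / r) *\<^sub>R x))"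
  using assms(2) by (simp only: norm_scaleR) simp
 also have "... \<le> (1 / r) * b" using assms by (intro mult_left_mono) auto
 finally show ?thesis by simp
qed

lemma norm_gradient_mult_le:
 assumes "f differentiable (at x)" "g differentiable (at x)"
  and "\<bar>f x\<bar> \<le> 1" "norm (gradient f x) \<le> d" "p \<ge> (1::real)" "d \<ge> 0" shows "grad_powr p (\<lambda>x. f x * g x) x
  \<le> 2 powr p * (grad_powr p g x + d powr p * \<bar>g x\<bar> powr p)"
proof -
 have "norm (gradient (\<lambda>x. f x * g x) x) \<le> \<bar>f x\<bar> * norm (gradient g x) + \<bar>g x\<bar> * norm (gradient f x)"
  unfolding gradient_mult[OF assms(1,2)] by (rule order.trans[OF norm_triangle_ineq]) simp
 also have "... \<le> 1 * norm (gradient g x) + \<bar>g x\<bar> * d"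
  using assms by (intro add_mono mult_right_mono mult_left_mono) auto
 finally have "grad_powr p (\<lambda>x. f x * g x) x \<le> (norm (gradient g x) + d * \<bar>g x\<bar>) powr p"
  using assms by (intro powr_mono2) (auto simp: mult.commute)
 also have "... \<le> 2 powr p * (grad_powr p g x + (d * \<bar>g x\<bar>) powr p)" using assms by (intro powr_add_le) auto
 finally show ?thesis using assms by (simp add: powr_mult)
qed

lemma sum_set_integral_le:
 fixes f :: "'a \<Rightarrow> real"
 assumes f: "integrable M f" "\<And>x. f x \<ge> 0" and A: "finite I" "\<And>i. i \<in> I \<Longrightarrow> A i \<in> sets M" "disjoint_family_on A I"
 shows "(\<Sum>i\<in>I. (LINT x:(A i)|M. f x)) \<le> (LINT x|M. f x)"
proof -
 have i: "integrable M (\<lambda>x. indicator (A i) x *\<^sub>R f x)" if "i \<in> I" for i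
  using A(2)[OF that] f(1) by (rule integrable_mult_indicator)
 have "(\<Sum>i\<in>I. (LINT x:(A i)|M. f x)) = (LINT x|M. (\<Sum>i\<in>I. indicator (A i) x *\<^sub>R f x))"
  unfolding LINT_def by (rule Bochner_Integration.integral_sum[symmetric]) (rule i)
 also have "... \<le> (LINT x|M. f x)"
 proof (rule integral_mono)
  fix x
  have "(\<Sum>i\<in>I. indicator (A i) x :: real) = indicator (\<Union>i\<in>I. A i) x" using A by (simp add: indicator_UN_disjoint)
  then have "(\<Sum>i\<in>I. indicator (A i) x *\<^sub>R f x) = indicator (\<Union>i\<in>I. A i) x * f x"
   by (simp add: sum_distrib_right[symmetric])
  also have "... \<le> f x" using f(2)[of x] by (simp add: indicator_def)
  finally show "(\<Sum>i\<in>I. indicator (A i) x *\<^sub>R f x) \<le> f x" .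
 qed (use f i in auto)
 finally show ?thesis .
qed

context hs_problem
begin

text \<open>\<open>(1 + sharp) / real J\<close> bounds energy plus mass on the chosen annulus, since
  over all annuli they sum to at most \<open>1 + sharp\<close>. The term with exponent
  \<open>p/q\<close> is the price of the gradient of the cutoff, estimated through the mass on the
  annulus by \<open>local_Holder\<close>.\<close>

abbreviation (input) splits :: "real \<Rightarrow> ('a \<times> 'b \<Rightarrow> real) \<Rightarrow> 'a \<times> 'b \<Rightarrow> real \<Rightarrow> nat \<Rightarrow> bool" where
 "splits D u \<zeta> r J \<equiv> \<exists>a\<in>T. \<exists>b\<in>T. \<exists>\<rho>. r \<le> \<rho> \<and> 2 * \<rho> \<le> 4 ^ J * r \<and> (\<forall>x\<in>ball \<zeta> \<rho>. a x = u x)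
  \<and> (\<forall>x. dist \<zeta> x > 2 * \<rho> \<longrightarrow> b x = u x)
  \<and> energy p a + energy p b \<le> energy p u + D * ((1 + sharp) / real J + ((1 + sharp) / real J) powr (p/q))
  \<and> mass UNIV u \<le> mass UNIV a + mass UNIV b + (1 + sharp) / real J"

text \<open>One of \<open>J\<close> disjoint dyadic annuli carries at most the fraction \<open>1/J\<close> of the energy and mass; the cutoff lives there.\<close>

lemma T_splitting:
 obtains D where "D \<ge> 0"
  "\<And>u \<zeta> r J. \<lbrakk>u \<in> T; energy p u \<le> 1; rad \<zeta> = 0; r > 0; J \<ge> 1\<rbrakk> \<Longrightarrow>
   splits D u \<zeta> r J"
proof -
 obtain c where c: "c \<ge> 0" "\<And>x :: 'a \<times> 'b. norm (gradient cutoff x) \<le> c" using bounded_gradient_cutoff by blast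
 define \<omega> where "\<omega> = measure lborel (ball (0::'a \<times> 'b) 1) powr (1 - p/q)"
 have \<omega>: "\<omega> \<ge> 0" by (simp add: \<omega>_def)
 define B where "B = 2 * 2 powr p * (1 + c powr p)"
 have B: "B \<ge> 0" by (simp add: B_def)
 define D where "D = B * (1 + \<omega> * 3 powr p)"
 have D: "D \<ge> 0" using B \<omega> by (simp add: D_def)
 have main: "splits D u \<zeta> r J" if u: "u \<in> T" and e: "energy p u \<le> 1" and \<zeta>: "rad \<zeta> = 0" and r: "r > 0" and J: "J \<ge> 1"
  for u :: "'a \<times> 'b \<Rightarrow> real" and \<zeta> and r :: real and J :: nat
 proof -
  define t where "t = (1 + sharp) / real J"
  \<comment> \<open>The inner radii grow by the factor 4 while each annulus spans a factor 2; the
    gaps make the closed annuli disjoint, and each one holds the whole transition region of a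
    cutoff.\<close>
  define A where "A j = {x. 4 ^ j * r \<le> dist \<zeta> x \<and> dist \<zeta> x \<le> 2 * (4 ^ j * r)}" for j :: nat
  have A_closed: "closed (A j)" for j
   unfolding A_def by (intro closed_Collect_conj closed_Collect_le continuous_intros)
  have A_borel [measurable]: "A j \<in> sets borel" for j using A_closed by (rule borel_closed)
  have disj: "disjoint_family_on A {..<J}" unfolding disjoint_family_on_def
  proof (intro ballI impI)
   have *: "A i \<inter> A j = {}" if "i < j" for i j :: nat
   proof -
    have "4 * (4::real) ^ i \<le> 4 ^ j" using that power_increasing[of "Suc i" j "4::real"] by simp
    then have "4 * (4 ^ i * r) \<le> 4 ^ j * r" using r by (simp add: mult_right_mono mult.assoc[symmetric])
    moreover have "4 ^ i * r > 0" using r by simp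
    ultimately show ?thesis by (auto simp: A_def)
   qed
   fix i j :: nat assume "i \<noteq> j"
   then show "A i \<inter> A j = {}" using *[of i j] *[of j i] by (cases "i < j") auto
  qed
  let ?C = "(\<Sum>j<J. energy_on (A j) u + mass (A j) u)"
  have "?C \<le> energy p u + mass UNIV u"
  proof -
   have "(\<Sum>j<J. energy_on (A j) u) \<le> energy p u" unfolding energy_on_def energy_def
    by (rule sum_set_integral_le) (use disj integrable_energy[OF u] in auto)
   moreover have "(\<Sum>j<J. mass (A j) u) \<le> mass UNIV u"
    unfolding mass_def by (simp add: LINT_def[of _ UNIV], rule sum_set_integral_le)
     (use disj integrable_mass[OF u] in auto)
   ultimately show ?thesis by (simp add: sum.distrib)
  qed
  also have "... \<le> 1 + sharp" using e mass_le_sharp[OF u e] by simp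
  finally have sum_le: "?C \<le> 1 + sharp" .
  have "\<exists>j<J. energy_on (A j) u + mass (A j) u \<le> t"
  proof (rule ccontr)
   assume "\<not> ?thesis"
   then have "(\<Sum>j<J. t) < ?C" using J by (intro sum_strict_mono) (auto simp: not_le lessThan_empty_iff)
   moreover have "(\<Sum>j<J. t) = 1 + sharp" using J by (simp add: t_def)
   ultimately show False using sum_le by simp
  qed
  then obtain j where j: "j < J" "energy_on (A j) u + mass (A j) u \<le> t" by auto
  then have et: "energy_on (A j) u \<le> t" and mt: "mass (A j) u \<le> t"
   using energy_on_nonneg[of "A j" u] mass_nonneg[of "A j" u] by auto
  define \<rho> where "\<rho> = 4 ^ j * r"
  have \<rho>: "\<rho> > 0" "r \<le> \<rho>" using r by (auto simp: \<rho>_def)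
  have "4 * (4::real) ^ j \<le> 4 ^ J" using j power_increasing[of "Suc j" J "4::real"] by simp
  then have "4 * 4 ^ j * r \<le> 4 ^ J * r" using r by (intro mult_right_mono) auto
  then have \<rho>J: "2 * \<rho> \<le> 4 ^ J * r" using \<rho> by (simp add: \<rho>_def)
  define \<eta> where "\<eta> = cutoff_at \<zeta> \<rho>"
  have \<eta>C: "C_class k \<eta>" "C_class k (\<lambda>x. 1 - \<eta> x)" for k
   unfolding \<eta>_def by (intro C_class_cutoff_at C_class_diff C_class_const)+
  have \<eta>d: "\<eta> differentiable (at x)" "(\<lambda>x. 1 - \<eta> x) differentiable (at x)" for x
   using C_class_differentiable \<eta>C by blast+
  define a where "a x = \<eta> x * u x" for x
  define b where "b x = (1 - \<eta> x) * u x" for x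
  have aT: "a \<in> T" and bT: "b \<in> T" unfolding a_def[abs_def] b_def[abs_def] by (intro test_functions_mult \<eta>C u)+
  have au: "a x = u x" and b0: "b x = 0" if "dist \<zeta> x < \<rho>" for x
   using cutoff_at_1[OF \<rho>(1), of \<zeta> x] that by (auto simp: a_def b_def \<eta>_def)
  have a0: "a x = 0" and bu: "b x = u x" if "dist \<zeta> x > 2 * \<rho>" for x
   using cutoff_at_0[OF \<rho>(1), of \<zeta> x] that by (auto simp: a_def b_def \<eta>_def)
  let ?In = "ball \<zeta> \<rho>" and ?Out = "{x. dist \<zeta> x > 2 * \<rho>}"
  have Out_open: "open ?Out" by (intro open_Collect_less continuous_intros)
  have Out_borel [measurable]: "?Out \<in> sets borel" using Out_open by simp
  have A_eq: "A j = {x. \<rho> \<le> dist \<zeta> x \<and> dist \<zeta> x \<le> 2 * \<rho>}" by (simp add: A_def \<rho>_def)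
  have dec: "?In \<union> (A j \<union> ?Out) = UNIV" by (auto simp: A_eq)
  let ?G = "\<lambda>x. grad_powr p u x"
  \<comment> \<open>Inside the small ball and outside the large one, one of \<open>a\<close> and
    \<open>b\<close> is locally \<open>u\<close> and the other locally 0, so the energies add
    exactly. Only the annulus produces an error.\<close>
  have pt: "grad_powr p a x + grad_powr p b x
   \<le> ?G x + (B * (indicator (A j) x * ?G x) + B * \<rho> powr (- p) * (indicator (A j) x * \<bar>u x\<bar> powr p))" for x
  proof -
   let ?A = "2 powr p * (?G x + (c / \<rho>) powr p * \<bar>u x\<bar> powr p)"
   have "x \<in> ?In \<union> (A j \<union> ?Out)" unfolding dec by simp
   then consider "x \<in> ?In" | "x \<in> ?Out" | "x \<in> A j" by blast
   then show ?thesis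
   proof cases
    case 1
    have "gradient a x = gradient u x" by (rule gradient_cong_open[of ?In]) (use 1 au in auto)
    moreover have "gradient b x = gradient (\<lambda>x. 0) x" by (rule gradient_cong_open[of ?In]) (use 1 b0 in auto)
    ultimately show ?thesis using B p0 by (simp add: gradient_const)
   next
    case 2
    have "gradient a x = gradient (\<lambda>x. 0) x" by (rule gradient_cong_open[OF Out_open]) (use 2 a0 in auto)
    moreover have "gradient b x = gradient u x" by (rule gradient_cong_open[OF Out_open]) (use 2 bu in auto)
    ultimately show ?thesis using B p0 by (simp add: gradient_const)
   next
    case 3
    have g\<eta>: "norm (gradient \<eta> x) \<le> c / \<rho>" unfolding \<eta>_def using c \<rho> by (intro gradient_cutoff_at_le) auto
    have "gradient (\<lambda>x. 1 - \<eta> x) x = - gradient \<eta> x"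
     using gradient_diff[of "\<lambda>x. 1" x \<eta>] \<eta>d by (simp add: gradient_const)
    then have g1: "norm (gradient (\<lambda>x. 1 - \<eta> x) x) \<le> c / \<rho>" using g\<eta> by simp
    have d: "c / \<rho> \<ge> 0" using c \<rho> by simp
    have "grad_powr p a x \<le> ?A"
     unfolding a_def[abs_def] using cutoff_at_range[of \<zeta> \<rho> x] p1 d g\<eta> \<eta>d T_differentiable[OF u]
     by (intro norm_gradient_mult_le) (auto simp: \<eta>_def)
    moreover have "grad_powr p b x \<le> ?A"
     unfolding b_def[abs_def] using cutoff_at_range[of \<zeta> \<rho> x] p1 d g1 \<eta>d T_differentiable[OF u]
     by (intro norm_gradient_mult_le) (auto simp: \<eta>_def)
    moreover have "2 * ?A \<le> B * ?G x + B * \<rho> powr (- p) * \<bar>u x\<bar> powr p"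
    proof -
     have "(c / \<rho>) powr p = c powr p * \<rho> powr (- p)" using c \<rho> by (simp add: powr_divide powr_minus_divide)
     then have "2 * ?A = 2 * 2 powr p * ?G x + 2 * 2 powr p * c powr p * (\<rho> powr (- p) * \<bar>u x\<bar> powr p)"
      by (simp add: algebra_simps)
     also have "... \<le> B * ?G x + B * (\<rho> powr (- p) * \<bar>u x\<bar> powr p)"
      by (intro add_mono mult_right_mono) (auto simp: B_def)
     finally show ?thesis by (simp add: mult.assoc)
    qed
    moreover have "?G x \<ge> 0" by simp
    ultimately have "grad_powr p a x + grad_powr p b x
      \<le> ?G x + (B * ?G x + B * \<rho> powr (- p) * \<bar>u x\<bar> powr p)" by linarith
    then show ?thesis using 3 by simp
   qed
  qed
  have iA: "integrable lborel (\<lambda>x. indicator (A j) x * ?G x)" "integrable lborel (\<lambda>x. indicator (A j) x * \<bar>u x\<bar> powr p)"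
   using integrable_mult_indicator[OF _ integrable_energy[OF u], of "A j"]
    integrable_mult_indicator[OF _ integrable_powr_C1c[OF T_C1c[OF u] p0], of "A j"] by simp_all
  let ?B = "\<omega> * (3 * \<rho>) powr p * t powr (p/q)"
  let ?D = "B * (\<omega> * 3 powr p) * t powr (p/q)"
  have "energy p a + energy p b = (LINT x|lborel. grad_powr p a x + grad_powr p b x)"
   unfolding energy_def using integrable_energy aT bT by (simp add: Bochner_Integration.integral_add)
  also have "... \<le> (LINT x|lborel. ?G x + (B * (indicator (A j) x * ?G x) + B * \<rho> powr (- p) * (indicator (A j) x * \<bar>u x\<bar> powr p)))"
   by (rule integral_mono[OF _ _ pt])
    (intro Bochner_Integration.integrable_add integrable_mult_right iA integrable_energy aT bT u)+
  also have "... = energy p u + (B * energy_on (A j) u + B * \<rho> powr (- p) * (LINT x:(A j)|lborel. \<bar>u x\<bar> powr p))"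
   unfolding energy_def energy_on_def LINT_def using iA integrable_energy[OF u] by simp
  also have "... \<le> energy p u + (B * t + B * \<rho> powr (- p) * ?B)"
  proof (intro add_mono mult_left_mono order_refl et)
   have "(LINT x:(A j)|lborel. \<bar>u x\<bar> powr p) \<le> \<omega> * (3 * \<rho>) powr p * mass (A j) u powr (p/q)"
    unfolding \<omega>_def using \<rho> by (intro local_Holder[OF u A_borel _ \<zeta>]) (auto simp: A_eq)
   also have "... \<le> ?B" using mt mass_nonneg p0 q0 \<omega> by (intro mult_left_mono powr_mono2) auto
   finally show "(LINT x:(A j)|lborel. \<bar>u x\<bar> powr p) \<le> ?B" .
  qed (use B in auto)
  \<comment> \<open>The powers of \<open>\<rho>\<close> from the cutoff and from
    \<open>local_Holder\<close> cancel, so the error depends on neither \<open>r\<close> nor the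
    annulus that was chosen.\<close>
  also have "\<rho> powr (- p) * ?B = \<omega> * 3 powr p * t powr (p/q)" using \<rho> by (simp add: powr_mult powr_minus)
  then have "B * t + B * \<rho> powr (- p) * ?B = B * t + ?D" by (simp only: mult.assoc)
  also have "B * t + ?D \<le> D * (t + t powr (p/q))"
  proof -
   have "t \<ge> 0" using sharp_pos by (simp add: t_def)
   then have "B * t \<le> D * t" "?D \<le> D * t powr (p/q)"
    using B \<omega> mult_nonneg_nonneg[OF B mult_nonneg_nonneg[OF \<omega>, of "3 powr p"]]
    by (auto simp: D_def distrib_left intro!: mult_right_mono)
   then show ?thesis by (simp add: distrib_left)
  qed
  finally have E: "energy p a + energy p b \<le> energy p u + D * (t + t powr (p/q))" by simp
  have "mass UNIV u = mass (?In \<union> (A j \<union> ?Out)) u" unfolding dec ..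
  also have "... \<le> mass ?In u + (mass (A j) u + mass ?Out u)"
   by (intro order.trans[OF mass_Un[OF u]] add_left_mono mass_Un[OF u]) auto
  also have "mass ?In u = mass ?In a" by (rule mass_cong) (simp add: au)
  also have "... \<le> mass UNIV a" by (rule mass_mono[OF aT]) auto
  also have "mass ?Out u = mass ?Out b" by (rule mass_cong) (simp add: bu)
  also have "... \<le> mass UNIV b" by (rule mass_mono[OF bT]) auto
  finally have "mass UNIV u \<le> mass UNIV a + mass UNIV b + t" using mt by simp
  then show ?thesis using aT bT \<rho> \<rho>J au bu E unfolding t_def by (intro bexI[of _ a] bexI[of _ b] exI[of _ \<rho>]) auto
 qed
 show ?thesis by (rule that[OF D]) (rule main)
qed

text \<open>For \<open>s = q/p > 1\<close> the function \<open>z powr s\<close> is strictly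
  superadditive. If both parts of a splitting with total energy about 1 had energy above
  \<open>\<delta>'\<close>, their masses would add up to at most about
  \<open>(1 - \<delta>') powr (s - 1) * sharp\<close>, which a near-maximiser exceeds. So one part
  is small in energy, hence also in mass.\<close>

lemma dichotomy:
 assumes \<delta>: "\<delta> > 0"
 obtains \<epsilon> R where "\<epsilon> > 0" "R > 1"
  "\<And>u \<zeta> r. \<lbrakk>u \<in> T; energy p u \<le> 1; mass UNIV u \<ge> sharp - \<epsilon>; rad \<zeta> = 0; r > 0\<rbrakk> \<Longrightarrow>
   energy_on (ball \<zeta> r) u \<le> \<delta> \<and> mass (ball \<zeta> r) u \<le> \<delta> \<or> mass (- ball \<zeta> (R * r)) u \<le> \<delta>"
proof -
 obtain D where D: "D \<ge> 0" and split: "\<And>u \<zeta> r J. \<lbrakk>u \<in> T; energy p u \<le> 1; rad \<zeta> = 0; r > 0; J \<ge> 1\<rbrakk> \<Longrightarrow>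
   splits D u \<zeta> r J" using T_splitting by blast
 define s where "s = q / p"
 have s: "s > 1" using pq p0 by (simp add: s_def)
 \<comment> \<open>The minimum secures a small energy, a small mass through
   \<open>sharp * \<delta>'\<close>, and \<open>\<delta>' < 1\<close> for the strict loss
   below.\<close>
 define \<delta>' where "\<delta>' = min (min \<delta> (\<delta> / sharp)) (1/2)"
 have \<delta>': "0 < \<delta>'" "\<delta>' \<le> \<delta>" "sharp * \<delta>' \<le> \<delta>" "\<delta>' < 1" using \<delta> sharp_pos by (auto simp: \<delta>'_def min_def field_simps)
 define t where "t J = (1 + sharp) / real J" for J
 define e where "e J = D * (t J + t J powr (p/q))" for J
 have t0: "t \<longlonglongrightarrow> 0" unfolding t_def[abs_def] by (rule lim_const_over_n)
 have e0: "e \<longlonglongrightarrow> D * (0 + 0 powr (p/q))" unfolding e_def[abs_def]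
  by (intro tendsto_intros tendsto_powr2 t0) (use sharp_pos p0 q0 in \<open>auto simp: t_def\<close>)
 then have e0: "e \<longlonglongrightarrow> 0" using p0 q0 by simp
 \<comment> \<open>The number \<open>J\<close> of annuli is fixed so large that the splitting errors
   do not consume the strict loss. Of the two terms \<open>t J\<close>, one is the deficit granted
   to the near-maximiser and the other the error in mass.\<close>
 have "(\<lambda>J. sharp * ((1 + e J - \<delta>') powr (s - 1) * (1 + e J)) + 2 * t J)
   \<longlonglongrightarrow> sharp * ((1 + 0 - \<delta>') powr (s - 1) * (1 + 0)) + 2 * 0" using \<delta>' by (intro tendsto_intros e0 t0) auto
 moreover have "(1 - \<delta>') powr (s - 1) < 1" using \<delta>' s powr_less_mono2[of "s - 1" "1 - \<delta>'" 1] by simp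
 then have "sharp * ((1 + 0 - \<delta>') powr (s - 1) * (1 + 0)) + 2 * 0 < sharp" using sharp_pos by simp
 ultimately have "\<forall>\<^sub>F J in sequentially. sharp * ((1 + e J - \<delta>') powr (s - 1) * (1 + e J)) + 2 * t J < sharp"
  by (rule order_tendstoD)
 then have "\<forall>\<^sub>F J in sequentially. J \<ge> 1 \<and> sharp * ((1 + e J - \<delta>') powr (s - 1) * (1 + e J)) + 2 * t J < sharp"
  using eventually_ge_at_top[of 1] by eventually_elim simp
 then obtain J where J: "J \<ge> 1" "sharp * ((1 + e J - \<delta>') powr (s - 1) * (1 + e J)) + 2 * t J < sharp"
  using eventually_happens sequentially_bot by blast
 have tJ: "t J > 0" using sharp_pos J by (simp add: t_def)
 have eJ: "e J \<ge> 0" using D tJ by (simp add: e_def)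
 show ?thesis
 proof (rule that[of "t J" "4 ^ J"])
  show "t J > 0" by (rule tJ)
  show "(4::real) ^ J > 1" using J by (intro one_less_power) auto
  fix u :: "'a \<times> 'b \<Rightarrow> real" and \<zeta> :: "'a \<times> 'b" and r :: real
  assume u: "u \<in> T" and E: "energy p u \<le> 1" and m: "mass UNIV u \<ge> sharp - t J" and \<zeta>: "rad \<zeta> = 0" and r: "r > 0"
  obtain a b \<rho> where aT: "a \<in> T" and bT: "b \<in> T" and \<rho>: "r \<le> \<rho>" "2 * \<rho> \<le> 4 ^ J * r"
   and au: "\<And>x. x \<in> ball \<zeta> \<rho> \<Longrightarrow> a x = u x" and bu: "\<And>x. dist \<zeta> x > 2 * \<rho> \<Longrightarrow> b x = u x"
   and Eab: "energy p a + energy p b \<le> energy p u + e J" and mab: "mass UNIV u \<le> mass UNIV a + mass UNIV b + t J"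
   using split[OF u E \<zeta> r J(1)] unfolding e_def t_def by blast
  define x where "x = energy p a"
  define y where "y = energy p b"
  have xy: "x \<ge> 0" "y \<ge> 0" "x + y \<le> 1 + e J" using Eab E energy_nonneg by (auto simp: x_def y_def)
  let ?B = "ball \<zeta> r"
  have "x \<le> \<delta>' \<or> y \<le> \<delta>'"
  proof (rule ccontr)
   assume "\<not> ?thesis"
   then have g: "x > \<delta>'" "y > \<delta>'" by auto
   let ?A = "1 + e J - \<delta>'"
   have le: "z powr s \<le> ?A powr (s - 1) * z" if "0 < z" "z \<le> ?A" for z
   proof -
    have "z powr s = z powr (s - 1) * z" using that by (simp add: powr_diff)
    also have "... \<le> ?A powr (s - 1) * z" using that s by (intro mult_right_mono powr_mono2) auto
    finally show ?thesis .
   qed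
   have "sharp - 2 * t J \<le> mass UNIV a + mass UNIV b" using m mab by simp
   also have "... \<le> sharp * x powr s + sharp * y powr s"
    using mass_le[OF aT] mass_le[OF bT] by (simp add: x_def y_def s_def)
   also have "... \<le> sharp * (?A powr (s - 1) * x) + sharp * (?A powr (s - 1) * y)"
    using g xy \<delta>' sharp_pos by (intro add_mono mult_left_mono le) auto
   also have "... = sharp * (?A powr (s - 1) * (x + y))" by (simp add: algebra_simps)
   also have "... \<le> sharp * (?A powr (s - 1) * (1 + e J))" using xy sharp_pos by (intro mult_left_mono) auto
   finally show False using J(2) by simp
  qed
  then show "energy_on ?B u \<le> \<delta> \<and> mass ?B u \<le> \<delta> \<or> mass (- ball \<zeta> (4 ^ J * r)) u \<le> \<delta>"
  proof
   have small: "sharp * z powr s \<le> \<delta>" if "0 \<le> z" "z \<le> \<delta>'" for z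
   proof -
    have "z powr s \<le> \<delta>' powr s" using that s by (intro powr_mono2) auto
    also have "\<delta>' powr s \<le> \<delta>' powr 1" using \<delta>' s by (intro powr_mono') auto
    finally have "sharp * z powr s \<le> sharp * \<delta>'" using \<delta>' sharp_pos by (intro mult_left_mono) auto
    with \<delta>' show ?thesis by simp
   qed
   {
    assume x: "x \<le> \<delta>'"
    have "energy_on ?B u = energy_on ?B a" by (rule energy_on_cong[of "ball \<zeta> \<rho>"]) (use \<rho> au in auto)
    also have "... \<le> x" unfolding x_def energy_on_UNIV[symmetric] by (rule energy_on_mono[OF aT]) auto
    finally have 1: "energy_on ?B u \<le> \<delta>" using x \<delta>' by simp
    have "mass ?B u = mass ?B a" by (rule mass_cong) (use \<rho> au in auto)
    also have "... \<le> mass UNIV a" by (rule mass_mono[OF aT]) auto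
    also have "... \<le> sharp * x powr s" using mass_le[OF aT] by (simp add: x_def s_def)
    also have "... \<le> \<delta>" using x xy by (intro small)
    finally show ?thesis using 1 by simp
   next
    assume y: "y \<le> \<delta>'"
    \<comment> \<open>\<open>b\<close> is known to equal \<open>u\<close> only strictly beyond the
      radius \<open>2 * \<rho>\<close>; the sphere left over is a null set.\<close>
    have N: "emeasure lborel (sphere \<zeta> (2 * \<rho>)) = 0"
     using negligible_sphere[of \<zeta> "2 * \<rho>"] by (simp add: negligible_iff_emeasure0)
    let ?C = "- ball \<zeta> (2 * \<rho>)"
    have "mass (- ball \<zeta> (4 ^ J * r)) u \<le> mass ?C u" by (rule mass_mono[OF u]) (use \<rho> in auto)
    also have "... = mass ?C b" unfolding mass_def LINT_def
    proof (rule integral_cong_AE)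
     have "AE x in lborel. x \<notin> sphere \<zeta> (2 * \<rho>)" using N by (intro AE_not_in null_setsI) auto
     then show "AE x in lborel. indicat_real ?C x *\<^sub>R (dens x (u x))
      = indicat_real ?C x *\<^sub>R (dens x (b x))" by eventually_elim (auto simp: indicator_def bu)
    qed (use T_measurable[OF u] T_measurable[OF bT] in measurable)
    also have "... \<le> mass UNIV b" by (rule mass_mono[OF bT]) auto
    also have "... \<le> sharp * y powr s" using mass_le[OF bT] by (simp add: y_def s_def)
    also have "... \<le> \<delta>" using y xy by (intro small)
    finally show ?thesis by simp
   }
  qed
 qed
qed

section \<open>Scaling and translation along the plane\<close>

definition rescale :: "'a \<times> 'b \<Rightarrow> real \<Rightarrow> ('a \<times> 'b \<Rightarrow> real) \<Rightarrow> 'a \<times> 'b \<Rightarrow> real" where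
 "rescale \<zeta> r u x = r powr ((n - p) / p) * u (\<zeta> + r *\<^sub>R x)"

lemma rescale_T:
 assumes u: "u \<in> T" and \<zeta>: "rad \<zeta> = 0" and r: "r > 0"
 shows "rescale \<zeta> r u \<in> T"
proof -
 obtain C where C: "compact C" "C \<subseteq> \<Omega>" "\<And>x. x \<notin> C \<Longrightarrow> u x = 0" using test_functions_compact_support[OF u] by blast
 let ?D = "(\<lambda>x. (1 / r) *\<^sub>R (x - \<zeta>)) ` C"
 have "(\<lambda>x. u (\<zeta> + r *\<^sub>R x)) \<in> T"
 proof (rule test_functionsI[of _ ?D])
  show "C_class k (\<lambda>x. u (\<zeta> + r *\<^sub>R x))" for k by (intro C_class_affine test_functions_smooth[OF u])
  show "compact ?D" by (intro compact_continuous_image C(1) continuous_intros)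
  show "?D \<subseteq> \<Omega>"
  proof (rule image_subsetI)
   fix x assume "x \<in> C"
   then have "fst x \<in> K" using C(2) by (auto simp: \<Omega>_eq)
   then have "(1 / r) *\<^sub>R fst x \<in> K" using r by (intro K_cone) auto
   then show "(1 / r) *\<^sub>R (x - \<zeta>) \<in> \<Omega>" using \<zeta> by (simp add: \<Omega>_eq mem_Times_iff rad_def)
  qed
  show "u (\<zeta> + r *\<^sub>R x) = 0" if "x \<notin> ?D" for x
  proof (rule C(3))
   show "\<zeta> + r *\<^sub>R x \<notin> C"
   proof
    assume "\<zeta> + r *\<^sub>R x \<in> C"
    then have "(1 / r) *\<^sub>R ((\<zeta> + r *\<^sub>R x) - \<zeta>) \<in> ?D" by (rule imageI)
    then show False using that r by simp
   qed
  qed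
 qed
 then show ?thesis unfolding rescale_def[abs_def] by (rule test_functions_cmult)
qed

text \<open>The exponent \<open>(n - p) / p\<close> in \<open>rescale\<close> is forced by
  invariance of the energy; that the mass is invariant as well is the relation between
  \<open>\<beta>\<close>, \<open>q\<close> and \<open>n\<close>. A centre on the plane keeps the
  weight homogeneous.\<close>

lemma mass_rescale:
 assumes u: "u \<in> T" and \<zeta>: "rad \<zeta> = 0" and r: "r > 0"
  and S: "S \<in> sets borel" "S' \<in> sets borel" "\<And>x. x \<in> S \<longleftrightarrow> \<zeta> + r *\<^sub>R x \<in> S'"
 shows "mass S (rescale \<zeta> r u) = mass S' u"
proof -
 have [measurable]: "u \<in> Borel" "S' \<in> sets borel" using u S by (auto intro: T_measurable)
 have pt: "dens x (rescale \<zeta> r u x) = r powr n * (wt (\<zeta> + r *\<^sub>R x) * \<bar>u (\<zeta> + r *\<^sub>R x)\<bar> powr q)" for x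
 proof -
  have "rad (\<zeta> + r *\<^sub>R x) = r * rad x" using \<zeta> r by (simp add: rad_def)
  then have h1: "wt (\<zeta> + r *\<^sub>R x) = r powr (- \<beta>) * wt x" using r by (simp add: wt_def powr_mult)
  have h3: "(n - p) / p * q = n - \<beta>" unfolding \<beta>_eq using p0 by (simp add: field_simps)
  have h2: "\<bar>rescale \<zeta> r u x\<bar> powr q = r powr (n - \<beta>) * \<bar>u (\<zeta> + r *\<^sub>R x)\<bar> powr q"
   unfolding h3[symmetric] by (simp add: rescale_def abs_mult powr_mult powr_powr)
  have h4: "r powr (n - \<beta>) = r powr n * r powr (- \<beta>)" by (simp flip: powr_add)
  show ?thesis unfolding h1 h2 h4 by (simp only: mult_ac)
 qed
 let ?A = "1 / \<bar>r\<bar> ^ DIM('a \<times> 'b)"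
 have "ennreal (mass S (rescale \<zeta> r u)) = (\<integral>x\<in>S. dens x (rescale \<zeta> r u x))"
  by (rule nn_integral_mass[symmetric, OF rescale_T[OF u \<zeta> r] S(1)])
 also have "... = (\<integral>\<^sup>+x. ennreal (r powr n) * (ennreal (wt (\<zeta> + r *\<^sub>R x) * \<bar>u (\<zeta> + r *\<^sub>R x)\<bar> powr q) * indicator S' (\<zeta> + r *\<^sub>R x)))"
  unfolding pt using S(3) by (intro nn_integral_cong) (auto simp: indicator_def ennreal_mult)
 also have "... = ennreal (r powr n) * (\<integral>\<^sup>+x. ennreal (wt (\<zeta> + r *\<^sub>R x) * \<bar>u (\<zeta> + r *\<^sub>R x)\<bar> powr q) * indicator S' (\<zeta> + r *\<^sub>R x))"
  by (rule nn_integral_cmult) measurable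
 also have "... = ennreal (r powr n) * (ennreal ?A * (\<integral>x\<in>S'. dens x (u x)))"
  by (subst nn_integral_affine[of "\<lambda>x. ennreal (dens x (u x)) * indicator S' x"]) (use r in auto)
 also have "... = ennreal (r powr n) * ennreal ?A * ennreal (mass S' u)"
  by (simp only: nn_integral_mass[OF u S(2)] mult.assoc)
 also have "ennreal (r powr n) * ennreal ?A = 1"
  using r by (simp add: n_eq powr_realpow del: DIM_prod flip: ennreal_mult)
 finally show ?thesis by (simp add: mass_nonneg)
qed

lemma energy_rescale:
 assumes u: "u \<in> T" and \<zeta>: "rad \<zeta> = 0" and r: "r > 0"
 shows "energy p (rescale \<zeta> r u) = energy p u"
proof -
 have [measurable]: "gradient u \<in> Borel" using u by (rule T_gradient_measurable)
 have "gradient (rescale \<zeta> r u) x = r powr ((n - p) / p) *\<^sub>R (r *\<^sub>R gradient u (\<zeta> + r *\<^sub>R x))" for x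
  unfolding rescale_def[abs_def]
  by (subst gradient_cmult, rule C_class_differentiable[OF C_class_affine[OF test_functions_smooth[OF u]]])
   (simp add: gradient_affine[OF T_differentiable[OF u]])
 then have "norm (gradient (rescale \<zeta> r u) x) = r powr (n / p) * norm (gradient u (\<zeta> + r *\<^sub>R x))" for x
  using r p0 by (simp add: powr_diff diff_divide_distrib)
 then have pt: "grad_powr p (rescale \<zeta> r u) x = r powr n * grad_powr p u (\<zeta> + r *\<^sub>R x)" for x
  using p0 by (simp add: powr_mult powr_powr)
 let ?A = "1 / \<bar>r\<bar> ^ DIM('a \<times> 'b)"
 have "ennreal (energy p (rescale \<zeta> r u)) = (\<integral>x. grad_powr p (rescale \<zeta> r u) x)"
  by (rule nn_integral_energy[symmetric, OF T_C1c[OF rescale_T[OF u \<zeta> r]] p0])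
 also have "... = (\<integral>\<^sup>+x. ennreal (r powr n) * ennreal (grad_powr p u (\<zeta> + r *\<^sub>R x)))"
  unfolding pt by (simp add: ennreal_mult)
 also have "... = ennreal (r powr n) * (\<integral>x. grad_powr p u (\<zeta> + r *\<^sub>R x))" by (rule nn_integral_cmult) measurable
 also have "... = ennreal (r powr n) * (ennreal ?A * (\<integral>x. grad_powr p u x))"
  by (subst nn_integral_affine[of "\<lambda>x. ennreal (grad_powr p u x)"]) (use r in auto)
 also have "... = ennreal (r powr n) * ennreal ?A * ennreal (energy p u)"
  by (simp only: nn_integral_energy[OF T_C1c[OF u] p0] mult.assoc)
 also have "ennreal (r powr n) * ennreal ?A = 1"
  using r by (simp add: n_eq powr_realpow del: DIM_prod flip: ennreal_mult)
 finally show ?thesis by (simp add: energy_nonneg)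
qed

text \<open>Dominated convergence, as the strips shrink to a null set. It keeps the radii that
  compete in \<open>normalise\<close> away from 0.\<close>

lemma mass_near_plane_small:
 assumes u: "u \<in> T" and e: "e > 0"
 obtains d where "d > 0" "mass {x. rad x < d} u < e"
proof -
 let ?f = "\<lambda>x. dens x (u x)"
 have [measurable]: "u \<in> Borel" using u by (rule T_measurable)
 have "(\<lambda>k. LINT x|lborel. indicator {x. rad x < 1 / real (Suc k)} x *\<^sub>R ?f x) \<longlonglongrightarrow> (LINT x|(lborel :: ('a \<times> 'b) measure). 0)"
 proof (rule integral_dominated_convergence[where w="?f"])
  show "AE x in lborel. (\<lambda>k. indicator {x. rad x < 1 / real (Suc k)} x *\<^sub>R ?f x) \<longlonglongrightarrow> 0" using AE_rad_pos
  proof eventually_elim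
   fix x :: "'a \<times> 'b" assume "rad x > 0"
   then have "\<forall>\<^sub>F k in sequentially. 1 / real (Suc k) < rad x"
    using LIMSEQ_inverse_real_of_nat by (auto simp: inverse_eq_divide dest: order_tendstoD(2))
   then show "(\<lambda>k. indicator {x. rad x < 1 / real (Suc k)} x *\<^sub>R ?f x) \<longlonglongrightarrow> 0"
    by (intro tendsto_eventually, elim eventually_mono) auto
  qed
 qed (use integrable_mass[OF u] in \<open>auto simp: indicator_def\<close>)
 then have "(\<lambda>k. mass {x. rad x < 1 / real (Suc k)} u) \<longlonglongrightarrow> 0" by (simp add: mass_def LINT_def)
 then have "\<forall>\<^sub>F k in sequentially. mass {x. rad x < 1 / real (Suc k)} u < e" using e by (rule order_tendstoD)
 then obtain k where "mass {x. rad x < 1 / real (Suc k)} u < e" using eventually_happens sequentially_bot by blast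
 then show ?thesis using that[of "1 / real (Suc k)"] by simp
qed

text \<open>Among the radii of balls centred on the plane that hold half of \<open>sharp\<close>,
  one below twice the infimum is rescaled to 1, and its half falls below the infimum. The infimum
  need not be attained; this is why the excluded balls have radius \<open>1/2\<close>.\<close>

lemma normalise:
 assumes u: "u \<in> T" and m: "mass UNIV u \<ge> sharp / 2"
 obtains v where "v \<in> T" "energy p v = energy p u" "mass UNIV v = mass UNIV u"
  "mass (ball 0 1) v \<ge> sharp / 2" "\<And>\<zeta>. rad \<zeta> = 0 \<Longrightarrow> mass (ball \<zeta> (1/2)) v < sharp / 2"
  "(\<forall>x. u x \<ge> 0) \<Longrightarrow> (\<forall>x. v x \<ge> 0)"
proof -
 define S where "S = {r. r > 0 \<and> (\<exists>\<zeta>. rad \<zeta> = 0 \<and> mass (ball \<zeta> r) u \<ge> sharp / 2)}"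
 obtain R where R: "R > 0" "{x. u x \<noteq> 0} \<subseteq> ball 0 R"
  using bounded_subset_ballD[OF C1c_bounded_support[OF T_C1c[OF u]], of 0] by blast
 have "mass (ball 0 R) u = mass UNIV u" unfolding mass_def LINT_def
  using R(2) q0 by (intro Bochner_Integration.integral_cong) (auto simp: indicator_def subset_iff)
 moreover have "rad (0 :: 'a \<times> 'b) = 0" by (simp add: rad_def)
 ultimately have "R \<in> S" unfolding S_def using R(1) m by (intro CollectI conjI exI[of _ "0 :: 'a \<times> 'b"]) simp_all
 obtain d where d: "d > 0" "mass {x. rad x < d} u < sharp / 2"
  using mass_near_plane_small[OF u, of "sharp / 2"] sharp_pos by auto
 have S_ge: "d \<le> r" if "r \<in> S" for r
 proof (rule ccontr)
  assume "\<not> d \<le> r"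
  obtain \<zeta> where \<zeta>: "rad \<zeta> = 0" "mass (ball \<zeta> r) u \<ge> sharp / 2" using \<open>r \<in> S\<close> by (auto simp: S_def)
  have "ball \<zeta> r \<subseteq> {x. rad x < d}"
  proof
   fix x assume "x \<in> ball \<zeta> r"
   have "rad x = norm (fst (x - \<zeta>))" using \<zeta> by (simp add: rad_def)
   also have "... \<le> norm (x - \<zeta>)" by (metis norm_fst_le prod.collapse)
   also have "... < d" using \<open>x \<in> ball \<zeta> r\<close> \<open>\<not> d \<le> r\<close> by (simp add: dist_norm norm_minus_commute)
   finally show "x \<in> {x. rad x < d}" by simp
  qed
  then have "mass (ball \<zeta> r) u \<le> mass {x. rad x < d} u" by (intro mass_mono[OF u]) measurable
  then show False using d \<zeta> by simp
 qed
 define r0 where "r0 = Inf S"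
 have bdd: "bdd_below S" using S_ge by (intro bdd_belowI)
 have r0: "d \<le> r0" unfolding r0_def using \<open>R \<in> S\<close> S_ge by (intro cInf_greatest) auto
 then have "r0 < 2 * r0" using d by simp
 then obtain r where r: "r \<in> S" "r < 2 * r0" unfolding r0_def using cInf_lessD[of S] \<open>R \<in> S\<close> by blast
 have "r / 2 \<notin> S"
 proof
  assume "r / 2 \<in> S"
  then have "r0 \<le> r / 2" unfolding r0_def by (rule cInf_lower[OF _ bdd])
  then show False using r by simp
 qed
 obtain \<zeta> where \<zeta>: "rad \<zeta> = 0" "mass (ball \<zeta> r) u \<ge> sharp / 2" and rpos: "r > 0" using r(1) by (auto simp: S_def)
 define v where "v = rescale \<zeta> r u"
 have d1: "dist (\<zeta> + r *\<^sub>R y) (\<zeta> + r *\<^sub>R x) = r * dist y x" for x y :: "'a \<times> 'b"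
  using rpos by (simp add: dist_norm flip: scaleR_diff_right)
 have b: "mass (ball \<eta> s) v = mass (ball (\<zeta> + r *\<^sub>R \<eta>) (r * s)) u" for \<eta> s
  unfolding v_def by (rule mass_rescale[OF u \<zeta>(1) rpos]) (simp, simp, unfold mem_ball d1, use rpos in simp)
 show ?thesis
 proof (rule that[of v])
  show "v \<in> T" "energy p v = energy p u" unfolding v_def using u \<zeta> rpos by (auto intro: rescale_T energy_rescale)
  show "mass UNIV v = mass UNIV u" unfolding v_def by (rule mass_rescale[OF u \<zeta>(1) rpos]) auto
  show "mass (ball 0 1) v \<ge> sharp / 2" using b[of 0 1] \<zeta> by simp
  show "mass (ball \<eta> (1/2)) v < sharp / 2" if "rad \<eta> = 0" for \<eta>
  proof -
   let ?A = "\<zeta> + r *\<^sub>R \<eta>"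
   have "rad ?A = 0" using that \<zeta> by (simp add: rad_def)
   then have "mass (ball ?A (r / 2)) u \<ge> sharp / 2 \<Longrightarrow> r / 2 \<in> S"
    unfolding S_def using rpos by (intro CollectI conjI exI[of _ "?A"]) simp_all
   then have "\<not> mass (ball ?A (r / 2)) u \<ge> sharp / 2" using \<open>r / 2 \<notin> S\<close> by blast
   then show ?thesis using b[of \<eta> "1/2"] by simp
  qed
  show "(\<forall>x. v x \<ge> 0)" if "\<forall>x. u x \<ge> 0" using that unfolding v_def rescale_def
   by (intro allI mult_nonneg_nonneg powr_ge_zero) blast
 qed
qed

text \<open>A smooth substitute for \<open>\<bar>u\<bar>\<close>. Subtracting \<open>e\<close> makes
  it vanish wherever \<open>u\<close> does, so it remains a test function; the outer function has
  slope at most 1 in modulus, so gradients do not grow.\<close>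

lemma smooth_abs:
 assumes u: "u \<in> T" and e: "e > 0"
 defines "w \<equiv> \<lambda>x. sqrt (u x * u x + e * e) - e"
 shows "w \<in> T" "\<And>x. w x \<ge> 0" "\<And>x. \<bar>w x\<bar> \<le> \<bar>u x\<bar>" "\<And>x. norm (gradient w x) \<le> norm (gradient u x)"
proof -
 have pos: "t * t + e * e > 0" for t using e by (simp add: add_nonneg_pos)
 obtain C where C: "compact C" "C \<subseteq> \<Omega>" "\<And>x. x \<notin> C \<Longrightarrow> u x = 0" using test_functions_compact_support[OF u] by blast
 have w_powr: "w = (\<lambda>x. (u x * u x + e * e) powr (1/2) - e)"
  using pos by (simp add: w_def powr_half_sqrt less_imp_le)
 show "w \<in> T"
 proof (rule test_functionsI[OF _ C(1,2)])
  show "C_class k w" for k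
   unfolding w_powr by (intro C_class_diff C_class_powr C_class_add C_class_mult C_class_const test_functions_smooth[OF u] pos)
  show "w x = 0" if "x \<notin> C" for x using C(3)[OF that] e by (simp add: w_def)
 qed
 show nn: "w x \<ge> 0" for x using e real_le_rsqrt[of e "u x * u x + e * e"] by (simp add: w_def power2_eq_square)
 show "\<bar>w x\<bar> \<le> \<bar>u x\<bar>" for x
 proof -
  have "sqrt (u x * u x + e * e) \<le> \<bar>u x\<bar> + e"
   using e by (intro real_le_lsqrt) (auto simp: power2_eq_square algebra_simps)
  then show ?thesis using nn[of x] by (simp add: w_def)
 qed
 show "norm (gradient w x) \<le> norm (gradient u x)" for x
 proof -
  let ?A = "u x * u x + e * e"
  have "((\<lambda>t. sqrt (t * t + e * e) - e) has_real_derivative u x / sqrt ?A) (at (u x))"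
   using pos[of "u x"] by (auto intro!: derivative_eq_intros simp: field_simps)
  from gradient_compose[OF T_differentiable[OF u] this]
  have "norm (gradient w x) = \<bar>u x / sqrt ?A\<bar> * norm (gradient u x)" by (simp add: w_def)
  also have "\<bar>u x / sqrt ?A\<bar> \<le> 1"
  proof -
   have "\<bar>u x\<bar> \<le> sqrt ?A" using e by (intro real_le_rsqrt) (auto simp: power2_eq_square)
   then show ?thesis using pos[of "u x"] by (simp add: abs_divide divide_le_eq)
  qed
  then have "\<bar>u x / sqrt ?A\<bar> * norm (gradient u x) \<le> 1 * norm (gradient u x)" by (rule mult_right_mono) simp
  finally show ?thesis by simp
 qed
qed

text \<open>As the regularisation in \<open>smooth_abs\<close> is removed, the mass returns to that
  of \<open>u\<close> by dominated convergence, while the energy never exceeds that of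
  \<open>u\<close>.\<close>

lemma nonneg_near_maximiser:
 assumes \<epsilon>: "\<epsilon> > 0"
 obtains u where "u \<in> T" "\<forall>x. u x \<ge> 0" "energy p u \<le> 1" "mass UNIV u > sharp - \<epsilon>"
proof -
 have "sharp - \<epsilon> < (SUP u\<in>{u\<in>T. energy p u \<le> 1}. mass UNIV u)" using \<epsilon> by (simp add: sharp_def)
 moreover have "(\<lambda>x. 0) \<in> {u\<in>T. energy p u \<le> 1}" using T_zero p0 by (simp add: energy_def gradient_const)
 ultimately obtain u where u: "u \<in> T" "energy p u \<le> 1" "sharp - \<epsilon> < mass UNIV u"
  using less_cSUP_iff[OF _ bdd_sharp, of "sharp - \<epsilon>"] by blast
 have [measurable]: "u \<in> Borel" using u(1) by (rule T_measurable)
 define w where "w k = (\<lambda>x. sqrt (u x * u x + (1 / real (Suc k)) * (1 / real (Suc k))) - 1 / real (Suc k))" for k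
 have w: "w k \<in> T" "\<And>x. w k x \<ge> 0" "\<And>x. \<bar>w k x\<bar> \<le> \<bar>u x\<bar>" "\<And>x. norm (gradient (w k) x) \<le> norm (gradient u x)" for k
  unfolding w_def by (rule smooth_abs[OF u(1)], simp)+
 have [measurable]: "w k \<in> Borel" for k using w(1) by (rule T_measurable)
 have "(\<lambda>k. LINT x|lborel. dens x (w k x)) \<longlonglongrightarrow> (LINT x|lborel. dens x (u x))"
 proof (rule integral_dominated_convergence[where w="\<lambda>x. dens x (u x)"])
  show "AE x in lborel. (\<lambda>k. dens x (w k x)) \<longlonglongrightarrow> dens x (u x)"
  proof (rule AE_I2)
   fix x
   have "(\<lambda>k. 1 / real (Suc k)) \<longlonglongrightarrow> 0" using LIMSEQ_inverse_real_of_nat by (simp add: inverse_eq_divide)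
   then have "(\<lambda>k. w k x) \<longlonglongrightarrow> sqrt (u x * u x + 0 * 0) - 0" unfolding w_def by (intro tendsto_intros)
   then have "(\<lambda>k. w k x) \<longlonglongrightarrow> \<bar>u x\<bar>" by simp
   then have "(\<lambda>k. dens x (w k x)) \<longlonglongrightarrow> wt x * \<bar>\<bar>u x\<bar>\<bar> powr q" using q0 by (intro tendsto_intros tendsto_powr') auto
   then show "(\<lambda>k. dens x (w k x)) \<longlonglongrightarrow> dens x (u x)" by simp
  qed
  show "AE x in lborel. norm (dens x (w k x)) \<le> dens x (u x)" for k
   using w(3) q0 by (intro AE_I2) (auto simp: abs_mult intro!: mult_left_mono powr_mono2)
 qed (use integrable_mass[OF u(1)] in auto)
 then have "(\<lambda>k. mass UNIV (w k)) \<longlonglongrightarrow> mass UNIV u" by (simp add: mass_def LINT_def)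
 then have "\<forall>\<^sub>F k in sequentially. sharp - \<epsilon> < mass UNIV (w k)" using u(3) by (rule order_tendstoD)
 then obtain k where k: "sharp - \<epsilon> < mass UNIV (w k)" using eventually_happens sequentially_bot by blast
 have "energy p (w k) \<le> energy p u" unfolding energy_def using w(4)[of k] p0
  by (intro integral_mono integrable_energy w u) (auto intro!: powr_mono2)
 then show ?thesis using that[of "w k"] w k u by auto
qed

end

section \<open>Compactness\<close>

lemma diagonal_convergent:
 fixes f :: "nat \<Rightarrow> nat \<Rightarrow> real"
 assumes bounded: "\<And>i. \<exists>B. \<forall>k. \<bar>f i k\<bar> \<le> B"
 obtains r :: "nat \<Rightarrow> nat" where "strict_mono r" "\<And>i. convergent (\<lambda>k. f i (r k))"
proof -
 interpret subseqs "\<lambda>i s. convergent (\<lambda>k. f i (s k))"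
 proof
  fix i and s :: "nat \<Rightarrow> nat" assume "strict_mono s"
  obtain B where "\<forall>k. \<bar>f i k\<bar> \<le> B" using bounded by blast
  then have "bounded (range (\<lambda>k. f i (s k)))" by (auto simp: bounded_iff)
  then obtain l r' where "strict_mono r'" "((\<lambda>k. f i (s k)) \<circ> r') \<longlonglongrightarrow> l"
   using bounded_imp_convergent_subsequence by blast
  then show "\<exists>r'. strict_mono r' \<and> convergent (\<lambda>k. f i ((s \<circ> r') k))" by (auto simp: o_def convergent_def)
 qed
 \<comment> \<open>The diagonal sequence is a subsequence of the \<open>i\<close>-th selected one
   only beyond index \<open>i\<close>; dropping an initial segment does not affect
   convergence.\<close>
 have H: "convergent (\<lambda>k. f i ((diagseq \<circ> (+) (Suc i)) k))" for i
 proof (rule diagseq_holds)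
  fix r s :: "nat \<Rightarrow> nat" and n assume "strict_mono r" "convergent (\<lambda>k. f n (s k))"
  then obtain l where "(\<lambda>k. f n (s k)) \<longlonglongrightarrow> l" by (auto simp: convergent_def)
  from LIMSEQ_subseq_LIMSEQ[OF this \<open>strict_mono r\<close>]
  show "convergent (\<lambda>k. f n ((s \<circ> r) k))" by (auto simp: convergent_def o_def)
 qed
 have "(\<lambda>k. f i ((diagseq \<circ> (+) (Suc i)) k)) = (\<lambda>k. f i (diagseq (k + Suc i)))" for i
  by (rule ext) (simp add: add.commute)
 then have "convergent (\<lambda>k. f i (diagseq (k + Suc i)))" for i using H[of i] by (simp only:)
 then have "convergent (\<lambda>k. f i (diagseq k))" for i
  using convergent_ignore_initial_segment[of "\<lambda>k. f i (diagseq k)" "Suc i"] by blast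
 then show ?thesis using that subseq_diagseq by blast
qed

text \<open>The difference quotient bound along a segment, localised to a convex set: used with the whole
 space for compactness and with a ball for positivity.\<close>

lemma nn_integral_translate_diff_le:
 fixes f :: "'a::euclidean_space \<Rightarrow> real"
 assumes f: "C_class (Suc 0) f" and B: "convex B" "B \<in> sets borel" and p: "p \<ge> 1"
 shows "(\<integral>\<^sup>+x. ennreal (\<bar>f (x + h) - f x\<bar> powr p) * (indicator B x * indicator B (x + h)))
  \<le> ennreal (norm h powr p) * (\<integral>x\<in>B. grad_powr p f x)"
proof -
 have [measurable]: "f \<in> Borel" "gradient f \<in> Borel" "B \<in> sets borel"
  using f C_class_continuous continuous_on_gradient B(2) by (blast intro: borel_measurable_continuous_onI)+
 let ?G = "\<lambda>x. ennreal (grad_powr p f x) * indicator B x"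
 have "(\<integral>\<^sup>+x. ennreal (\<bar>f (x + h) - f x\<bar> powr p) * (indicator B x * indicator B (x + h)))
  \<le> (\<integral>\<^sup>+x. (\<integral>\<^sup>+t. ennreal (norm h powr p) * ?G (t *\<^sub>R h + x) * indicator {0..1::real} t))"
 proof (rule nn_integral_mono)
  fix x
  let ?A = "(\<integral>\<^sup>+t. ennreal (norm h powr p) * ?G (t *\<^sub>R h + x) * indicator {0..1::real} t)"
  show "ennreal (\<bar>f (x + h) - f x\<bar> powr p) * (indicator B x * indicator B (x + h)) \<le> ?A"
  proof (cases "x \<in> B \<and> x + h \<in> B")
   case True
   have seg: "t *\<^sub>R h + x \<in> B" if "t \<in> {0..1}" for t
   proof -
    have "(1 - t) *\<^sub>R x + t *\<^sub>R (x + h) \<in> B" using True that B(1) by (intro convexD_alt) auto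
    then show ?thesis by (simp add: algebra_simps)
   qed
   have "ennreal (\<bar>f (x + h) - f x\<bar> powr p) \<le> (\<integral>t\<in>{0..1}. (norm h * norm (gradient f (x + t *\<^sub>R h))) powr p)"
    using p by (intro nn_integral_Jensen'[OF _ _ _ _ _ abs_diff_le_nn_integral[OF f]]) auto
   also have "... = ?A"
    using seg by (intro nn_integral_cong) (auto simp: indicator_def powr_mult ennreal_mult add.commute)
   finally show ?thesis using True by simp
  qed auto
 qed
 also have "... = (\<integral>\<^sup>+t. (\<integral>\<^sup>+x. ennreal (norm h powr p) * ?G (t *\<^sub>R h + x) * indicator {0..1::real} t))"
  by (rule lborel_pair.Fubini'[symmetric]) measurable
 also have "... = (\<integral>\<^sup>+t. ennreal (norm h powr p) * (\<integral>\<^sup>+x. ?G x) * indicator {0..1::real} t)"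
 proof (rule nn_integral_cong)
  fix t :: real
  have "(\<integral>\<^sup>+x. ennreal (norm h powr p) * ?G (t *\<^sub>R h + x) * indicator {0..1::real} t)
   = (\<integral>\<^sup>+x. ennreal (norm h powr p) * ?G (t *\<^sub>R h + x)) * indicator {0..1::real} t"
   by (rule nn_integral_multc) measurable
  also have "(\<integral>\<^sup>+x. ennreal (norm h powr p) * ?G (t *\<^sub>R h + x)) = ennreal (norm h powr p) * (\<integral>\<^sup>+x. ?G (t *\<^sub>R h + x))"
   by (rule nn_integral_cmult) measurable
  also have "(\<integral>\<^sup>+x. ?G (t *\<^sub>R h + x)) = (\<integral>\<^sup>+x. ?G x)" by (rule nn_integral_translate) measurable
  finally show "(\<integral>\<^sup>+x. ennreal (norm h powr p) * ?G (t *\<^sub>R h + x) * indicator {0..1::real} t)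
   = ennreal (norm h powr p) * (\<integral>\<^sup>+x. ?G x) * indicator {0..1::real} t" .
 qed
 also have "... = ennreal (norm h powr p) * (\<integral>x\<in>B. grad_powr p f x)" by (subst nn_integral_cmult_indicator) auto
 finally show ?thesis .
qed

lemma nn_integral_double_diff_le:
 fixes f :: "'a::euclidean_space \<Rightarrow> real"
 assumes f: "C_class (Suc 0) f" and B: "convex B" "B \<in> sets borel" and p: "p \<ge> 1" and d: "d > 0"
 shows "(\<integral>\<^sup>+x. (\<integral>\<^sup>+h. ennreal (\<bar>f (x + h) - f x\<bar> powr p) * (indicator B x * indicator B (x + h)) * indicator (ball 0 d) h))
  \<le> ennreal (d powr p * (d ^ DIM('a) * measure lborel (ball (0::'a) 1))) * (\<integral>x\<in>B. grad_powr p f x)"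
proof -
 have [measurable]: "f \<in> Borel" "gradient f \<in> Borel" "B \<in> sets borel"
  using f C_class_continuous continuous_on_gradient B(2) by (blast intro: borel_measurable_continuous_onI)+
 let ?E = "(\<integral>x\<in>B. grad_powr p f x)"
 have "(\<integral>\<^sup>+x. (\<integral>\<^sup>+h. ennreal (\<bar>f (x + h) - f x\<bar> powr p) * (indicator B x * indicator B (x + h)) * indicator (ball 0 d) h))
  = (\<integral>\<^sup>+h. (\<integral>\<^sup>+x. ennreal (\<bar>f (x + h) - f x\<bar> powr p) * (indicator B x * indicator B (x + h)) * indicator (ball 0 d) h))"
  by (rule lborel_pair.Fubini'[symmetric]) measurable
 also have "... \<le> (\<integral>\<^sup>+h. ennreal (d powr p) * ?E * indicator (ball (0::'a) d) h)"
 proof (rule nn_integral_mono)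
  fix h :: 'a
  have "(\<integral>\<^sup>+x. ennreal (\<bar>f (x + h) - f x\<bar> powr p) * (indicator B x * indicator B (x + h)) * indicator (ball 0 d) h)
   = (\<integral>\<^sup>+x. ennreal (\<bar>f (x + h) - f x\<bar> powr p) * (indicator B x * indicator B (x + h))) * indicator (ball 0 d) h"
   by (rule nn_integral_multc) measurable
  also have "... \<le> ennreal (norm h powr p) * ?E * indicator (ball 0 d) h"
   by (intro mult_right_mono nn_integral_translate_diff_le f B p) auto
  also have "... \<le> ennreal (d powr p) * ?E * indicator (ball 0 d) h"
   using p by (auto simp: indicator_def intro!: mult_right_mono ennreal_leI powr_mono2)
  finally show "(\<integral>\<^sup>+x. ennreal (\<bar>f (x + h) - f x\<bar> powr p) * (indicator B x * indicator B (x + h)) * indicator (ball 0 d) h)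
   \<le> ennreal (d powr p) * ?E * indicator (ball (0::'a) d) h" .
 qed
 also have "... = ennreal (d powr p) * ?E * ennreal (d ^ DIM('a) * measure lborel (ball (0::'a) 1))"
  using d by (subst nn_integral_cmult_indicator) (auto simp: emeasure_lborel_ball)
 also have "... = ennreal (d powr p * (d ^ DIM('a) * measure lborel (ball (0::'a) 1))) * ?E"
  using d by (simp add: ennreal_mult mult_ac)
 finally show ?thesis .
qed

lemma abs_integral_ball_le:
 fixes w :: "'a::euclidean_space \<Rightarrow> real"
 assumes w: "C1c w" and p: "p \<ge> 1"
 shows "\<bar>LINT x:ball c d|lborel. w x\<bar> \<le> measure lborel (ball c d) powr (1 - 1/p) * (LINT x:ball c d|lborel. \<bar>w x\<bar> powr p) powr (1/p)"
proof -
 have [measurable]: "w \<in> Borel" using w by (rule borel_measurable_C1c)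
 have i1: "integrable lborel (\<lambda>x. indicator (ball c d) x *\<^sub>R \<bar>w x\<bar> powr p)"
  using p by (intro integrable_mult_indicator integrable_powr_C1c w) auto
 have i2: "integrable lborel (\<lambda>x. indicator (ball c d) x *\<^sub>R \<bar>w x\<bar>)"
  using integrable_mult_indicator[OF _ integrable_powr_C1c[OF w, of 1], of "ball c d"] by simp
 let ?A = "(LINT x:ball c d|lborel. \<bar>w x\<bar> powr p) powr (1/p) * measure lborel (ball c d) powr (1 - 1/p)"
 let ?B = "(\<integral>x\<in>ball c d. \<bar>w x\<bar>)"
 have "?B \<le> ennreal ?A"
 proof (rule nn_integral_Jensen)
  show "(\<integral>x\<in>ball c d. \<bar>w x\<bar> powr p) \<le> ennreal (LINT x:ball c d|lborel. \<bar>w x\<bar> powr p)" unfolding LINT_def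
   by (subst nn_integral_eq_integral[OF i1, symmetric]) (auto intro!: nn_integral_mono simp: indicator_def)
  show "emeasure lborel (ball c d) = ennreal (measure lborel (ball c d))"
   using emeasure_lborel_ball_finite[of c d] by (simp add: emeasure_eq_ennreal_measure)
  show "0 \<le> (LINT x:ball c d|lborel. \<bar>w x\<bar> powr p)" unfolding LINT_def by (intro integral_nonneg_AE) auto
 qed (use p in auto)
 also have "?B = ennreal (LINT x:ball c d|lborel. \<bar>w x\<bar>)" unfolding LINT_def
  by (subst nn_integral_eq_integral[OF i2, symmetric]) (auto intro!: nn_integral_cong simp: indicator_def)
 finally have "(LINT x:ball c d|lborel. \<bar>w x\<bar>) \<le> ?A" by (subst (asm) ennreal_le_iff) auto
 moreover have "\<bar>LINT x:ball c d|lborel. w x\<bar> \<le> (LINT x:ball c d|lborel. \<bar>w x\<bar>)" unfolding LINT_def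
  using integral_norm_bound[of lborel "\<lambda>x. indicator (ball c d) x *\<^sub>R w x"] by (simp add: abs_mult)
 ultimately show ?thesis by (simp add: mult.commute)
qed

text \<open>On a ball of radius \<open>d\<close> a function differs from its mean, in
  \<open>p\<close>-th power, by about \<open>d powr p\<close> times its energy, as in Poincare's
  inequality. A finite covering by such balls reduces the local norm to finitely many averages, up
  to an error that is small with \<open>d\<close> uniformly for bounded energy.\<close>

lemma local_Lp_le_averages:
 fixes w :: "'a::euclidean_space \<Rightarrow> real"
 assumes w: "C1c w" and p: "p \<ge> 1" and d: "d > 0"
  and X: "finite X" "ball 0 R \<subseteq> (\<Union>c\<in>X. ball c d)"
 shows "(LINT x:ball 0 R|lborel. \<bar>w x\<bar> powr p) \<le> 2 powr p * (2 ^ DIM('a) * (2 * d) powr p * energy p w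
  + measure lborel (ball (0::'a) R) * (\<Sum>c\<in>X. \<bar>(LINT x:ball c d|lborel. w x) / measure lborel (ball (0::'a) d)\<bar> powr p))"
proof -
 have [measurable]: "w \<in> Borel" using w by (rule borel_measurable_C1c)
 define V where "V = measure lborel (ball (0::'a) d)"
 have V: "V > 0" unfolding V_def using d by (rule content_ball_pos)
 have Vc: "measure lborel (ball c d) = V" for c :: 'a
  unfolding V_def using content_ball_conv_unit_ball[of d c] content_ball_conv_unit_ball[of d "0::'a"] d by simp
 define A where "A c = (LINT x:ball c d|lborel. w x) / V" for c
 define S where "S = (\<Sum>c\<in>X. \<bar>A c\<bar> powr p)"
 have S: "S \<ge> 0" unfolding S_def by (intro sum_nonneg) auto
 let ?R = "measure lborel (ball (0::'a) R)" and ?U = "(2 * d) powr p * ((2 * d) ^ DIM('a) * measure lborel (ball (0::'a) 1))" and ?L = "LINT x:ball 0 R|lborel. \<bar>w x\<bar> powr p" and ?I = "\<integral>x\<in>ball 0 R. \<bar>w x\<bar> powr p"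
 let ?W = "2 powr p * (2 ^ DIM('a) * (2 * d) powr p * energy p w + S * ?R)"
 \<comment> \<open>Two points of one covering ball differ by a vector shorter than
   \<open>2 * d\<close>. Admitting all such vectors gives a bound in which the centre
   \<open>c\<close> no longer occurs, so overlaps of the covering are not counted.\<close>
 let ?H = "\<lambda>x. (\<integral>\<^sup>+h. ennreal (\<bar>w (x + h) - w x\<bar> powr p) * (indicator UNIV x * indicator UNIV (x + h)) * indicator (ball 0 (2 * d)) h)"
 have pt: "ennreal (\<bar>w x\<bar> powr p) * indicator (ball 0 R) x
  \<le> ennreal (2 powr p) * (ennreal (1 / V) * ?H x + ennreal S * indicator (ball 0 R) x)" for x
 proof (cases "x \<in> ball 0 R")
  case True
  then obtain c where c: "c \<in> X" "x \<in> ball c d" using X by blast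
  define g where "g y = w y - w x" for y
  have [measurable]: "g \<in> Borel" unfolding g_def by measurable
  have iw: "integrable lborel (\<lambda>y. indicator (ball c d) y *\<^sub>R w y)"
   by (intro integrable_mult_indicator integrable_continuous_bounded_support C1c_continuous C1c_bounded_support w) auto
  have ic: "integrable lborel (\<lambda>y. indicator (ball c d) y *\<^sub>R w x)"
   using emeasure_lborel_ball_finite[of c d] by (intro integrable_scaleR_left) (auto simp: integrable_indicator_iff)
  have ig: "integrable lborel (\<lambda>y. indicator (ball c d) y *\<^sub>R g y)"
   unfolding g_def scaleR_diff_right by (intro Bochner_Integration.integrable_diff iw ic)
  have "(LINT y:ball c d|lborel. g y) = (LINT y:ball c d|lborel. w y) - V * w x"
   unfolding LINT_def g_def scaleR_diff_right
   using Bochner_Integration.integral_diff[OF iw ic] Vc[of c] emeasure_lborel_ball_finite[of c d] by simp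
  then have Ag: "A c - w x = (LINT y:ball c d|lborel. g y) / V" using V by (simp add: A_def field_simps)
  let ?v = "V * \<bar>A c - w x\<bar>" and ?g = "\<integral>y\<in>ball c d. \<bar>g y\<bar> powr p"
  let ?A = "\<bar>A c - w x\<bar> powr p"
  let ?C = "(\<integral>y\<in>ball c d. \<bar>g y\<bar>)"
  have "ennreal ?A \<le> ennreal (1 / V) * ?H x"
  proof -
   let ?D = "ennreal (V powr (p - 1)) * ?H x"
   have "ennreal ?v \<le> ?C"
   proof -
    have "?v = norm (LINT y|lborel. indicator (ball c d) y *\<^sub>R g y)"
     unfolding Ag LINT_def using V by (simp add: abs_divide)
    also have "ennreal ... \<le> (\<integral>\<^sup>+y. norm (indicator (ball c d) y *\<^sub>R g y))"
     by (rule integral_norm_bound_ennreal[OF ig])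
    also have "... = ?C" by (intro nn_integral_cong) (auto simp: indicator_def)
    finally show ?thesis .
   qed
   moreover have "?g \<le> ?H x"
   proof -
    have "?g = (\<integral>\<^sup>+h. ennreal (\<bar>g (x + h)\<bar> powr p) * indicator (ball c d) (x + h))"
     by (rule nn_integral_translate[symmetric]) measurable
    also have "... \<le> ?H x"
    proof (intro nn_integral_mono)
     fix h
     have "h \<in> ball 0 (2 * d)" if "x + h \<in> ball c d"
     proof -
      have "norm h = dist x (x + h)" by (simp add: dist_norm)
      also have "... \<le> dist x c + dist c (x + h)" by (rule dist_triangle)
      also have "... < 2 * d" using that c(2) by (simp add: dist_commute)
      finally show ?thesis by simp
     qed
     then show "ennreal (\<bar>g (x + h)\<bar> powr p) * indicator (ball c d) (x + h)
      \<le> ennreal (\<bar>w (x + h) - w x\<bar> powr p) * (indicator UNIV x * indicator UNIV (x + h)) * indicator (ball 0 (2 * d)) h"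
      by (auto simp: indicator_def g_def)
    qed
    finally show ?thesis .
   qed
   moreover have "ennreal (?v powr p) \<le> ennreal (V powr (p - 1)) * ?g"
   proof (cases "?g")
    case (real b)
    let ?q = "b powr (1/p) * V powr (1 - 1/p)"
    have "?C \<le> ennreal ?q"
     using real p V Vc[of c] emeasure_lborel_ball_finite[of c d]
     by (intro nn_integral_Jensen) (auto simp: emeasure_eq_ennreal_measure)
    with calculation(1) have "ennreal ?v \<le> ennreal ?q" by (rule order.trans)
    then have "?v \<le> ?q" by (subst (asm) ennreal_le_iff) auto
    then have "?v powr p \<le> ?q powr p"
     using p V by (intro powr_mono2) auto
    also have "... = V powr (p - 1) * b"
    proof -
     have "1/p * p = 1" "(1 - 1/p) * p = p - 1" using p by (auto simp: field_simps)
     then have "?q powr p = b powr 1 * V powr (p - 1)"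
      by (simp only: powr_mult powr_powr powr_ge_zero)
     then show ?thesis using real by simp
    qed
    finally show ?thesis using real by (simp add: ennreal_leI flip: ennreal_mult)
   next
    case top
    then show ?thesis using V by (simp add: ennreal_mult_top)
   qed
   ultimately have "ennreal (?v powr p) \<le> ?D"
    by (meson mult_left_mono order.trans zero_le)
   then have "ennreal (V powr (- p)) * ennreal (?v powr p) \<le> ennreal (V powr (- p)) * ?D"
    by (rule mult_left_mono) simp
   also have "ennreal (V powr (- p)) * ennreal (?v powr p) = ennreal ?A"
    using V by (simp add: powr_mult powr_minus flip: ennreal_mult)
   also have "ennreal (V powr (- p)) * ?D = ennreal (V powr (- p) * V powr (p - 1)) * ?H x"
    by (simp add: ennreal_mult mult.assoc)
   also have "V powr (- p) * V powr (p - 1) = 1 / V"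
   proof -
    have "- p + (p - 1) = - 1" by simp
    then show ?thesis unfolding powr_add[symmetric] using V by (simp only: powr_minus_divide) simp
   qed
   finally show ?thesis .
  qed
  moreover have "\<bar>A c\<bar> powr p \<le> S" unfolding S_def using X(1) c(1) by (intro member_le_sum) auto
  moreover have "\<bar>w x\<bar> powr p \<le> 2 powr p * (?A + \<bar>A c\<bar> powr p)"
  proof -
   have "\<bar>w x\<bar> powr p \<le> (\<bar>A c - w x\<bar> + \<bar>A c\<bar>) powr p" using p by (intro powr_mono2) auto
   also have "... \<le> 2 powr p * (?A + \<bar>A c\<bar> powr p)" using p by (intro powr_add_le) auto
   finally show ?thesis .
  qed
  ultimately have "ennreal (\<bar>w x\<bar> powr p) \<le> ennreal (2 powr p * (?A + S))"
   by (intro ennreal_leI) (smt (verit) mult_left_mono powr_ge_zero)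
  also have "... = ennreal (2 powr p) * (ennreal ?A + ennreal S)"
   using S by (simp add: ennreal_mult)
  also have "... \<le> ennreal (2 powr p) * (ennreal (1 / V) * ?H x + ennreal S)"
   using \<open>ennreal (\<bar>A c - w x\<bar> powr p) \<le> ennreal (1 / V) * ?H x\<close> by (intro mult_left_mono add_right_mono) auto
  finally show ?thesis using True by simp
 qed simp
 let ?B = "(2 * d) powr p * ((2 * d) ^ DIM('a) * measure lborel (ball (0::'a) 1)) * energy p w"
 let ?E = "(\<integral>\<^sup>+x. ennreal S * indicator (ball (0::'a) R) x)"
 have "?I
  \<le> (\<integral>\<^sup>+x. ennreal (2 powr p) * (ennreal (1 / V) * ?H x + ennreal S * indicator (ball 0 R) x))"
  by (rule nn_integral_mono) (rule pt)
 also have "... = ennreal (2 powr p) * (\<integral>\<^sup>+x. ennreal (1 / V) * ?H x + ennreal S * indicator (ball 0 R) x)"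
  by (rule nn_integral_cmult) measurable
 also have "(\<integral>\<^sup>+x. ennreal (1 / V) * ?H x + ennreal S * indicator (ball 0 R) x)
  = (\<integral>\<^sup>+x. ennreal (1 / V) * ?H x) + ?E"
  by (rule nn_integral_add) measurable
 also have "(\<integral>\<^sup>+x. ennreal (1 / V) * ?H x) = ennreal (1 / V) * (\<integral>\<^sup>+x. ?H x)" by (rule nn_integral_cmult) measurable
 also have "?E = ennreal S * ennreal (?R)"
  using emeasure_lborel_ball_finite[of "0::'a" R] by (subst nn_integral_cmult_indicator) (auto simp: emeasure_eq_ennreal_measure)
 also have "ennreal (2 powr p) * (ennreal (1 / V) * (\<integral>\<^sup>+x. ?H x) + ennreal S * ennreal (?R))
  \<le> ennreal (2 powr p) * (ennreal (1 / V) * (ennreal ?U * ennreal (energy p w))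
   + ennreal S * ennreal (?R))"
 proof (intro mult_left_mono add_right_mono)
  have "C_class (Suc 0) w" using w by (simp add: C1c_def)
  moreover have "(\<integral>x\<in>UNIV. grad_powr p w x) = ennreal (energy p w)" using nn_integral_energy[OF w, of p] p by simp
  ultimately show "(\<integral>\<^sup>+x. ?H x) \<le> ennreal ?U * ennreal (energy p w)"
   using nn_integral_double_diff_le[of w UNIV p "2 * d"] p d by simp
 qed auto
 also have "... = ennreal (2 powr p * (1 / V * ?B + S * ?R))"
  using V S d by (simp add: energy_nonneg flip: ennreal_mult ennreal_plus)
 finally have "?I \<le> ..." .
 moreover have "V = d ^ DIM('a) * measure lborel (ball (0::'a) 1)"
  unfolding V_def using content_ball_conv_unit_ball[of d "0::'a"] d by simp
 then have "1 / V * ?B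
  = 2 ^ DIM('a) * (2 * d) powr p * energy p w" using V by (simp add: power_mult_distrib field_simps)
 ultimately have "?I
  \<le> ennreal (?W)" by simp
 moreover have "?I = ennreal ?L"
  unfolding LINT_def using p
  by (subst nn_integral_eq_integral[symmetric, OF integrable_mult_indicator[OF _ integrable_powr_C1c[OF w]]])
   (auto intro!: nn_integral_cong simp: indicator_def)
 ultimately have "ennreal ?L
  \<le> ennreal (?W)" by (simp only:)
 moreover have "0 \<le> ?W"
  using S by (simp add: energy_nonneg)
 ultimately have "?L
  \<le> ?W"
  by (simp only: ennreal_le_iff)
 then show ?thesis unfolding S_def A_def V_def by (simp only: mult.commute)
qed

lemma set_integral_le_sum:
 fixes f g h :: "'a \<Rightarrow> real"
 assumes "set_integrable M S f" "set_integrable M S g" "set_integrable M S h" "\<And>x. h x \<le> k * (f x + g x)"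
 shows "(LINT x:S|M. h x) \<le> k * ((LINT x:S|M. f x) + (LINT x:S|M. g x))"
proof -
 have "(LINT x:S|M. h x) \<le> (LINT x:S|M. k * (f x + g x))"
  using assms by (intro set_integral_mono set_integrable_mult_right set_integral_add(1)) auto
 then show ?thesis using assms by simp
qed

lemma energy_diff_le:
 assumes u: "C1c u" and v: "C1c v" and p: "p \<ge> 1"
 shows "energy p (\<lambda>x. u x - v x) \<le> 2 powr p * (energy p u + energy p v)"
proof -
 have i: "set_integrable lborel UNIV (grad_powr p w)" if "C1c w" for w :: "'a \<Rightarrow> real"
  using integrable_powr_gradient[OF that, of p] p by (simp add: set_integrable_def)
 have "grad_powr p (\<lambda>x. u x - v x) x \<le> 2 powr p * (grad_powr p u x + grad_powr p v x)" for x
  unfolding gradient_diff[OF C1c_differentiable[OF u] C1c_differentiable[OF v]]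
  using p by (intro order.trans[OF powr_mono2[OF _ _ norm_triangle_ineq4] powr_add_le]) auto
 from set_integral_le_sum[OF i[OF u] i[OF v] i[OF C1c_diff[OF u v]] this]
 show ?thesis by (simp add: energy_def LINT_def)
qed

text \<open>By \<open>local_Lp_le_averages\<close> it is enough that countably many averages
  converge, namely those over the balls of finite coverings at the scales \<open>d m\<close>; a
  diagonal subsequence achieves this. The conclusion is a Cauchy property, so no limit function is
  needed at this stage.\<close>

lemma Rellich:
 fixes u :: "nat \<Rightarrow> 'a::euclidean_space \<Rightarrow> real"
 assumes u: "\<And>k. C1c (u k)" and p: "p \<ge> 1" and E: "\<And>k. energy p (u k) \<le> B"
  and L: "\<And>R. \<exists>B. \<forall>k. (LINT x:ball 0 R|lborel. \<bar>u k x\<bar> powr p) \<le> B"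
 obtains r :: "nat \<Rightarrow> nat" where "strict_mono r"
  "\<And>R e. e > 0 \<Longrightarrow> \<exists>N. \<forall>k\<ge>N. \<forall>l\<ge>N. (LINT x:ball 0 R|lborel. \<bar>u (r k) x - u (r l) x\<bar> powr p) < e"
proof -
 define d where "d m = 1 / real (Suc m)" for m
 have d: "d m > 0" for m by (simp add: d_def)
 have "\<exists>X. finite X \<and> ball (0::'a) (real m) \<subseteq> (\<Union>c\<in>X. ball c (d m))" for m
 proof -
  obtain X where "finite X" "cball (0::'a) (real m) \<subseteq> (\<Union>c\<in>X. ball c (d m))"
   using compactE_image[OF compact_cball, of UNIV "\<lambda>c. ball c (d m)" 0 "real m"] d[of m]
   by (metis UNIV_I UN_I centre_in_ball open_ball subsetI)
  then show ?thesis using ball_subset_cball by blast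
 qed
 then obtain X where X: "\<And>m. finite (X m)" "\<And>m. ball (0::'a) (real m) \<subseteq> (\<Union>c\<in>X m. ball c (d m))" by metis
 define A where "A m c w = (LINT x:ball c (d m)|lborel. w x) / measure lborel (ball (0::'a) (d m))" for m c and w :: "'a \<Rightarrow> real"
 define I where "I = (SIGMA m:UNIV. X m)"
 have I: "countable I" unfolding I_def using X(1) by (intro countable_SIGMA) (auto intro: countable_finite)
 define f where "f i k = A (fst (from_nat_into I i)) (snd (from_nat_into I i)) (u k)" for i k
 have bnd: "\<exists>B'. \<forall>k. \<bar>A m c (u k)\<bar> \<le> B'" for m c
 proof -
  define V where "V = measure lborel (ball (0::'a) (d m))"
  have V: "V > 0" unfolding V_def using d by (rule content_ball_pos)
  define W where "W = measure lborel (ball c (d m))"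
  obtain B' where B': "\<And>k. (LINT x:ball 0 (norm c + d m)|lborel. \<bar>u k x\<bar> powr p) \<le> B'" using L by blast
  have "\<bar>A m c (u k)\<bar> \<le> W powr (1 - 1/p) * B' powr (1/p) / V" for k
  proof -
   have i: "integrable lborel (\<lambda>x. indicator (ball y s) x *\<^sub>R \<bar>u k x\<bar> powr p)" for y s
    using p by (intro integrable_mult_indicator integrable_powr_C1c u) auto
   have "(LINT x:ball c (d m)|lborel. \<bar>u k x\<bar> powr p) \<le> (LINT x:ball 0 (norm c + d m)|lborel. \<bar>u k x\<bar> powr p)"
    unfolding LINT_def
   proof (rule integral_mono[OF i i])
    fix x
    have "x \<in> ball 0 (norm c + d m)" if "x \<in> ball c (d m)"
     using that norm_triangle_ineq[of c "x - c"] by (simp add: dist_norm norm_minus_commute)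
    then show "indicator (ball c (d m)) x *\<^sub>R \<bar>u k x\<bar> powr p \<le> indicator (ball 0 (norm c + d m)) x *\<^sub>R \<bar>u k x\<bar> powr p"
     by (auto simp: indicator_def)
   qed
   also have "... \<le> B'" by (rule B')
   finally have le: "(LINT x:ball c (d m)|lborel. \<bar>u k x\<bar> powr p) \<le> B'" .
   have "\<bar>LINT x:ball c (d m)|lborel. u k x\<bar> \<le> W powr (1 - 1/p) * (LINT x:ball c (d m)|lborel. \<bar>u k x\<bar> powr p) powr (1/p)"
    unfolding W_def by (rule abs_integral_ball_le[OF u p])
   also have "... \<le> W powr (1 - 1/p) * B' powr (1/p)" using le p by (intro mult_left_mono powr_mono2)
     (auto simp: LINT_def intro!: integral_nonneg_AE)
   finally show ?thesis using V by (simp add: A_def V_def[symmetric] divide_right_mono)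
  qed
  then show ?thesis by blast
 qed
 have "\<exists>B'. \<forall>k. \<bar>f i k\<bar> \<le> B'" for i unfolding f_def by (rule bnd)
 then obtain r :: "nat \<Rightarrow> nat" where r: "strict_mono r" "\<And>i. convergent (\<lambda>k. f i (r k))"
  using diagonal_convergent[of f] by blast
 have conv: "convergent (\<lambda>k. A m c (u (r k)))" if "c \<in> X m" for m c
 proof -
  have "(m, c) \<in> I" using that by (simp add: I_def)
  then obtain i where "from_nat_into I i = (m, c)" using from_nat_into_surj[OF I] by blast
  then show ?thesis using r(2)[of i] by (simp add: f_def)
 qed
 define B1 where "B1 = 2 powr p * (B + B)"
 have Ediff: "energy p (\<lambda>x. u k x - u l x) \<le> B1" for k l
  unfolding B1_def by (rule order.trans[OF energy_diff_le[OF u u p]]) (intro mult_left_mono add_mono E, simp)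
 have Adiff: "A m c (\<lambda>x. u k x - u l x) = A m c (u k) - A m c (u l)" for m c k l
 proof -
  have i: "integrable lborel (\<lambda>x. indicator (ball c (d m)) x *\<^sub>R u k x)" for k
   by (intro integrable_mult_indicator integrable_continuous_bounded_support C1c_continuous C1c_bounded_support u) auto
  show ?thesis unfolding A_def LINT_def scaleR_diff_right
   by (simp only: Bochner_Integration.integral_diff[OF i i] diff_divide_distrib)
 qed
 have main: "\<exists>N. \<forall>k\<ge>N. \<forall>l\<ge>N. (LINT x:ball 0 R|lborel. \<bar>u (r k) x - u (r l) x\<bar> powr p) < e" if e: "e > 0" for R e
 proof -
  have "(\<lambda>m. 2 powr p * (2 ^ DIM('a) * (2 * d m) powr p * B1)) \<longlonglongrightarrow> 2 powr p * (2 ^ DIM('a) * (2 * 0) powr p * B1)"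
   unfolding d_def using LIMSEQ_inverse_real_of_nat p
   by (intro tendsto_intros tendsto_powr') (auto simp: inverse_eq_divide)
  then have "\<forall>\<^sub>F m in sequentially. 2 powr p * (2 ^ DIM('a) * (2 * d m) powr p * B1) < e / 2"
   by (rule order_tendstoD(2)) (use e p in auto)
  moreover have "\<forall>\<^sub>F m in sequentially. R \<le> real m" by (rule eventually_sequentiallyI[of "nat \<lceil>R\<rceil>"]) linarith
  ultimately have "\<forall>\<^sub>F m in sequentially. 2 powr p * (2 ^ DIM('a) * (2 * d m) powr p * B1) < e / 2 \<and> R \<le> real m"
   by (rule eventually_conj)
  then obtain m where m: "2 powr p * (2 ^ DIM('a) * (2 * d m) powr p * B1) < e / 2" "R \<le> real m"
   using eventually_happens sequentially_bot by blast
  define M where "M = 2 powr p * measure lborel (ball (0::'a) (real m)) + 1"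
  have M: "M > 0" unfolding M_def by (simp add: add_nonneg_pos)
  \<comment> \<open>\<open>e'\<close> distributes \<open>e / 2\<close> over the averages attached to
    the covering; the summands 1 here and in \<open>M\<close> keep the denominator positive.\<close>
  define e' where "e' = e / (2 * M * (real (card (X m)) + 1))"
  have e': "e' > 0" using e M by (simp add: e'_def)
  have "\<exists>N. \<forall>c\<in>X m. \<forall>k\<ge>N. \<forall>l\<ge>N. \<bar>A m c (u (r k)) - A m c (u (r l))\<bar> < e' powr (1/p)"
  proof -
   have "\<exists>N. \<forall>k\<ge>N. \<forall>l\<ge>N. \<bar>A m c (u (r k)) - A m c (u (r l))\<bar> < e' powr (1/p)" if "c \<in> X m" for c
    using CauchyD[OF convergent_Cauchy[OF conv[OF that]], of "e' powr (1/p)"] e' by auto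
   then obtain N where N: "\<And>c k l. c \<in> X m \<Longrightarrow> k \<ge> N c \<Longrightarrow> l \<ge> N c \<Longrightarrow> \<bar>A m c (u (r k)) - A m c (u (r l))\<bar> < e' powr (1/p)"
    by metis
   show ?thesis
   proof (intro exI[of _ "\<Sum>c\<in>X m. N c"] ballI allI impI)
    fix c k l assume c: "c \<in> X m" and k: "(\<Sum>c\<in>X m. N c) \<le> k" "(\<Sum>c\<in>X m. N c) \<le> l"
    have "N c \<le> (\<Sum>c\<in>X m. N c)" using c X(1) by (intro member_le_sum) auto
    then show "\<bar>A m c (u (r k)) - A m c (u (r l))\<bar> < e' powr (1/p)" using N c k by simp
   qed
  qed
  then obtain N where N: "\<And>c k l. c \<in> X m \<Longrightarrow> k \<ge> N \<Longrightarrow> l \<ge> N \<Longrightarrow> \<bar>A m c (u (r k)) - A m c (u (r l))\<bar> < e' powr (1/p)"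
   by blast
  show ?thesis
  proof (intro exI[of _ N] allI impI)
   fix k l assume kl: "N \<le> k" "N \<le> l"
   let ?w = "\<lambda>x. u (r k) x - u (r l) x"
   have w: "C1c ?w" by (intro C1c_diff u)
   have i: "integrable lborel (\<lambda>x. indicator (ball y s) x *\<^sub>R \<bar>?w x\<bar> powr p)" for y s
    using p by (intro integrable_mult_indicator integrable_powr_C1c w) auto
   have "(LINT x:ball 0 R|lborel. \<bar>?w x\<bar> powr p) \<le> (LINT x:ball 0 (real m)|lborel. \<bar>?w x\<bar> powr p)"
    unfolding LINT_def using m(2) by (intro integral_mono[OF i i]) (auto simp: indicator_def)
   also have "... \<le> 2 powr p * (2 ^ DIM('a) * (2 * d m) powr p * energy p ?w
    + measure lborel (ball (0::'a) (real m)) * (\<Sum>c\<in>X m. \<bar>A m c ?w\<bar> powr p))"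
    unfolding A_def by (rule local_Lp_le_averages[OF w p d X])
   also have "... \<le> 2 powr p * (2 ^ DIM('a) * (2 * d m) powr p * B1
    + measure lborel (ball (0::'a) (real m)) * (\<Sum>c\<in>X m. e'))"
   proof (intro mult_left_mono add_mono sum_mono Ediff)
    fix c assume "c \<in> X m"
    then have "\<bar>A m c ?w\<bar> powr p \<le> (e' powr (1/p)) powr p"
     unfolding Adiff using N[of c k l] kl p by (intro powr_mono2) auto
    then show "\<bar>A m c ?w\<bar> powr p \<le> e'" using p e' by (simp add: powr_powr)
   qed auto
   also have "... < e / 2 + e / 2"
   proof -
    have "2 powr p * (measure lborel (ball (0::'a) (real m)) * (\<Sum>c\<in>X m. e')) = (M - 1) * (real (card (X m)) * e')"
     by (simp add: M_def mult.assoc)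
    also have "... \<le> M * ((real (card (X m)) + 1) * e')" using M e' by (intro mult_mono) auto
    also have "... = e / 2"
    proof -
     have "M * (n1 * (e / (2 * M * n1))) = e / 2" if "n1 > 0" for n1 using that M by (simp add: field_simps)
     from this[of "real (card (X m)) + 1"] show ?thesis unfolding e'_def by linarith
    qed
    finally show ?thesis using m(1) by (simp add: distrib_left)
   qed
   finally show "(LINT x:ball 0 R|lborel. \<bar>?w x\<bar> powr p) < e" by simp
  qed
 qed
 show ?thesis by (rule that[OF r(1) main])
qed

section \<open>Convergence of maximising sequences\<close>

text \<open>The difference between the power and its tangent at 1 has derivative
  \<open>p * (t powr (p - 1) - 1)\<close>, negative before 1 and positive after it.\<close>

lemma powr_strict_tangent:
 fixes x p :: real
 assumes "p > 1" "x \<ge> 0" "x \<noteq> 1"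
 shows "x powr p > 1 + p * (x - 1)"
proof -
 let ?f = "\<lambda>x. x powr p - (1 + p * (x - 1))"
 have D: "(?f has_real_derivative p * (t powr (p - 1) - 1)) (at t)" if "t > 0" for t
  using that by (auto intro!: derivative_eq_intros simp: algebra_simps)
 have c: "continuous_on {a..b} ?f" if "a \<ge> 0" for a b
  by (intro continuous_on_diff continuous_on_powr' continuous_intros) (use assms that in auto)
 have "?f x > ?f 1"
 proof (cases "x > 1")
  case True
  have "\<exists>y. DERIV ?f t :> y \<and> 0 < y" if "1 < t" for t
   using D[of t] that assms by (intro exI[of _ "p * (t powr (p - 1) - 1)"]) auto
  then show ?thesis by (rule DERIV_pos_imp_increasing_open[where f="?f", OF True _ c]) simp_all
 next
  case False
  have neg: "\<exists>y. DERIV ?f t :> y \<and> y < 0" if "0 < t" "t < 1" for t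
  proof -
   have "t powr (p - 1) < 1 powr (p - 1)" using that assms by (intro powr_less_mono2) auto
   then show ?thesis using D[of t] that assms by (intro exI[of _ "p * (t powr (p - 1) - 1)"]) (auto simp: mult_pos_neg)
  qed
  have "x < 1" using False assms by simp
  then show ?thesis
   by (rule DERIV_neg_imp_decreasing_open[where f="?f", OF _ neg c[OF assms(2)]]) (use assms(2) in simp_all)
 qed
 then show ?thesis by simp
qed

lemma powr_midpoint_less:
 fixes a b p :: real
 assumes "p > 1" "a \<ge> 0" "b \<ge> 0" "a \<noteq> b"
 shows "((a + b) / 2) powr p < (a powr p + b powr p) / 2"
proof -
 define c where "c = (a + b) / 2"
 have c: "c > 0" using assms by (simp add: c_def)
 have t: "t powr p > c powr p * (1 + p * (t / c - 1))" if "t \<ge> 0" "t \<noteq> c" for t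
 proof -
  have "(t / c) powr p > 1 + p * (t / c - 1)" using that c assms by (intro powr_strict_tangent) auto
  then have "c powr p * (t / c) powr p > c powr p * (1 + p * (t / c - 1))" using c by simp
  then show ?thesis using c that by (simp add: powr_divide)
 qed
 have "c powr p * (1 + p * (a / c - 1)) + c powr p * (1 + p * (b / c - 1)) = c powr p * (2 + p * ((a + b) / c - 2))"
  by (simp add: algebra_simps add_divide_distrib)
 also have "(a + b) / c = 2" using c by (simp add: c_def field_simps)
 finally show ?thesis using t[of a] t[of b] assms by (simp add: c_def)
qed

lemma norm_midpoint_powr:
 fixes a b :: "'a::real_inner"
 assumes "p > 1"
 shows "norm ((1/2) *\<^sub>R (a + b)) powr p \<le> (norm a powr p + norm b powr p) / 2"
  "a \<noteq> b \<Longrightarrow> norm ((1/2) *\<^sub>R (a + b)) powr p < (norm a powr p + norm b powr p) / 2"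
proof -
 let ?A = "(1/2) *\<^sub>R (a + b)"
 let ?B = "(norm a + norm b) / 2"
 have le: "norm ?A \<le> ?B" using norm_triangle_ineq[of a b] by simp
 then have 1: "norm ?A powr p \<le> ?B powr p" using assms by (intro powr_mono2) auto
 let ?C = "(norm a powr p + norm b powr p) / 2"
 have 2: "?B powr p \<le> ?C" using powr_midpoint_less[of p "norm a" "norm b"] assms by (cases "norm a = norm b") auto
 show "norm ?A powr p \<le> ?C" using 1 2 by simp
 assume ne: "a \<noteq> b"
 show "norm ?A powr p < ?C"
 proof (cases "norm a = norm b")
  case False
  then show ?thesis using 1 powr_midpoint_less[of p "norm a" "norm b"] assms by simp
 next
  case True
  \<comment> \<open>Equality in the triangle inequality would make the vectors point in the same
    direction, and equal norms would then make them equal.\<close>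
  have "norm (a + b) \<noteq> norm a + norm b"
  proof
   assume "norm (a + b) = norm a + norm b"
   then have "norm a *\<^sub>R b = norm b *\<^sub>R a" by (simp add: norm_triangle_eq)
   then have "norm b = 0 \<or> b = a" using True by auto
   then show False using ne True by auto
  qed
  then have "norm ?A < ?B" using norm_triangle_ineq[of a b] by simp
  then have "norm ?A powr p < ?B powr p" using assms by (intro powr_less_mono2) auto
  then show ?thesis using 2 by simp
 qed
qed

text \<open>Uniform convexity in a quantitative form that can be integrated pointwise: by homogeneity it
 suffices to bound the midpoint defect from below on a compact set of pairs.\<close>

lemma uniform_convexity:
 fixes p \<epsilon> :: real
 assumes p: "p > 1" and \<epsilon>: "\<epsilon> > 0"
 obtains C where "C \<ge> 0"
  "\<And>a b :: 'a::euclidean_space. norm (a - b) powr p \<le> \<epsilon> * (norm a powr p + norm b powr p)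
   + C * ((norm a powr p + norm b powr p) / 2 - norm ((1/2) *\<^sub>R (a + b)) powr p)"
proof -
 define F where "F z = norm (fst z) powr p + norm (snd z) powr p" for z :: "'a \<times> 'a"
 define D where "D z = F z / 2 - norm ((1/2) *\<^sub>R (fst z + snd z)) powr p" for z :: "'a \<times> 'a"
 \<comment> \<open>Pairs violating the second condition are served by the term with
   \<open>\<epsilon>\<close> alone. On the remaining ones \<open>a \<noteq> b\<close>, so the defect
   \<open>D\<close> is positive, and by compactness it stays above some
   \<open>\<mu>\<close>.\<close>
 define S where "S = {z :: 'a \<times> 'a. F z = 1 \<and> \<epsilon> \<le> norm (fst z - snd z) powr p}"
 have cpow: "continuous_on UNIV (\<lambda>z :: 'a \<times> 'a. norm (f z) powr p)" if "continuous_on UNIV f" for f :: "'a \<times> 'a \<Rightarrow> 'a"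
  by (rule continuous_on_powr') (use p that in \<open>auto intro: continuous_on_norm\<close>)
 have cF: "continuous_on UNIV F" unfolding F_def by (intro continuous_on_add cpow continuous_intros)
 have cD: "continuous_on UNIV D" unfolding D_def
  by (intro continuous_on_diff cpow continuous_on_divide cF continuous_intros) auto
 have "closed S" unfolding S_def
  by (intro closed_Collect_conj closed_Collect_eq closed_Collect_le cF cpow continuous_intros)
 moreover have "bounded S"
 proof -
  have "norm z \<le> 2" if "z \<in> S" for z
  proof -
   have le1: "t \<le> 1" if "t powr p \<le> 1" for t :: real
   proof (rule ccontr)
    assume "\<not> t \<le> 1"
    then have "1 powr p < t powr p" using p by (intro powr_less_mono2) auto
    with that show False by simp
   qed
   have "norm (fst z) powr p + norm (snd z) powr p = 1" using that by (simp add: S_def F_def)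
   then have "norm (fst z) \<le> 1" "norm (snd z) \<le> 1"
    using powr_ge_zero[of "norm (fst z)" p] powr_ge_zero[of "norm (snd z)" p] by - (rule le1, linarith)+
   moreover have "norm z \<le> norm (fst z) + norm (snd z)"
    using norm_Pair_le[of "fst z" "snd z"] by (simp only: prod.collapse)
   ultimately show ?thesis by linarith
  qed
  then show ?thesis unfolding bounded_iff by blast
 qed
 ultimately have "compact S" by (simp add: compact_eq_bounded_closed)
 have D_nn: "D z \<ge> 0" for z using norm_midpoint_powr(1)[OF p, of "fst z" "snd z"] by (simp add: D_def F_def)
 have D_pos: "D z > 0" if "z \<in> S" for z
 proof -
  have "fst z \<noteq> snd z" using that \<epsilon> p by (auto simp: S_def)
  then show ?thesis using norm_midpoint_powr(2)[OF p, of "fst z" "snd z"] by (simp add: D_def F_def)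
 qed
 obtain \<mu> where \<mu>: "\<mu> > 0" "\<And>z. z \<in> S \<Longrightarrow> \<mu> \<le> D z"
 proof (cases "S = {}")
  case True
  then show ?thesis using that[of 1] by simp
 next
  case False
  obtain z0 where "z0 \<in> S" "\<And>z. z \<in> S \<Longrightarrow> D z0 \<le> D z"
   using continuous_attains_inf[OF \<open>compact S\<close> False continuous_on_subset[OF cD]] by auto
  then show ?thesis using that[of "D z0"] D_pos by blast
 qed
 \<comment> \<open>On \<open>S\<close> the left side is at most \<open>2 powr p\<close>, and
   \<open>C * \<mu>\<close> is exactly that.\<close>
 define C where "C = 2 powr p / \<mu>"
 have C: "C \<ge> 0" using \<mu> by (simp add: C_def)
 have diff_le: "norm (a - b) powr p \<le> 2 powr p * (norm a powr p + norm b powr p)" for a b :: 'a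
 proof -
  have "norm (a - b) powr p \<le> (norm a + norm b) powr p" using p by (intro powr_mono2 norm_triangle_ineq4) auto
  also have "... \<le> 2 powr p * (norm a powr p + norm b powr p)" using p by (intro powr_add_le) auto
  finally show ?thesis .
 qed
 have unit: "norm (a - b) powr p \<le> \<epsilon> + C * D (a, b)" if "F (a, b) = 1" for a b
 proof (cases "(a, b) \<in> S")
  case True
  have "norm (a - b) powr p \<le> 2 powr p" using diff_le[of a b] that by (simp add: F_def)
  also have "... = C * \<mu>" using \<mu> by (simp add: C_def)
  also have "... \<le> C * D (a, b)" using \<mu>(2)[OF True] C by (intro mult_left_mono)
  finally show ?thesis using \<epsilon> by simp
 next
  case False
  then have "norm (a - b) powr p \<le> \<epsilon>" using that by (simp add: S_def)
  then show ?thesis using C D_nn[of "(a, b)"] by (simp add: add_increasing2)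
 qed
 have main: "norm (a - b) powr p \<le> \<epsilon> * F (a, b) + C * D (a, b)" for a b
 proof (cases "F (a, b) = 0")
  case True
  then have "norm a powr p = 0" "norm b powr p = 0" unfolding F_def by (smt (verit) fst_conv snd_conv powr_ge_zero)+
  then have "a = 0" "b = 0" by auto
  then show ?thesis using C D_nn[of "(a, b)"] True p by simp
 next
  case False
  define s where "s = F (a, b)"
  have s: "s > 0" using False unfolding s_def F_def by (smt (verit) powr_ge_zero)
  \<comment> \<open>Scaling by \<open>t\<close> brings \<open>F\<close> to 1; both sides of the
    claim are homogeneous of degree \<open>p\<close>.\<close>
  define t where "t = s powr (- 1 / p)"
  have "t powr p = s powr (- 1)" unfolding t_def powr_powr using p by simp
  then have t: "t > 0" "t powr p = 1 / s" using s by (simp_all add: t_def powr_minus_divide)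
  have sc: "norm (t *\<^sub>R x) powr p = norm x powr p / s" for x :: 'a using t by (simp add: powr_mult)
  have F1: "F (t *\<^sub>R a, t *\<^sub>R b) = 1" using s sc by (simp add: F_def s_def flip: add_divide_distrib)
  have "(1/2) *\<^sub>R (t *\<^sub>R a + t *\<^sub>R b) = t *\<^sub>R ((1/2) *\<^sub>R (a + b))" by (simp add: algebra_simps)
  then have D1: "D (t *\<^sub>R a, t *\<^sub>R b) = D (a, b) / s"
   unfolding D_def F1 fst_conv snd_conv using s by (simp only: sc) (simp add: s_def diff_divide_distrib)
  have "t *\<^sub>R a - t *\<^sub>R b = t *\<^sub>R (a - b)" by (simp add: algebra_simps)
  then have "norm (a - b) powr p / s \<le> \<epsilon> + C * (D (a, b) / s)" using unit[OF F1] unfolding D1 by (simp only: sc)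
  then have "norm (a - b) powr p / s * s \<le> (\<epsilon> + C * (D (a, b) / s)) * s" using s by (intro mult_right_mono) auto
  then show ?thesis using s by (simp add: s_def[symmetric] distrib_right)
 qed
 show ?thesis using that[OF C] main by (simp add: F_def D_def)
qed

context hs_problem
begin

lemma mass_diff_le:
 assumes u: "u \<in> T" and v: "v \<in> T" and S: "S \<in> sets borel"
 shows "mass S (\<lambda>x. u x - v x) \<le> 2 powr q * (mass S u + mass S v)"
 unfolding mass_def
proof (rule set_integral_le_sum)
 fix x
 have "\<bar>u x - v x\<bar> powr q \<le> 2 powr q * (\<bar>u x\<bar> powr q + \<bar>v x\<bar> powr q)"
  using q1 by (intro order.trans[OF powr_mono2[OF _ _ abs_triangle_ineq4] powr_add_le]) auto
 from mult_left_mono[OF this wt_nonneg[of x]]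
 show "dens x (u x - v x) \<le> 2 powr q * (dens x (u x) + dens x (v x))" by (simp add: algebra_simps)
qed (intro set_integrable_mass test_functions_diff u v S)+

lemma energy_on_diff_le:
 assumes u: "u \<in> T" and v: "v \<in> T" and S: "S \<in> sets borel"
 shows "energy_on S (\<lambda>x. u x - v x) \<le> 2 powr p * (energy_on S u + energy_on S v)"
 unfolding energy_on_def
proof (rule set_integral_le_sum)
 show "grad_powr p (\<lambda>x. u x - v x) x \<le> 2 powr p * (grad_powr p u x + grad_powr p v x)" for x
  unfolding gradient_diff[OF T_differentiable[OF u] T_differentiable[OF v]]
  using p1 by (intro order.trans[OF powr_mono2[OF _ _ norm_triangle_ineq4] powr_add_le]) auto
qed (intro set_integrable_energy test_functions_diff u v S)+

lemma integrable_Lp: "v \<in> T \<Longrightarrow> S \<in> sets borel \<Longrightarrow> integrable lborel (\<lambda>x. indicator S x *\<^sub>R \<bar>v x\<bar> powr p)"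
 using p0 by (intro integrable_mult_indicator integrable_powr_C1c T_C1c) auto

abbreviation (input) local_bound :: "real \<Rightarrow> real \<Rightarrow> ('a \<times> 'b \<Rightarrow> real) \<Rightarrow> 'a \<times> 'b \<Rightarrow> real \<Rightarrow> bool" where
 "local_bound C c v \<zeta> \<rho> \<equiv> mass (ball \<zeta> \<rho>) v \<le> C * (energy_on (ball \<zeta> (3 * \<rho>)) v powr (q/p)
  + ((c / \<rho>) powr p * (LINT x:ball \<zeta> (3 * \<rho>)|lborel. \<bar>v x\<bar> powr p)) powr (q/p))"

text \<open>The global inequality for a cutoff times \<open>v\<close>; the term with
  \<open>c / \<rho>\<close> comes from the gradient of the cutoff. The radius
  \<open>3 * \<rho>\<close> exceeds the support radius \<open>2 * \<rho>\<close>, so every point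
  outside has a neighbourhood on which the product is 0.\<close>

lemma local_mass_bound:
 obtains C c where "C \<ge> 0" "c \<ge> 0"
  "\<And>v \<zeta> \<rho>. \<lbrakk>v \<in> T; \<rho> > 0\<rbrakk> \<Longrightarrow> local_bound C c v \<zeta> \<rho>"
proof -
 obtain c where c: "c \<ge> 0" "\<And>x :: 'a \<times> 'b. norm (gradient cutoff x) \<le> c" using bounded_gradient_cutoff by blast
 define C where "C = sharp * (2 powr p) powr (q/p) * 2 powr (q/p)"
 have C: "C \<ge> 0" using sharp_pos by (simp add: C_def)
 have "local_bound C c v \<zeta> \<rho>" if v: "v \<in> T" and \<rho>: "\<rho> > 0" for v \<zeta> \<rho>
 proof -
  let ?B = "ball \<zeta> (3 * \<rho>)"
  define \<eta> where "\<eta> = cutoff_at \<zeta> \<rho>"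
  have \<eta>C: "C_class k \<eta>" for k unfolding \<eta>_def by (rule C_class_cutoff_at)
  define a where "a x = \<eta> x * v x" for x
  have aT: "a \<in> T" unfolding a_def[abs_def] by (intro test_functions_mult \<eta>C v)
  define X where "X = energy_on ?B v"
  define Y where "Y = (c / \<rho>) powr p * (LINT x:?B|lborel. \<bar>v x\<bar> powr p)"
  have X: "X \<ge> 0" unfolding X_def by (rule energy_on_nonneg)
  have Y: "Y \<ge> 0" unfolding Y_def LINT_def by (intro mult_nonneg_nonneg integral_nonneg_AE) auto
  have iE: "integrable lborel (\<lambda>x. indicator ?B x *\<^sub>R (grad_powr p v x))"
   using set_integrable_energy[OF v, of ?B] by (simp add: set_integrable_def)
  have iL: "integrable lborel (\<lambda>x. indicator ?B x *\<^sub>R \<bar>v x\<bar> powr p)" by (rule integrable_Lp[OF v]) simp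
  have "energy p a \<le> (LINT x|lborel. 2 powr p * (indicator ?B x *\<^sub>R (grad_powr p v x) + (c / \<rho>) powr p * (indicator ?B x *\<^sub>R \<bar>v x\<bar> powr p)))"
   unfolding energy_def
  proof (rule integral_mono[OF integrable_energy[OF aT]])
   show "integrable lborel (\<lambda>x. 2 powr p * (indicator ?B x *\<^sub>R (grad_powr p v x) + (c / \<rho>) powr p * (indicator ?B x *\<^sub>R \<bar>v x\<bar> powr p)))"
    by (intro integrable_mult_right Bochner_Integration.integrable_add iE iL)
   fix x
   show "grad_powr p a x \<le> 2 powr p * (indicator ?B x *\<^sub>R (grad_powr p v x) + (c / \<rho>) powr p * (indicator ?B x *\<^sub>R \<bar>v x\<bar> powr p))"
   proof (cases "x \<in> ?B")
    case True
    have "grad_powr p a x \<le> 2 powr p * (grad_powr p v x + (c / \<rho>) powr p * \<bar>v x\<bar> powr p)" unfolding a_def[abs_def]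
    proof (rule norm_gradient_mult_le)
     show "norm (gradient \<eta> x) \<le> c / \<rho>" unfolding \<eta>_def using c \<rho> by (intro gradient_cutoff_at_le) auto
     show "\<eta> differentiable (at x)" using C_class_differentiable \<eta>C by blast
    qed (use cutoff_at_range[of \<zeta> \<rho> x] p1 c \<rho> T_differentiable[OF v] in \<open>auto simp: \<eta>_def\<close>)
    then show ?thesis using True by simp
   next
    case False
    have "gradient a x = gradient (\<lambda>x. 0) x"
    proof (rule gradient_cong_open)
     show "open (- cball \<zeta> (2 * \<rho>))" by (rule open_Compl[OF closed_cball])
     show "x \<in> - cball \<zeta> (2 * \<rho>)" using False \<rho> by simp
     show "a y = 0" if "y \<in> - cball \<zeta> (2 * \<rho>)" for y
      using cutoff_at_0[OF \<rho>, of \<zeta> y] that by (simp add: a_def \<eta>_def)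
    qed
    then show ?thesis using p0 by (simp add: gradient_const)
   qed
  qed
  also have "... = 2 powr p * (X + Y)" unfolding X_def Y_def energy_on_def LINT_def using iE iL
   by (simp add: Bochner_Integration.integral_add)
  finally have Ea: "energy p a \<le> 2 powr p * (X + Y)" .
  have "mass (ball \<zeta> \<rho>) v = mass (ball \<zeta> \<rho>) a"
   by (rule mass_cong) (use cutoff_at_1[OF \<rho>, of \<zeta>] in \<open>auto simp: a_def \<eta>_def\<close>)
  also have "... \<le> mass UNIV a" by (rule mass_mono[OF aT]) auto
  also have "... \<le> sharp * energy p a powr (q/p)" by (rule mass_le[OF aT])
  also have "... \<le> sharp * (2 powr p * (X + Y)) powr (q/p)"
   using Ea sharp_pos p0 q0 by (intro mult_left_mono powr_mono2) (auto simp: energy_nonneg)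
  also have "... = sharp * (2 powr p) powr (q/p) * (X + Y) powr (q/p)" using X Y by (simp add: powr_mult)
  also have "... \<le> sharp * (2 powr p) powr (q/p) * (2 powr (q/p) * (X powr (q/p) + Y powr (q/p)))"
   using X Y sharp_pos pq p0 by (intro mult_left_mono powr_add_le) auto
  also have "... = C * (X powr (q/p) + Y powr (q/p))" by (simp add: C_def)
  finally show ?thesis unfolding X_def Y_def .
 qed
 then show ?thesis using that[OF C c(1)] by blast
qed

section \<open>Tightness and absence of concentration at the plane\<close>

definition normalised :: "('a \<times> 'b \<Rightarrow> real) \<Rightarrow> bool" where
 "normalised u \<longleftrightarrow> u \<in> T \<and> energy p u \<le> 1 \<and> mass (ball 0 1) u \<ge> sharp / 2 \<and>
  (\<forall>\<zeta>. rad \<zeta> = 0 \<longrightarrow> mass (ball \<zeta> (1/2)) u < sharp / 2)"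

lemma rad_0 [simp]: "rad (0 :: 'a \<times> 'b) = 0" "rad (0 :: 'a, z :: 'b) = 0"
 by (simp_all add: rad_def)

lemma Lp_le_mass:
 assumes u: "u \<in> T" and m: "mass UNIV u \<le> M"
 shows "(LINT x:ball 0 R|lborel. \<bar>u x\<bar> powr p)
  \<le> (if R > 0 then measure lborel (ball (0::'a \<times> 'b) 1) powr (1 - p/q) * R powr p * M powr (p/q) else 0)"
proof (cases "R > 0")
 case True
 have "(LINT x:ball 0 R|lborel. \<bar>u x\<bar> powr p)
  \<le> measure lborel (ball (0::'a \<times> 'b) 1) powr (1 - p/q) * R powr p * mass (ball 0 R) u powr (p/q)"
  by (rule local_Holder[OF u]) (use True in auto)
 also have "... \<le> measure lborel (ball (0::'a \<times> 'b) 1) powr (1 - p/q) * R powr p * M powr (p/q)"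
  using m mass_mono[OF u, of "ball 0 R" UNIV] p0 q0 by (intro mult_left_mono powr_mono2) (auto simp: mass_nonneg)
 finally show ?thesis using True by simp
next
 case False
 then have emp: "ball (0 :: 'a \<times> 'b) R = {}" by simp
 show ?thesis unfolding LINT_def emp using False by simp
qed

lemma maximising_sequence:
 obtains w where "\<And>k::nat. normalised (w k)" "\<And>k x. w k x \<ge> 0"
  "(\<lambda>k. mass UNIV (w k)) \<longlonglongrightarrow> sharp"
  "\<And>R e. e > 0 \<Longrightarrow> \<exists>N. \<forall>k\<ge>N. \<forall>l\<ge>N. (LINT x:ball 0 R|lborel. \<bar>w k x - w l x\<bar> powr p) < e"
proof -
 \<comment> \<open>The factor \<open>sharp / 2\<close> in the deficit keeps every mass at or above
   \<open>sharp / 2\<close>, as \<open>normalise\<close> requires.\<close>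
 have "\<exists>v. normalised v \<and> (\<forall>x. v x \<ge> 0) \<and> mass UNIV v > sharp - sharp / 2 * (1 / real (Suc k))" for k
 proof -
  have "sharp / 2 * (1 / real (Suc k)) > 0" using sharp_pos by simp
  then obtain u where u: "u \<in> T" "\<forall>x. u x \<ge> 0" "energy p u \<le> 1" "mass UNIV u > sharp - sharp / 2 * (1 / real (Suc k))"
   by (rule nonneg_near_maximiser)
  have "sharp / 2 * (1 / real (Suc k)) \<le> sharp / 2 * 1" using sharp_pos by (intro mult_left_mono) auto
  then have "mass UNIV u \<ge> sharp / 2" using u(4) by simp
  from normalise[OF u(1) this] obtain v where "v \<in> T" "energy p v = energy p u" "mass UNIV v = mass UNIV u"
   "mass (ball 0 1) v \<ge> sharp / 2" "\<And>\<zeta>. rad \<zeta> = 0 \<Longrightarrow> mass (ball \<zeta> (1/2)) v < sharp / 2"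
   "(\<forall>x. u x \<ge> 0) \<Longrightarrow> (\<forall>x. v x \<ge> 0)" by blast
  then show ?thesis using u by (intro exI[of _ v]) (simp add: normalised_def)
 qed
 then obtain v where v: "\<And>k. normalised (v k)" "\<And>k x. v k x \<ge> 0" "\<And>k. mass UNIV (v k) > sharp - sharp / 2 * (1 / real (Suc k))"
  by metis
 have vT: "v k \<in> T" and vE: "energy p (v k) \<le> 1" for k using v(1) by (auto simp: normalised_def)
 have mle: "mass UNIV (v k) \<le> sharp" for k by (rule mass_le_sharp[OF vT vE])
 have lim: "(\<lambda>k. mass UNIV (v k)) \<longlonglongrightarrow> sharp"
 proof (rule tendsto_sandwich)
  show "\<forall>\<^sub>F k in sequentially. sharp - sharp / 2 * (1 / real (Suc k)) \<le> mass UNIV (v k)"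
   using v(3) by (intro always_eventually) (auto intro: less_imp_le)
  show "\<forall>\<^sub>F k in sequentially. mass UNIV (v k) \<le> sharp" using mle by simp
  have "(\<lambda>k. 1 / real (Suc k)) \<longlonglongrightarrow> 0" using LIMSEQ_inverse_real_of_nat by (simp add: inverse_eq_divide)
  then have "(\<lambda>k. sharp - sharp / 2 * (1 / real (Suc k))) \<longlonglongrightarrow> sharp - sharp / 2 * 0" by (intro tendsto_intros)
  then show "(\<lambda>k. sharp - sharp / 2 * (1 / real (Suc k))) \<longlonglongrightarrow> sharp" by simp
 qed simp
 have "\<exists>B. \<forall>k. (LINT x:ball 0 R|lborel. \<bar>v k x\<bar> powr p) \<le> B" for R using Lp_le_mass[OF vT mle, where R=R] by blast
 note bdd = this
 show ?thesis
 proof (rule Rellich[OF T_C1c[OF vT] less_imp_le[OF p1] vE bdd])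
  fix r :: "nat \<Rightarrow> nat" assume r: "strict_mono r"
   "\<And>R e. e > 0 \<Longrightarrow> \<exists>N. \<forall>k\<ge>N. \<forall>l\<ge>N. (LINT x:ball 0 R|lborel. \<bar>v (r k) x - v (r l) x\<bar> powr p) < e"
  show ?thesis
  proof (rule that[of "\<lambda>k. v (r k)"])
   show "(\<lambda>k. mass UNIV (v (r k))) \<longlonglongrightarrow> sharp" using LIMSEQ_subseq_LIMSEQ[OF lim r(1)] by (simp add: o_def)
  qed (use v r(2) in blast)+
 qed
qed

text \<open>Two uses of \<open>dichotomy\<close>. For the unit ball at the origin the first
  alternative fails, since that ball holds half of \<open>sharp\<close>; so little mass lies beyond
  radius \<open>R\<close>. For radius \<open>1 / (2 * R)\<close> about a point of the plane the
  outer ball has radius \<open>1/2\<close>; the second alternative fails, since that ball holds less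
  than half of \<open>sharp\<close>, so the inner ball has little energy.\<close>

lemma tight:
 assumes \<delta>: "\<delta> > 0"
 shows "\<exists>\<epsilon>>0. \<exists>R>1. \<forall>u. normalised u \<longrightarrow> mass UNIV u \<ge> sharp - \<epsilon> \<longrightarrow>
  mass (- ball 0 R) u \<le> \<delta> \<and> (\<forall>\<zeta>. rad \<zeta> = 0 \<longrightarrow> energy_on (ball \<zeta> (1 / (2 * R))) u \<le> \<delta>)"
proof -
 \<comment> \<open>One half plus two eighths of \<open>sharp\<close>, the second eighth being the
   deficit, is still less than \<open>sharp\<close>; this is the contradiction used below.\<close>
 define \<delta>' where "\<delta>' = min \<delta> (sharp / 8)"
 have \<delta>': "\<delta>' > 0" "\<delta>' \<le> \<delta>" "\<delta>' \<le> sharp / 8" using \<delta> sharp_pos by (auto simp: \<delta>'_def)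
 obtain \<epsilon> R where e: "\<epsilon> > 0" "R > 1" and dich:
  "\<And>u \<zeta> r. \<lbrakk>u \<in> T; energy p u \<le> 1; mass UNIV u \<ge> sharp - \<epsilon>; rad \<zeta> = 0; r > 0\<rbrakk> \<Longrightarrow>
   energy_on (ball \<zeta> r) u \<le> \<delta>' \<and> mass (ball \<zeta> r) u \<le> \<delta>' \<or> mass (- ball \<zeta> (R * r)) u \<le> \<delta>'"
  using dichotomy[OF \<delta>'(1)] by blast
 have "mass (- ball 0 R) u \<le> \<delta> \<and> (\<forall>\<zeta>. rad \<zeta> = 0 \<longrightarrow> energy_on (ball \<zeta> (1 / (2 * R))) u \<le> \<delta>)"
  if u: "normalised u" and m: "mass UNIV u \<ge> sharp - min \<epsilon> (sharp / 8)" for u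
 proof (intro conjI allI impI)
  from u m have uT: "u \<in> T" and E: "energy p u \<le> 1" and b: "mass (ball 0 1) u \<ge> sharp / 2"
   and small: "\<And>\<zeta>. rad \<zeta> = 0 \<Longrightarrow> mass (ball \<zeta> (1/2)) u < sharp / 2"
   and m1: "mass UNIV u \<ge> sharp - \<epsilon>" and m2: "mass UNIV u \<ge> sharp - sharp / 8" by (auto simp: normalised_def)
  show "mass (- ball 0 R) u \<le> \<delta>" using dich[OF uT E m1, of 0 1] b \<delta>' sharp_pos by auto
  fix \<zeta> :: "'a \<times> 'b" assume \<zeta>: "rad \<zeta> = 0"
  have "R * (1 / (2 * R)) = 1 / 2" using e by simp
  then have "energy_on (ball \<zeta> (1 / (2 * R))) u \<le> \<delta>' \<or> mass (- ball \<zeta> (1/2)) u \<le> \<delta>'"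
   using dich[OF uT E m1 \<zeta>, of "1 / (2 * R)"] e by auto
  moreover have "mass UNIV u \<le> mass (ball \<zeta> (1/2)) u + mass (- ball \<zeta> (1/2)) u"
   using mass_Un[OF uT, of "ball \<zeta> (1/2)" "- ball \<zeta> (1/2)"] by simp
  ultimately show "energy_on (ball \<zeta> (1 / (2 * R))) u \<le> \<delta>" using small[OF \<zeta>] m2 \<delta>' sharp_pos by linarith
 qed
 moreover have "min \<epsilon> (sharp / 8) > 0" using e sharp_pos by auto
 ultimately show ?thesis using e(2) by blast
qed

abbreviation (input) near_plane_bound :: "real \<Rightarrow> real \<Rightarrow> real \<Rightarrow> real \<Rightarrow> bool" where
 "near_plane_bound \<rho> R C A \<equiv> \<forall>v\<in>T. \<forall>\<delta>\<ge>0. (\<forall>\<zeta>. rad \<zeta> = 0 \<longrightarrow> energy_on (ball \<zeta> (3 * \<rho>)) v \<le> \<delta>) \<longrightarrow>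
  mass ({x. rad x < \<rho> / 2} \<inter> ball 0 R) v
   \<le> C * \<delta> powr (q/p - 1) * energy p v + A * (LINT x:ball 0 (R + 4 * \<rho>)|lborel. \<bar>v x\<bar> powr p) powr (q/p)"

text \<open>The local bounds on balls about \<open>(0, z)\<close> are integrated over
  \<open>z\<close>, which replaces a covering of bounded overlap. Since \<open>q/p > 1\<close>, the
  local energy to the power \<open>q/p\<close> is at most \<open>\<delta> powr (q/p - 1)\<close>
  times the local energy, and the latter integrates to a multiple of the total energy.
  \<open>C\<close> depends on neither \<open>\<rho>\<close> nor \<open>R\<close>, which later allows
  \<open>\<delta>\<close> to be fixed before \<open>\<rho>\<close>.\<close>

lemma mass_near_plane:
 obtains C where "C \<ge> 0"
  "\<And>\<rho> R. \<lbrakk>\<rho> > 0; R > 0\<rbrakk> \<Longrightarrow> \<exists>A\<ge>0. near_plane_bound \<rho> R C A"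
proof -
 obtain C0 c where C0: "C0 \<ge> 0" and c: "c \<ge> 0" and loc: "\<And>v \<zeta> \<rho>. \<lbrakk>v \<in> T; \<rho> > 0\<rbrakk> \<Longrightarrow> local_bound C0 c v \<zeta> \<rho>"
  using local_mass_bound by blast
 let ?k = "DIM('b)"
 define vb where "vb = measure lborel (ball (0::'b) 1)"
 have vb: "vb > 0" unfolding vb_def by (rule content_ball_pos) simp
 have vball: "emeasure lborel (ball (z::'b) r) = ennreal (vb * r ^ ?k)" if "r \<ge> 0" for z r
  using emeasure_lborel_ball[OF that, of z] by (simp add: vb_def mult.commute)
 define s where "s = q / p"
 have s: "s > 1" using pq p0 by (simp add: s_def)
 have [measurable]: "(\<lambda>w. dist (0::'a, fst w) (snd w)) \<in> borel_measurable ((borel :: 'b measure) \<Otimes>\<^sub>M (borel :: ('a \<times> 'b) measure))"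
  unfolding borel_prod by (intro borel_measurable_continuous_onI continuous_intros)
 \<comment> \<open>An indicator of a ball, written through the distance so that joint measurability
   in \<open>z\<close> and \<open>x\<close>, needed for Fubini, is evident.\<close>
 define kk where "kk r z x = (if dist (0::'a, z) x < r then 1 else 0 :: ennreal)" for r :: real and z :: 'b and x :: "'a \<times> 'b"
 have kk_ind: "kk r z x = indicator (ball (0, z) r) x" for r z x by (simp add: kk_def indicator_def)
 have [measurable]: "(\<lambda>(z, x). kk r z x) \<in> borel_measurable (borel \<Otimes>\<^sub>M borel)"
  "(\<lambda>(x, z). kk r z x) \<in> borel_measurable (borel \<Otimes>\<^sub>M borel)" "(\<lambda>z. kk r z x) \<in> Borel" for r x
  unfolding kk_def by measurable
 show ?thesis
 \<comment> \<open>The 6 is the ratio of two radii: centres within \<open>\<rho> / 2\<close> of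
   \<open>snd x\<close> have \<open>x\<close> in their ball of radius \<open>\<rho>\<close>, while
   the energy at \<open>x\<close> is counted by centres within \<open>3 * \<rho>\<close>.\<close>
 proof (rule that[of "C0 * 6 ^ ?k"])
  show "C0 * 6 ^ ?k \<ge> 0" using C0 by simp
  fix \<rho> R :: real assume \<rho>: "\<rho> > 0" and R: "R > 0"
  let ?C = "vb * (R + \<rho>) ^ ?k"
  let ?D = "vb * (\<rho> / 2) ^ ?k"
  define A where "A = C0 * ((c / \<rho>) powr p) powr s * ?C / ?D"
  have A: "A \<ge> 0" using C0 vb R \<rho> by (simp add: A_def)
  define P where "P = {x :: 'a \<times> 'b. rad x < \<rho> / 2} \<inter> ball 0 R"
  have [measurable]: "P \<in> sets borel" unfolding P_def by measurable
  let ?M = "R + 4 * \<rho>"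
  have "mass P v \<le> C0 * 6 ^ ?k * \<delta> powr (s - 1) * energy p v + A * (LINT x:ball 0 ?M|lborel. \<bar>v x\<bar> powr p) powr s"
   if v: "v \<in> T" and \<delta>: "\<delta> \<ge> 0" and small: "\<forall>\<zeta>. rad \<zeta> = 0 \<longrightarrow> energy_on (ball \<zeta> (3 * \<rho>)) v \<le> \<delta>" for v \<delta>
  proof -
   have [measurable]: "v \<in> Borel" "gradient v \<in> Borel" using v T_measurable T_gradient_measurable by blast+
   define \<tau> where "\<tau> = (LINT x:ball 0 ?M|lborel. \<bar>v x\<bar> powr p)"
   define F where "F x = ennreal (dens x (v x))" for x
   define G where "G x = ennreal (grad_powr p v x)" for x
   have [measurable]: "F \<in> Borel" "G \<in> Borel" unfolding F_def G_def by measurable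
   define B where "B = ball (0::'b) (R + \<rho>)"
   have [measurable]: "B \<in> sets borel" by (simp add: B_def)
   let ?X = "\<lambda>z. energy_on (ball (0, z) (3 * \<rho>)) v"
   have X_eq: "ennreal (?X z) = (\<integral>\<^sup>+x. G x * kk (3 * \<rho>) z x)" for z
    using nn_integral_energy_on[OF v, of "ball (0, z) (3 * \<rho>)"] by (simp add: G_def kk_ind)
   have [measurable]: "(\<lambda>z. ennreal (?X z)) \<in> Borel" unfolding X_eq by measurable
   let ?B = "(c / \<rho>) powr p * \<tau>"
   let ?E = "vb * (3 * \<rho>) ^ ?k"
   let ?A = "C0 * \<delta> powr (s - 1) * (energy p v * ?E) + C0 * ?B powr s * ?C"
   let ?F = "C0 * \<delta> powr (s - 1)"
   let ?N = "C0 * ?B powr s"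
   let ?O = "ennreal ?F * (\<integral>z. ?X z)"
   let ?Q = "ennreal ?D * ennreal (mass P v)"
   have "?Q = (\<integral>\<^sup>+x. ennreal ?D * (F x * indicator P x))"
    using nn_integral_mass[OF v, of P] by (subst nn_integral_cmult) (auto simp: F_def)
   also have "... \<le> (\<integral>\<^sup>+x. (\<integral>\<^sup>+z. F x * kk \<rho> z x * indicator B z))"
   proof (rule nn_integral_mono)
    fix x :: "'a \<times> 'b"
    let ?J = "(\<integral>\<^sup>+z. F x * kk \<rho> z x * indicator B z)"
    show "ennreal ?D * (F x * indicator P x) \<le> ?J"
    proof (cases "x \<in> P")
     case True
     have sn: "norm (snd x) < R" using True norm_snd_le[of "snd x" "fst x"] by (auto simp: P_def)
     have "ennreal ?D * (F x * indicator P x) = F x * emeasure lborel (ball (snd x) (\<rho> / 2))"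
      using True \<rho> by (subst vball) (auto simp: mult.commute)
     also have "... = (\<integral>\<^sup>+z. F x * indicator (ball (snd x) (\<rho> / 2)) z)" by (subst nn_integral_cmult_indicator) auto
     also have "... \<le> ?J"
     proof (rule nn_integral_mono)
      fix z
      have "dist (0, z) x < \<rho> \<and> z \<in> B" if "z \<in> ball (snd x) (\<rho> / 2)"
      proof
       have "dist (0::'a, z) x = norm (- fst x, z - snd x)" by (simp add: dist_norm minus_prod_def)
       also have "... \<le> norm (fst x) + norm (z - snd x)" using norm_Pair_le[of "- fst x" "z - snd x"] by simp
       also have "... < \<rho>" using that True by (simp add: P_def rad_def dist_norm norm_minus_commute)
       finally show "dist (0::'a, z) x < \<rho>" .
       have "norm z \<le> norm (snd x) + norm (z - snd x)" using norm_triangle_ineq[of "snd x" "z - snd x"] by simp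
       also have "... < R + \<rho>" using that sn \<rho> by (simp add: dist_norm norm_minus_commute)
       finally show "z \<in> B" by (simp add: B_def)
      qed
      then show "F x * indicator (ball (snd x) (\<rho> / 2)) z \<le> F x * kk \<rho> z x * indicator B z"
       by (auto simp: indicator_def kk_def)
     qed
     finally show ?thesis .
    qed simp
   qed
   also have "... = (\<integral>\<^sup>+z. (\<integral>\<^sup>+x. F x * kk \<rho> z x * indicator B z))"
    by (rule lborel_pair.Fubini'[symmetric]) measurable
   also have "... \<le> (\<integral>\<^sup>+z. ennreal ?F * ennreal (?X z) + ennreal ?N * indicator B z)"
   proof (rule nn_integral_mono)
    fix z :: 'b
    let ?R = "(\<integral>\<^sup>+x. F x * kk \<rho> z x * indicator B z)"
    show "?R \<le> ennreal ?F * ennreal (?X z) + ennreal ?N * indicator B z"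
    proof (cases "z \<in> B")
     case True
     let ?H = "((c / \<rho>) powr p * (LINT x:ball (0, z) (3 * \<rho>)|lborel. \<bar>v x\<bar> powr p)) powr s"
     let ?I = "\<delta> powr (s - 1) * ?X z"
     have "?R = ennreal (mass (ball (0, z) \<rho>) v)"
      using nn_integral_mass[OF v, of "ball (0, z) \<rho>"] True by (simp add: F_def kk_ind)
     also have "mass (ball (0, z) \<rho>) v \<le> C0 * (?X z powr s + ?H)" unfolding s_def by (rule loc[OF v \<rho>])
     also have "... \<le> C0 * (?I + ?B powr s)"
     proof (intro mult_left_mono add_mono C0)
      have X: "0 \<le> ?X z" "?X z \<le> \<delta>" using small energy_on_nonneg by auto
      have "?X z powr s = ?X z powr (s - 1) * ?X z" using X s by (cases "?X z = 0") (auto simp: powr_diff)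
      also have "... \<le> ?I" using X s by (intro mult_right_mono powr_mono2) auto
      finally show "?X z powr s \<le> ?I" .
      have "(LINT x:ball (0, z) (3 * \<rho>)|lborel. \<bar>v x\<bar> powr p) \<le> \<tau>" unfolding \<tau>_def LINT_def
      proof (rule integral_mono)
       show "integrable lborel (\<lambda>x. indicator (ball (0, z) (3 * \<rho>)) x *\<^sub>R \<bar>v x\<bar> powr p)"
        "integrable lborel (\<lambda>x. indicator (ball 0 ?M) x *\<^sub>R \<bar>v x\<bar> powr p)"
        by (rule integrable_Lp[OF v], simp)+
       fix x
       have "x \<in> ball 0 ?M" if "x \<in> ball (0::'a, z) (3 * \<rho>)"
       proof -
        have "dist 0 x \<le> dist 0 (0::'a, z) + dist (0::'a, z) x" by (rule dist_triangle)
        also have "dist 0 (0::'a, z) = norm z" by simp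
        finally show ?thesis using that True by (simp add: B_def)
       qed
       then show "indicator (ball (0, z) (3 * \<rho>)) x *\<^sub>R \<bar>v x\<bar> powr p \<le> indicator (ball 0 ?M) x *\<^sub>R \<bar>v x\<bar> powr p"
        by (auto simp: indicator_def)
      qed
      then show "?H \<le> ?B powr s" using s by (intro powr_mono2 mult_left_mono)
        (auto simp: LINT_def intro!: mult_nonneg_nonneg integral_nonneg_AE)
     qed
     finally have "?R \<le> ennreal (C0 * (?I + ?B powr s))" by (simp add: ennreal_leI)
     also have "... = ennreal ?F * ennreal (?X z) + ennreal ?N"
      using C0 by (simp add: energy_on_nonneg distrib_left mult.assoc flip: ennreal_mult ennreal_plus)
     finally show ?thesis using True by simp
    qed simp
   qed
   also have "... = ?O + ennreal ?N * emeasure lborel B"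
    by (subst nn_integral_add, measurable, subst nn_integral_cmult, measurable, subst nn_integral_cmult_indicator, auto)
   also have "emeasure lborel B = ennreal ?C" unfolding B_def using R \<rho> by (intro vball) simp
   also have "(\<integral>z. ?X z) \<le> ennreal (energy p v) * ennreal ?E"
   proof -
    have "(\<integral>z. ?X z) = (\<integral>\<^sup>+z. (\<integral>\<^sup>+x. G x * kk (3 * \<rho>) z x))" unfolding X_eq ..
    also have "... = (\<integral>\<^sup>+x. (\<integral>\<^sup>+z. G x * kk (3 * \<rho>) z x))" by (rule lborel_pair.Fubini') measurable
    also have "... \<le> (\<integral>\<^sup>+x. G x * ennreal ?E)"
    proof (rule nn_integral_mono)
     fix x :: "'a \<times> 'b"
     let ?P = "(\<integral>\<^sup>+z. G x * kk (3 * \<rho>) z x)"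
     have "?P \<le> (\<integral>\<^sup>+z. G x * indicator (ball (snd x) (3 * \<rho>)) z)"
     proof (rule nn_integral_mono)
      fix z
      have "dist (snd x) z \<le> dist (0::'a, z) x" using dist_snd_le[of "(0::'a, z)" x] by (simp add: dist_commute)
      then show "G x * kk (3 * \<rho>) z x \<le> G x * indicator (ball (snd x) (3 * \<rho>)) z"
       by (auto simp: indicator_def kk_def)
     qed
     also have "... = G x * ennreal ?E" using \<rho> by (subst nn_integral_cmult_indicator) (auto simp: vball)
     finally show "?P \<le> G x * ennreal ?E" .
    qed
    also have "... = (\<integral>\<^sup>+x. G x) * ennreal ?E" by (rule nn_integral_multc) measurable
    also have "(\<integral>\<^sup>+x. G x) = ennreal (energy p v)" unfolding G_def by (rule nn_integral_energy[OF T_C1c[OF v] p0])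
    finally show ?thesis .
   qed
   then have "?O + ennreal ?N * ennreal ?C
    \<le> ennreal ?F * (ennreal (energy p v) * ennreal ?E) + ennreal ?N * ennreal ?C"
    by (intro add_right_mono mult_left_mono) auto
   also have "... = ennreal ?A" using C0 vb \<rho> R by (simp add: energy_nonneg flip: ennreal_mult ennreal_plus)
   finally have le: "?Q \<le> ennreal ?A" .
   let ?G = "vb * (\<rho> / 2) ^ ?k * mass P v"
   have "ennreal ?G = ?Q" using vb \<rho> by (intro ennreal_mult) (auto simp: mass_nonneg)
   with le have "ennreal ?G \<le> ennreal ?A" by (simp only:)
   moreover have "0 \<le> ?A"
    using C0 vb \<rho> R by (intro add_nonneg_nonneg mult_nonneg_nonneg) (auto simp: energy_nonneg)
   ultimately have "?G \<le> ?A" by (simp only: ennreal_le_iff)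
   also have "(3 * \<rho>) ^ ?k = 6 ^ ?k * (\<rho> / 2) ^ ?k" by (subst power_mult_distrib[symmetric]) simp
   finally have "?G \<le> vb * (\<rho> / 2) ^ ?k * (C0 * 6 ^ ?k * \<delta> powr (s - 1) * energy p v) + C0 * ?B powr s * ?C"
    by (simp only: mult_ac)
   moreover have "C0 * ?B powr s * ?C = vb * (\<rho> / 2) ^ ?k * (A * \<tau> powr s)"
   proof -
    have "\<tau> \<ge> 0" unfolding \<tau>_def LINT_def by (intro integral_nonneg_AE) auto
    then have "?B powr s = ((c / \<rho>) powr p) powr s * \<tau> powr s" by (simp add: powr_mult)
    moreover have "vb * (\<rho> / 2) ^ ?k * A = C0 * ((c / \<rho>) powr p) powr s * ?C" using vb \<rho> by (simp add: A_def)
    ultimately have "C0 * ?B powr s * ?C = (vb * (\<rho> / 2) ^ ?k * A) * \<tau> powr s"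
     by (simp only:) (simp only: mult_ac)
    then show ?thesis by (simp only: mult.assoc)
   qed
   ultimately have "?G \<le> vb * (\<rho> / 2) ^ ?k * (C0 * 6 ^ ?k * \<delta> powr (s - 1) * energy p v + A * \<tau> powr s)"
    by (simp only: distrib_left)
   moreover have "vb * (\<rho> / 2) ^ ?k > 0" using vb \<rho> by simp
   ultimately show ?thesis unfolding \<tau>_def by (simp only: mult_le_cancel_left_pos)
  qed
  then show "\<exists>A\<ge>0. \<forall>v\<in>T. \<forall>\<delta>\<ge>0. (\<forall>\<zeta>. rad \<zeta> = 0 \<longrightarrow> energy_on (ball \<zeta> (3 * \<rho>)) v \<le> \<delta>) \<longrightarrow>
   mass ({x. rad x < \<rho> / 2} \<inter> ball 0 R) v
    \<le> C0 * 6 ^ ?k * \<delta> powr (q/p - 1) * energy p v + A * (LINT x:ball 0 ?M|lborel. \<bar>v x\<bar> powr p) powr (q/p)"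
   using A unfolding P_def s_def by blast
 qed
qed

text \<open>As a function of \<open>q\<close>, the exponent of the weight is affine with slope
  \<open>1 - n / p\<close>. For \<open>n > p\<close> it decreases, and \<open>q1\<close> is where
  half of \<open>\<beta>\<close> is left. For \<open>n \<le> p\<close> it does not decrease, but
  then \<open>\<beta> \<ge> n\<close>, which exceeds \<open>DIM('a)\<close>; so
  \<open>K \<noteq> UNIV\<close>, and a larger exponent is admissible.\<close>

lemma higher_exponent:
 obtains q1 \<beta>1 where "q < q1" "hs_problem K \<Omega> p q1 n \<beta>1"
proof (cases "n > p")
 case True
 define q1 where "q1 = q + \<beta> / (2 * (n / p - 1))"
 have np: "n / p - 1 > 0" using True p0 by simp
 have "q < q1" using np \<beta>_pos by (simp add: q1_def)
 have "q1 - n * (q1 / p - 1) = \<beta> - (q1 - q) * (n / p - 1)" unfolding \<beta>_eq by (simp add: algebra_simps diff_divide_distrib)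
 also have "(q1 - q) * (n / p - 1) = \<beta> / 2"
 proof -
  have "\<beta> / (2 * t) * t = \<beta> / 2" if "t > 0" for t using that by simp
  from this[OF np] show ?thesis by (simp only: q1_def add_diff_cancel_left')
 qed
 finally have b1: "q1 - n * (q1 / p - 1) = \<beta> / 2" by simp
 have "hs_problem K \<Omega> p q1 n (\<beta> / 2)"
  by unfold_locales (use cone \<Omega>_eq n_eq p1 pq \<open>q < q1\<close> b1 \<beta>_pos admissible in auto)
 then show ?thesis using that \<open>q < q1\<close> by blast
next
 case False
 define b1 where "b1 = (q + 1) - n * ((q + 1) / p - 1)"
 have np: "n / p \<le> 1" using False p0 by simp
 have "b1 = \<beta> + (1 - n / p)" unfolding b1_def \<beta>_eq by (simp add: algebra_simps add_divide_distrib)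
 then have "b1 \<ge> \<beta>" using np by simp
 have "q * (1 - n / p) \<ge> 0" using np q0 by simp
 then have "\<beta> \<ge> n" unfolding \<beta>_eq by (simp add: algebra_simps)
 then have "\<not> \<beta> < real DIM('a)" by (simp add: n_eq)
 then have "K \<noteq> UNIV" using admissible by blast
 have "hs_problem K \<Omega> p (q + 1) n b1"
  by unfold_locales (use cone \<Omega>_eq n_eq p1 pq b1_def \<open>b1 \<ge> \<beta>\<close> \<beta>_pos \<open>K \<noteq> UNIV\<close> in auto)
 then show ?thesis using that[of "q + 1"] by simp
qed

text \<open>Where the weight is bounded, \<open>q\<close> lies strictly between \<open>p\<close> and an exponent that is still admissible.\<close>

lemma mass_away_plane:
 assumes \<rho>: "\<rho> > 0" and R: "R > 0" and B: "B \<ge> 0"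
 obtains A \<theta> where "A \<ge> 0" "\<theta> > 0"
  "\<And>v. \<lbrakk>v \<in> T; energy p v \<le> B\<rbrakk> \<Longrightarrow>
   mass ({x. rad x \<ge> \<rho>} \<inter> ball 0 R) v \<le> A * (LINT x:ball 0 R|lborel. \<bar>v x\<bar> powr p) powr \<theta>"
proof -
 obtain q1 \<beta>1 where qq1: "q < q1" and hs1: "hs_problem K \<Omega> p q1 n \<beta>1" by (rule higher_exponent)
 interpret Q: hs_problem K \<Omega> p q1 n \<beta>1 by (rule hs1)
 \<comment> \<open>The share of \<open>q\<close> that falls on the local \<open>p\<close>-norm when
   \<open>q\<close> is interpolated between \<open>p\<close> and \<open>q1\<close>; the rest is
   bounded by the inequality for \<open>q1\<close>.\<close>
 define \<theta> where "\<theta> = (q1 - q) / (q1 - p)"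
 have \<theta>: "0 < \<theta>" "\<theta> < 1" using qq1 pq by (auto simp: \<theta>_def)
 have "\<theta> * (q1 - p) = q1 - q" using qq1 pq by (simp add: \<theta>_def)
 then have q_eq: "p * \<theta> + q1 * (1 - \<theta>) = q" by (simp add: algebra_simps)
 define M1 where "M1 = Q.sharp * B powr (q1/p)"
 have M1: "M1 \<ge> 0" using Q.sharp_pos by (simp add: M1_def)
 define A where "A = \<rho> powr (- \<beta>) * (R powr \<beta>1 * M1) powr (1 - \<theta>)"
 have A: "A \<ge> 0" by (simp add: A_def)
 let ?P = "{x. rad x \<ge> \<rho>} \<inter> ball 0 R"
 have [measurable]: "?P \<in> sets borel" by measurable
 let ?A = "\<rho> powr (- \<beta>)"
 let ?D = "R powr \<beta>1"
 have "mass ?P v \<le> A * (LINT x:ball 0 R|lborel. \<bar>v x\<bar> powr p) powr \<theta>" if v: "v \<in> T" and E: "energy p v \<le> B" for v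
 proof -
  have [measurable]: "v \<in> Borel" using v by (rule T_measurable)
  define \<tau> where "\<tau> = (LINT x:ball 0 R|lborel. \<bar>v x\<bar> powr p)"
  have \<tau>: "\<tau> \<ge> 0" unfolding \<tau>_def LINT_def by (intro integral_nonneg_AE) auto
  have "Q.mass UNIV v \<le> Q.sharp * energy p v powr (q1/p)" by (rule Q.mass_le[OF v])
  also have "... \<le> M1" unfolding M1_def using Q.sharp_pos E p0 Q.q0
   by (intro mult_left_mono powr_mono2) (auto simp: energy_nonneg)
  finally have Qm: "Q.mass UNIV v \<le> M1" .
  have rad_le: "rad x < R" if "x \<in> ball 0 R" for x :: "'a \<times> 'b"
  proof -
   have "rad x \<le> norm x" unfolding rad_def by (metis norm_fst_le prod.collapse)
   then show ?thesis using that by simp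
  qed
  let ?B = "(\<integral>x. indicator ?P x * \<bar>v x\<bar> powr q1)"
  let ?C = "\<tau> powr \<theta> * (R powr \<beta>1 * M1) powr (1 - \<theta>)"
  have "(\<integral>x. (indicator (ball 0 R) x * \<bar>v x\<bar> powr p)) \<le> ennreal \<tau>" unfolding \<tau>_def LINT_def
   using nn_integral_eq_integral[OF integrable_Lp[OF v, of "ball 0 R"]] by simp
  moreover have "?B \<le> ennreal (R powr \<beta>1 * M1)"
  proof -
   have "?B \<le> (\<integral>\<^sup>+x. ennreal ?D * ennreal (Q.wt x * \<bar>v x\<bar> powr q1))"
   proof (rule nn_integral_mono)
    fix x
    show "ennreal (indicator ?P x * \<bar>v x\<bar> powr q1) \<le> ennreal ?D * ennreal (Q.wt x * \<bar>v x\<bar> powr q1)"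
    proof (cases "x \<in> ?P")
     case True
     \<comment> \<open>The weight for \<open>q1\<close> is bounded below because
       \<open>rad x < R\<close>; further down, the weight for \<open>q\<close> is bounded above
       because \<open>rad x \<ge> \<rho>\<close>.\<close>
     then have "R powr (- \<beta>1) \<le> Q.wt x"
      unfolding Q.wt_def using rad_le[of x] \<rho> Q.\<beta>_pos by (intro powr_mono2') auto
     then have "R powr \<beta>1 * R powr (- \<beta>1) \<le> R powr \<beta>1 * Q.wt x" by (rule mult_left_mono) simp
     moreover have "R powr \<beta>1 * R powr (- \<beta>1) = 1" using R by (simp flip: powr_add)
     ultimately have "1 * \<bar>v x\<bar> powr q1 \<le> R powr \<beta>1 * Q.wt x * \<bar>v x\<bar> powr q1" by (intro mult_right_mono) auto
     then show ?thesis using True by (simp add: mult.assoc ennreal_leI flip: ennreal_mult)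
    qed simp
   qed
   also have "... = ennreal ?D * (\<integral>x. Q.wt x * \<bar>v x\<bar> powr q1)" by (rule nn_integral_cmult) measurable
   also have "(\<integral>x. Q.wt x * \<bar>v x\<bar> powr q1) = ennreal (Q.mass UNIV v)"
    using Q.nn_integral_mass[OF v, of UNIV] by simp
   also have "ennreal ?D * ennreal (Q.mass UNIV v) \<le> ennreal ?D * ennreal M1"
    using Qm by (intro mult_left_mono ennreal_leI) auto
   finally show ?thesis by (simp add: ennreal_mult M1)
  qed
  ultimately have H: "(\<integral>x. (indicator (ball 0 R) x * \<bar>v x\<bar> powr p) powr \<theta> * (indicator ?P x * \<bar>v x\<bar> powr q1) powr (1 - \<theta>))
    \<le> ennreal ?C" using \<theta> \<tau> M1 by (intro nn_integral_Holder) auto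
  have "ennreal (mass ?P v) = (\<integral>x\<in>?P. dens x (v x))" by (rule nn_integral_mass[symmetric, OF v]) measurable
  also have "... \<le> (\<integral>\<^sup>+x. ennreal ?A * ennreal ((indicator (ball 0 R) x * \<bar>v x\<bar> powr p) powr \<theta> * (indicator ?P x * \<bar>v x\<bar> powr q1) powr (1 - \<theta>)))"
  proof (rule nn_integral_mono)
   fix x
   show "ennreal (dens x (v x)) * indicator ?P x
    \<le> ennreal ?A * ennreal ((indicator (ball 0 R) x * \<bar>v x\<bar> powr p) powr \<theta> * (indicator ?P x * \<bar>v x\<bar> powr q1) powr (1 - \<theta>))"
   proof (cases "x \<in> ?P")
    case True
    have "wt x \<le> ?A" unfolding wt_def using True \<rho> \<beta>_pos by (intro powr_mono2') auto
    then have "dens x (v x) \<le> \<rho> powr (- \<beta>) * \<bar>v x\<bar> powr q" by (rule mult_right_mono) simp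
    moreover have "(\<bar>v x\<bar> powr p) powr \<theta> * (\<bar>v x\<bar> powr q1) powr (1 - \<theta>) = \<bar>v x\<bar> powr q"
     unfolding powr_powr powr_add[symmetric] q_eq ..
    ultimately show ?thesis using True by (simp add: ennreal_leI flip: ennreal_mult)
   qed simp
  qed
  also have "... = ennreal ?A * (\<integral>x. (indicator (ball 0 R) x * \<bar>v x\<bar> powr p) powr \<theta> * (indicator ?P x * \<bar>v x\<bar> powr q1) powr (1 - \<theta>))"
   by (rule nn_integral_cmult) measurable
  also have "... \<le> ennreal ?A * ennreal ?C" by (intro mult_left_mono H) simp
  also have "... = ennreal (A * \<tau> powr \<theta>)" by (simp add: A_def mult_ac flip: ennreal_mult)
  finally show ?thesis using A by (simp add: \<tau>_def ennreal_le_iff)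
 qed
 then show ?thesis using that[OF A \<theta>(1)] by blast
qed

text \<open>Space is divided into the outside of a large ball, a strip about the plane, and the
  rest. The first part is small by tightness. The second is small by absence of concentration and
  the third by interpolation, each up to a local \<open>p\<close>-norm of the difference, and these
  norms tend to 0.\<close>

lemma mass_Cauchy:
 fixes w :: "nat \<Rightarrow> 'a \<times> 'b \<Rightarrow> real"
 assumes norm: "\<And>k. normalised (w k)" and lim: "(\<lambda>k. mass UNIV (w k)) \<longlonglongrightarrow> sharp"
  and Lp: "\<And>R e. e > 0 \<Longrightarrow> \<exists>N. \<forall>k\<ge>N. \<forall>l\<ge>N. (LINT x:ball 0 R|lborel. \<bar>w k x - w l x\<bar> powr p) < e"
  and e: "e > 0" shows "\<exists>N. \<forall>k\<ge>N. \<forall>l\<ge>N. mass UNIV (\<lambda>x. w k x - w l x) < e"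
proof -
 have wT: "w k \<in> T" and wE: "energy p (w k) \<le> 1" for k using norm[of k] by (auto simp: normalised_def)
 define B where "B = 2 powr p * 2"
 have B: "B > 0" by (simp add: B_def)
 have dT: "(\<lambda>x. w k x - w l x) \<in> T" for k l by (intro test_functions_diff wT)
 have dE: "energy p (\<lambda>x. w k x - w l x) \<le> B" for k l
 proof -
  have "energy p (\<lambda>x. w k x - w l x) \<le> 2 powr p * (energy p (w k) + energy p (w l))"
   using p1 by (intro energy_diff_le T_C1c wT) auto
  also have "... \<le> 2 powr p * (1 + 1)" by (intro mult_left_mono add_mono wE) simp
  finally show ?thesis by (simp add: B_def)
 qed
 have near: "\<forall>\<^sub>F k in sequentially. mass UNIV (w k) \<ge> sharp - \<epsilon>" if "\<epsilon> > 0" for \<epsilon>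
  using order_tendstoD(1)[OF lim, of "sharp - \<epsilon>"] that by (auto elim: eventually_mono)
 define \<delta>1 where "\<delta>1 = e / (8 * 2 powr q)"
 have \<delta>1: "\<delta>1 > 0" using e by (simp add: \<delta>1_def)
 obtain \<epsilon>1 R where \<epsilon>1: "\<epsilon>1 > 0" and R: "R > 1" and out:
  "\<And>u. normalised u \<Longrightarrow> mass UNIV u \<ge> sharp - \<epsilon>1 \<Longrightarrow> mass (- ball 0 R) u \<le> \<delta>1" using tight[OF \<delta>1] by meson
 obtain C where C: "C \<ge> 0" and plane: "\<And>\<rho> R. \<lbrakk>\<rho> > 0; R > 0\<rbrakk> \<Longrightarrow> \<exists>A\<ge>0. near_plane_bound \<rho> R C A"
  using mass_near_plane by blast
 have s: "q/p - 1 > 0" using pq p0 by simp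
 let ?B = "e / (8 * (C + 1) * B)"
 \<comment> \<open>Solves \<open>C * \<delta>2 powr (q/p - 1) * B \<le> e / 8\<close>. This is
   possible before the width \<open>\<rho>\<close> is known, because \<open>C\<close> does not
   depend on it.\<close>
 define \<delta>2 where "\<delta>2 = ?B powr (1 / (q/p - 1))"
 have \<delta>2: "\<delta>2 > 0" using e C B by (simp add: \<delta>2_def)
 have "\<delta>2 powr (q/p - 1) = ?B"
 proof -
  have "1 / t * t = (1::real)" if "t > 0" for t using that by simp
  from this[OF s] have "\<delta>2 powr (q/p - 1) = ?B powr 1" unfolding \<delta>2_def powr_powr by (simp only:)
  moreover have "e / (8 * (C + 1) * B) > 0" using e C B by simp
  ultimately show ?thesis by (simp only: powr_one less_imp_le)
 qed
 then have "C * \<delta>2 powr (q/p - 1) * B \<le> (C + 1) * ?B * B" using C B e by (simp only:) (intro mult_right_mono, auto)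
 also have "... = e / 8"
 proof -
  have "t * (e / (8 * t * B)) * B = e / 8" if "t > 0" for t using that B by simp
  from this[of "C + 1"] C show ?thesis by linarith
 qed
 finally have \<delta>2_le: "C * \<delta>2 powr (q/p - 1) * B \<le> e / 8" .
 have "\<delta>2 / (2 powr p * 2) > 0" using \<delta>2 by simp
 then obtain \<epsilon>2 R2 where \<epsilon>2: "\<epsilon>2 > 0" and R2: "R2 > 1" and conc:
  "\<And>u \<zeta>. normalised u \<Longrightarrow> mass UNIV u \<ge> sharp - \<epsilon>2 \<Longrightarrow> rad \<zeta> = 0 \<Longrightarrow> energy_on (ball \<zeta> (1 / (2 * R2))) u \<le> \<delta>2 / (2 powr p * 2)"
  using tight by meson
 \<comment> \<open>With this width, \<open>3 * \<rho>\<close> is the radius at which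
   \<open>tight\<close> controls the energy.\<close>
 define \<rho> where "\<rho> = 1 / (6 * R2)"
 have \<rho>: "\<rho> > 0" "3 * \<rho> = 1 / (2 * R2)" using R2 by (auto simp: \<rho>_def)
 have R0: "R > 0" using R by simp
 obtain A1 where A1: "A1 \<ge> 0" and plane1: "\<And>v \<delta>. v \<in> T \<Longrightarrow> \<delta> \<ge> 0 \<Longrightarrow> (\<forall>\<zeta>. rad \<zeta> = 0 \<longrightarrow> energy_on (ball \<zeta> (3 * \<rho>)) v \<le> \<delta>) \<Longrightarrow>
   mass ({x. rad x < \<rho> / 2} \<inter> ball 0 R) v
    \<le> C * \<delta> powr (q/p - 1) * energy p v + A1 * (LINT x:ball 0 (R + 4 * \<rho>)|lborel. \<bar>v x\<bar> powr p) powr (q/p)"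
  using plane[OF \<rho>(1) R0] by blast
 have "\<rho> / 2 > 0" using \<rho> by simp
 obtain A2 \<theta> where A2: "A2 \<ge> 0" and \<theta>: "\<theta> > 0" and away: "\<And>v. \<lbrakk>v \<in> T; energy p v \<le> B\<rbrakk> \<Longrightarrow>
   mass ({x. rad x \<ge> \<rho> / 2} \<inter> ball 0 R) v \<le> A2 * (LINT x:ball 0 R|lborel. \<bar>v x\<bar> powr p) powr \<theta>"
  using mass_away_plane[OF \<open>\<rho> / 2 > 0\<close> R0 less_imp_le[OF B]] by blast
 have small: "\<exists>N. \<forall>k\<ge>N. \<forall>l\<ge>N. A * (LINT x:ball 0 S|lborel. \<bar>w k x - w l x\<bar> powr p) powr t \<le> e / 8"
  if A: "A \<ge> 0" and t: "t > 0" for A S t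
 proof -
  define e' where "e' = (e / (8 * (A + 1))) powr (1 / t)"
  have e': "e' > 0" using e A by (simp add: e'_def)
  have "e' powr t = e / (8 * (A + 1))" unfolding e'_def powr_powr using t e A by simp
  then have le: "A * e' powr t \<le> (A + 1) * (e / (8 * (A + 1)))" using e A by (simp only:) (intro mult_right_mono; simp)
  have "X * (e / (8 * X)) = e / 8" if "X > 0" for X :: real using that by simp
  from this[of "A + 1"] have "(A + 1) * (e / (8 * (A + 1))) = e / 8" using A by linarith
  with le have Ae: "A * e' powr t \<le> e / 8" by linarith
  obtain N where N: "\<And>k l. k \<ge> N \<Longrightarrow> l \<ge> N \<Longrightarrow> (LINT x:ball 0 S|lborel. \<bar>w k x - w l x\<bar> powr p) < e'"
   using Lp[OF e'] by blast
  have "A * (LINT x:ball 0 S|lborel. \<bar>w k x - w l x\<bar> powr p) powr t \<le> e / 8" if "k \<ge> N" "l \<ge> N" for k l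
  proof -
   have "(LINT x:ball 0 S|lborel. \<bar>w k x - w l x\<bar> powr p) powr t \<le> e' powr t"
    using N[OF that] t by (intro powr_mono2) (auto simp: LINT_def intro!: integral_nonneg_AE)
   then show ?thesis using Ae A by (meson mult_left_mono order.trans)
  qed
  then show ?thesis by blast
 qed
 obtain N1 where N1: "\<And>k l. k \<ge> N1 \<Longrightarrow> l \<ge> N1 \<Longrightarrow> A1 * (LINT x:ball 0 (R + 4 * \<rho>)|lborel. \<bar>w k x - w l x\<bar> powr p) powr (q/p) \<le> e / 8"
  using small[OF A1, of "q/p" "R + 4 * \<rho>"] p0 q0 by auto
 obtain N2 where N2: "\<And>k l. k \<ge> N2 \<Longrightarrow> l \<ge> N2 \<Longrightarrow> A2 * (LINT x:ball 0 R|lborel. \<bar>w k x - w l x\<bar> powr p) powr \<theta> \<le> e / 8"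
  using small[OF A2 \<theta>, of R] by auto
 obtain N3 where N3: "\<And>k. k \<ge> N3 \<Longrightarrow> mass UNIV (w k) \<ge> sharp - \<epsilon>1" using near[OF \<epsilon>1] by (auto simp: eventually_sequentially)
 obtain N4 where N4: "\<And>k. k \<ge> N4 \<Longrightarrow> mass UNIV (w k) \<ge> sharp - \<epsilon>2" using near[OF \<epsilon>2] by (auto simp: eventually_sequentially)
 show ?thesis
 proof (intro exI[of _ "N1 + N2 + N3 + N4"] allI impI)
  fix k l assume kl: "N1 + N2 + N3 + N4 \<le> k" "N1 + N2 + N3 + N4 \<le> l"
  let ?v = "\<lambda>x. w k x - w l x"
  let ?P = "{x. rad x < \<rho> / 2} \<inter> ball (0 :: 'a \<times> 'b) R" and ?Q = "{x. rad x \<ge> \<rho> / 2} \<inter> ball (0 :: 'a \<times> 'b) R"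
  have [measurable]: "?P \<in> sets borel" "?Q \<in> sets borel" by measurable
  have "mass (- ball 0 R) ?v \<le> 2 powr q * (mass (- ball 0 R) (w k) + mass (- ball 0 R) (w l))"
   by (rule mass_diff_le[OF wT wT]) simp
  also have "... \<le> 2 powr q * (\<delta>1 + \<delta>1)" using kl by (intro mult_left_mono add_mono out norm N3) auto
  also have "... = e / 4" by (simp add: \<delta>1_def)
  finally have m1: "mass (- ball 0 R) ?v \<le> e / 4" .
  have conc': "\<forall>\<zeta>. rad \<zeta> = 0 \<longrightarrow> energy_on (ball \<zeta> (3 * \<rho>)) ?v \<le> \<delta>2"
  proof (intro allI impI)
   fix \<zeta> :: "'a \<times> 'b" assume \<zeta>: "rad \<zeta> = 0"
   let ?A = "ball \<zeta> (3 * \<rho>)"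
   have "energy_on ?A ?v \<le> 2 powr p * (energy_on ?A (w k) + energy_on ?A (w l))"
    by (rule energy_on_diff_le[OF wT wT]) simp
   also have "... \<le> 2 powr p * (\<delta>2 / (2 powr p * 2) + \<delta>2 / (2 powr p * 2))"
    unfolding \<rho>(2) using kl by (intro mult_left_mono add_mono conc norm N4 \<zeta>) auto
   also have "... = \<delta>2" by simp
   finally show "energy_on ?A ?v \<le> \<delta>2" .
  qed
  have "mass ?P ?v \<le> C * \<delta>2 powr (q/p - 1) * energy p ?v + A1 * (LINT x:ball 0 (R + 4 * \<rho>)|lborel. \<bar>?v x\<bar> powr p) powr (q/p)"
   by (rule plane1[OF dT less_imp_le[OF \<delta>2] conc'])
  also have "... \<le> C * \<delta>2 powr (q/p - 1) * B + e / 8" using kl C by (intro add_mono mult_left_mono dE N1) auto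
  also have "... \<le> e / 4" using \<delta>2_le by simp
  finally have m2: "mass ?P ?v \<le> e / 4" .
  have "mass ?Q ?v \<le> A2 * (LINT x:ball 0 R|lborel. \<bar>?v x\<bar> powr p) powr \<theta>" by (rule away[OF dT dE])
  also have "... \<le> e / 8" using kl by (intro N2) auto
  finally have m3: "mass ?Q ?v \<le> e / 8" .
  have "UNIV = - ball 0 R \<union> (?P \<union> ?Q)" by auto
  then have "mass UNIV ?v = mass (- ball 0 R \<union> (?P \<union> ?Q)) ?v" by (simp only:)
  also have "... \<le> mass (- ball 0 R) ?v + (mass ?P ?v + mass ?Q ?v)"
   by (intro order.trans[OF mass_Un[OF dT]] add_left_mono mass_Un[OF dT]) auto
  also have "... < e" using m1 m2 m3 e by simp
  finally show "mass UNIV ?v < e" .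
 qed
qed

text \<open>\<open>u\<close> is the midpoint plus half of the difference;
  \<open>convex_powr_add\<close> is solved for the mass of the midpoint. A difference of small mass
  thus makes the mass of the midpoint close to that of \<open>u\<close>.\<close>

lemma mass_midpoint_ge:
 assumes u: "u \<in> T" and v: "v \<in> T" and s: "0 < s" "s < 1"
 shows "mass UNIV (\<lambda>x. (1/2) * (u x + v x)) \<ge> (1 - s) powr (q - 1) * (mass UNIV u - s powr (1 - q) * mass UNIV (\<lambda>x. u x - v x))"
proof -
 let ?m = "\<lambda>x. (1/2) * (u x + v x)" and ?d = "\<lambda>x. u x - v x"
 have mT: "?m \<in> T" by (intro test_functions_cmult test_functions_add u v)
 have dT: "?d \<in> T" by (rule test_functions_diff[OF u v])
 let ?A = "(1 - s) powr (1 - q) * mass UNIV ?m"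
 have "mass UNIV u \<le> (LINT x|lborel. (1 - s) powr (1 - q) * (dens x (?m x)) + s powr (1 - q) * (dens x (?d x)))"
  unfolding mass_def LINT_def indicator_UNIV scaleR_one
 proof (rule integral_mono[OF integrable_mass[OF u]])
  show "integrable lborel (\<lambda>x. (1 - s) powr (1 - q) * (dens x (?m x)) + s powr (1 - q) * (dens x (?d x)))"
   by (intro Bochner_Integration.integrable_add integrable_mult_right integrable_mass mT dT)
  fix x
  let ?B = "(1 - s) powr (1 - q) * \<bar>?m x\<bar> powr q + s powr (1 - q) * \<bar>?d x\<bar> powr q"
  have "\<bar>u x\<bar> = \<bar>?m x + ?d x / 2\<bar>" by (simp add: field_simps)
  also have "... \<le> \<bar>?m x\<bar> + \<bar>?d x / 2\<bar>" by (rule abs_triangle_ineq)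
  also have "\<bar>?d x / 2\<bar> \<le> \<bar>?d x\<bar>" by simp
  finally have "\<bar>u x\<bar> \<le> \<bar>?m x\<bar> + \<bar>?d x\<bar>" by simp
  then have "\<bar>u x\<bar> powr q \<le> (\<bar>?m x\<bar> + \<bar>?d x\<bar>) powr q" using q0 by (intro powr_mono2) auto
  also have "... \<le> ?B" using s q1 by (intro convex_powr_add) auto
  finally have "dens x (u x) \<le> wt x * ?B" by (rule mult_left_mono) simp
  then show "dens x (u x) \<le> (1 - s) powr (1 - q) * (dens x (?m x)) + s powr (1 - q) * (dens x (?d x))"
   by (simp only: distrib_left mult_ac)
 qed
 also have "... = ?A + s powr (1 - q) * mass UNIV ?d" unfolding mass_def LINT_def indicator_UNIV scaleR_one
  using integrable_mass[OF mT] integrable_mass[OF dT] by (simp add: Bochner_Integration.integral_add)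
 finally have "mass UNIV u - s powr (1 - q) * mass UNIV ?d \<le> ?A" by simp
 then have "(1 - s) powr (q - 1) * (mass UNIV u - s powr (1 - q) * mass UNIV ?d) \<le> (1 - s) powr (q - 1) * ?A"
  by (rule mult_left_mono) simp
 also have "(1 - s) powr (q - 1) * ?A = mass UNIV ?m" using s by (simp add: mult.assoc[symmetric] flip: powr_add)
 finally show ?thesis .
qed

text \<open>Midpoints of late members have mass near \<open>sharp\<close>, so by
  \<open>mass_le\<close> nearly full energy, while the members have energy at most 1. The convexity
  defect of the pair is then small, and \<open>uniform_convexity\<close>, integrated, bounds the
  energy of the difference.\<close>

lemma energy_Cauchy:
 fixes w :: "nat \<Rightarrow> 'a \<times> 'b \<Rightarrow> real"
 assumes wT: "\<And>k. w k \<in> T" and wE: "\<And>k. energy p (w k) \<le> 1" and lim: "(\<lambda>k. mass UNIV (w k)) \<longlonglongrightarrow> sharp"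
  and mC: "\<And>e. e > 0 \<Longrightarrow> \<exists>N. \<forall>k\<ge>N. \<forall>l\<ge>N. mass UNIV (\<lambda>x. w k x - w l x) < e"
  and e: "e > 0" shows "\<exists>N. \<forall>k\<ge>N. \<forall>l\<ge>N. energy p (\<lambda>x. w k x - w l x) < e"
proof -
 define \<epsilon> where "\<epsilon> = e / 4"
 have \<epsilon>: "\<epsilon> > 0" using e by (simp add: \<epsilon>_def)
 obtain C where C: "C \<ge> 0" and uc: "\<And>a b :: 'a \<times> 'b. norm (a - b) powr p \<le> \<epsilon> * (norm a powr p + norm b powr p)
   + C * ((norm a powr p + norm b powr p) / 2 - norm ((1/2) *\<^sub>R (a + b)) powr p)"
  using uniform_convexity[OF p1 \<epsilon>] by blast
 \<comment> \<open>The lower bound aimed at for the energy of the midpoint: a defect of at most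
   \<open>1 - \<mu>\<close>, multiplied by \<open>C\<close>, stays below \<open>e / 2\<close>, and
   the terms with \<open>\<epsilon> = e / 4\<close> account for the other half.\<close>
 define \<mu> where "\<mu> = 1 - e / (4 * (C + 1))"
 have "C * (e / (4 * (C + 1))) \<le> (C + 1) * (e / (4 * (C + 1)))" using e C by (intro mult_right_mono) auto
 also have "... = e / 4" using C by (simp add: field_simps)
 finally have "C * (1 - \<mu>) \<le> e / 4" by (simp only: \<mu>_def) simp
 moreover have "e / (4 * (C + 1)) > 0" using e C by simp
 ultimately have \<mu>: "\<mu> < 1" "C * (1 - \<mu>) < e / 2" using e unfolding \<mu>_def by linarith+
 \<comment> \<open>One number \<open>s\<close> is the convexity parameter, the deficit in mass and
   the bound for the difference term at once; the expression tends to 1 as \<open>s\<close> tends to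
   0.\<close>
 have "((\<lambda>s. ((1 - s) powr (q - 1) * (sharp - s - s) / sharp) powr (p/q)) \<longlongrightarrow> ((1 - 0) powr (q - 1) * (sharp - 0 - 0) / sharp) powr (p/q)) (at_right 0)"
  using sharp_pos by (intro tendsto_intros) auto
 moreover have "\<mu> < ((1 - 0) powr (q - 1) * (sharp - 0 - 0) / sharp) powr (p/q)" using sharp_pos \<mu> by simp
 ultimately have "\<forall>\<^sub>F s in at_right 0. \<mu> < ((1 - s) powr (q - 1) * (sharp - s - s) / sharp) powr (p/q)"
  by (rule order_tendstoD)
 moreover have "\<forall>\<^sub>F s::real in at_right 0. s < 1" "\<forall>\<^sub>F s::real in at_right 0. 0 < s"
  unfolding eventually_at_right_field by (intro exI[of _ 1], simp)+
 moreover have "\<forall>\<^sub>F s in at_right 0. s < sharp / 2"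
  unfolding eventually_at_right_field using sharp_pos by (intro exI[of _ "sharp / 2"]) simp
 ultimately have "\<forall>\<^sub>F s in at_right 0. \<mu> < ((1 - s) powr (q - 1) * (sharp - s - s) / sharp) powr (p/q) \<and> s < 1 \<and> s < sharp / 2 \<and> 0 < s"
  by eventually_elim simp
 then obtain s where s: "\<mu> < ((1 - s) powr (q - 1) * (sharp - s - s) / sharp) powr (p/q)" "s < 1" "s < sharp / 2" "0 < s"
  using eventually_happens'[OF trivial_limit_at_right_real] by blast
 obtain N1 where N1: "\<And>k l. k \<ge> N1 \<Longrightarrow> l \<ge> N1 \<Longrightarrow> mass UNIV (\<lambda>x. w k x - w l x) < s / s powr (1 - q)"
  using mC[of "s / s powr (1 - q)"] s by auto
 obtain N2 where N2: "\<And>k. k \<ge> N2 \<Longrightarrow> sharp - s < mass UNIV (w k)"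
  using order_tendstoD(1)[OF lim, of "sharp - s"] s by (auto simp: eventually_sequentially)
 show ?thesis
 proof (intro exI[of _ "N1 + N2"] allI impI)
  fix k l assume kl: "N1 + N2 \<le> k" "N1 + N2 \<le> l"
  let ?m = "\<lambda>x. (1/2) * (w k x + w l x)"
  have mT: "?m \<in> T" by (intro test_functions_cmult test_functions_add wT)
  have dT: "(\<lambda>x. w k x - w l x) \<in> T" by (intro test_functions_diff wT)
  have "s powr (1 - q) * mass UNIV (\<lambda>x. w k x - w l x) \<le> s"
   using N1[of k l] kl s by (simp add: pos_less_divide_eq less_imp_le mult.commute)
  then have "(1 - s) powr (q - 1) * (sharp - s - s) \<le> (1 - s) powr (q - 1) * (mass UNIV (w k) - s powr (1 - q) * mass UNIV (\<lambda>x. w k x - w l x))"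
   using N2[of k] kl by (intro mult_left_mono) auto
  also have "... \<le> mass UNIV ?m" using s by (intro mass_midpoint_ge wT) auto
  also have "... \<le> sharp * energy p ?m powr (q/p)" by (rule mass_le[OF mT])
  finally have "(1 - s) powr (q - 1) * (sharp - s - s) / sharp \<le> energy p ?m powr (q/p)"
   using sharp_pos by (simp add: pos_divide_le_eq mult.commute)
  then have "((1 - s) powr (q - 1) * (sharp - s - s) / sharp) powr (p/q) \<le> (energy p ?m powr (q/p)) powr (p/q)"
   using s sharp_pos p0 q0 by (intro powr_mono2) auto
  also have "... = energy p ?m" using p0 q0 by (simp add: powr_powr energy_nonneg)
  finally have Em: "energy p ?m > \<mu>" using s(1) by simp
  note i = integrable_energy
  have "energy p (\<lambda>x. w k x - w l x) \<le> (LINT x|lborel. \<epsilon> * (grad_powr p (w k) x + grad_powr p (w l) x)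
   + C * ((grad_powr p (w k) x + grad_powr p (w l) x) / 2 - grad_powr p ?m x))" unfolding energy_def
  proof (rule integral_mono[OF i[OF dT]])
   show "integrable lborel (\<lambda>x. \<epsilon> * (grad_powr p (w k) x + grad_powr p (w l) x)
   + C * ((grad_powr p (w k) x + grad_powr p (w l) x) / 2 - grad_powr p ?m x))"
    by (intro Bochner_Integration.integrable_add Bochner_Integration.integrable_diff integrable_mult_right integrable_divide i wT mT)
   fix x
   have "gradient ?m x = (1/2) *\<^sub>R (gradient (w k) x + gradient (w l) x)"
    unfolding gradient_cmult[OF T_differentiable[OF test_functions_add[OF wT wT]]]
     gradient_add[OF T_differentiable[OF wT] T_differentiable[OF wT]] ..
   then show "grad_powr p (\<lambda>x. w k x - w l x) x \<le> \<epsilon> * (grad_powr p (w k) x + grad_powr p (w l) x)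
   + C * ((grad_powr p (w k) x + grad_powr p (w l) x) / 2 - grad_powr p ?m x)"
    unfolding gradient_diff[OF T_differentiable[OF wT] T_differentiable[OF wT]] by (simp only: uc)
  qed
  also have "... = \<epsilon> * (energy p (w k) + energy p (w l)) + C * ((energy p (w k) + energy p (w l)) / 2 - energy p ?m)"
   unfolding energy_def using i[OF wT[of k]] i[OF wT[of l]] i[OF mT]
   by (simp add: Bochner_Integration.integral_add Bochner_Integration.integral_diff)
  also have "... \<le> \<epsilon> * (1 + 1) + C * ((1 + 1) / 2 - \<mu>)"
   using \<epsilon> C Em wE[of k] wE[of l] by (intro add_mono mult_left_mono diff_mono divide_right_mono) auto
  also have "... < e" using \<mu> by (simp add: \<epsilon>_def)
  finally show "energy p (\<lambda>x. w k x - w l x) < e" .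
 qed
qed

end

section \<open>Completeness in the mean of order \<open>p\<close>\<close>

abbreviation (input) tail_le :: "(nat \<Rightarrow> ennreal) \<Rightarrow> real \<Rightarrow> bool" where "tail_le a e \<equiv> \<exists>N. \<forall>k\<ge>N. a k \<le> ennreal e"

lemma fast_subsequence:
 assumes "\<And>j. \<exists>N. \<forall>k\<ge>N. \<forall>l\<ge>N. P j k l"
 shows "\<exists>r :: nat \<Rightarrow> nat. strict_mono r \<and> (\<forall>j. \<forall>k\<ge>r j. \<forall>l\<ge>r j. P j k l)"
proof -
 obtain N where N: "\<And>j k l. k \<ge> N j \<Longrightarrow> l \<ge> N j \<Longrightarrow> P j k l" using assms by metis
 \<comment> \<open>Summing the thresholds gives strict growth and domination of each
   \<open>N j\<close> at once.\<close>
 define r where "r j = (\<Sum>i\<le>j. Suc (N i))" for j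
 have "strict_mono r" by (rule strict_monoI_Suc) (simp add: r_def)
 moreover have "N j \<le> r j" for j using member_le_sum[of j "{..j}" "\<lambda>i. Suc (N i)"] by (simp add: r_def)
 ultimately show ?thesis using N by (meson order.trans)
qed

text \<open>Along a fast subsequence the increments, even multiplied by \<open>2 ^ j\<close>, have
  summable integrals of \<open>p\<close>-th powers. Almost everywhere they are then at most a
  constant times \<open>(1/2) ^ j\<close>, so the telescoping series converges absolutely. This
  route uses no triangle inequality for the norm and works for every \<open>p > 0\<close>; Fatou's
  lemma gives convergence of the whole sequence.\<close>

lemma Lp_complete:
 fixes f :: "nat \<Rightarrow> 'a \<Rightarrow> 'b::euclidean_space"
 assumes f: "\<And>k. f k \<in> borel_measurable M" and p: "p > 0"
  and C: "\<And>e. e > 0 \<Longrightarrow> \<exists>N. \<forall>k\<ge>N. \<forall>l\<ge>N. (\<integral>\<^sup>+x. ennreal (norm (f k x - f l x) powr p) \<partial>M) \<le> ennreal e"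
 obtains g r where "g \<in> borel_measurable M" "strict_mono r" "AE x in M. (\<lambda>k. f (r k) x) \<longlonglongrightarrow> g x"
  "\<And>e. e > 0 \<Longrightarrow> tail_le (\<lambda>k. \<integral>\<^sup>+x. ennreal (norm (f k x - g x) powr p) \<partial>M) e"
proof -
 note [measurable] = f
 have "\<exists>N. \<forall>k\<ge>N. \<forall>l\<ge>N. (\<integral>\<^sup>+x. ennreal (norm (f k x - f l x) powr p) \<partial>M) \<le> ennreal ((1/2) ^ j * (1/2 ^ j) powr p)" for j
  by (rule C) simp
 then obtain r where r: "strict_mono r"
  "\<And>j k l. k \<ge> r j \<Longrightarrow> l \<ge> r j \<Longrightarrow> (\<integral>\<^sup>+x. ennreal (norm (f k x - f l x) powr p) \<partial>M) \<le> ennreal ((1/2) ^ j * (1/2 ^ j) powr p)"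
  using fast_subsequence[of "\<lambda>j k l. (\<integral>\<^sup>+x. ennreal (norm (f k x - f l x) powr p) \<partial>M) \<le> ennreal ((1/2) ^ j * (1/2 ^ j) powr p)"]
  by blast
 define h where "h j x = norm (f (r (Suc j)) x - f (r j) x)" for j x
 have [measurable]: "h j \<in> borel_measurable M" for j unfolding h_def[abs_def] by measurable
 have hj: "(\<integral>\<^sup>+x. ennreal ((2 ^ j) powr p * h j x powr p) \<partial>M) \<le> ennreal ((1/2) ^ j)" for j
 proof -
  have "(\<integral>\<^sup>+x. ennreal ((2 ^ j) powr p * h j x powr p) \<partial>M) = ennreal ((2 ^ j) powr p) * (\<integral>\<^sup>+x. ennreal (h j x powr p) \<partial>M)"
   by (simp add: ennreal_mult' nn_integral_cmult)
  also have "... \<le> ennreal ((2 ^ j) powr p) * ennreal ((1/2) ^ j * (1/2 ^ j) powr p)"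
   unfolding h_def using r(1) by (intro mult_left_mono r(2)) (auto simp: strict_mono_less_eq)
  also have "... = ennreal ((1/2) ^ j)" by (simp add: powr_divide flip: ennreal_mult)
  finally show ?thesis .
 qed
 have "(\<integral>\<^sup>+x. (\<Sum>j. ennreal ((2 ^ j) powr p * h j x powr p)) \<partial>M) = (\<Sum>j. \<integral>\<^sup>+x. ennreal ((2 ^ j) powr p * h j x powr p) \<partial>M)"
  by (rule nn_integral_suminf) measurable
 also have "... \<le> (\<Sum>j. ennreal ((1/2) ^ j))" by (intro suminf_le hj) auto
 also have "... = ennreal (\<Sum>j. (1/2) ^ j)" by (rule suminf_ennreal2) (auto intro: summable_geometric)
 finally have "(\<integral>\<^sup>+x. (\<Sum>j. ennreal ((2 ^ j) powr p * h j x powr p)) \<partial>M) \<noteq> \<infinity>" by (auto simp: top_unique)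
 then have "AE x in M. (\<Sum>j. ennreal ((2 ^ j) powr p * h j x powr p)) \<noteq> \<infinity>" by (intro nn_integral_PInf_AE) measurable
 then have conv: "AE x in M. convergent (\<lambda>j. f (r j) x)"
 proof eventually_elim
  fix x assume fin: "(\<Sum>j. ennreal ((2 ^ j) powr p * h j x powr p)) \<noteq> \<infinity>"
  define A where "A = enn2real (\<Sum>j. ennreal ((2 ^ j) powr p * h j x powr p))"
  have hle: "h j x \<le> A powr (1/p) * (1/2) ^ j" for j
  proof -
   have "ennreal ((2 ^ j) powr p * h j x powr p) = (\<Sum>j\<in>{j}. ennreal ((2 ^ j) powr p * h j x powr p))" by simp
   also have "... \<le> (\<Sum>j. ennreal ((2 ^ j) powr p * h j x powr p))" by (rule sum_le_suminf) auto
   also have "... = ennreal A" using fin by (simp add: A_def less_top)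
   finally have "(2 ^ j * h j x) powr p \<le> A" by (simp add: powr_mult A_def ennreal_le_iff h_def)
   then have "((2 ^ j * h j x) powr p) powr (1/p) \<le> A powr (1/p)" using p by (intro powr_mono2) auto
   then show ?thesis using p by (simp add: powr_powr h_def field_simps)
  qed
  have "summable (\<lambda>j. A powr (1/p) * (1/2) ^ j)" by (intro summable_mult summable_geometric) simp
  then have "summable (\<lambda>j. h j x)" by (rule summable_comparison_test') (use hle in \<open>auto simp: h_def\<close>)
  then have "summable (\<lambda>j. f (r (Suc j)) x - f (r j) x)" unfolding h_def by (rule summable_norm_cancel)
  then have "convergent (\<lambda>n. \<Sum>j<n. f (r (Suc j)) x - f (r j) x)" by (simp add: summable_iff_convergent)
  then have "convergent (\<lambda>n. f (r n) x - f (r 0) x)" by (simp add: sum_lessThan_telescope[of "\<lambda>j. f (r j) x"])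
  then have "convergent (\<lambda>n. (f (r n) x - f (r 0) x) + f (r 0) x)" by (intro convergent_add convergent_const)
  then show "convergent (\<lambda>j. f (r j) x)" by simp
 qed
 define g where "g x = lim (\<lambda>j. f (r j) x)" for x
 have g[measurable]: "g \<in> borel_measurable M" unfolding g_def[abs_def] by (rule borel_measurable_lim_metric) measurable
 have lim: "AE x in M. (\<lambda>k. f (r k) x) \<longlonglongrightarrow> g x" using conv by eventually_elim (simp add: g_def convergent_LIMSEQ_iff)
 show ?thesis
 proof (rule that[OF g r(1) lim])
  fix e :: real assume "e > 0"
  from C[OF this] obtain N where N: "\<And>k l. k \<ge> N \<Longrightarrow> l \<ge> N \<Longrightarrow> (\<integral>\<^sup>+x. ennreal (norm (f k x - f l x) powr p) \<partial>M) \<le> ennreal e"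
   by blast
  have "(\<integral>\<^sup>+x. ennreal (norm (f k x - g x) powr p) \<partial>M) \<le> ennreal e" if k: "k \<ge> N" for k
  proof -
   have "(\<integral>\<^sup>+x. ennreal (norm (f k x - g x) powr p) \<partial>M) = (\<integral>\<^sup>+x. liminf (\<lambda>j. ennreal (norm (f k x - f (r j) x) powr p)) \<partial>M)"
   proof (rule nn_integral_cong_AE)
    show "AE x in M. ennreal (norm (f k x - g x) powr p) = liminf (\<lambda>j. ennreal (norm (f k x - f (r j) x) powr p))"
     using lim
    proof eventually_elim
     fix x assume "(\<lambda>j. f (r j) x) \<longlonglongrightarrow> g x"
     then have "(\<lambda>j. norm (f k x - f (r j) x) powr p) \<longlonglongrightarrow> norm (f k x - g x) powr p"
      using p by (intro tendsto_powr' tendsto_intros) auto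
     then show "ennreal (norm (f k x - g x) powr p) = liminf (\<lambda>j. ennreal (norm (f k x - f (r j) x) powr p))"
      by (intro lim_imp_Liminf[symmetric] tendsto_ennrealI) auto
    qed
   qed
   also have "... \<le> liminf (\<lambda>j. \<integral>\<^sup>+x. ennreal (norm (f k x - f (r j) x) powr p) \<partial>M)"
    by (rule nn_integral_liminf) measurable
   also have "... \<le> liminf (\<lambda>j. ennreal e)"
    by (rule Liminf_mono) (auto simp: eventually_sequentially intro!: exI[of _ N] N[OF k] order.trans[OF _ seq_suble[OF r(1)]])
   finally show ?thesis by (simp add: Liminf_const)
  qed
  then show "tail_le (\<lambda>k. \<integral>\<^sup>+x. ennreal (norm (f k x - g x) powr p) \<partial>M) e" by blast
 qed
qed

section \<open>Positivity of the limit\<close>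

text \<open>A power \<open>N \<ge> p\<close> of the cutoff: its gradient keeps \<open>N - 1\<close>
  factors, and \<open>(N - 1) * p \<ge> N * (p - 1)\<close>. The resulting bound lets the gradient
  of \<open>\<theta>\<close> absorb the factor \<open>\<theta> powr (1 - p)\<close> that arises in
  \<open>log_perturbation_pointwise\<close>.\<close>

lemma cutoff_powr:
 fixes c :: "'a::euclidean_space"
 assumes r: "r > 0" and p: "p > 1"
 obtains \<theta> :: "'a \<Rightarrow> real" and M where "\<And>k. C_class k \<theta>" "\<And>x. 0 \<le> \<theta> x" "\<And>x. \<theta> x \<le> 1" "\<And>x. x \<in> ball c r \<Longrightarrow> \<theta> x = 1"
  "\<And>x. x \<notin> cball c (2 * r) \<Longrightarrow> \<theta> x = 0" "M \<ge> 0" "\<And>x. grad_powr p \<theta> x \<le> M * \<theta> x powr (p - 1)"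
proof -
 define N where "N = nat \<lceil>p\<rceil>"
 have N: "real N \<ge> p" unfolding N_def by linarith
 with p obtain j where j: "N = Suc j" "j \<ge> 1" by (cases N) auto
 let ?f = "cutoff_at c r" and ?\<theta> = "\<lambda>x. cutoff_at c r x ^ N"
 obtain b where b: "b \<ge> 0" "\<And>x :: 'a. norm (gradient cutoff x) \<le> b" using bounded_gradient_cutoff[where 'a='a] by blast
 show ?thesis
 proof (rule that[of ?\<theta> "(real N * (b / r)) powr p"])
  fix x
  have f: "0 \<le> ?f x" "?f x \<le> 1" by (rule cutoff_at_range)+
  show "0 \<le> ?\<theta> x" "?\<theta> x \<le> 1" using f by (auto intro: power_le_one)
  have "gradient ?\<theta> x = (real N * ?f x ^ j) *\<^sub>R gradient ?f x"
   by (rule gradient_compose[OF C_class_differentiable[OF C_class_cutoff_at]]) (use DERIV_pow[of N "?f x"] in \<open>simp add: j\<close>)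
  then have "norm (gradient ?\<theta> x) = real N * ?f x ^ j * norm (gradient ?f x)" using f by simp
  also have "... \<le> real N * ?f x ^ j * (b / r)"
   using f gradient_cutoff_at_le[OF b(2) r, of c x] by (intro mult_left_mono) auto
  finally have "grad_powr p ?\<theta> x \<le> ((real N * (b / r)) * ?f x ^ j) powr p"
   using p by (intro powr_mono2) (auto simp: mult_ac)
  also have "... = (real N * (b / r)) powr p * (?f x ^ j) powr p" by (rule powr_mult)
  also have "(?f x ^ j) powr p \<le> ?\<theta> x powr (p - 1)"
  proof (cases "?f x = 0")
   case False
   then have f0: "?f x > 0" using f by simp
   have "(?f x ^ j) powr p = ?f x powr (real j * p)" using f0 by (simp add: powr_powr flip: powr_realpow)
   also have "... \<le> ?f x powr (real N * (p - 1))" using f N j f0 by (intro powr_mono') (auto simp: algebra_simps)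
   also have "... = ?\<theta> x powr (p - 1)" using f0 by (simp add: powr_powr flip: powr_realpow)
   finally show ?thesis .
  qed (use j in simp)
  finally show "grad_powr p ?\<theta> x \<le> (real N * (b / r)) powr p * ?\<theta> x powr (p - 1)" by (simp add: mult_left_mono)
 next
  show "C_class k ?\<theta>" for k by (intro C_class_power C_class_cutoff_at)
  show "?\<theta> x = 1" if "x \<in> ball c r" for x using that r by (simp add: cutoff_at_1)
  show "?\<theta> x = 0" if "x \<notin> cball c (2 * r)" for x using that r by (simp add: cutoff_at_0 j)
 qed simp
qed

text \<open>\<open>convex_powr_add\<close> with the same \<open>s\<close> that multiplies
  \<open>g\<close>: the first term keeps the factor \<open>1 - s\<close>, and in the second all
  powers of \<open>v\<close> and \<open>\<theta>\<close> cancel. This cancellation singles out the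
  exponent \<open>1 - p\<close> and the form of the bound on \<open>norm h\<close>.\<close>

lemma log_perturbation_pointwise:
 fixes g h :: "'a::real_normed_vector"
 assumes p: "p > 1" and v: "v > 0" and t: "t > 0" and th: "0 \<le> \<theta>" and M: "norm h powr p \<le> M * \<theta> powr (p - 1)" and M0: "M \<ge> 0"
  and s_def: "s = (p - 1) * t * \<theta> * v powr (- p)" and s1: "s < 1"
 shows "norm ((1 - s) *\<^sub>R g + (t * v powr (1 - p)) *\<^sub>R h) powr p
  \<le> (1 - s) * norm g powr p + t * ((p - 1) powr (1 - p) * M)"
proof (cases "\<theta> = 0")
 case True
 then have "norm h powr p \<le> 0" using M p by simp
 then have "h = 0" by simp
 then show ?thesis using True t M0 by (simp add: s_def)
next
 case False
 then have th: "\<theta> > 0" using th by simp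
 have s: "s > 0" using th p t v by (simp add: s_def)
 let ?A = "t * v powr (1 - p)"
 let ?B = "t * v powr (1 - p) * norm h"
 let ?C = "s powr (1 - p) * ?A powr p * (M * \<theta> powr (p - 1))"
 have "norm ((1 - s) *\<^sub>R g + ?A *\<^sub>R h) \<le> (1 - s) * norm g + ?B"
  using norm_triangle_ineq[of "(1 - s) *\<^sub>R g" "?A *\<^sub>R h"] s1 t by simp
 then have "norm ((1 - s) *\<^sub>R g + ?A *\<^sub>R h) powr p \<le> ((1 - s) * norm g + ?B) powr p"
  using p by (intro powr_mono2) auto
 also have "... \<le> (1 - s) powr (1 - p) * ((1 - s) * norm g) powr p + s powr (1 - p) * ?B powr p"
  using s s1 p t by (intro convex_powr_add) auto
 also have "(1 - s) powr (1 - p) * ((1 - s) * norm g) powr p = (1 - s) * norm g powr p"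
 proof -
  have "(1 - s) powr (1 - p) * (1 - s) powr p = 1 - s" using s1 by (simp flip: powr_add)
  then show ?thesis by (simp only: powr_mult mult.assoc[symmetric])
 qed
 also have "s powr (1 - p) * ?B powr p \<le> ?C"
  using M by (simp add: powr_mult mult_left_mono mult.assoc)
 also have "?C = t * ((p - 1) powr (1 - p) * M)"
 proof -
  have 1: "s powr (1 - p) = (p - 1) powr (1 - p) * t powr (1 - p) * \<theta> powr (1 - p) * v powr (- p * (1 - p))"
   by (simp only: s_def powr_mult powr_powr)
  have 2: "?A powr p = t powr p * v powr ((1 - p) * p)" by (simp only: powr_mult powr_powr)
  have 3: "t powr (1 - p) * t powr p = t" "\<theta> powr (1 - p) * \<theta> powr (p - 1) = 1" "v powr (- p * (1 - p)) * v powr ((1 - p) * p) = 1"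
   using t th v by (simp_all flip: powr_add)
  have "s powr (1 - p) * ?A powr p * (M * \<theta> powr (p - 1))
   = (p - 1) powr (1 - p) * M * (t powr (1 - p) * t powr p) * (\<theta> powr (1 - p) * \<theta> powr (p - 1)) * (v powr (- p * (1 - p)) * v powr ((1 - p) * p))"
   unfolding 1 2 by (simp only: mult_ac)
  then show ?thesis unfolding 3 by (simp only: mult_1_right mult_ac)
 qed
 finally show ?thesis by simp
qed

context hs_problem
begin

text \<open>The perturbed function \<open>a\<close> has at least the mass of \<open>u\<close>, so by
  \<open>mass_le\<close> its energy is at least \<open>(mass UNIV u / sharp) powr (p/q)\<close>. On
  the other hand that energy is at most the energy of \<open>u\<close>, less the integral of
  \<open>s x * grad_powr p u x\<close>, plus a multiple of \<open>t\<close>. The constant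
  \<open>A\<close> is chosen before \<open>\<epsilon>\<close>, and for fixed
  \<open>\<epsilon>\<close> the other term vanishes along a maximising sequence.\<close>

lemma log_energy_bound:
 assumes r: "r > 0" and B: "cball c (2 * r) \<subseteq> \<Omega>"
 shows "\<exists>A\<ge>0. \<forall>u \<epsilon>. u \<in> T \<longrightarrow> (\<forall>x. u x \<ge> 0) \<longrightarrow> energy p u \<le> 1 \<longrightarrow> \<epsilon> > 0 \<longrightarrow>
  (\<integral>x\<in>ball c r. grad_powr p (\<lambda>x. ln (u x + \<epsilon>)) x)
   \<le> ennreal (A + 2 * \<epsilon> powr (- p) * (1 - (mass UNIV u / sharp) powr (p/q)))"
proof -
 obtain \<theta> :: "'a \<times> 'b \<Rightarrow> real" and M where \<theta>: "\<And>k. C_class k \<theta>" "\<And>x. 0 \<le> \<theta> x" "\<And>x. \<theta> x \<le> 1" "\<And>x. x \<in> ball c r \<Longrightarrow> \<theta> x = 1"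
  "\<And>x. x \<notin> cball c (2 * r) \<Longrightarrow> \<theta> x = 0" and M: "M \<ge> 0" "\<And>x. grad_powr p \<theta> x \<le> M * \<theta> x powr (p - 1)"
  using cutoff_powr[OF r p1, where c=c] by blast
 have \<theta>T: "\<theta> \<in> T" by (rule test_functionsI[OF \<theta>(1) compact_cball B \<theta>(5)])
 have \<theta>m[measurable]: "\<theta> \<in> Borel" by (rule T_measurable[OF \<theta>T])
 define H where "H = (p - 1) powr (1 - p) * M"
 have H: "H \<ge> 0" using M(1) by (simp add: H_def)
 define L where "L = measure lborel (cball c (2 * r))"
 have iL: "integrable lborel (indicator (cball c (2 * r)) :: 'a \<times> 'b \<Rightarrow> real)"
  by (rule integrable_real_indicator) (use emeasure_bounded_finite[OF bounded_cball] in auto)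
 show ?thesis
 proof (intro exI[of _ "H * L / (p - 1)"] conjI allI impI)
  show "0 \<le> H * L / (p - 1)" using H p1 by (simp add: L_def)
  fix u \<epsilon> assume u: "u \<in> T" "\<forall>x. u x \<ge> 0" and E: "energy p u \<le> 1" and \<epsilon>: "\<epsilon> > (0::real)"
  have [measurable]: "u \<in> Borel" "gradient u \<in> Borel" using u T_measurable T_gradient_measurable by auto
  define v where "v x = u x + \<epsilon>" for x
  have v: "v x \<ge> \<epsilon>" "v x > 0" for x using u(2)[rule_format, of x] \<epsilon> by (auto simp: v_def)
  have vC: "C_class k v" for k
   unfolding v_def[abs_def] by (intro C_class_add C_class_const test_functions_smooth[OF u(1)])
  have vd: "v differentiable (at x)" for x by (rule C_class_differentiable[OF vC])
  have gv: "gradient v x = gradient u x" for x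
   unfolding v_def[abs_def] by (subst gradient_add) (auto simp: gradient_const T_differentiable[OF u(1)])
  \<comment> \<open>With this step \<open>v \<ge> \<epsilon>\<close> and
    \<open>\<theta> \<le> 1\<close> give \<open>s \<le> 1/2\<close>. It is proportional to
    \<open>\<epsilon> powr p\<close>, so multiplying the estimate by
    \<open>2 * \<epsilon> powr (- p)\<close> leaves the constant term free of
    \<open>\<epsilon>\<close>.\<close>
  define t where "t = \<epsilon> powr p / (2 * (p - 1))"
  have t: "t > 0" using \<epsilon> p1 by (simp add: t_def)
  define s where "s x = (p - 1) * t * \<theta> x * v x powr (- p)" for x
  have s_eq: "s x = \<epsilon> powr p / 2 * (\<theta> x * v x powr (- p))" for x
  proof -
   have "X * (y / (2 * X)) = y / 2" if "X > 0" for X y :: real using that by simp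
   from this[of "p - 1"] have "(p - 1) * t = \<epsilon> powr p / 2" using p1 by (simp add: t_def)
   then show ?thesis unfolding s_def by (simp only: mult.assoc[symmetric])
  qed
  have s1: "s x < 1" for x
  proof -
   have "v x powr (- p) \<le> \<epsilon> powr (- p)" using v[of x] \<epsilon> p0 by (intro powr_mono2') auto
   then have "\<theta> x * v x powr (- p) \<le> 1 * \<epsilon> powr (- p)" using \<theta> by (intro mult_mono) auto
   then have "s x \<le> \<epsilon> powr p / 2 * (1 * \<epsilon> powr (- p))" unfolding s_eq by (intro mult_left_mono) auto
   also have "... = 1 / 2" using \<epsilon> by (simp add: powr_minus)
   finally show ?thesis by simp
  qed
  define a where "a x = u x + t * (v x powr (1 - p) * \<theta> x)" for x
  have pT: "(\<lambda>x. v x powr (1 - p) * \<theta> x) \<in> T" by (intro test_functions_mult C_class_powr vC v \<theta>T)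
  have aT: "a \<in> T" unfolding a_def[abs_def] by (intro test_functions_add test_functions_cmult u pT)
  have gpow: "gradient (\<lambda>x. v x powr (1 - p)) x = ((1 - p) * v x powr (- p)) *\<^sub>R gradient u x" for x
  proof -
   have "((\<lambda>y. y powr (1 - p)) has_real_derivative (1 - p) * v x powr (- p)) (at (v x))"
    using v(2)[of x] by (auto intro!: derivative_eq_intros)
   from gradient_compose[OF vd this] show ?thesis by (simp only: gv)
  qed
  have ga: "gradient a x = (1 - s x) *\<^sub>R gradient u x + (t * v x powr (1 - p)) *\<^sub>R gradient \<theta> x" for x
  proof -
   have "gradient a x = gradient u x + t *\<^sub>R (v x powr (1 - p) *\<^sub>R gradient \<theta> x + \<theta> x *\<^sub>R ((1 - p) * v x powr (- p)) *\<^sub>R gradient u x)"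
    unfolding a_def[abs_def] gpow[symmetric]
    by (subst gradient_add[OF T_differentiable[OF u(1)] T_differentiable[OF test_functions_cmult[OF pT]]],
      subst gradient_cmult[OF T_differentiable[OF pT]],
      subst gradient_mult[OF C_class_differentiable[OF C_class_powr[OF vC v(2)]] T_differentiable[OF \<theta>T]]) (rule refl)
   then show ?thesis by (simp add: s_def algebra_simps)
  qed
  have pt: "grad_powr p a x \<le> grad_powr p u x - s x * grad_powr p u x + t * H * indicator (cball c (2 * r)) x" for x
  proof (cases "x \<in> cball c (2 * r)")
   case True
   have "grad_powr p a x \<le> (1 - s x) * grad_powr p u x + t * H"
    unfolding ga H_def by (rule log_perturbation_pointwise[OF p1 v(2) t \<theta>(2) M(2) M(1) s_def s1])
   then show ?thesis using True by (simp add: algebra_simps)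
  next
   case False
   then have "\<theta> x = 0" by (rule \<theta>(5))
   moreover from this have "grad_powr p \<theta> x \<le> 0" using M(2)[of x] p1 by simp
   then have "gradient \<theta> x = 0" by simp
   ultimately show ?thesis using False unfolding ga by (simp add: s_def)
  qed
  note iu = integrable_energy[OF u(1)]
  have [measurable]: "s \<in> Borel" unfolding s_def[abs_def] v_def[abs_def] by measurable
  have ise: "integrable lborel (\<lambda>x. s x * grad_powr p u x)"
  proof (rule Bochner_Integration.integrable_bound[OF iu])
   have "s x * grad_powr p u x \<le> 1 * grad_powr p u x" for x using s1[of x] by (intro mult_right_mono) auto
   moreover have "s x \<ge> 0" for x using \<theta>(2) by (simp add: s_eq)
   ultimately show "AE x in lborel. norm (s x * grad_powr p u x) \<le> norm (grad_powr p u x)" by simp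
  qed measurable
  define X where "X = (mass UNIV u / sharp) powr (p/q)"
  let ?D = "2 * \<epsilon> powr (- p) * (LINT x|lborel. s x * grad_powr p u x)"
  have "mass UNIV u \<le> mass UNIV a" unfolding mass_def LINT_def indicator_UNIV scaleR_one
  proof (rule integral_mono[OF integrable_mass[OF u(1)] integrable_mass[OF aT]])
   fix x
   have "0 \<le> u x" "u x \<le> a x" using u(2)[rule_format, of x] t \<theta>(2)[of x] by (auto simp: a_def)
   then show "dens x (u x) \<le> dens x (a x)" using q0 by (intro mult_left_mono powr_mono2) auto
  qed
  also have "... \<le> sharp * energy p a powr (q/p)" by (rule mass_le[OF aT])
  finally have "mass UNIV u / sharp \<le> energy p a powr (q/p)" using sharp_pos by (simp add: pos_divide_le_eq mult.commute)
  then have "X \<le> (energy p a powr (q/p)) powr (p/q)" unfolding X_def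
   using p0 q0 sharp_pos mass_nonneg[of UNIV u] by (intro powr_mono2) auto
  also have "... = energy p a" using p0 q0 by (simp add: powr_powr energy_nonneg)
  also have "... \<le> (LINT x|lborel. grad_powr p u x - s x * grad_powr p u x + t * H * indicator (cball c (2 * r)) x)"
   unfolding energy_def by (rule integral_mono[OF integrable_energy[OF aT] _ pt])
    (intro Bochner_Integration.integrable_add Bochner_Integration.integrable_diff iu ise integrable_mult_right iL)
  also have "... = energy p u - (LINT x|lborel. s x * grad_powr p u x) + t * H * L"
   unfolding energy_def L_def using iu ise iL
   by (simp add: Bochner_Integration.integral_add Bochner_Integration.integral_diff)
  finally have "(LINT x|lborel. s x * grad_powr p u x) \<le> 1 - X + t * H * L" using E by simp
  then have "?D \<le> 2 * \<epsilon> powr (- p) * (1 - X + t * H * L)"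
   by (rule mult_left_mono) simp
  also have "2 * \<epsilon> powr (- p) * (1 - X + t * H * L) = H * L / (p - 1) + 2 * \<epsilon> powr (- p) * (1 - X)"
  proof -
   have "2 * \<epsilon> powr (- p) * t = 1 / (p - 1)" using \<epsilon> p1 by (simp add: t_def powr_minus field_simps)
   then have "2 * \<epsilon> powr (- p) * t * (H * L) = H * L / (p - 1)" by simp
   then show ?thesis by (simp only: distrib_left mult_ac add_ac)
  qed
  finally have le: "?D \<le> H * L / (p - 1) + 2 * \<epsilon> powr (- p) * (1 - X)" .
  have gl: "gradient (\<lambda>x. ln (u x + \<epsilon>)) x = (1 / v x) *\<^sub>R gradient u x" for x
  proof -
   have "gradient (\<lambda>x. ln (v x)) x = (1 / v x) *\<^sub>R gradient v x"
    using v(2)[of x] by (intro gradient_compose[OF vd]) (auto intro!: derivative_eq_intros)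
   then show ?thesis by (simp only: gv v_def)
  qed
  let ?C = "ennreal (H * L / (p - 1) + 2 * \<epsilon> powr (- p) * (1 - (mass UNIV u / sharp) powr (p/q)))"
  have "(\<integral>x\<in>ball c r. grad_powr p (\<lambda>x. ln (u x + \<epsilon>)) x) \<le> (\<integral>x. 2 * \<epsilon> powr (- p) * (s x * grad_powr p u x))"
  proof (rule nn_integral_mono)
   fix x
   let ?A = "grad_powr p (\<lambda>x. ln (u x + \<epsilon>)) x"
   let ?B = "2 * \<epsilon> powr (- p) * (s x * grad_powr p u x)"
   have "?A = ?B" if "x \<in> ball c r"
   proof -
    have "?A = v x powr (- p) * grad_powr p u x"
     unfolding gl using v(2)[of x] by (simp add: powr_mult powr_divide powr_minus field_simps)
    also have "... = ?B"
     unfolding s_eq \<theta>(4)[OF that] using \<epsilon> by (simp add: powr_minus)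
    finally show ?thesis .
   qed
   then show "ennreal ?A * indicator (ball c r) x
    \<le> ennreal ?B" by (cases "x \<in> ball c r") auto
  qed
  also have "... = ennreal (LINT x|lborel. 2 * \<epsilon> powr (- p) * (s x * grad_powr p u x))"
   using \<theta>(2) by (intro nn_integral_eq_integral integrable_mult_right ise) (auto simp: s_eq)
  also have "... \<le> ?C"
   using le by (intro ennreal_leI) (simp add: X_def)
  finally show "(\<integral>x\<in>ball c r. grad_powr p (\<lambda>x. ln (u x + \<epsilon>)) x)
   \<le> ?C" .
 qed
qed

end

text \<open>A triangle inequality in the mean without taking roots; the factor in front of the
  integral of \<open>g\<close> approaches 1 with small \<open>s\<close>.\<close>

lemma nn_integral_convex_add:
 fixes f g :: "'a \<Rightarrow> 'b::euclidean_space"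
 assumes [measurable]: "f \<in> borel_measurable M" "g \<in> borel_measurable M" and p: "p \<ge> 1" and s: "0 < s" "s < 1"
 shows "(\<integral>\<^sup>+x. ennreal (norm (f x) powr p) \<partial>M) \<le> ennreal ((1 - s) powr (1 - p)) * (\<integral>\<^sup>+x. ennreal (norm (g x) powr p) \<partial>M)
  + ennreal (s powr (1 - p)) * (\<integral>\<^sup>+x. ennreal (norm (f x - g x) powr p) \<partial>M)"
proof -
 have "norm (f x) powr p \<le> (1 - s) powr (1 - p) * norm (g x) powr p + s powr (1 - p) * norm (f x - g x) powr p" for x
 proof -
  have "norm (f x) powr p \<le> (norm (g x) + norm (f x - g x)) powr p"
   using p norm_triangle_sub[of "f x" "g x"] by (intro powr_mono2) auto
  also have "... \<le> (1 - s) powr (1 - p) * norm (g x) powr p + s powr (1 - p) * norm (f x - g x) powr p"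
   using s p by (intro convex_powr_add) auto
  finally show ?thesis .
 qed
 then have "(\<integral>\<^sup>+x. ennreal (norm (f x) powr p) \<partial>M)
  \<le> (\<integral>\<^sup>+x. ennreal ((1 - s) powr (1 - p)) * ennreal (norm (g x) powr p) + ennreal (s powr (1 - p)) * ennreal (norm (f x - g x) powr p) \<partial>M)"
  by (intro nn_integral_mono) (simp add: ennreal_leI flip: ennreal_mult ennreal_plus)
 also have "... = ennreal ((1 - s) powr (1 - p)) * (\<integral>\<^sup>+x. ennreal (norm (g x) powr p) \<partial>M)
  + ennreal (s powr (1 - p)) * (\<integral>\<^sup>+x. ennreal (norm (f x - g x) powr p) \<partial>M)"
  by (simp add: nn_integral_add nn_integral_cmult)
 finally show ?thesis .
qed

text \<open>\<open>nn_integral_convex_add\<close> in both directions: first the difference tends to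
  0 for fixed \<open>s\<close>, then \<open>s\<close> tends to 0.\<close>

lemma Lp_norm_tendsto:
 fixes f :: "nat \<Rightarrow> 'a \<Rightarrow> 'b::euclidean_space"
 assumes [measurable]: "\<And>k. f k \<in> borel_measurable M" "g \<in> borel_measurable M" and p: "p \<ge> 1"
  and L: "\<And>e. e > 0 \<Longrightarrow> tail_le (\<lambda>k. \<integral>\<^sup>+x. ennreal (norm (f k x - g x) powr p) \<partial>M) e"
  and a: "\<And>k. a k \<ge> 0" "\<And>k. (\<integral>\<^sup>+x. ennreal (norm (f k x) powr p) \<partial>M) = ennreal (a k)"
 shows "\<exists>b\<ge>0. (\<integral>\<^sup>+x. ennreal (norm (g x) powr p) \<partial>M) = ennreal b \<and> a \<longlonglongrightarrow> b"
proof -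
 let ?D = "\<lambda>k. \<integral>\<^sup>+x. ennreal (norm (f k x - g x) powr p) \<partial>M"
 let ?X = "\<integral>\<^sup>+x. ennreal (norm (g x) powr p) \<partial>M"
 have up: "ennreal (a k) \<le> ennreal ((1 - s) powr (1 - p)) * ?X + ennreal (s powr (1 - p)) * ?D k"
  and lo: "?X \<le> ennreal ((1 - s) powr (1 - p)) * ennreal (a k) + ennreal (s powr (1 - p)) * ?D k"
  if "0 < s" "s < 1" for s k
  using nn_integral_convex_add[of "f k" M g p s] nn_integral_convex_add[of g M "f k" p s] p that
  by (simp_all add: a norm_minus_commute)
 obtain N where N: "?D N \<le> ennreal 1" using L[of 1] by auto
 have "?X \<le> ennreal ((1 - 1/2) powr (1 - p)) * ennreal (a N) + ennreal ((1/2) powr (1 - p)) * ?D N" by (rule lo) auto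
 also have "... < top" using N by (auto simp: ennreal_mult_less_top intro: le_less_trans)
 finally have "?X < top" .
 define b where "b = enn2real ?X"
 have b: "b \<ge> 0" "?X = ennreal b" using \<open>?X < top\<close> by (auto simp: b_def)
 have up': "a k \<le> (1 - s) powr (1 - p) * b + s powr (1 - p) * e"
  and lo': "b \<le> (1 - s) powr (1 - p) * a k + s powr (1 - p) * e"
  if "0 < s" "s < 1" "e \<ge> 0" "?D k \<le> ennreal e" for s k e
 proof -
  have D: "ennreal (s powr (1 - p)) * ?D k \<le> ennreal (s powr (1 - p)) * ennreal e"
   by (intro mult_left_mono that) auto
  have "ennreal (a k) \<le> ennreal ((1 - s) powr (1 - p) * b + s powr (1 - p) * e)"
   using order.trans[OF up[of s k] add_left_mono[OF D]] that b a by (simp flip: ennreal_mult ennreal_plus)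
  then show "a k \<le> (1 - s) powr (1 - p) * b + s powr (1 - p) * e" using b that by (subst (asm) ennreal_le_iff) auto
  have "ennreal b \<le> ennreal ((1 - s) powr (1 - p) * a k + s powr (1 - p) * e)"
   using order.trans[OF lo[of s k] add_left_mono[OF D]] that b a by (simp flip: ennreal_mult ennreal_plus)
  then show "b \<le> (1 - s) powr (1 - p) * a k + s powr (1 - p) * e" using a that by (subst (asm) ennreal_le_iff) auto
 qed
 \<comment> \<open>The tolerance turns the second term of the estimates into exactly
   \<open>s\<close>.\<close>
 have ev: "\<forall>\<^sub>F k in sequentially. ?D k \<le> ennreal (s / s powr (1 - p))" if "s > 0" for s
  using L[of "s / s powr (1 - p)"] that by (auto simp: eventually_sequentially)
 have r: "\<forall>\<^sub>F s::real in at_right 0. 0 < s \<and> s < 1" unfolding eventually_at_right_field by (intro exI[of _ 1]) simp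
 have c: "((\<lambda>s. (1 - s) powr (1 - p)) \<longlongrightarrow> (1 - 0) powr (1 - p)) (at_right (0::real))" by (intro tendsto_intros) auto
 have "a \<longlonglongrightarrow> b"
 proof (rule order_tendstoI)
  fix l assume l: "l < b"
  have "((\<lambda>s. (b - s) / (1 - s) powr (1 - p)) \<longlongrightarrow> (b - 0) / (1 - 0) powr (1 - p)) (at_right (0::real))"
   by (intro tendsto_divide c tendsto_intros) auto
  then have "\<forall>\<^sub>F s in at_right 0. l < (b - s) / (1 - s) powr (1 - p)" using l by (intro order_tendstoD) auto
  with r have "\<forall>\<^sub>F s in at_right 0. l < (b - s) / (1 - s) powr (1 - p) \<and> 0 < s \<and> s < 1" by eventually_elim simp
  then obtain s where s: "l < (b - s) / (1 - s) powr (1 - p)" "0 < s" "s < 1"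
   using eventually_happens'[OF trivial_limit_at_right_real] by blast
  show "\<forall>\<^sub>F k in sequentially. l < a k" using ev[OF s(2)]
  proof eventually_elim
   fix k assume "?D k \<le> ennreal (s / s powr (1 - p))"
   from lo'[OF s(2,3) _ this] s have "b - s \<le> (1 - s) powr (1 - p) * a k" by simp
   then have "(b - s) / (1 - s) powr (1 - p) \<le> a k" using s by (simp add: pos_divide_le_eq mult.commute)
   then show "l < a k" using s(1) by simp
  qed
 next
  fix l assume l: "b < l"
  have "((\<lambda>s. (1 - s) powr (1 - p) * b + s) \<longlongrightarrow> (1 - 0) powr (1 - p) * b + 0) (at_right (0::real))"
   by (intro tendsto_add tendsto_mult c tendsto_const tendsto_ident_at)
  then have "\<forall>\<^sub>F s in at_right 0. (1 - s) powr (1 - p) * b + s < l" using l by (intro order_tendstoD) auto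
  with r have "\<forall>\<^sub>F s in at_right 0. (1 - s) powr (1 - p) * b + s < l \<and> 0 < s \<and> s < 1" by eventually_elim simp
  then obtain s where s: "(1 - s) powr (1 - p) * b + s < l" "0 < s" "s < 1"
   using eventually_happens'[OF trivial_limit_at_right_real] by blast
  show "\<forall>\<^sub>F k in sequentially. a k < l" using ev[OF s(2)]
  proof eventually_elim
   fix k assume "?D k \<le> ennreal (s / s powr (1 - p))"
   from up'[OF s(2,3) _ this] s show "a k < l" by simp
  qed
 qed
 then show ?thesis using b by blast
qed

section \<open>Zero or positive: the alternative on balls and on connected sets\<close>

lemma nn_integral_oscillation_le:
 fixes f :: "'a::euclidean_space \<Rightarrow> real"
 assumes f: "C_class (Suc 0) f" and p: "p \<ge> 1" and r: "r > 0"
 shows "(\<integral>\<^sup>+x. (\<integral>\<^sup>+y. ennreal (\<bar>f y - f x\<bar> powr p) * (indicator (ball c r) x * indicator (ball c r) y)))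
  \<le> ennreal ((2 * r) powr p * ((2 * r) ^ DIM('a) * measure lborel (ball (0::'a) 1))) * (\<integral>x\<in>ball c r. grad_powr p f x)"
proof -
 have [measurable]: "f \<in> Borel" using f C_class_continuous by (blast intro: borel_measurable_continuous_onI)
 have "(\<integral>\<^sup>+y. ennreal (\<bar>f y - f x\<bar> powr p) * (indicator (ball c r) x * indicator (ball c r) y))
  = (\<integral>\<^sup>+h. ennreal (\<bar>f (x + h) - f x\<bar> powr p) * (indicator (ball c r) x * indicator (ball c r) (x + h)) * indicator (ball 0 (2 * r)) h)" for x
 proof -
  have "(\<integral>\<^sup>+y. ennreal (\<bar>f y - f x\<bar> powr p) * (indicator (ball c r) x * indicator (ball c r) y))
   = (\<integral>\<^sup>+h. ennreal (\<bar>f (x + h) - f x\<bar> powr p) * (indicator (ball c r) x * indicator (ball c r) (x + h)))"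
   by (rule nn_integral_translate[symmetric]) measurable
  also have "... = (\<integral>\<^sup>+h. ennreal (\<bar>f (x + h) - f x\<bar> powr p) * (indicator (ball c r) x * indicator (ball c r) (x + h)) * indicator (ball 0 (2 * r)) h)"
  proof (rule nn_integral_cong)
   fix h
   let ?A = "indicator (ball c r) x * indicator (ball c r) (x + h)"
   have "h \<in> ball 0 (2 * r)" if "x \<in> ball c r" "x + h \<in> ball c r"
    using that dist_triangle2[of "x + h" x c] by (simp add: dist_commute) (simp add: dist_norm)
   then show "ennreal (\<bar>f (x + h) - f x\<bar> powr p) * ?A
    = ennreal (\<bar>f (x + h) - f x\<bar> powr p) * ?A * indicator (ball 0 (2 * r)) h"
    unfolding indicator_def by (cases "x \<in> ball c r"; cases "x + h \<in> ball c r") simp_all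
  qed
  finally show ?thesis .
 qed
 then show ?thesis using nn_integral_double_diff_le[OF f convex_ball _ p, where d="2 * r"] r by simp
qed

text \<open>If \<open>V\<close> vanished on one set of positive measure and were at least
  \<open>\<eta>\<close> on another, the logarithms would differ by at least
  \<open>ln (\<eta> / \<epsilon>)\<close> on their product. That is unbounded as
  \<open>\<epsilon>\<close> tends to 0, while \<open>A\<close> does not depend on
  \<open>\<epsilon>\<close>.\<close>

lemma AE_dichotomy_ball:
 fixes V :: "'a::euclidean_space \<Rightarrow> real"
 assumes V[measurable]: "V \<in> Borel" and V0: "\<And>x. V x \<ge> 0" and p: "p > 0"
  and A: "\<And>\<epsilon>. \<epsilon> > 0 \<Longrightarrow> (\<integral>\<^sup>+x. (\<integral>\<^sup>+y. ennreal (\<bar>ln (V y + \<epsilon>) - ln (V x + \<epsilon>)\<bar> powr p) *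
    (indicator (ball c r) x * indicator (ball c r) y))) \<le> ennreal A"
 shows "(AE x in lborel. x \<in> ball c r \<longrightarrow> V x = 0) \<or> (AE x in lborel. x \<in> ball c r \<longrightarrow> V x > 0)"
proof -
 define Z where "Z = {x \<in> ball c r. V x = 0}"
 define P where "P \<eta> = {x \<in> ball c r. V x \<ge> \<eta>}" for \<eta>
 have Zm[measurable]: "Z \<in> sets borel" and Pm[measurable]: "P \<eta> \<in> sets borel" for \<eta> by (simp_all add: Z_def P_def)
 have fin: "S \<subseteq> ball c r \<Longrightarrow> S \<in> sets borel \<Longrightarrow> emeasure lborel S = ennreal (measure lborel S)" for S
  using emeasure_bounded_finite[OF bounded_subset[OF bounded_ball], of S] by (intro emeasure_eq_ennreal_measure) (auto simp: less_top)
 have null: "measure lborel Z * measure lborel (P \<eta>) = 0" if \<eta>: "\<eta> > 0" for \<eta>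
 proof (rule ccontr)
  define m where "m = measure lborel Z * measure lborel (P \<eta>)"
  assume "measure lborel Z * measure lborel (P \<eta>) \<noteq> 0"
  then have m: "m > 0" by (simp add: m_def less_le)
  \<comment> \<open>Makes \<open>s powr p * m\<close> equal to \<open>\<bar>A\<bar> + 1\<close>;
    \<open>\<epsilon>\<close> is then adjusted so that the logarithms differ by at least
    \<open>s\<close>.\<close>
  define s where "s = ((\<bar>A\<bar> + 1) / m) powr (1/p)"
  have s: "s > 0" using m by (simp add: s_def)
  define \<epsilon> where "\<epsilon> = \<eta> * exp (- s)"
  have \<epsilon>: "\<epsilon> > 0" using \<eta> by (simp add: \<epsilon>_def)
  have "(\<integral>\<^sup>+x. (\<integral>\<^sup>+y. ennreal (s powr p) * (indicator Z x * indicator (P \<eta>) y)))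
   \<le> (\<integral>\<^sup>+x. (\<integral>\<^sup>+y. ennreal (\<bar>ln (V y + \<epsilon>) - ln (V x + \<epsilon>)\<bar> powr p) * (indicator (ball c r) x * indicator (ball c r) y)))"
  proof (intro nn_integral_mono)
   fix x y
   let ?A = "\<bar>ln (V y + \<epsilon>) - ln (V x + \<epsilon>)\<bar> powr p"
   have "s powr p \<le> ?A" if "x \<in> Z" "y \<in> P \<eta>"
   proof -
    have "s = ln \<eta> - ln \<epsilon>" using \<eta> by (simp add: \<epsilon>_def ln_mult)
    also have "... \<le> ln (V y + \<epsilon>) - ln (V x + \<epsilon>)" using that \<eta> \<epsilon> by (intro diff_mono) (auto simp: Z_def P_def)
    finally show ?thesis using s p by (intro powr_mono2) auto
   qed
   then show "ennreal (s powr p) * (indicator Z x * indicator (P \<eta>) y)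
    \<le> ennreal ?A * (indicator (ball c r) x * indicator (ball c r) y)"
    by (cases "x \<in> Z"; cases "y \<in> P \<eta>") (auto simp: Z_def P_def ennreal_leI)
  qed
  also have "... \<le> ennreal A" by (rule A[OF \<epsilon>])
  also have "(\<integral>\<^sup>+x. (\<integral>\<^sup>+y. ennreal (s powr p) * (indicator Z x * indicator (P \<eta>) y)))
   = ennreal (s powr p) * (ennreal (measure lborel Z) * ennreal (measure lborel (P \<eta>)))"
  proof -
   have "Z \<subseteq> ball c r" "P \<eta> \<subseteq> ball c r" by (auto simp: Z_def P_def)
   from fin[OF this(1) Zm] fin[OF this(2) Pm] show ?thesis by (simp add: nn_integral_cmult nn_integral_multc)
  qed
  also have "ennreal A \<le> ennreal \<bar>A\<bar>" by (rule ennreal_leI) simp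
  finally have "ennreal (s powr p * m) \<le> ennreal \<bar>A\<bar>" by (simp add: m_def flip: ennreal_mult)
  then have "s powr p * m \<le> \<bar>A\<bar>" by (subst (asm) ennreal_le_iff) auto
  moreover have "s powr p * m = \<bar>A\<bar> + 1" using m p by (simp add: s_def powr_powr)
  ultimately show False by simp
 qed
 show ?thesis
 proof (cases "measure lborel Z = 0")
  case True
  moreover have "Z \<subseteq> ball c r" by (auto simp: Z_def)
  ultimately have "Z \<in> null_sets lborel" using fin[of Z] Zm by (auto simp del: mem_ball)
  then have "AE x in lborel. x \<notin> Z" by (rule AE_not_in)
  then have "AE x in lborel. x \<in> ball c r \<longrightarrow> V x > 0" by eventually_elim (use V0 in \<open>auto simp: Z_def less_le\<close>)
  then show ?thesis ..
 next
  case False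
  have "P (1 / real (Suc k)) \<in> null_sets lborel" for k
  proof -
   have "P (1 / real (Suc k)) \<subseteq> ball c r" by (auto simp: P_def)
   with null[of "1 / real (Suc k)"] False fin[of "P (1 / real (Suc k))"] have "emeasure lborel (P (1 / real (Suc k))) = 0" by simp
   then show ?thesis by (intro null_setsI) measurable
  qed
  then have "AE x in lborel. x \<notin> P (1 / real (Suc k))" for k by (rule AE_not_in)
  then have "AE x in lborel. \<forall>k. x \<notin> P (1 / real (Suc k))" unfolding AE_all_countable ..
  then have "AE x in lborel. x \<in> ball c r \<longrightarrow> V x = 0"
  proof eventually_elim
   fix x assume *: "\<forall>k. x \<notin> P (1 / real (Suc k))"
   have "V x = 0" if "x \<in> ball c r"
   proof (rule ccontr)
    assume "V x \<noteq> 0"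
    then have "V x > 0" using V0[of x] by simp
    then obtain k where "1 / real (Suc k) < V x" using reals_Archimedean by (metis inverse_eq_divide)
    then show False using *[rule_format, of k] that by (simp add: P_def)
   qed
   then show "x \<in> ball c r \<longrightarrow> V x = 0" by simp
  qed
  then show ?thesis ..
 qed
qed

text \<open>Lindelof's theorem makes the cover by open sets countable, so that the exceptional null
  sets can be united.\<close>

lemma AE_locally_imp_AE:
 fixes S :: "'a::euclidean_space set"
 assumes "\<And>x. x \<in> S \<Longrightarrow> \<exists>U. open U \<and> x \<in> U \<and> (AE y in lborel. y \<in> U \<longrightarrow> Q y)"
 shows "AE y in lborel. y \<in> S \<longrightarrow> Q y"
proof -
 let ?F = "{U. open U \<and> (AE y in lborel. y \<in> U \<longrightarrow> Q y)}"
 have "\<exists>F. F \<subseteq> ?F \<and> countable F \<and> \<Union>F = \<Union>?F" by (rule Lindelof[of ?F]) auto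
 then obtain F where F: "F \<subseteq> ?F" "countable F" "\<Union>F = \<Union>?F" by blast
 have "AE y in lborel. \<forall>U\<in>F. y \<in> U \<longrightarrow> Q y" unfolding AE_ball_countable[OF F(2)] using F(1) by blast
 then show ?thesis
 proof eventually_elim
  fix y assume *: "\<forall>U\<in>F. y \<in> U \<longrightarrow> Q y"
  have "Q y" if "y \<in> S" using assms[OF that] F(3) * by blast
  then show "y \<in> S \<longrightarrow> Q y" ..
 qed
qed

text \<open>The unions \<open>Z\<close> and \<open>P\<close> of the open sets of either kind are
  disjoint, because a nonempty open set has positive measure, and the hypothesis on balls makes them
  cover \<open>\<Omega>\<close>.\<close>

lemma AE_dichotomy_connected:
 fixes V :: "'a::euclidean_space \<Rightarrow> real"
 assumes \<Omega>: "open \<Omega>" "connected \<Omega>"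
  and D: "\<And>c r. r > 0 \<Longrightarrow> cball c (2 * r) \<subseteq> \<Omega> \<Longrightarrow>
   (AE x in lborel. x \<in> ball c r \<longrightarrow> V x = 0) \<or> (AE x in lborel. x \<in> ball c r \<longrightarrow> V x > 0)"
 shows "(AE x in lborel. x \<in> \<Omega> \<longrightarrow> V x = 0) \<or> (AE x in lborel. x \<in> \<Omega> \<longrightarrow> V x > 0)"
proof -
 define Z where "Z = \<Union>{U. open U \<and> (AE y in lborel. y \<in> U \<longrightarrow> V y = 0)}"
 define P where "P = \<Union>{U. open U \<and> (AE y in lborel. y \<in> U \<longrightarrow> V y > 0)}"
 have o: "open Z" "open P" unfolding Z_def P_def by auto
 have "Z \<inter> P = {}"
 proof (rule ccontr)
  assume "Z \<inter> P \<noteq> {}"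
  then obtain U W x where U: "open U" "AE y in lborel. y \<in> U \<longrightarrow> V y = 0" and W: "open W" "AE y in lborel. y \<in> W \<longrightarrow> V y > 0"
   and x: "x \<in> U \<inter> W" unfolding Z_def P_def by blast
  obtain e where e: "e > 0" "ball x e \<subseteq> U \<inter> W" using U(1) W(1) x open_contains_ball[of "U \<inter> W"] by blast
  have "AE y in lborel. y \<notin> ball x e" using U(2) W(2) by eventually_elim (use e(2) in auto)
  then have "emeasure lborel (ball x e) = 0" by (subst (asm) AE_iff_measurable[of "ball x e"]) auto
  then show False using e(1) content_ball_pos[OF e(1), of x] by (simp add: measure_def)
 qed
 moreover have "\<Omega> \<subseteq> Z \<union> P"
 proof
  fix x assume "x \<in> \<Omega>"
  then obtain e where e: "e > 0" "cball x e \<subseteq> \<Omega>" using \<Omega>(1) open_contains_cball by blast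
  have x: "x \<in> ball x (e / 2)" using e by simp
  from e have "(AE y in lborel. y \<in> ball x (e / 2) \<longrightarrow> V y = 0) \<or> (AE y in lborel. y \<in> ball x (e / 2) \<longrightarrow> V y > 0)"
   by (intro D) auto
  then show "x \<in> Z \<union> P" unfolding Z_def P_def Un_iff Union_iff mem_Collect_eq using x open_ball by blast
 qed
 ultimately have "\<Omega> \<subseteq> Z \<or> \<Omega> \<subseteq> P" using connectedD[OF \<Omega>(2) o] by blast
 then show ?thesis
 proof
  assume "\<Omega> \<subseteq> Z"
  then have "AE x in lborel. x \<in> \<Omega> \<longrightarrow> V x = 0" by (intro AE_locally_imp_AE) (auto simp: Z_def)
  then show ?thesis ..
 next
  assume "\<Omega> \<subseteq> P"
  then have "AE x in lborel. x \<in> \<Omega> \<longrightarrow> V x > 0" by (intro AE_locally_imp_AE) (auto simp: P_def)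
  then show ?thesis ..
 qed
qed

context hs_problem
begin

lemma connected_\<Omega>: "connected \<Omega>"
 unfolding \<Omega>_eq by (intro connected_Times connected_K connected_UNIV)

lemma T_zero_outside: "u \<in> T \<Longrightarrow> x \<notin> \<Omega> \<Longrightarrow> u x = 0"
 using test_functions_compact_support by blast

text \<open>Fatou's lemma, once in each variable, carries the oscillation bound for the logarithms
  from \<open>u k\<close> to \<open>V\<close>. In the limit the mass quotient is 1, and only
  \<open>D * A\<close> is left.\<close>

lemma limit_dichotomy_ball:
 assumes u: "\<And>k. u k \<in> T" "\<And>k x. u k x \<ge> 0" "\<And>k. energy p (u k) \<le> 1"
  and lim: "(\<lambda>k. mass UNIV (u k)) \<longlonglongrightarrow> sharp"
  and V[measurable]: "V \<in> Borel" and V0: "\<And>x. V x \<ge> 0"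
  and uV: "AE x in lborel. (\<lambda>k. u k x) \<longlonglongrightarrow> V x"
  and r: "r > 0" and B: "cball c (2 * r) \<subseteq> \<Omega>"
 shows "(AE x in lborel. x \<in> ball c r \<longrightarrow> V x = 0) \<or> (AE x in lborel. x \<in> ball c r \<longrightarrow> V x > 0)"
proof -
 obtain A where A: "A \<ge> 0" and bound: "\<And>u \<epsilon>. u \<in> T \<Longrightarrow> (\<forall>x. u x \<ge> 0) \<Longrightarrow> energy p u \<le> 1 \<Longrightarrow> \<epsilon> > 0 \<Longrightarrow>
  (\<integral>x\<in>ball c r. grad_powr p (\<lambda>x. ln (u x + \<epsilon>)) x)
   \<le> ennreal (A + 2 * \<epsilon> powr (- p) * (1 - (mass UNIV u / sharp) powr (p/q)))"
  using log_energy_bound[OF r B] by blast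
 define D where "D = (2 * r) powr p * ((2 * r) ^ DIM('a \<times> 'b) * measure lborel (ball (0::'a \<times> 'b) 1))"
 have D: "D \<ge> 0" using r by (simp add: D_def)
 have [measurable]: "u k \<in> Borel" for k by (rule T_measurable[OF u(1)])
 show ?thesis
 proof (rule AE_dichotomy_ball[OF V V0 p0])
  fix \<epsilon> :: real assume \<epsilon>: "\<epsilon> > 0"
  let ?h = "\<lambda>v x y. ennreal (\<bar>ln (v y + \<epsilon>) - ln (v x + \<epsilon>)\<bar> powr p) * (indicator (ball c r) x * indicator (ball c r) y)"
  have conv: "(\<lambda>k. ?h (u k) x y) \<longlonglongrightarrow> ?h V x y" if "(\<lambda>k. u k x) \<longlonglongrightarrow> V x" "(\<lambda>k. u k y) \<longlonglongrightarrow> V y" for x y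
  proof -
   have "(\<lambda>k. \<bar>ln (u k y + \<epsilon>) - ln (u k x + \<epsilon>)\<bar> powr p) \<longlonglongrightarrow> \<bar>ln (V y + \<epsilon>) - ln (V x + \<epsilon>)\<bar> powr p"
    using that p0 add_nonneg_pos[OF V0[of x] \<epsilon>] add_nonneg_pos[OF V0[of y] \<epsilon>]
    by (intro tendsto_powr' tendsto_intros) auto
   then show ?thesis by (intro tendsto_mult_ennreal tendsto_ennrealI tendsto_const) (auto simp: indicator_def)
  qed
  have "(\<integral>\<^sup>+x. (\<integral>\<^sup>+y. ?h V x y)) \<le> (\<integral>\<^sup>+x. liminf (\<lambda>k. (\<integral>\<^sup>+y. ?h (u k) x y)))"
  proof (rule nn_integral_mono_AE, use uV in eventually_elim)
   fix x assume x: "(\<lambda>k. u k x) \<longlonglongrightarrow> V x"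
   have "(\<integral>\<^sup>+y. ?h V x y) = (\<integral>\<^sup>+y. liminf (\<lambda>k. ?h (u k) x y))"
    by (rule nn_integral_cong_AE, use uV in eventually_elim)
     (rule lim_imp_Liminf[symmetric, OF _ conv[OF x]], simp_all)
   also have "... \<le> liminf (\<lambda>k. (\<integral>\<^sup>+y. ?h (u k) x y))" by (rule nn_integral_liminf) measurable
   finally show "(\<integral>\<^sup>+y. ?h V x y) \<le> liminf (\<lambda>k. (\<integral>\<^sup>+y. ?h (u k) x y))" .
  qed
  also have "... \<le> liminf (\<lambda>k. (\<integral>\<^sup>+x. (\<integral>\<^sup>+y. ?h (u k) x y)))" by (rule nn_integral_liminf) measurable
  also have "... \<le> liminf (\<lambda>k. ennreal (D * (A + 2 * \<epsilon> powr (- p) * (1 - (mass UNIV (u k) / sharp) powr (p/q)))))"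
  proof (rule Liminf_mono, rule always_eventually, rule allI)
   fix k
   have "C_class (Suc 0) (\<lambda>x. ln (u k x + \<epsilon>))"
    using u(2) \<epsilon> by (intro C_class_ln C_class_add C_class_const test_functions_smooth[OF u(1)]) (simp add: add_nonneg_pos)
   from nn_integral_oscillation_le[OF this less_imp_le[OF p1] r, of c]
   have "(\<integral>\<^sup>+x. (\<integral>\<^sup>+y. ?h (u k) x y)) \<le> ennreal D * (\<integral>x\<in>ball c r. grad_powr p (\<lambda>x. ln (u k x + \<epsilon>)) x)"
    by (simp only: D_def)
   also have "... \<le> ennreal D * ennreal (A + 2 * \<epsilon> powr (- p) * (1 - (mass UNIV (u k) / sharp) powr (p/q)))"
    using u \<epsilon> by (intro mult_left_mono bound) auto
   finally show "(\<integral>\<^sup>+x. (\<integral>\<^sup>+y. ?h (u k) x y))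
    \<le> ennreal (D * (A + 2 * \<epsilon> powr (- p) * (1 - (mass UNIV (u k) / sharp) powr (p/q))))"
    using D by (simp add: ennreal_mult')
  qed
  also have "... = ennreal (D * (A + 2 * \<epsilon> powr (- p) * (1 - (sharp / sharp) powr (p/q))))"
   using lim sharp_pos p0 q0 by (intro lim_imp_Liminf tendsto_ennrealI tendsto_intros) auto
  finally show "(\<integral>\<^sup>+x. (\<integral>\<^sup>+y. ?h V x y)) \<le> ennreal (D * A)" using sharp_pos by simp
 qed
qed

lemma weighted_limit:
 assumes wT: "\<And>k. w k \<in> T"
  and mC: "\<And>e. e > 0 \<Longrightarrow> \<exists>N. \<forall>k\<ge>N. \<forall>l\<ge>N. mass UNIV (\<lambda>x. w k x - w l x) < e"
 shows "\<exists>V r. V \<in> Borel \<and> strict_mono (r :: nat \<Rightarrow> nat) \<and> (AE x in lborel. (\<lambda>k. w (r k) x) \<longlonglongrightarrow> V x) \<and>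
  (\<forall>e>0. tail_le (\<lambda>k. \<integral>x. dens x (w k x - V x)) e)"
proof -
 have dT: "(\<lambda>x. w k x - w l x) \<in> T" for k l by (intro test_functions_diff wT)
 have [measurable]: "w k \<in> Borel" for k using wT T_measurable by blast
 \<comment> \<open>Multiplication by \<open>s\<close> turns the weighted norm into an unweighted
   one, so that \<open>Lp_complete\<close> applies; off the plane \<open>s\<close> is positive and
   can be divided out again.\<close>
 define s where "s x = wt x powr (1/q)" for x
 have [measurable]: "s \<in> Borel" unfolding s_def[abs_def] by measurable
 have s_eq: "norm (s x * a - s x * b) powr q = dens x (a - b)" for x a b
  using q0 by (simp add: s_def abs_mult powr_mult powr_powr flip: right_diff_distrib)
 have "\<exists>N. \<forall>k\<ge>N. \<forall>l\<ge>N. (\<integral>x. norm (s x * w k x - s x * w l x) powr q) \<le> ennreal e" if e: "e > 0" for e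
 proof -
  obtain N where N: "\<And>k l. k \<ge> N \<Longrightarrow> l \<ge> N \<Longrightarrow> mass UNIV (\<lambda>x. w k x - w l x) < e" using mC[OF e] by blast
  have "(\<integral>x. norm (s x * w k x - s x * w l x) powr q) \<le> ennreal e" if "k \<ge> N" "l \<ge> N" for k l
   using nn_integral_mass[OF dT[of k l], of UNIV] N[OF that] e unfolding s_eq by (simp add: ennreal_leI)
  then show ?thesis by blast
 qed
 note cauchy = this
 obtain g r where g: "g \<in> borel_measurable lborel" and r: "strict_mono r" "AE x in lborel. (\<lambda>k. s x * w (r k) x) \<longlonglongrightarrow> g x"
  "\<And>e. e > 0 \<Longrightarrow> tail_le (\<lambda>k. \<integral>x. norm (s x * w k x - g x) powr q) e"
  by (rule Lp_complete[of "\<lambda>k x. s x * w k x" lborel q]) (use q0 cauchy in auto)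
 have [measurable]: "g \<in> Borel" using g by simp
 define V where "V x = g x / s x" for x
 have V[measurable]: "V \<in> Borel" unfolding V_def[abs_def] by measurable
 have lim: "AE x in lborel. (\<lambda>k. w (r k) x) \<longlonglongrightarrow> V x \<and> g x = s x * V x" using r(2) AE_rad_pos
 proof eventually_elim
  fix x :: "'a \<times> 'b" assume x: "(\<lambda>k. s x * w (r k) x) \<longlonglongrightarrow> g x" "rad x > 0"
  have s: "s x > 0" using x(2) by (simp add: s_def wt_def)
  have "(\<lambda>k. s x * w (r k) x / s x) \<longlonglongrightarrow> g x / s x" using s by (intro tendsto_intros x) auto
  then show "(\<lambda>k. w (r k) x) \<longlonglongrightarrow> V x \<and> g x = s x * V x" using s by (simp add: V_def)
 qed
 have "tail_le (\<lambda>k. \<integral>x. dens x (w k x - V x)) e" if e: "e > 0" for e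
 proof -
  have "(\<integral>x. dens x (w k x - V x)) = (\<integral>x. norm (s x * w k x - g x) powr q)" for k
   by (rule nn_integral_cong_AE, use lim in eventually_elim) (simp only: s_eq)
  then show ?thesis using r(3)[OF e] by simp
 qed
 moreover have "AE x in lborel. (\<lambda>k. w (r k) x) \<longlonglongrightarrow> V x" using lim by eventually_elim simp
 ultimately show ?thesis using V r(1) by blast
qed

lemma extremal_limit:
 obtains u V G where "\<And>k::nat. u k \<in> T" "V \<in> Borel" "G \<in> Borel"
  "\<And>x. x \<in> \<Omega> \<Longrightarrow> V x > 0" "\<And>x. x \<notin> \<Omega> \<Longrightarrow> V x = 0" "\<And>e. e > 0 \<Longrightarrow> tail_le (\<lambda>k. \<integral>x. dens x (u k x - V x)) e"
  "\<And>e. e > 0 \<Longrightarrow> tail_le (\<lambda>k. \<integral>x. norm (gradient (u k) x - G x) powr p) e"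
  "(\<lambda>k. mass UNIV (u k)) \<longlonglongrightarrow> sharp" "\<And>k. energy p (u k) \<le> 1"
proof -
 obtain w where w: "\<And>k::nat. normalised (w k)" "\<And>k x. w k x \<ge> 0" "(\<lambda>k. mass UNIV (w k)) \<longlonglongrightarrow> sharp"
  and Lp: "\<And>R e. e > 0 \<Longrightarrow> \<exists>N. \<forall>k\<ge>N. \<forall>l\<ge>N. (LINT x:ball 0 R|lborel. \<bar>w k x - w l x\<bar> powr p) < e"
  using maximising_sequence by blast
 have wT: "w k \<in> T" and wE: "energy p (w k) \<le> 1" for k using w(1) by (auto simp: normalised_def)
 have dT: "(\<lambda>x. w k x - w l x) \<in> T" for k l by (intro test_functions_diff wT)
 have mC: "\<exists>N. \<forall>k\<ge>N. \<forall>l\<ge>N. mass UNIV (\<lambda>x. w k x - w l x) < e" if "e > 0" for e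
  by (rule mass_Cauchy[OF w(1,3) _ that]) (rule Lp)
 have eC: "\<exists>N. \<forall>k\<ge>N. \<forall>l\<ge>N. energy p (\<lambda>x. w k x - w l x) < e" if "e > 0" for e
  by (rule energy_Cauchy[OF wT wE w(3) _ that]) (rule mC)
 have [measurable]: "gradient (w k) \<in> Borel" for k using wT T_gradient_measurable by blast
 obtain V1 r where V1[measurable]: "V1 \<in> Borel" and r: "strict_mono (r :: nat \<Rightarrow> nat)"
  "AE x in lborel. (\<lambda>k. w (r k) x) \<longlonglongrightarrow> V1 x" "\<And>e. e > 0 \<Longrightarrow> tail_le (\<lambda>k. \<integral>x. dens x (w k x - V1 x)) e"
  using weighted_limit[of w] wT mC by blast
 \<comment> \<open>Equal to \<open>V1\<close> almost everywhere, as a limit of nonnegative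
   functions; the change makes nonnegativity hold at every point.\<close>
 define V where "V x = max 0 (V1 x)" for x
 have V[measurable]: "V \<in> Borel" unfolding V_def[abs_def] by measurable
 have V0: "V x \<ge> 0" for x by (simp add: V_def)
 define u where "u k = w (r k)" for k
 have uT: "u k \<in> T" and uE: "energy p (u k) \<le> 1" and u0: "u k x \<ge> 0" for k x by (simp_all add: u_def wT wE w(2))
 have rk: "k \<le> r k" for k by (rule seq_suble[OF r(1)])
 have um: "(\<lambda>k. mass UNIV (u k)) \<longlonglongrightarrow> sharp"
  unfolding u_def using LIMSEQ_subseq_LIMSEQ[OF w(3) r(1)] by (simp add: o_def)
 have lim: "AE x in lborel. (\<lambda>k. u k x) \<longlonglongrightarrow> V x \<and> V1 x = V x" using r(2)
 proof eventually_elim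
  fix x assume x: "(\<lambda>k. w (r k) x) \<longlonglongrightarrow> V1 x"
  have "V1 x \<ge> 0" by (rule LIMSEQ_le_const[OF x]) (use w(2) in auto)
  then show "(\<lambda>k. u k x) \<longlonglongrightarrow> V x \<and> V1 x = V x" using x by (simp add: u_def V_def)
 qed
 have VL: "tail_le (\<lambda>k. \<integral>x. dens x (u k x - V x)) e" if e: "e > 0" for e
 proof -
  obtain N where N: "\<And>k. k \<ge> N \<Longrightarrow> (\<integral>x. dens x (w k x - V1 x)) \<le> ennreal e" using r(3)[OF e] by blast
  have "(\<integral>x. dens x (u k x - V x)) = (\<integral>x. dens x (w (r k) x - V1 x))" for k
   by (rule nn_integral_cong_AE, use lim in eventually_elim) (simp only: u_def)
  then show ?thesis using N[OF order.trans[OF _ rk]] by auto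
 qed
 have "\<exists>N. \<forall>k\<ge>N. \<forall>l\<ge>N. (\<integral>x. norm (gradient (u k) x - gradient (u l) x) powr p) \<le> ennreal e" if e: "e > 0" for e
 proof -
  obtain N where N: "\<And>k l. k \<ge> N \<Longrightarrow> l \<ge> N \<Longrightarrow> energy p (\<lambda>x. w k x - w l x) < e" using eC[OF e] by blast
  have "(\<integral>x. norm (gradient (u k) x - gradient (u l) x) powr p) \<le> ennreal e" if "k \<ge> N" "l \<ge> N" for k l
  proof -
   have "r k \<ge> N" "r l \<ge> N" using that rk[of k] rk[of l] by linarith+
   then show ?thesis using nn_integral_energy_on[OF dT[of "r k" "r l"], of UNIV] N[of "r k" "r l"]
    by (simp add: u_def energy_on_UNIV gradient_diff[OF T_differentiable[OF wT] T_differentiable[OF wT]] ennreal_leI)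
  qed
  then show ?thesis by blast
 qed
 note gcauchy = this
 obtain G r' where G: "G \<in> borel_measurable lborel" and GL:
  "\<And>e. e > 0 \<Longrightarrow> tail_le (\<lambda>k. \<integral>x. norm (gradient (u k) x - G x) powr p) e"
  by (rule Lp_complete[of "\<lambda>k. gradient (u k)" lborel p]) (use p0 gcauchy in \<open>auto simp: u_def\<close>)
 have "(AE x in lborel. x \<in> \<Omega> \<longrightarrow> V x = 0) \<or> (AE x in lborel. x \<in> \<Omega> \<longrightarrow> V x > 0)"
 proof (rule AE_dichotomy_connected[OF open_\<Omega> connected_\<Omega>])
  fix c r assume "r > 0" "cball c (2 * r) \<subseteq> \<Omega>"
  moreover have "AE x in lborel. (\<lambda>k. u k x) \<longlonglongrightarrow> V x" using lim by eventually_elim simp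
  ultimately show "(AE x in lborel. x \<in> ball c r \<longrightarrow> V x = 0) \<or> (AE x in lborel. x \<in> ball c r \<longrightarrow> V x > 0)"
   by (intro limit_dichotomy_ball[OF uT u0 uE um V V0])
 qed
 \<comment> \<open>A vanishing limit would force the masses of \<open>u k\<close> to tend to 0
   instead of \<open>sharp\<close>.\<close>
 moreover have False if V_0: "AE x in lborel. x \<in> \<Omega> \<longrightarrow> V x = 0"
 proof -
  obtain N1 where N1: "\<And>k. k \<ge> N1 \<Longrightarrow> (\<integral>x. dens x (u k x - V x)) \<le> ennreal (sharp / 2)"
   using VL[of "sharp / 2"] sharp_pos by auto
  obtain N2 where N2: "\<And>k. k \<ge> N2 \<Longrightarrow> mass UNIV (u k) > sharp / 2"
   using order_tendstoD(1)[OF um, of "sharp / 2"] sharp_pos by (auto simp: eventually_sequentially)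
  let ?k = "N1 + N2"
  have "ennreal (mass UNIV (u ?k)) = (\<integral>x. dens x (u ?k x))" using nn_integral_mass[OF uT, of UNIV] by simp
  also have "... \<le> (\<integral>x. dens x (u ?k x - V x))"
  proof (rule nn_integral_mono_AE, use V_0 in eventually_elim)
   fix x assume "x \<in> \<Omega> \<longrightarrow> V x = 0"
   then show "ennreal (dens x (u ?k x)) \<le> ennreal (dens x (u ?k x - V x))"
    using T_zero_outside[OF uT, of x ?k] by (cases "x \<in> \<Omega>") auto
  qed
  also have "... \<le> ennreal (sharp / 2)" by (rule N1) simp
  finally show False using N2[of ?k] sharp_pos by (simp add: ennreal_le_iff)
 qed
 ultimately have pos: "AE x in lborel. x \<in> \<Omega> \<longrightarrow> V x > 0" by blast
 \<comment> \<open>Positivity is wanted at every point of \<open>\<Omega>\<close>; the value 1 is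
   arbitrary and is taken only on a null set.\<close>
 define V' where "V' x = (if x \<in> \<Omega> then if V x > 0 then V x else 1 else 0)" for x
 have [measurable]: "\<Omega> \<in> sets borel" using open_\<Omega> by simp
 have V': "V' \<in> Borel" unfolding V'_def[abs_def] by measurable
 have VL': "tail_le (\<lambda>k. \<integral>x. dens x (u k x - V' x)) e" if e: "e > 0" for e
 proof -
  have "(\<integral>x. dens x (u k x - V' x)) \<le> (\<integral>x. dens x (u k x - V x))" for k
  proof (rule nn_integral_mono_AE, use pos in eventually_elim)
   fix x assume "x \<in> \<Omega> \<longrightarrow> V x > 0"
   then show "ennreal (dens x (u k x - V' x)) \<le> ennreal (dens x (u k x - V x))"
    using T_zero_outside[OF uT, of x k] q0 by (cases "x \<in> \<Omega>") (auto simp: V'_def)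
  qed
  then show ?thesis using VL[OF e] by (meson order.trans)
 qed
 show ?thesis by (rule that[OF uT V' _ _ _ VL' GL um uE]) (use G in \<open>simp_all add: V'_def\<close>)
qed

end

section \<open>Weak gradients\<close>

text \<open>If \<open>a > t\<close>, then \<open>(a / t) powr (s - 1) \<ge> 1\<close>, and
  \<open>a\<close> times this factor is the second summand.\<close>

lemma young_split:
 fixes a t s :: real
 assumes "a \<ge> 0" "t > 0" "s > 1"
 shows "a \<le> t + t powr (1 - s) * a powr s"
proof (cases "a \<le> t")
 case False
 then have a: "a > t" "a > 0" using assms by auto
 have "1 \<le> (a / t) powr (s - 1)" using a assms by (intro ge_one_powr_ge_zero) auto
 also have "... = a powr (s - 1) * t powr (1 - s)" using a assms by (simp add: powr_divide powr_diff field_simps)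
 finally have "a * 1 \<le> a * (a powr (s - 1) * t powr (1 - s))" using a by (intro mult_left_mono) auto
 also have "... = t powr (1 - s) * a powr s" using a by (simp add: powr_diff)
 finally show ?thesis using assms by simp
qed (simp add: add_increasing2)

lemma bounded_continuous_support:
 fixes f :: "'a::euclidean_space \<Rightarrow> 'b::real_normed_vector"
 assumes "continuous_on UNIV f" "bounded {x. f x \<noteq> 0}"
 shows "\<exists>M\<ge>0. \<forall>x. norm (f x) \<le> M"
proof -
 let ?S = "closure {x. f x \<noteq> 0}"
 have "compact (f ` ?S)" using assms by (intro compact_continuous_image continuous_on_subset[OF assms(1)]) auto
 then obtain M where M: "M > 0" "\<And>y. y \<in> f ` ?S \<Longrightarrow> norm y \<le> M" using compact_imp_bounded bounded_pos by metis
 have "norm (f x) \<le> M" for x using M closure_subset[of "{x. f x \<noteq> 0}"] by (cases "f x = 0") auto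
 then show ?thesis using M(1) less_imp_le by blast
qed

lemma abs_diff_le_gradient_bound:
 fixes f :: "'a::euclidean_space \<Rightarrow> real"
 assumes f: "C_class (Suc 0) f" and M: "M \<ge> 0" "\<And>x. norm (gradient f x) \<le> M"
 shows "\<bar>f (x + h) - f x\<bar> \<le> norm h * M"
proof -
 have "ennreal \<bar>f (x + h) - f x\<bar> \<le> (\<integral>t\<in>{0..1}. norm h * norm (gradient f (x + t *\<^sub>R h)))"
  by (rule abs_diff_le_nn_integral[OF f])
 also have "... \<le> (\<integral>\<^sup>+t. ennreal (norm h * M) * indicator {0..1::real} t)"
  using M by (intro nn_integral_mono mult_right_mono ennreal_leI mult_left_mono) auto
 also have "... = ennreal (norm h * M)" by (subst nn_integral_cmult_indicator) auto
 finally show ?thesis using M by (simp add: ennreal_le_iff)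
qed

text \<open>Difference quotients in the direction \<open>b\<close> have integral 0 by translation
  invariance. They are bounded by \<open>norm b * M\<close> and supported in a fixed ball, so
  dominated convergence applies.\<close>

lemma integral_gradient_C1c:
 fixes f :: "'a::euclidean_space \<Rightarrow> real"
 assumes f: "C1c f"
 shows "(LINT x|lborel. gradient f x \<bullet> b) = 0"
proof -
 have fC: "C_class (Suc 0) f" using f by (simp only: C1c_def)
 have [measurable]: "f \<in> Borel" "gradient f \<in> Borel"
  using f by (rule borel_measurable_C1c, rule borel_measurable_gradient)
 have fi: "integrable lborel f"
  by (rule integrable_continuous_bounded_support[OF C1c_continuous[OF f] C1c_bounded_support[OF f]])
 obtain M where M: "M \<ge> 0" "\<And>x. norm (gradient f x) \<le> M"
  using bounded_continuous_support[OF C1c_continuous_gradient[OF f] C1c_bounded_support_gradient[OF f]] by blast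
 obtain R where R: "R > 0" "\<And>x. f x \<noteq> 0 \<Longrightarrow> norm x \<le> R" using C1c_bounded_support[OF f] unfolding bounded_pos by blast
 define \<tau> where "\<tau> k = 1 / real (Suc k)" for k
 have \<tau>: "\<tau> k > 0" "\<tau> k \<le> 1" for k by (auto simp: \<tau>_def)
 have \<tau>0: "filterlim \<tau> (at 0) sequentially" using LIMSEQ_inverse_real_of_nat \<tau>(1) unfolding filterlim_at
  by (auto simp: \<tau>_def[abs_def] inverse_eq_divide)
 define d where "d k x = (f (\<tau> k *\<^sub>R b + x) - f x) / \<tau> k" for k x
 have tr: "integrable lborel (\<lambda>x. f (c + x))" "(LINT x|lborel. f (c + x)) = (LINT x|lborel. f x)" for c
 proof -
  have "integrable (distr lborel borel ((+) c)) f" unfolding lborel_distr_plus by (rule fi)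
  then show "integrable lborel (\<lambda>x. f (c + x))" by (subst (asm) integrable_distr_eq) auto
  have "(LINT x|lborel. f x) = integral\<^sup>L (distr lborel borel ((+) c)) f" unfolding lborel_distr_plus ..
  also have "... = (LINT x|lborel. f (c + x))" by (subst integral_distr) auto
  finally show "(LINT x|lborel. f (c + x)) = (LINT x|lborel. f x)" ..
 qed
 have "(LINT x|lborel. d k x) = 0" for k unfolding d_def using tr fi by (simp add: Bochner_Integration.integral_diff)
 moreover have "(\<lambda>k. LINT x|lborel. d k x) \<longlonglongrightarrow> (LINT x|lborel. gradient f x \<bullet> b)"
 proof (rule integral_dominated_convergence)
  let ?B = "cball (0::'a) (R + norm b)"
  show "integrable lborel (\<lambda>x. norm b * M * indicator ?B x)"
   by (intro integrable_mult_right integrable_real_indicator) (use emeasure_bounded_finite[OF bounded_cball] in auto)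
  show "(\<lambda>x. gradient f x \<bullet> b) \<in> borel_measurable lborel" by measurable
  show "d k \<in> borel_measurable lborel" for k unfolding d_def[abs_def] by measurable
  show "AE x in lborel. (\<lambda>k. d k x) \<longlonglongrightarrow> gradient f x \<bullet> b"
  proof (rule AE_I2)
   fix x
   have "((\<lambda>t. f (t *\<^sub>R b + x)) has_derivative (\<lambda>t. gradient f (0 *\<^sub>R b + x) \<bullet> (t *\<^sub>R b))) (at (0::real))"
    by (rule has_derivative_compose[of "\<lambda>t. t *\<^sub>R b + x", OF _ has_derivative_gradient[OF C1c_differentiable[OF f]]])
     (auto intro!: derivative_eq_intros)
   then have "((\<lambda>t. f (t *\<^sub>R b + x)) has_real_derivative gradient f x \<bullet> b) (at 0)"
    by (simp add: has_field_derivative_def mult_commute_abs)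
   then have "((\<lambda>t. (f (t *\<^sub>R b + x) - f x) / t) \<longlongrightarrow> gradient f x \<bullet> b) (at 0)" by (simp add: DERIV_def)
   from filterlim_compose[OF this \<tau>0] show "(\<lambda>k. d k x) \<longlonglongrightarrow> gradient f x \<bullet> b" by (simp add: d_def)
  qed
  show "AE x in lborel. norm (d k x) \<le> norm b * M * indicator ?B x" for k
  proof (rule AE_I2)
   fix x
   let ?A = "\<tau> k *\<^sub>R b"
   show "norm (d k x) \<le> norm b * M * indicator ?B x"
   proof (cases "x \<in> ?B")
    case True
    have "\<bar>f (x + ?A) - f x\<bar> \<le> norm ?A * M" by (rule abs_diff_le_gradient_bound[OF fC M])
    then have "norm (d k x) \<le> norm ?A * M / \<tau> k"
     using \<tau>(1)[of k] unfolding d_def by (simp only: real_norm_def abs_divide add.commute abs_of_pos divide_right_mono less_imp_le)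
    then show ?thesis using True \<tau>(1)[of k] by simp
   next
    case False
    then have x: "norm x > R + norm b" by simp
    have "norm ?A \<le> norm b" using \<tau>[of k] by (simp add: mult_left_le_one_le)
    then have "norm (?A + x) > R" using x norm_triangle_ineq4[of "?A + x" "?A"] by simp
    moreover have "norm x > R" using x norm_ge_zero[of b] by linarith
    ultimately have "f (?A + x) = 0" "f x = 0" using R(2) not_le by blast+
    then show ?thesis using False by (simp add: d_def)
   qed
  qed
 qed
 ultimately show ?thesis by (simp add: LIMSEQ_const_iff)
qed

lemma gradient_inner_Basis: "b \<in> Basis \<Longrightarrow> gradient f x \<bullet> b = partial_deriv b f x"
 by (simp add: gradient_def inner_sum_left inner_Basis if_distrib[of "\<lambda>c. _ * c"] cong: if_cong)

lemma integral_by_parts_C1c: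
 fixes u \<phi> :: "'a::euclidean_space \<Rightarrow> real"
 assumes u: "C1c u" and \<phi>: "C1c \<phi>"
 shows "(LINT x|lborel. u x * (gradient \<phi> x \<bullet> b)) = - (LINT x|lborel. (gradient u x \<bullet> b) * \<phi> x)"
proof -
 have uC: "C_class (Suc 0) u" using u by (simp only: C1c_def)
 have c: "continuous_on UNIV u" "continuous_on UNIV \<phi>" "continuous_on UNIV (gradient u)" "continuous_on UNIV (gradient \<phi>)"
  by (intro C1c_continuous C1c_continuous_gradient u \<phi>)+
 have i1: "integrable lborel (\<lambda>x. u x * (gradient \<phi> x \<bullet> b))" by (rule integrable_continuous_bounded_support)
   (intro continuous_intros c, rule bounded_subset[OF C1c_bounded_support[OF u]], auto)
 have i2: "integrable lborel (\<lambda>x. (gradient u x \<bullet> b) * \<phi> x)" by (rule integrable_continuous_bounded_support)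
   (intro continuous_intros c, rule bounded_subset[OF C1c_bounded_support[OF \<phi>]], auto)
 have "0 = (LINT x|lborel. gradient (\<lambda>x. u x * \<phi> x) x \<bullet> b)"
  by (rule integral_gradient_C1c[OF C1c_mult[OF uC \<phi>], symmetric])
 also have "... = (LINT x|lborel. u x * (gradient \<phi> x \<bullet> b) + (gradient u x \<bullet> b) * \<phi> x)"
  by (simp add: gradient_mult C1c_differentiable u \<phi> inner_add_left mult.commute[of "\<phi> _"] add.commute)
 also have "... = (LINT x|lborel. u x * (gradient \<phi> x \<bullet> b)) + (LINT x|lborel. (gradient u x \<bullet> b) * \<phi> x)"
  by (rule Bochner_Integration.integral_add[OF i1 i2])
 finally show ?thesis by simp
qed

text \<open>A product of flat steps in the coordinates, steepened by the factor
  \<open>Suc k\<close>. The limit is the indicator of the open box because the flat step vanishes at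
  0.\<close>

lemma test_functions_box_approx:
 fixes c d :: "'a::euclidean_space"
 assumes "cbox c d \<subseteq> \<Omega>"
 shows "\<exists>\<phi> :: nat \<Rightarrow> 'a \<Rightarrow> real. (\<forall>k. \<phi> k \<in> test_functions \<Omega>) \<and> (\<forall>k x. \<bar>\<phi> k x\<bar> \<le> indicator (cbox c d) x) \<and>
  (\<forall>x. (\<lambda>k. \<phi> k x) \<longlonglongrightarrow> indicator (box c d) x)"
proof -
 define \<phi> where "\<phi> k x = (\<Prod>i\<in>Basis. flat_step (real (Suc k) * (x \<bullet> i - c \<bullet> i)) * flat_step (real (Suc k) * (d \<bullet> i - x \<bullet> i)))"
  for k and x :: 'a
 have range: "0 \<le> flat_step t" "flat_step t \<le> 1" for t by (auto simp: flat_step_eq)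
 have zero: "\<phi> k x = 0" if "x \<notin> cbox c d" for k x
 proof -
  obtain i where "i \<in> Basis" "x \<bullet> i < c \<bullet> i \<or> d \<bullet> i < x \<bullet> i" using \<open>x \<notin> cbox c d\<close> by (auto simp: mem_box not_le)
  then show ?thesis by (auto simp: \<phi>_def flat_step_eq mult_less_0_iff zero_less_mult_iff intro!: bexI[of _ i])
 qed
 have "\<phi> k \<in> test_functions \<Omega>" for k
 proof (rule test_functionsI[OF _ compact_cbox assms zero])
  show "C_class j (\<phi> k)" for j unfolding \<phi>_def[abs_def]
   by (intro C_class_prod C_class_mult C_class_flat_step C_class_diff C_class_const C_class_inner) simp
 qed
 moreover have "\<bar>\<phi> k x\<bar> \<le> indicator (cbox c d) x" for k x
 proof (cases "x \<in> cbox c d")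
  case True
  have "0 \<le> \<phi> k x" "\<phi> k x \<le> 1" unfolding \<phi>_def using range by (auto intro!: prod_nonneg prod_le_1 mult_le_one)
  then show ?thesis using True by simp
 qed (simp add: zero)
 moreover have "(\<lambda>k. \<phi> k x) \<longlonglongrightarrow> indicator (box c d) x" for x
 proof -
  have lim: "(\<lambda>k. flat_step (real (Suc k) * t)) \<longlonglongrightarrow> of_bool (t > 0)" for t
  proof (cases "t > 0")
   case True
   have "(\<lambda>k. exp (- (inverse (real (Suc k)) * (1 / t)))) \<longlonglongrightarrow> exp (- (0 * (1 / t)))"
    by (intro tendsto_intros LIMSEQ_inverse_real_of_nat)
   moreover have "exp (- (inverse (real (Suc k)) * (1 / t))) = flat_step (real (Suc k) * t)" for k
    using True by (simp add: flat_step_eq inverse_eq_divide zero_less_mult_iff del: of_nat_Suc)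
   ultimately show ?thesis using True by simp
  next
   case False
   then have "flat_step (real (Suc k) * t) = 0" for k by (simp add: flat_step_eq zero_less_mult_iff)
   then show ?thesis using False by simp
  qed
  have "(\<lambda>k. \<phi> k x) \<longlonglongrightarrow> (\<Prod>i\<in>Basis. of_bool (x \<bullet> i - c \<bullet> i > 0) * of_bool (d \<bullet> i - x \<bullet> i > 0))"
   unfolding \<phi>_def by (intro tendsto_prod tendsto_mult lim)
  also have "(\<Prod>i\<in>Basis. of_bool (x \<bullet> i - c \<bullet> i > 0) * of_bool (d \<bullet> i - x \<bullet> i > 0)) = (indicator (box c d) x :: real)"
   by (auto simp: indicator_def mem_box intro!: prod.neutral)
  finally show ?thesis .
 qed
 ultimately show ?thesis by blast
qed

text \<open>The positive and negative parts of \<open>h\<close> are densities of two finite measures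
  that agree on boxes. Boxes are stable under intersection and generate the Borel sets, so the
  measures coincide, and with them the densities almost everywhere.\<close>

lemma AE_zero_of_box_integrals:
 fixes h :: "'a::euclidean_space \<Rightarrow> real"
 assumes h: "integrable lborel h" and supp: "\<And>x. x \<notin> box a b \<Longrightarrow> h x = 0"
  and z: "\<And>c d. box c d \<subseteq> box a b \<Longrightarrow> (LINT x|lborel. indicator (box c d) x * h x) = 0"
 shows "AE x in lborel. h x = 0"
proof -
 have hm[measurable]: "h \<in> Borel" using h by simp
 have eq: "(\<integral>\<^sup>+x. ennreal (h x) * indicator X x) = (\<integral>\<^sup>+x. ennreal (- h x) * indicator X x)" if X: "X \<in> range (\<lambda>(c, d). box c d)" for X
 proof -
  obtain c d where X: "X = box c d" using X by auto
  \<comment> \<open>A box that sticks out of \<open>box a b\<close> may be replaced by the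
    intersection, since \<open>h\<close> vanishes outside.\<close>
  obtain c' d' where cd: "X \<inter> box a b = box c' d'" unfolding X box_Int_box by blast
  let ?g = "\<lambda>x. indicator (box c' d') x * h x"
  have g: "integrable lborel ?g" using integrable_mult_indicator[OF _ h, of "box c' d'"] by simp
  have "0 = (LINT x|lborel. ?g x)" using z[of c' d'] cd by (metis Int_lower2)
  also have "... = enn2real (\<integral>x. ?g x) - enn2real (\<integral>x. - ?g x)" by (rule real_lebesgue_integral_def[OF g])
  finally have "enn2real (\<integral>x. ?g x) = enn2real (\<integral>x. - ?g x)" by simp
  moreover have "(\<integral>x. ?g x) < \<infinity>" "(\<integral>x. - ?g x) < \<infinity>" using g by (auto simp: real_integrable_def less_top)
  moreover have "A = B" if "enn2real A = enn2real B" "A < \<infinity>" "B < \<infinity>" for A B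
   using that by (metis ennreal_enn2real infinity_ennreal_def)
  ultimately have "(\<integral>x. ?g x) = (\<integral>x. - ?g x)" by blast
  moreover have "ennreal (?g x) = ennreal (h x) * indicator X x" "ennreal (- ?g x) = ennreal (- h x) * indicator X x" for x
  proof -
   have "h x = 0 \<or> indicator (box c' d') x = (indicator X x :: real)"
    using supp[of x] unfolding cd[symmetric] by (cases "x \<in> box a b") (simp_all add: indicator_inter_arith)
   then show "ennreal (?g x) = ennreal (h x) * indicator X x" "ennreal (- ?g x) = ennreal (- h x) * indicator X x"
    by (cases "x \<in> X"; auto)+
  qed
  ultimately show ?thesis by simp
 qed
 have fin: "(\<integral>x. h x) \<noteq> \<infinity>" using h by (simp add: real_integrable_def)
 let ?B = "density lborel (\<lambda>x. ennreal (h x))"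
 let ?C = "density lborel (\<lambda>x. ennreal (- h x))"
 have "?B = ?C"
 proof (rule measure_eqI_generator_eq)
  let ?E = "range (\<lambda>(c, d). box c d :: 'a set)" and ?A = "\<lambda>n::nat. box (- (real n *\<^sub>R One)) (real n *\<^sub>R One) :: 'a set"
  show "Int_stable ?E" by (auto simp: Int_stable_def box_Int_box)
  show "?E \<subseteq> Pow UNIV" "sets ?B = sigma_sets UNIV ?E" "sets ?C = sigma_sets UNIV ?E" by (simp_all add: borel_eq_box)
  show "range ?A \<subseteq> ?E" by auto
  show "(\<Union>i. ?A i) = UNIV" unfolding UN_box_eq_UNIV by auto
  show "emeasure ?B (?A n) \<noteq> \<infinity>" for n
  proof -
   have "emeasure ?B (?A n) \<le> (\<integral>x. h x)"
    by (subst emeasure_density) (auto intro!: nn_integral_mono simp: indicator_def)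
   then show ?thesis using fin by (auto simp: top_unique)
  qed
  show "emeasure ?B X = emeasure ?C X" if "X \<in> ?E" for X
   using eq[OF that] that by (subst (1 2) emeasure_density) auto
 qed
 then have "AE x in lborel. ennreal (h x) = ennreal (- h x)" by (intro sigma_finite_measure.density_unique[OF sigma_finite_lborel]) auto
 then show ?thesis
 proof eventually_elim
  fix x assume "ennreal (h x) = ennreal (- h x)"
  then show "h x = 0" by (cases "h x \<ge> 0") (simp_all add: ennreal_neg)
 qed
qed

text \<open>An exhaustion of the open set by compact sets presents the function as a pointwise limit
  of measurable ones.\<close>

lemma locally_integrable_measurable:
 fixes f :: "'a::euclidean_space \<Rightarrow> 'b::euclidean_space"
 assumes "open \<Omega>" and f: "locally_integrable \<Omega> f"
 shows "set_borel_measurable lebesgue \<Omega> f"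
proof -
 obtain C :: "nat \<Rightarrow> 'a set" where C: "\<And>n. compact (C n)" "\<And>n. C n \<subseteq> \<Omega>" "\<And>n. C n \<subseteq> interior (C (Suc n))" "\<Union>(range C) = \<Omega>"
  by (rule open_Union_compact_subsets[OF assms(1)]) blast
 have mono: "C m \<subseteq> C n" if "m \<le> n" for m n
  using C(3) interior_subset by (intro lift_Suc_mono_le[OF _ that, of C]) blast
 have "(\<lambda>x. indicator (C n) x *\<^sub>R f x) \<in> borel_measurable lebesgue" for n
  using f C(1,2)[of n] by (auto simp: locally_integrable_def set_integrable_def)
 moreover have "(\<lambda>n. indicator (C n) x *\<^sub>R f x) \<longlonglongrightarrow> indicator \<Omega> x *\<^sub>R f x" for x
 proof (cases "x \<in> \<Omega>")
  case True
  then obtain m where "x \<in> C m" using C(4) by blast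
  then have "x \<in> C n" if "n \<ge> m" for n using mono[OF that] by blast
  then have "\<forall>\<^sub>F n in sequentially. indicator (C n) x *\<^sub>R f x = indicator \<Omega> x *\<^sub>R f x"
   using True by (auto simp: eventually_sequentially intro!: exI[of _ m])
  then show ?thesis by (rule tendsto_eventually)
 next
  case False
  then have "x \<notin> C n" for n using C(2) by blast
  then show ?thesis using False by simp
 qed
 ultimately show ?thesis unfolding set_borel_measurable_def by (rule borel_measurable_LIMSEQ_metric)
qed

lemma locally_integrable_inner:
 "locally_integrable \<Omega> f \<Longrightarrow> locally_integrable \<Omega> (\<lambda>x. f x \<bullet> b)" unfolding locally_integrable_def set_integrable_def
 by (auto intro!: integrable_inner_left simp flip: inner_scaleR_left)

lemma locally_integrable_diff:
 "locally_integrable \<Omega> f \<Longrightarrow> locally_integrable \<Omega> g \<Longrightarrow> locally_integrable \<Omega> (\<lambda>x. f x - g x)"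
 unfolding locally_integrable_def by (auto intro: set_integral_diff)

lemma integrable_locally_integrable_mult:
 fixes f g :: "'a::euclidean_space \<Rightarrow> real"
 assumes f: "locally_integrable \<Omega> f" and C: "compact C" "C \<subseteq> \<Omega>" "\<And>x. x \<notin> C \<Longrightarrow> g x = 0"
  and g: "g \<in> Borel" "\<And>x. \<bar>g x\<bar> \<le> M" shows "set_integrable lebesgue \<Omega> (\<lambda>x. f x * g x)"
proof -
 have fC: "integrable lebesgue (\<lambda>x. indicator C x *\<^sub>R f x)" using f C by (auto simp: locally_integrable_def set_integrable_def)
 have [measurable]: "g \<in> borel_measurable lebesgue" using g(1) by (simp add: measurable_completion)
 have "integrable lebesgue (\<lambda>x. M * (indicator C x *\<^sub>R f x))" by (intro integrable_mult_right fC)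
 then have "integrable lebesgue (\<lambda>x. (indicator C x *\<^sub>R f x) * g x)"
 proof (rule Bochner_Integration.integrable_bound)
  show "(\<lambda>x. (indicator C x *\<^sub>R f x) * g x) \<in> borel_measurable lebesgue"
   by (intro borel_measurable_times borel_measurable_integrable[OF fC]) measurable
  show "AE x in lebesgue. norm ((indicator C x *\<^sub>R f x) * g x) \<le> norm (M * (indicator C x *\<^sub>R f x))"
   using g(2) by (intro AE_I2) (auto simp: abs_mult mult.commute[of M] intro!: mult_left_mono order.trans[OF g(2)] split: split_indicator)
 qed
 also have "(\<lambda>x. (indicator C x *\<^sub>R f x) * g x) = (\<lambda>x. indicator \<Omega> x *\<^sub>R (f x * g x))"
 proof
  fix x show "(indicator C x *\<^sub>R f x) * g x = indicator \<Omega> x *\<^sub>R (f x * g x)"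
   using C(3)[of x] C(2) by (cases "x \<in> C") (auto simp: subset_iff)
 qed
 finally show ?thesis by (simp add: set_integrable_def)
qed

text \<open>On a box whose closure lies in \<open>\<Omega>\<close> the function has a Borel
  representative, and test functions approximating the indicators of smaller boxes show that its
  integral over each of them vanishes.\<close>

lemma fundamental_lemma:
 fixes f :: "'a::euclidean_space \<Rightarrow> real"
 assumes \<Omega>: "open \<Omega>" and f: "locally_integrable \<Omega> f"
  and z: "\<And>\<phi>. \<phi> \<in> test_functions \<Omega> \<Longrightarrow> (LINT x:\<Omega>|lebesgue. f x * \<phi> x) = 0" shows "AE x in lborel. x \<in> \<Omega> \<longrightarrow> f x = 0"
proof (rule AE_locally_imp_AE)
 fix x assume "x \<in> \<Omega>"
 then obtain a b where ab: "cbox a b \<subseteq> \<Omega>" "x \<in> box a b" using open_contains_cbox[OF \<Omega>] by metis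
 define F where "F x = indicator (cbox a b) x *\<^sub>R f x" for x
 have F: "integrable lebesgue F" using f ab(1) unfolding F_def[abs_def] locally_integrable_def set_integrable_def by auto
 obtain F' where F': "F' \<in> borel_measurable lborel" "AE x in lborel. F x = F' x"
  using completion_ex_borel_measurable_real[OF borel_measurable_integrable[OF F]] by blast
 have [measurable]: "F' \<in> Borel" using F' by simp
 have F'l: "F' \<in> borel_measurable lebesgue" using F'(1) by (simp add: measurable_completion)
 have ae: "AE x in lebesgue. F x = F' x" using F'(2) by (simp add: AE_completion_iff)
 have iF': "integrable lborel F'"
  using F integrable_cong_AE[OF borel_measurable_integrable[OF F] F'l ae] F'(1) by (simp add: integrable_completion)
 define h where "h x = indicator (box a b) x * F' x" for x
 have h: "integrable lborel h" unfolding h_def[abs_def] using integrable_mult_indicator[OF _ iF', of "box a b"] by simp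
 have "AE x in lborel. h x = 0"
 proof (rule AE_zero_of_box_integrals[OF h])
  show "h x = 0" if "x \<notin> box a b" for x using that by (simp add: h_def)
  fix c d assume cd: "box c d \<subseteq> box a b"
  show "(LINT x|lborel. indicator (box c d) x * h x) = 0"
  proof (cases "box c d = {}")
   case False
   have "cbox c d \<subseteq> cbox a b" using closure_mono[OF cd] False cd by (metis closure_box subset_empty)
   then have sub: "cbox c d \<subseteq> \<Omega>" using ab by blast
   obtain \<phi> :: "nat \<Rightarrow> 'a \<Rightarrow> real" where \<phi>: "\<And>k. \<phi> k \<in> test_functions \<Omega>" "\<And>k x. \<bar>\<phi> k x\<bar> \<le> indicator (cbox c d) x"
    "\<And>x. (\<lambda>k. \<phi> k x) \<longlonglongrightarrow> indicator (box c d) x" using test_functions_box_approx[OF sub] by blast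
   have [measurable]: "\<phi> k \<in> Borel" for k by (intro borel_measurable_C1c test_functions_C1c[OF \<phi>(1)])
   have "(\<lambda>k. LINT x|lborel. F' x * \<phi> k x) \<longlonglongrightarrow> (LINT x|lborel. F' x * indicator (box c d) x)"
   proof (rule integral_dominated_convergence)
    show "integrable lborel (\<lambda>x. \<bar>F' x\<bar>)" using iF' by simp
    show "AE x in lborel. (\<lambda>k. F' x * \<phi> k x) \<longlonglongrightarrow> F' x * indicator (box c d) x" by (intro AE_I2 tendsto_intros \<phi>)
    have "\<bar>\<phi> k x\<bar> \<le> 1" for k x using order.trans[OF \<phi>(2)[of k x] indicator_le_1] by simp
    then show "AE x in lborel. norm (F' x * \<phi> k x) \<le> \<bar>F' x\<bar>" for k
     by (intro AE_I2) (simp add: abs_mult mult_left_le)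
   qed measurable
   moreover have "(LINT x|lborel. F' x * \<phi> k x) = 0" for k
   proof -
    have "\<phi> k x = 0" if "x \<notin> cbox a b" for x
    proof -
     have "x \<notin> cbox c d" using that \<open>cbox c d \<subseteq> cbox a b\<close> by blast
     then show ?thesis using \<phi>(2)[of k x] by simp
    qed
    then have eq: "indicator \<Omega> x *\<^sub>R (f x * \<phi> k x) = F x * \<phi> k x" for x
     using ab(1) by (cases "x \<in> cbox a b") (auto simp: F_def subset_iff)
    have "0 = (LINT x|lebesgue. F x * \<phi> k x)" using z[OF \<phi>(1), of k] by (simp only: LINT_def eq)
    also have "... = (LINT x|lebesgue. F' x * \<phi> k x)"
    proof (rule integral_cong_AE)
     show "AE x in lebesgue. F x * \<phi> k x = F' x * \<phi> k x" using ae by eventually_elim simp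
    qed (use F F'l in \<open>auto simp: measurable_completion intro!: borel_measurable_times\<close>)
    also have "... = (LINT x|lborel. F' x * \<phi> k x)" by (rule integral_completion) measurable
    finally show ?thesis by simp
   qed
   ultimately have "(LINT x|lborel. F' x * indicator (box c d) x) = 0" by (simp add: LIMSEQ_const_iff)
   also have "(\<lambda>x. F' x * indicator (box c d) x) = (\<lambda>x. indicator (box c d) x * h x)"
    using cd by (auto simp: h_def fun_eq_iff indicator_def)
   finally show ?thesis .
  qed simp
 qed
 then have "AE y in lborel. y \<in> box a b \<longrightarrow> f y = 0" using F'(2)
 proof eventually_elim
  fix y assume "h y = 0" "F y = F' y"
  then show "y \<in> box a b \<longrightarrow> f y = 0" using box_subset_cbox[of a b] by (auto simp: h_def F_def subset_iff)
 qed
 then show "\<exists>U. open U \<and> x \<in> U \<and> (AE y in lborel. y \<in> U \<longrightarrow> f y = 0)" using ab(2) open_box by blast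
qed

lemma test_function_bounds:
 fixes \<phi> :: "'a::euclidean_space \<Rightarrow> real"
 assumes "\<phi> \<in> test_functions \<Omega>"
 shows "\<exists>C M. compact C \<and> C \<subseteq> \<Omega> \<and> (\<forall>x. x \<notin> C \<longrightarrow> \<phi> x = 0 \<and> gradient \<phi> x = 0) \<and> (\<forall>x. \<bar>\<phi> x\<bar> \<le> M \<and> norm (gradient \<phi> x) \<le> M)"
proof -
 let ?C = "closure {x. \<phi> x \<noteq> 0}"
 have c: "C1c \<phi>" by (rule test_functions_C1c[OF assms])
 obtain M1 where M1: "\<forall>x. norm (\<phi> x) \<le> M1"
  using bounded_continuous_support[OF C1c_continuous[OF c] C1c_bounded_support[OF c]] by blast
 obtain M2 where M2: "\<forall>x. norm (gradient \<phi> x) \<le> M2"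
  using bounded_continuous_support[OF C1c_continuous_gradient[OF c] C1c_bounded_support_gradient[OF c]] by blast
 have "\<forall>x. x \<notin> ?C \<longrightarrow> \<phi> x = 0 \<and> gradient \<phi> x = 0"
  using closure_subset[of "{x. \<phi> x \<noteq> 0}"] gradient_zero_outside[of _ \<phi>] by blast
 moreover have "\<forall>x. \<bar>\<phi> x\<bar> \<le> max M1 M2 \<and> norm (gradient \<phi> x) \<le> max M1 M2" using M1 M2 by (simp add: le_max_iff_disj)
 moreover have "compact ?C" "?C \<subseteq> \<Omega>" using assms unfolding test_functions_def by blast+
 ultimately show ?thesis by blast
qed

text \<open>\<open>weak_gradient\<close> is an arbitrary choice by \<open>SOME\<close>; this allows
  a concrete gradient to be substituted for it inside integrals.\<close>

lemma has_weak_gradient_unique: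
 fixes v :: "'a::euclidean_space \<Rightarrow> real"
 assumes \<Omega>: "open \<Omega>" and G: "has_weak_gradient \<Omega> v G" "has_weak_gradient \<Omega> v G'"
 shows "AE x in lborel. x \<in> \<Omega> \<longrightarrow> G x = G' x"
proof -
 have li: "locally_integrable \<Omega> (\<lambda>x. G x \<bullet> b)" "locally_integrable \<Omega> (\<lambda>x. G' x \<bullet> b)" for b
  using G by (auto simp: has_weak_gradient_def intro: locally_integrable_inner)
 have "AE x in lborel. x \<in> \<Omega> \<longrightarrow> G x \<bullet> b - G' x \<bullet> b = 0" if b: "b \<in> Basis" for b
 proof (rule fundamental_lemma[OF \<Omega> locally_integrable_diff[OF li]])
  fix \<phi> assume \<phi>: "\<phi> \<in> test_functions \<Omega>"
  obtain C M where C: "compact C" "C \<subseteq> \<Omega>" "\<And>x. x \<notin> C \<Longrightarrow> \<phi> x = 0" "\<And>x. \<bar>\<phi> x\<bar> \<le> M"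
   using test_function_bounds[OF \<phi>] by blast
  have i: "set_integrable lebesgue \<Omega> (\<lambda>x. g x * \<phi> x)" if "locally_integrable \<Omega> g" for g
   by (rule integrable_locally_integrable_mult[OF that C(1-3) borel_measurable_C1c[OF test_functions_C1c[OF \<phi>]] C(4)])
  let ?A = "(LINT x:\<Omega>|lebesgue. (G x \<bullet> b - G' x \<bullet> b) * \<phi> x)"
  have "?A = (LINT x:\<Omega>|lebesgue. (G x \<bullet> b) * \<phi> x) - (LINT x:\<Omega>|lebesgue. (G' x \<bullet> b) * \<phi> x)"
   unfolding left_diff_distrib by (intro set_integral_diff i li)
  also have "... = 0" using G \<phi> b by (simp add: has_weak_gradient_def)
  finally show "?A = 0" .
 qed
 then have "AE x in lborel. \<forall>b\<in>Basis. x \<in> \<Omega> \<longrightarrow> G x \<bullet> b - G' x \<bullet> b = 0"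
  by (subst AE_ball_countable[OF countable_finite[OF finite_Basis]]) blast
 then show ?thesis
 proof eventually_elim
  fix x assume *: "\<forall>b\<in>Basis. x \<in> \<Omega> \<longrightarrow> G x \<bullet> b - G' x \<bullet> b = 0"
  have "G x = G' x" if "x \<in> \<Omega>" by (rule euclidean_eqI) (use * that in simp)
  then show "x \<in> \<Omega> \<longrightarrow> G x = G' x" ..
 qed
qed

text \<open>\<open>young_split\<close> with \<open>t * \<rho> x\<close> in place of
  \<open>t\<close>. It controls a plain first moment by a weighted \<open>s\<close>-th one;
  \<open>\<rho>\<close> is left free so that \<open>\<rho> x powr (1 - s)\<close> can be matched to
  a given weight.\<close>

lemma nn_integral_young:
 fixes f :: "'a::euclidean_space \<Rightarrow> 'b::euclidean_space" and \<rho> :: "'a \<Rightarrow> real"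
 assumes [measurable]: "f \<in> Borel" "\<rho> \<in> Borel" "S \<in> sets borel"
  and \<rho>: "AE x in lborel. \<rho> x > 0" and s: "s > 1" and t: "t > 0" shows "(\<integral>x\<in>S. norm (f x))
  \<le> ennreal t * (\<integral>x\<in>S. \<rho> x) + ennreal (t powr (1 - s)) * (\<integral>x. \<rho> x powr (1 - s) * norm (f x) powr s)"
proof -
 have "(\<integral>x\<in>S. norm (f x))
  \<le> (\<integral>\<^sup>+x. ennreal t * (ennreal (\<rho> x) * indicator S x) + ennreal (t powr (1 - s)) * ennreal (\<rho> x powr (1 - s) * norm (f x) powr s))"
 proof (rule nn_integral_mono_AE, use \<rho> in eventually_elim)
  fix x assume x: "\<rho> x > 0"
  let ?A = "\<rho> x powr (1 - s) * norm (f x) powr s"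
  have "norm (f x) \<le> t * \<rho> x + (t * \<rho> x) powr (1 - s) * norm (f x) powr s" using x t s by (intro young_split) auto
  then have "norm (f x) \<le> t * \<rho> x + t powr (1 - s) * ?A" by (simp only: powr_mult mult.assoc)
  then have "ennreal (norm (f x)) \<le> ennreal t * ennreal (\<rho> x) + ennreal (t powr (1 - s)) * ennreal ?A"
   using t x by (simp add: ennreal_leI flip: ennreal_mult ennreal_plus)
  then show "ennreal (norm (f x)) * indicator S x
   \<le> ennreal t * (ennreal (\<rho> x) * indicator S x) + ennreal (t powr (1 - s)) * ennreal ?A" by (cases "x \<in> S") auto
 qed
 also have "... = ennreal t * (\<integral>x\<in>S. \<rho> x) + ennreal (t powr (1 - s)) * (\<integral>x. \<rho> x powr (1 - s) * norm (f x) powr s)"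
  by (simp add: nn_integral_add nn_integral_cmult)
 finally show ?thesis .
qed

lemma local_L1_small:
 fixes f :: "nat \<Rightarrow> 'a::euclidean_space \<Rightarrow> 'b::euclidean_space" and \<rho> :: "'a \<Rightarrow> real"
 assumes f: "\<And>k. f k \<in> Borel" and \<rho>: "\<rho> \<in> Borel" "AE x in lborel. \<rho> x > 0"
  and S: "S \<in> sets borel" "(\<integral>x\<in>S. \<rho> x) < \<infinity>" and s: "s > 1"
  and L: "\<And>e. e > 0 \<Longrightarrow> tail_le (\<lambda>k. \<integral>x. \<rho> x powr (1 - s) * norm (f k x) powr s) e"
  and e: "e > 0" shows "tail_le (\<lambda>k. \<integral>x\<in>S. norm (f k x)) e"
proof -
 obtain K where K: "K \<ge> 0" "(\<integral>x\<in>S. \<rho> x) = ennreal K" using S(2) by (cases "(\<integral>x\<in>S. \<rho> x)" rule: ennreal_cases) auto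
 \<comment> \<open>\<open>t\<close> is fixed first, to make the term with \<open>\<rho>\<close> at
   most \<open>e / 2\<close>; only then is \<open>k\<close> taken large against the factor
   \<open>t powr (1 - s)\<close>. The summand 1 covers \<open>K = 0\<close>.\<close>
 define t where "t = e / (2 * (K + 1))"
 have t: "t > 0" using e K by (simp add: t_def)
 have "t * K \<le> t * (K + 1)" using t by simp
 also have "X * (e / (2 * X)) = e / 2" if "X > 0" for X :: real using that by simp
 from this[of "K + 1"] have "t * (K + 1) = e / 2" unfolding t_def using K by (simp only: mult.commute)
 finally have tK: "t * K \<le> e / 2" .
 obtain N where N: "\<And>k. k \<ge> N \<Longrightarrow> (\<integral>x. \<rho> x powr (1 - s) * norm (f k x) powr s) \<le> ennreal (e / 2 / t powr (1 - s))"
  using L[of "e / 2 / t powr (1 - s)"] e t by auto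
 have "(\<integral>x\<in>S. norm (f k x)) \<le> ennreal e" if "k \<ge> N" for k
 proof -
  have "(\<integral>x\<in>S. norm (f k x)) \<le> ennreal t * ennreal K + ennreal (t powr (1 - s)) * ennreal (e / 2 / t powr (1 - s))"
   using nn_integral_young[OF f \<rho>(1) S(1) \<rho>(2) s t, of k] mult_left_mono[OF N[OF that], of "ennreal (t powr (1 - s))"]
   unfolding K(2) by (meson add_left_mono order.trans zero_le)
  also have "... = ennreal (t * K + e / 2)" using t K e by (simp flip: ennreal_mult ennreal_plus)
  also have "... \<le> ennreal e" using tK by (intro ennreal_leI) simp
  finally show ?thesis .
 qed
 then show ?thesis by blast
qed

lemma integral_mult_tendsto:
 fixes f :: "nat \<Rightarrow> 'a::euclidean_space \<Rightarrow> real"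
 assumes i: "\<And>k. integrable lborel (\<lambda>x. f k x * g x)" "integrable lborel (\<lambda>x. F x * g x)"
  and m[measurable]: "\<And>k. f k \<in> Borel" "F \<in> Borel"  "C \<in> sets borel"
  and g: "\<And>x. \<bar>g x\<bar> \<le> M * indicator C x" and M: "M \<ge> 0"
  and L: "\<And>e. e > 0 \<Longrightarrow> tail_le (\<lambda>k. \<integral>x\<in>C. \<bar>f k x - F x\<bar>) e"
 shows "(\<lambda>k. LINT x|lborel. f k x * g x) \<longlonglongrightarrow> (LINT x|lborel. F x * g x)"
proof (rule LIMSEQ_I)
 fix e :: real assume e: "e > 0"
 let ?B = "e / (2 * (M + 1))"
 obtain N where N: "\<And>k. k \<ge> N \<Longrightarrow> (\<integral>x\<in>C. \<bar>f k x - F x\<bar>) \<le> ennreal ?B" using L[of "?B"] e M by auto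
 have "norm ((LINT x|lborel. f k x * g x) - (LINT x|lborel. F x * g x)) < e" if "k \<ge> N" for k
 proof -
  let ?A = "(LINT x|lborel. f k x * g x) - (LINT x|lborel. F x * g x)"
  have "?A = (LINT x|lborel. f k x * g x - F x * g x)" by (rule Bochner_Integration.integral_diff[OF i, symmetric])
  then have "ennreal (norm ?A) \<le> (\<integral>\<^sup>+x. norm (f k x * g x - F x * g x))"
   using integral_norm_bound_ennreal[OF Bochner_Integration.integrable_diff[OF i(1)[of k] i(2)]] by simp
  also have "... \<le> (\<integral>\<^sup>+x. ennreal M * (ennreal \<bar>f k x - F x\<bar> * indicator C x))"
  proof (rule nn_integral_mono)
   fix x
   have "norm (f k x * g x - F x * g x) = \<bar>f k x - F x\<bar> * \<bar>g x\<bar>" by (simp add: abs_mult flip: left_diff_distrib)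
   also have "... \<le> \<bar>f k x - F x\<bar> * (M * indicator C x)" by (intro mult_left_mono g) simp
   finally show "ennreal (norm (f k x * g x - F x * g x)) \<le> ennreal M * (ennreal \<bar>f k x - F x\<bar> * indicator C x)"
    using M by (cases "x \<in> C") (auto simp: ennreal_leI mult.commute simp flip: ennreal_mult)
  qed
  also have "... = ennreal M * (\<integral>x\<in>C. \<bar>f k x - F x\<bar>)" by (rule nn_integral_cmult) measurable
  also have "... \<le> ennreal M * ennreal ?B" by (intro mult_left_mono N that) auto
  also have "... = ennreal (M * ?B)" using M e by (simp flip: ennreal_mult)
  finally have "norm ?A \<le> M * ?B" using M e by (subst (asm) ennreal_le_iff) auto
  also have "... \<le> (M + 1) * ?B" using M e by (intro mult_right_mono) auto
  also have "... < e"
  proof -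
   have "X * (e / (2 * X)) < e" if "X > 0" for X using that e by simp
   from this[of "M + 1"] show ?thesis using M by linarith
  qed
  finally show ?thesis .
 qed
 then show "\<exists>no. \<forall>k\<ge>no. norm ((LINT x|lborel. f k x * g x) - (LINT x|lborel. F x * g x)) < e" by blast
qed

lemma lborel_lebesgue_transfer:
 fixes f :: "'a::euclidean_space \<Rightarrow> 'b::euclidean_space"
 assumes [measurable]: "f \<in> Borel" "S \<in> sets borel"
 shows "set_integrable lebesgue S f \<longleftrightarrow> integrable lborel (\<lambda>x. indicator S x *\<^sub>R f x)"
  and "(LINT x:S|lebesgue. f x) = (LINT x|lborel. indicator S x *\<^sub>R f x)" unfolding set_integrable_def LINT_def
 by (auto simp: integrable_completion integral_completion)

lemma locally_integrable_limit:
 fixes f :: "nat \<Rightarrow> 'a::euclidean_space \<Rightarrow> 'b::euclidean_space"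
 assumes f: "\<And>k. integrable lborel (f k)" and F[measurable]: "F \<in> Borel"
  and L: "\<And>C e. compact C \<Longrightarrow> e > 0 \<Longrightarrow> tail_le (\<lambda>k. \<integral>x\<in>C. norm (f k x - F x)) e" shows "locally_integrable \<Omega> F"
 unfolding locally_integrable_def
proof (intro allI impI)
 fix C assume C: "compact C \<and> C \<subseteq> \<Omega>"
 then have [measurable]: "C \<in> sets borel" by (simp add: borel_compact)
 have [measurable]: "f k \<in> Borel" for k using f[of k] by simp
 obtain N where N: "(\<integral>x\<in>C. norm (f N x - F x)) \<le> ennreal 1" using L[of C 1] C by auto
 have "(\<integral>x. norm (indicator C x *\<^sub>R F x))
  \<le> (\<integral>\<^sup>+x. ennreal (norm (f N x)) + ennreal (norm (f N x - F x)) * indicator C x)"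
 proof (rule nn_integral_mono)
  fix x
  have "norm (F x) \<le> norm (f N x) + norm (f N x - F x)" using norm_triangle_sub[of "F x" "f N x"] by (simp add: norm_minus_commute)
  then show "ennreal (norm (indicator C x *\<^sub>R F x)) \<le> ennreal (norm (f N x)) + ennreal (norm (f N x - F x)) * indicator C x"
   by (cases "x \<in> C") (simp_all add: ennreal_leI flip: ennreal_plus)
 qed
 also have "... = (\<integral>x. norm (f N x)) + (\<integral>x\<in>C. norm (f N x - F x))" by (rule nn_integral_add) measurable
 also have "... < \<infinity>" using f[of N] N by (auto simp: integrable_iff_bounded intro: le_less_trans)
 finally have "integrable lborel (\<lambda>x. indicator C x *\<^sub>R F x)" by (intro integrableI_bounded) measurable
 then show "set_integrable lebesgue C F" by (simp add: lborel_lebesgue_transfer(1))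
qed

text \<open>Integration by parts holds for each \<open>u k\<close>. Both sides pass to the limit
  because \<open>\<phi>\<close> and its gradient are bounded with compact support, and there the
  convergence is in the mean of order one.\<close>

lemma has_weak_gradient_limit:
 fixes V :: "'a::euclidean_space \<Rightarrow> real"
 assumes \<Omega>: "open \<Omega>" and u: "\<And>k::nat. u k \<in> test_functions \<Omega>"
  and V: "V \<in> Borel" and G: "G \<in> Borel"
  and VL: "\<And>C e. compact C \<Longrightarrow> e > 0 \<Longrightarrow> tail_le (\<lambda>k. \<integral>x\<in>C. \<bar>u k x - V x\<bar>) e"
  and GL: "\<And>C e. compact C \<Longrightarrow> e > 0 \<Longrightarrow> tail_le (\<lambda>k. \<integral>x\<in>C. norm (gradient (u k) x - G x)) e"
 shows "has_weak_gradient \<Omega> V G"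
proof -
 have \<Omega>m[measurable]: "\<Omega> \<in> sets borel" using \<Omega> by simp
 note [measurable] = V G
 have uc: "C1c (u k)" for k by (rule test_functions_C1c[OF u])
 have um[measurable]: "u k \<in> Borel" "gradient (u k) \<in> Borel" for k
  by (rule borel_measurable_C1c[OF uc], rule borel_measurable_gradient[OF uc])
 have liV: "locally_integrable \<Omega> V"
  by (rule locally_integrable_limit[of u, OF integrable_continuous_bounded_support[OF C1c_continuous[OF uc] C1c_bounded_support[OF uc]] V])
   (use VL in simp)
 have liG: "locally_integrable \<Omega> G" by (rule locally_integrable_limit[of "\<lambda>k. gradient (u k)",
     OF integrable_continuous_bounded_support[OF C1c_continuous_gradient[OF uc] C1c_bounded_support_gradient[OF uc]] G GL])
 have "(LINT x:\<Omega>|lebesgue. V x * partial_deriv b \<phi> x) = - (LINT x:\<Omega>|lebesgue. (G x \<bullet> b) * \<phi> x)"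
  if \<phi>: "\<phi> \<in> test_functions \<Omega>" and b: "b \<in> Basis" for \<phi> b
 proof -
  have \<phi>c: "C1c \<phi>" by (rule test_functions_C1c[OF \<phi>])
  obtain C M where C: "compact C" "C \<subseteq> \<Omega>" "\<And>x. x \<notin> C \<Longrightarrow> \<phi> x = 0" "\<And>x. x \<notin> C \<Longrightarrow> gradient \<phi> x = 0"
   and M: "\<And>x. \<bar>\<phi> x\<bar> \<le> M" "\<And>x. norm (gradient \<phi> x) \<le> M" using test_function_bounds[OF \<phi>] by blast
  have [measurable]: "C \<in> sets borel" using C by (simp add: borel_compact)
  have \<phi>m[measurable]: "\<phi> \<in> Borel" "gradient \<phi> \<in> Borel"
   by (rule borel_measurable_C1c[OF \<phi>c], rule borel_measurable_gradient[OF \<phi>c])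
  have M0: "M \<ge> 0" using M(1)[of 0] by linarith
  let ?g = "\<lambda>x. gradient \<phi> x \<bullet> b"
  have g: "\<bar>?g x\<bar> \<le> M" for x using Basis_le_norm[OF b, of "gradient \<phi> x"] M(2)[of x] by linarith
  have gC: "\<bar>?g x\<bar> \<le> M * indicator C x" "\<bar>\<phi> x\<bar> \<le> M * indicator C x" for x
   using C(3,4)[of x] g[of x] M(1)[of x] by (auto simp: indicator_def)
  have int: "integrable lborel (\<lambda>x. f x * h x)" "(LINT x:\<Omega>|lebesgue. f x * h x) = (LINT x|lborel. f x * h x)"
   if "locally_integrable \<Omega> f" and [measurable]: "f \<in> Borel" "h \<in> Borel"
    and h: "\<And>x. x \<notin> C \<Longrightarrow> h x = 0" "\<And>x. \<bar>h x\<bar> \<le> M" for f h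
  proof -
   have eq: "(\<lambda>x. indicator \<Omega> x *\<^sub>R (f x * h x)) = (\<lambda>x. f x * h x)"
    using h(1) C(2) by (force simp: indicator_def fun_eq_iff)
   have fh: "(\<lambda>x. f x * h x) \<in> Borel" by measurable
   have "set_integrable lebesgue \<Omega> (\<lambda>x. f x * h x)"
    using that C by (intro integrable_locally_integrable_mult[of \<Omega> f C h M]) auto
   then show "integrable lborel (\<lambda>x. f x * h x)" by (simp only: lborel_lebesgue_transfer(1)[OF fh \<Omega>m] eq)
   show "(LINT x:\<Omega>|lebesgue. f x * h x) = (LINT x|lborel. f x * h x)"
    by (simp only: lborel_lebesgue_transfer(2)[OF fh \<Omega>m] eq)
  qed
  have liu: "locally_integrable \<Omega> (u k)" for k
   by (rule locally_integrable_limit[of "\<lambda>_. u k", OF integrable_continuous_bounded_support[OF C1c_continuous[OF uc] C1c_bounded_support[OF uc]]]) auto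
  have ligu: "locally_integrable \<Omega> (\<lambda>x. gradient (u k) x \<bullet> b)" for k
   by (intro locally_integrable_inner, rule locally_integrable_limit[of "\<lambda>_. gradient (u k)",
     OF integrable_continuous_bounded_support[OF C1c_continuous_gradient[OF uc] C1c_bounded_support_gradient[OF uc]]]) auto
  have "(\<lambda>k. LINT x|lborel. u k x * ?g x) \<longlonglongrightarrow> (LINT x|lborel. V x * ?g x)"
  proof (rule integral_mult_tendsto[OF _ _ um(1) V _ gC(1) M0])
   show "integrable lborel (\<lambda>x. V x * ?g x)" using C(4) g by (intro int liV V) auto
   show "integrable lborel (\<lambda>x. u k x * ?g x)" for k using C(4) g by (intro int liu um) auto
  qed (use VL[OF C(1)] in simp_all)
  moreover have "(\<lambda>k. LINT x|lborel. (gradient (u k) x \<bullet> b) * \<phi> x) \<longlonglongrightarrow> (LINT x|lborel. (G x \<bullet> b) * \<phi> x)"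
  proof (rule integral_mult_tendsto[OF _ _ _ _ _ gC(2) M0])
   show "integrable lborel (\<lambda>x. (G x \<bullet> b) * \<phi> x)" using C(3) M by (intro int locally_integrable_inner liG) auto
   show "integrable lborel (\<lambda>x. (gradient (u k) x \<bullet> b) * \<phi> x)" for k using C(3) M by (intro int ligu) auto
   fix e :: real assume e: "e > 0"
   obtain N where N: "\<And>k. k \<ge> N \<Longrightarrow> (\<integral>x\<in>C. norm (gradient (u k) x - G x)) \<le> ennreal e" using GL[OF C(1) e] by blast
   have "(\<integral>x\<in>C. \<bar>gradient (u k) x \<bullet> b - G x \<bullet> b\<bar>) \<le> (\<integral>x\<in>C. norm (gradient (u k) x - G x))" for k
    using Basis_le_norm[OF b] by (intro nn_integral_mono mult_right_mono ennreal_leI) (simp_all flip: inner_diff_left)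
   then show "tail_le (\<lambda>k. \<integral>x\<in>C. \<bar>gradient (u k) x \<bullet> b - G x \<bullet> b\<bar>) e" using N by (meson order.trans)
  qed measurable
  then have "(\<lambda>k. LINT x|lborel. u k x * ?g x) \<longlonglongrightarrow> - (LINT x|lborel. (G x \<bullet> b) * \<phi> x)"
   unfolding integral_by_parts_C1c[OF uc \<phi>c] by (rule tendsto_minus)
  ultimately have "(LINT x|lborel. V x * ?g x) = - (LINT x|lborel. (G x \<bullet> b) * \<phi> x)" by (rule LIMSEQ_unique)
  moreover have "(LINT x:\<Omega>|lebesgue. V x * ?g x) = (LINT x|lborel. V x * ?g x)"
   using C(4) g by (intro int liV V) auto
  moreover have "(LINT x:\<Omega>|lebesgue. (G x \<bullet> b) * \<phi> x) = (LINT x|lborel. (G x \<bullet> b) * \<phi> x)"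
   using C(3) M by (intro int locally_integrable_inner liG) auto
  ultimately show ?thesis by (simp add: gradient_inner_Basis[OF b])
 qed
 then show ?thesis using liV liG unfolding has_weak_gradient_def by blast
qed

text \<open>A bridge from the Bochner integrals in \<open>in_Lp\<close> and \<open>Lp_norm\<close>
  to the extended integrals of the estimates. The second part asks for a finite value, because
  otherwise \<open>Lp_norm\<close> would have the default value 0.\<close>

lemma in_Lp_iff_nn_integral:
 fixes f :: "'a::euclidean_space \<Rightarrow> 'b::euclidean_space"
 assumes p: "p > 0" and m: "set_borel_measurable lebesgue \<Omega> f"
 shows "in_Lp p \<Omega> f \<longleftrightarrow> (\<integral>\<^sup>+x. ennreal (norm (indicator \<Omega> x *\<^sub>R f x) powr p) \<partial>lebesgue) < \<infinity>"
  and "E \<ge> 0 \<Longrightarrow> (\<integral>\<^sup>+x. ennreal (norm (indicator \<Omega> x *\<^sub>R f x) powr p) \<partial>lebesgue) = ennreal E \<Longrightarrow> Lp_norm p \<Omega> f = E powr (1/p)"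
proof -
 have eq: "(\<lambda>x. indicator \<Omega> x *\<^sub>R norm (f x) powr p) = (\<lambda>x. norm (indicator \<Omega> x *\<^sub>R f x) powr p)"
  using p by (auto simp: indicator_def fun_eq_iff)
 have [measurable]: "(\<lambda>x. indicator \<Omega> x *\<^sub>R f x) \<in> borel_measurable lebesgue" using m by (simp add: set_borel_measurable_def)
 have m2: "(\<lambda>x. norm (indicator \<Omega> x *\<^sub>R f x) powr p) \<in> borel_measurable lebesgue" by measurable
 show "in_Lp p \<Omega> f \<longleftrightarrow> (\<integral>\<^sup>+x. ennreal (norm (indicator \<Omega> x *\<^sub>R f x) powr p) \<partial>lebesgue) < \<infinity>"
  unfolding in_Lp_def set_integrable_def eq using m m2 by (simp add: integrable_iff_bounded)
 assume E: "E \<ge> 0" "(\<integral>\<^sup>+x. ennreal (norm (indicator \<Omega> x *\<^sub>R f x) powr p) \<partial>lebesgue) = ennreal E"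
 have "(LINT x|lebesgue. norm (indicator \<Omega> x *\<^sub>R f x) powr p) = E" using E m2 by (subst integral_eq_nn_integral) auto
 then show "Lp_norm p \<Omega> f = E powr (1/p)" unfolding Lp_norm_def LINT_def eq by simp
qed

lemma nn_integral_powr_diff_le:
 fixes f g :: "'a \<Rightarrow> 'b::euclidean_space"
 assumes "f \<in> borel_measurable M" "g \<in> borel_measurable M" "p \<ge> 1"
 shows "(\<integral>\<^sup>+x. ennreal (norm (f x - g x) powr p) \<partial>M) \<le> ennreal (2 powr (p - 1)) *
  ((\<integral>\<^sup>+x. ennreal (norm (f x) powr p) \<partial>M) + (\<integral>\<^sup>+x. ennreal (norm (g x) powr p) \<partial>M))"
proof -
 have "(1 - 1/2) powr (1 - p) = 2 powr (p - 1)" "(1/2) powr (1 - p) = 2 powr (p - 1)"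
  using powr_minus_divide[of 2 "1 - p"] by (simp_all add: powr_divide)
 then show ?thesis using nn_integral_convex_add[of "\<lambda>x. f x - g x" M f p "1/2"] assms by (simp add: distrib_left)
qed

lemma gradient_zero_off:
 assumes "\<phi> \<in> test_functions \<Omega>" "x \<notin> \<Omega>" shows "gradient \<phi> x = 0"
 using test_function_bounds[OF assms(1)] assms(2) by blast

section \<open>Extension to the closure and the extremal function\<close>

context hs_problem
begin

lemma local_L1_weighted:
 assumes f: "\<And>k::nat. f k \<in> Borel" and C: "compact C" and e: "e > 0"
  and L: "\<And>e. e > 0 \<Longrightarrow> tail_le (\<lambda>k. \<integral>x. dens x (f k x)) e" shows "tail_le (\<lambda>k. \<integral>x\<in>C. \<bar>f k x\<bar>) e"
proof -
 \<comment> \<open>The exponent is chosen so that \<open>\<rho> x powr (1 - q)\<close> is the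
   weight. It is positive, so \<open>\<rho>\<close> is bounded on compact sets, even where the
   weight is not.\<close>
 define \<rho> :: "'a \<times> 'b \<Rightarrow> real" where "\<rho> x = rad x powr (\<beta> / (q - 1))" for x
 have \<rho>q: "\<rho> x powr (1 - q) = wt x" for x
 proof -
  have "\<beta> / (q - 1) * (1 - q) = - \<beta>" using q1 by (simp add: field_simps)
  then show ?thesis unfolding \<rho>_def powr_powr wt_def by simp
 qed
 obtain R where R: "R > 0" "\<And>x. x \<in> C \<Longrightarrow> norm x \<le> R" using compact_imp_bounded[OF C] bounded_pos by metis
 have Cm[measurable]: "C \<in> sets borel" using C by (simp add: borel_compact)
 let ?A = "(\<integral>x\<in>C. \<rho> x)"
 have "?A \<le> (\<integral>\<^sup>+x. ennreal (R powr (\<beta> / (q - 1))) * indicator C x)"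
 proof (rule nn_integral_mono)
  fix x
  have "\<rho> x \<le> R powr (\<beta> / (q - 1))" if "x \<in> C"
   unfolding \<rho>_def using R(2)[OF that] norm_fst_le[of "fst x" "snd x"] q1 \<beta>_pos by (intro powr_mono2) (auto simp: rad_def)
  then show "ennreal (\<rho> x) * indicator C x \<le> ennreal (R powr (\<beta> / (q - 1))) * indicator C x"
   by (cases "x \<in> C") (simp_all add: ennreal_leI)
 qed
 also have "... < \<infinity>" using emeasure_bounded_finite[OF compact_imp_bounded[OF C]]
  by (simp add: nn_integral_cmult_indicator ennreal_mult_less_top)
 finally have fin: "?A < \<infinity>" .
 have "AE x in lborel. \<rho> x > 0" using AE_rad_pos by eventually_elim (simp add: \<rho>_def)
 moreover have "\<rho> \<in> Borel" unfolding \<rho>_def[abs_def] by measurable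
 ultimately show ?thesis using local_L1_small[of f \<rho> C q e] f Cm fin q1 L e by (simp add: \<rho>q)
qed

lemma local_L1_unweighted:
 fixes f :: "nat \<Rightarrow> 'a \<times> 'b \<Rightarrow> 'a \<times> 'b"
 assumes f: "\<And>k::nat. f k \<in> Borel" and C: "compact C" and e: "e > 0"
  and L: "\<And>e. e > 0 \<Longrightarrow> tail_le (\<lambda>k. \<integral>x. norm (f k x) powr p) e" shows "tail_le (\<lambda>k. \<integral>x\<in>C. norm (f k x)) e"
proof -
 have Cm[measurable]: "C \<in> sets borel" using C by (simp add: borel_compact)
 have "(\<integral>\<^sup>+x\<in>C. ennreal 1) < \<infinity>" using emeasure_bounded_finite[OF compact_imp_bounded[OF C]] by simp
 then show ?thesis using local_L1_small[of f "\<lambda>_. 1" C p e] f Cm p1 L e by simp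
qed

lemma mass_tendsto:
 assumes u: "\<And>k::nat. u k \<in> T" and V: "V \<in> Borel"
  and L: "\<And>e. e > 0 \<Longrightarrow> tail_le (\<lambda>k. \<integral>x. dens x (u k x - V x)) e"
 shows "\<exists>B\<ge>0. (\<integral>x. dens x (V x)) = ennreal B \<and> (\<lambda>k. mass UNIV (u k)) \<longlonglongrightarrow> B"
proof -
 define s where "s x = wt x powr (1/q)" for x
 have [measurable]: "s \<in> Borel" unfolding s_def[abs_def] by measurable
 have [measurable]: "u k \<in> Borel" for k by (rule T_measurable[OF u])
 note [measurable] = V
 have s1: "norm (s x * a) powr q = dens x a" for x a using q0 by (simp add: s_def abs_mult powr_mult powr_powr)
 have s2: "norm (s x * a - s x * b) powr q = dens x (a - b)" for x a b
  unfolding right_diff_distrib[symmetric] by (rule s1)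
 have "\<exists>B\<ge>0. (\<integral>x. norm (s x * V x) powr q) = ennreal B \<and> (\<lambda>k. mass UNIV (u k)) \<longlonglongrightarrow> B"
 proof (rule Lp_norm_tendsto[of "\<lambda>k x. s x * u k x"])
  show "(\<integral>x. norm (s x * u k x) powr q) = ennreal (mass UNIV (u k))" for k
   unfolding s1 using nn_integral_mass[OF u, of UNIV] by simp
 qed (use L q1 in \<open>simp_all only: s2 mass_nonneg\<close>, auto)
 then show ?thesis unfolding s1 .
qed

lemma energy_tendsto:
 assumes u: "\<And>k::nat. u k \<in> T" and G: "G \<in> borel_measurable M" and M: "M = lborel \<or> M = lebesgue"
  and L: "\<And>e. e > 0 \<Longrightarrow> tail_le (\<lambda>k. \<integral>\<^sup>+x. ennreal (norm (gradient (u k) x - G x) powr p) \<partial>M) e"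
 shows "\<exists>E\<ge>0. (\<integral>\<^sup>+x. ennreal (norm (G x) powr p) \<partial>M) = ennreal E \<and> (\<lambda>k. energy p (u k)) \<longlonglongrightarrow> E"
proof (rule Lp_norm_tendsto[OF _ G less_imp_le[OF p1] L energy_nonneg])
 show "gradient (u k) \<in> borel_measurable M" for k
  using M T_gradient_measurable[OF u, of k] by (auto simp: measurable_completion)
 show "(\<integral>\<^sup>+x. ennreal (grad_powr p (u k) x) \<partial>M) = ennreal (energy p (u k))" for k
  using M nn_integral_energy[OF T_C1c[OF u] p0, of k] by (auto simp: nn_integral_completion)
qed

text \<open>Convergence in the weighted norm implies local convergence in the mean of order one,
  which both identifies the weak gradient and supplies the last condition of
  \<open>homogeneous_sobolev\<close>. The definition refers to
  \<open>weak_gradient \<Omega> V\<close>, a possibly different representative \<open>W\<close> that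
  agrees with \<open>G\<close> almost everywhere in \<open>\<Omega>\<close>.\<close>

lemma sobolev_limitI:
 assumes u: "\<And>k::nat. u k \<in> T" and V: "V \<in> Borel" and G: "G \<in> Borel"
  and VL: "\<And>e. e > 0 \<Longrightarrow> tail_le (\<lambda>k. \<integral>x. dens x (u k x - V x)) e"
  and GL: "\<And>e. e > 0 \<Longrightarrow> tail_le (\<lambda>k. \<integral>x. norm (gradient (u k) x - G x) powr p) e"
 shows "has_weak_gradient \<Omega> V G" and "V \<in> homogeneous_sobolev p \<Omega>"
proof -
 have \<Omega>m[measurable]: "\<Omega> \<in> sets borel" using open_\<Omega> by simp
 have um[measurable]: "u k \<in> Borel" "gradient (u k) \<in> Borel" for k
  using T_measurable[OF u] T_gradient_measurable[OF u] by blast+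
 note [measurable] = V G
 have VC: "tail_le (\<lambda>k. \<integral>x\<in>C. \<bar>u k x - V x\<bar>) e" if "compact C" "e > 0" for C e
  by (rule local_L1_weighted[OF _ that VL]) measurable
 have GC: "tail_le (\<lambda>k. \<integral>x\<in>C. norm (gradient (u k) x - G x)) e" if "compact C" "e > 0" for C e
  by (rule local_L1_unweighted[OF _ that GL]) measurable
 show hG: "has_weak_gradient \<Omega> V G" by (rule has_weak_gradient_limit[OF open_\<Omega> u V G VC GC])
 define W where "W = weak_gradient \<Omega> V"
 have hW: "has_weak_gradient \<Omega> V W" unfolding W_def weak_gradient_def by (rule someI[of "has_weak_gradient \<Omega> V", OF hG])
 have ae: "AE x in lborel. x \<in> \<Omega> \<longrightarrow> W x = G x" by (rule has_weak_gradient_unique[OF open_\<Omega> hW hG])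
 have Wm: "set_borel_measurable lebesgue \<Omega> W"
  using hW by (intro locally_integrable_measurable open_\<Omega>) (simp add: has_weak_gradient_def)
 have le: "(\<integral>\<^sup>+x. ennreal (norm (indicator \<Omega> x *\<^sub>R (h x - W x)) powr p) \<partial>lebesgue) \<le> (\<integral>x. norm (h x - G x) powr p)" for h
  unfolding nn_integral_completion
  by (rule nn_integral_mono_AE, use ae in eventually_elim) (use p0 in \<open>auto simp: indicator_def\<close>)
 obtain E where "E \<ge> 0" "(\<integral>x. norm (G x) powr p) = ennreal E" using energy_tendsto[OF u _ _ GL] G by auto
 then have "in_Lp p \<Omega> W"
  using le[of "\<lambda>_. 0"] by (subst in_Lp_iff_nn_integral(1)[OF p0 Wm]) (auto intro: le_less_trans)
 moreover have "(\<lambda>k. Lp_norm p \<Omega> (\<lambda>x. gradient (u k) x - W x)) \<longlonglongrightarrow> 0"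
 proof (rule LIMSEQ_I)
  fix e :: real assume e: "e > 0"
  obtain N where N: "\<And>k. k \<ge> N \<Longrightarrow> (\<integral>x. norm (gradient (u k) x - G x) powr p) \<le> ennreal ((e/2) powr p)"
   using GL[of "(e/2) powr p"] e by auto
  have "norm (Lp_norm p \<Omega> (\<lambda>x. gradient (u k) x - W x) - 0) < e" if k: "k \<ge> N" for k
  proof -
   let ?D = "\<integral>\<^sup>+x. ennreal (norm (indicator \<Omega> x *\<^sub>R (gradient (u k) x - W x)) powr p) \<partial>lebesgue"
   have D: "?D \<le> ennreal ((e/2) powr p)" using le N[OF k] by (rule order.trans)
   then obtain d where d: "d \<ge> 0" "?D = ennreal d" by (cases ?D rule: ennreal_cases) (auto simp: top_unique)
   have m: "set_borel_measurable lebesgue \<Omega> (\<lambda>x. gradient (u k) x - W x)"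
    unfolding set_borel_measurable_def scaleR_diff_right
    by (intro borel_measurable_diff Wm[unfolded set_borel_measurable_def] measurable_completion) measurable
   have "Lp_norm p \<Omega> (\<lambda>x. gradient (u k) x - W x) = d powr (1/p)" by (rule in_Lp_iff_nn_integral(2)[OF p0 m d])
   also have "... \<le> ((e/2) powr p) powr (1/p)" using d D p0 by (intro powr_mono2) (auto simp: ennreal_le_iff)
   also have "... = e / 2" using e p0 by (simp add: powr_powr)
   finally have "Lp_norm p \<Omega> (\<lambda>x. gradient (u k) x - W x) \<le> e / 2" .
   moreover have "Lp_norm p \<Omega> (\<lambda>x. gradient (u k) x - W x) \<ge> 0" by (simp add: Lp_norm_def)
   ultimately show ?thesis using e by simp
  qed
  then show "\<exists>no. \<forall>k\<ge>no. norm (Lp_norm p \<Omega> (\<lambda>x. gradient (u k) x - W x) - 0) < e" by blast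
 qed
 moreover have "(\<lambda>k. LINT x:C|lebesgue. \<bar>u k x - V x\<bar>) \<longlonglongrightarrow> 0" if C: "compact C" for C
 proof (rule LIMSEQ_I)
  fix e :: real assume e: "e > 0"
  have Cm[measurable]: "C \<in> sets borel" using C by (simp add: borel_compact)
  obtain N where N: "\<And>k. k \<ge> N \<Longrightarrow> (\<integral>x\<in>C. \<bar>u k x - V x\<bar>) \<le> ennreal (e / 2)" using VC[OF C, of "e / 2"] e by auto
  have "norm ((LINT x:C|lebesgue. \<bar>u k x - V x\<bar>) - 0) < e" if k: "k \<ge> N" for k
  proof -
   have "(LINT x:C|lebesgue. \<bar>u k x - V x\<bar>) = (LINT x|lborel. indicator C x *\<^sub>R \<bar>u k x - V x\<bar>)"
    by (rule lborel_lebesgue_transfer(2)) measurable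
   also have "... = enn2real (\<integral>x. indicator C x *\<^sub>R \<bar>u k x - V x\<bar>)" by (rule integral_eq_nn_integral) auto
   also have "(\<integral>x. indicator C x *\<^sub>R \<bar>u k x - V x\<bar>) = (\<integral>x\<in>C. \<bar>u k x - V x\<bar>)"
    by (intro nn_integral_cong) (simp add: indicator_def)
   also have "enn2real ... \<le> e / 2" using N[OF k] e by (intro enn2real_leI) auto
   finally have "(LINT x:C|lebesgue. \<bar>u k x - V x\<bar>) \<le> e / 2" .
   moreover have "(LINT x:C|lebesgue. \<bar>u k x - V x\<bar>) \<ge> 0" unfolding LINT_def by (rule integral_nonneg_AE) simp
   ultimately show ?thesis using e by simp
  qed
  then show "\<exists>no. \<forall>k\<ge>no. norm ((LINT x:C|lebesgue. \<bar>u k x - V x\<bar>) - 0) < e" by blast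
 qed
 ultimately show "V \<in> homogeneous_sobolev p \<Omega>" unfolding homogeneous_sobolev_def W_def using hG u by blast
qed

text \<open>The approximating test functions are Cauchy in energy, hence by \<open>mass_le\<close>
  in the weighted norm. Their weighted limit coincides with \<open>v\<close> almost everywhere,
  because on each small ball some subsequence converges to \<open>v\<close>. A Borel representative
  is returned since \<open>v\<close> is only Lebesgue measurable.\<close>

lemma sobolev_inequality:
 assumes v: "v \<in> homogeneous_sobolev p \<Omega>"
 shows "\<exists>V B. V \<in> Borel \<and> (\<forall>x. x \<notin> \<Omega> \<longrightarrow> V x = 0) \<and> (AE x in lborel. x \<in> \<Omega> \<longrightarrow> v x = V x) \<and>
  B \<ge> 0 \<and> (\<integral>x. dens x (V x)) = ennreal B \<and>
  B powr (1/q) \<le> sharp powr (1/q) * Lp_norm p \<Omega> (weak_gradient \<Omega> v)"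
proof -
 define W where "W = weak_gradient \<Omega> v"
 obtain u :: "nat \<Rightarrow> 'a \<times> 'b \<Rightarrow> real" where u: "\<And>k. u k \<in> T"
  and GL: "(\<lambda>k. Lp_norm p \<Omega> (\<lambda>x. gradient (u k) x - W x)) \<longlonglongrightarrow> 0"
  and VL: "\<And>C. compact C \<Longrightarrow> C \<subseteq> \<Omega> \<Longrightarrow> (\<lambda>k. LINT x:C|lebesgue. \<bar>u k x - v x\<bar>) \<longlonglongrightarrow> 0"
  and W: "in_Lp p \<Omega> W" and ex: "\<exists>G. has_weak_gradient \<Omega> v G"
  using v unfolding homogeneous_sobolev_def W_def by blast
 have hW: "has_weak_gradient \<Omega> v W" unfolding W_def weak_gradient_def using someI_ex[OF ex] .
 have \<Omega>m[measurable]: "\<Omega> \<in> sets borel" using open_\<Omega> by simp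
 have um[measurable]: "u k \<in> Borel" "gradient (u k) \<in> Borel" for k
  using T_measurable[OF u] T_gradient_measurable[OF u] by blast+
 have Wm: "set_borel_measurable lebesgue \<Omega> W" using W by (simp add: in_Lp_def)
 \<comment> \<open>Extended by 0, the weak gradient can be compared on the whole space with the
   gradients of test functions, which vanish off \<open>\<Omega>\<close>.\<close>
 define g where "g x = indicator \<Omega> x *\<^sub>R W x" for x
 have gm: "g \<in> borel_measurable lebesgue" using Wm unfolding g_def[abs_def] set_borel_measurable_def .
 have gum: "gradient (u k) \<in> borel_measurable lebesgue" for k by (intro measurable_completion) measurable
 let ?B = "(\<integral>\<^sup>+x. ennreal (norm (g x) powr p) \<partial>lebesgue)"
 have gfin: "?B < \<infinity>" using W unfolding in_Lp_iff_nn_integral(1)[OF p0 Wm] g_def .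
 have off: "indicator \<Omega> x *\<^sub>R (gradient (u k) x - W x) = gradient (u k) x - g x" for k x
  using gradient_zero_off[OF u, of x k] by (cases "x \<in> \<Omega>") (auto simp: g_def)
 define d where "d k = enn2real (\<integral>\<^sup>+x. ennreal (norm (gradient (u k) x - g x) powr p) \<partial>lebesgue)" for k
 have d0: "d k \<ge> 0" for k by (simp add: d_def)
 have d: "(\<integral>\<^sup>+x. ennreal (norm (gradient (u k) x - g x) powr p) \<partial>lebesgue) = ennreal (d k)" for k
 proof -
  have "(\<integral>\<^sup>+x. ennreal (norm (gradient (u k) x - g x) powr p) \<partial>lebesgue) \<le> ennreal (2 powr (p - 1)) *
   ((\<integral>\<^sup>+x. ennreal (grad_powr p (u k) x) \<partial>lebesgue) + ?B)" using p1 by (intro nn_integral_powr_diff_le gum gm) simp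
  also have "... < \<infinity>"
   using gfin nn_integral_energy[OF T_C1c[OF u] p0, of k] by (auto simp: nn_integral_completion ennreal_mult_less_top)
  finally show ?thesis by (simp add: d_def less_top)
 qed
 have "Lp_norm p \<Omega> (\<lambda>x. gradient (u k) x - W x) = d k powr (1/p)" for k
 proof (rule in_Lp_iff_nn_integral(2)[OF p0 _ d0])
  show "set_borel_measurable lebesgue \<Omega> (\<lambda>x. gradient (u k) x - W x)"
   unfolding set_borel_measurable_def off by (intro borel_measurable_diff gum gm)
  show "(\<integral>\<^sup>+x. ennreal (norm (indicator \<Omega> x *\<^sub>R (gradient (u k) x - W x)) powr p) \<partial>lebesgue) = ennreal (d k)"
   unfolding off by (rule d)
 qed
 then have "(\<lambda>k. d k powr (1/p)) \<longlonglongrightarrow> 0" using GL by simp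
 then have "(\<lambda>k. (d k powr (1/p)) powr p) \<longlonglongrightarrow> 0 powr p" using p0 by (intro tendsto_powr' tendsto_const) auto
 then have dlim: "d \<longlonglongrightarrow> 0" using p0 d0 by (simp add: powr_powr)
 have dN: "\<exists>N. \<forall>k\<ge>N. d k < e" if "e > 0" for e
  using order_tendstoD(2)[OF dlim that] by (simp add: eventually_sequentially)
 have "tail_le (\<lambda>k. \<integral>\<^sup>+x. ennreal (norm (gradient (u k) x - g x) powr p) \<partial>lebesgue) e" if "e > 0" for e
  using dN[OF that] unfolding d by (meson ennreal_leI less_imp_le)
 from energy_tendsto[OF u gm _ this] obtain E where E: "E \<ge> 0" "?B = ennreal E" "(\<lambda>k. energy p (u k)) \<longlonglongrightarrow> E" by blast
 have LW: "Lp_norm p \<Omega> W = E powr (1/p)"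
  by (rule in_Lp_iff_nn_integral(2)[OF p0 Wm E(1)]) (use E(2) in \<open>simp only: g_def\<close>)
 have dT: "(\<lambda>x. u k x - u l x) \<in> T" for k l by (intro test_functions_diff u)
 have Ed: "energy p (\<lambda>x. u k x - u l x) \<le> 2 powr (p - 1) * (d k + d l)" for k l
 proof -
  have "ennreal (energy p (\<lambda>x. u k x - u l x)) = (\<integral>\<^sup>+x. ennreal (grad_powr p (\<lambda>x. u k x - u l x) x) \<partial>lebesgue)"
   using nn_integral_energy[OF T_C1c[OF dT[of k l]] p0] by (simp add: nn_integral_completion)
  also have "... = (\<integral>\<^sup>+x. ennreal (norm ((gradient (u k) x - g x) - (gradient (u l) x - g x)) powr p) \<partial>lebesgue)"
   by (simp add: gradient_diff[OF T_differentiable[OF u] T_differentiable[OF u]])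
  also have "... \<le> ennreal (2 powr (p - 1)) * (ennreal (d k) + ennreal (d l))"
   unfolding d[symmetric] using p1 by (intro nn_integral_powr_diff_le borel_measurable_diff gum gm) simp
  also have "... = ennreal (2 powr (p - 1) * (d k + d l))" using d0 by (simp flip: ennreal_plus ennreal_mult)
  finally show ?thesis using d0 by (subst (asm) ennreal_le_iff) auto
 qed
 have mC: "\<exists>N. \<forall>k\<ge>N. \<forall>l\<ge>N. mass UNIV (\<lambda>x. u k x - u l x) < e" if e: "e > 0" for e
 proof -
  \<comment> \<open>The energy at which the bound of \<open>mass_le\<close> equals
    \<open>e / 2\<close>.\<close>
  define \<eta> where "\<eta> = (e / (2 * sharp)) powr (p/q)"
  have \<eta>: "\<eta> > 0" using e sharp_pos by (simp add: \<eta>_def)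
  have \<eta>q: "\<eta> powr (q/p) = e / (2 * sharp)" using e sharp_pos p0 q0 by (simp add: \<eta>_def powr_powr)
  obtain N where N: "\<And>k. k \<ge> N \<Longrightarrow> d k < \<eta> / (2 * 2 powr (p - 1))" using dN[of "\<eta> / (2 * 2 powr (p - 1))"] \<eta> by auto
  have "mass UNIV (\<lambda>x. u k x - u l x) < e" if "k \<ge> N" "l \<ge> N" for k l
  proof -
   have "d k + d l \<le> \<eta> / 2 powr (p - 1)" using N[OF that(1)] N[OF that(2)] by simp
   then have "2 powr (p - 1) * (d k + d l) \<le> \<eta>" by (simp add: pos_le_divide_eq mult.commute)
   then have "energy p (\<lambda>x. u k x - u l x) \<le> \<eta>" using Ed[of k l] by linarith
   then have "energy p (\<lambda>x. u k x - u l x) powr (q/p) \<le> \<eta> powr (q/p)"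
    using energy_nonneg p0 q0 by (intro powr_mono2) auto
   then have "sharp * energy p (\<lambda>x. u k x - u l x) powr (q/p) \<le> sharp * (e / (2 * sharp))"
    unfolding \<eta>q using sharp_pos by (intro mult_left_mono) auto
   then have "mass UNIV (\<lambda>x. u k x - u l x) \<le> sharp * (e / (2 * sharp))" using mass_le[OF dT[of k l]] by linarith
   also have "... < e" using e sharp_pos by simp
   finally show ?thesis .
  qed
  then show ?thesis by blast
 qed
 obtain V0 r0 where V0m[measurable]: "V0 \<in> Borel" and r0: "strict_mono r0" "AE x in lborel. (\<lambda>k. u (r0 k) x) \<longlonglongrightarrow> V0 x"
  and V0L: "\<And>e. e > 0 \<Longrightarrow> tail_le (\<lambda>k. \<integral>x. dens x (u k x - V0 x)) e" using weighted_limit[of u] u mC by blast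
 define V where "V x = indicator \<Omega> x * V0 x" for x
 have Vm[measurable]: "V \<in> Borel" unfolding V_def[abs_def] by measurable
 have "\<bar>u k x - V x\<bar> \<le> \<bar>u k x - V0 x\<bar>" for k x
  using T_zero_outside[OF u, of x k] by (cases "x \<in> \<Omega>") (auto simp: V_def)
 then have "(\<integral>x. dens x (u k x - V x)) \<le> (\<integral>x. dens x (u k x - V0 x))" for k
  using q0 by (intro nn_integral_mono ennreal_leI mult_left_mono powr_mono2) auto
 then have V_lim: "tail_le (\<lambda>k. \<integral>x. dens x (u k x - V x)) e" if "e > 0" for e
  using V0L[OF that] by (meson order.trans)
 obtain B where B: "B \<ge> 0" "(\<integral>x. dens x (V x)) = ennreal B" "(\<lambda>k. mass UNIV (u k)) \<longlonglongrightarrow> B"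
  using mass_tendsto[OF u Vm V_lim] by blast
 have "(\<lambda>k. sharp * energy p (u k) powr (q/p)) \<longlonglongrightarrow> sharp * E powr (q/p)"
  using E(3) p0 q0 by (intro tendsto_mult tendsto_const tendsto_powr') (auto simp: energy_nonneg)
 then have "B \<le> sharp * E powr (q/p)" by (rule LIMSEQ_le[OF B(3)]) (use mass_le[OF u] in blast)
 then have "B powr (1/q) \<le> (sharp * E powr (q/p)) powr (1/q)" using B(1) q0 by (intro powr_mono2) auto
 also have "... = sharp powr (1/q) * Lp_norm p \<Omega> W" unfolding LW powr_mult powr_powr using q0 by simp
 finally have BW: "B powr (1/q) \<le> sharp powr (1/q) * Lp_norm p \<Omega> W" .
 have "AE x in lborel. x \<in> \<Omega> \<longrightarrow> v x = V x"
 proof (rule AE_locally_imp_AE)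
  fix x assume "x \<in> \<Omega>"
  then obtain r where r: "r > 0" "cball x r \<subseteq> \<Omega>" using open_\<Omega> open_contains_cball by blast
  let ?C = "cball x r"
  have vC: "integrable lebesgue (\<lambda>y. indicator ?C y *\<^sub>R v y)"
   using hW r(2) by (auto simp: has_weak_gradient_def locally_integrable_def set_integrable_def)
  have uC: "integrable lebesgue (\<lambda>y. indicator ?C y *\<^sub>R u k y)" for k
  proof -
   have "integrable lborel (u k)"
    by (rule integrable_continuous_bounded_support[OF C1c_continuous[OF T_C1c[OF u]] C1c_bounded_support[OF T_C1c[OF u]]])
   then have "integrable lebesgue (u k)" by (simp add: integrable_completion)
   then show ?thesis by (intro integrable_mult_indicator) auto
  qed
  have "integrable lebesgue (\<lambda>y. indicator ?C y *\<^sub>R (u k y - v y))" for k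
   unfolding scaleR_diff_right by (rule Bochner_Integration.integrable_diff[OF uC vC])
  moreover have "(\<lambda>k. LINT y|lebesgue. norm (indicator ?C y *\<^sub>R (u (r0 k) y - v y))) \<longlonglongrightarrow> 0"
   using LIMSEQ_subseq_LIMSEQ[OF VL[OF compact_cball r(2)] r0(1)] by (simp add: o_def LINT_def abs_mult)
  ultimately obtain s where s: "strict_mono s" "AE y in lborel. (\<lambda>k. indicator ?C y *\<^sub>R (u (r0 (s k)) y - v y)) \<longlonglongrightarrow> 0"
   using tendsto_L1_AE_subseq[of lebesgue "\<lambda>k y. indicator ?C y *\<^sub>R (u (r0 k) y - v y)"] unfolding AE_completion_iff by blast
  from s(2) r0(2) have "AE y in lborel. y \<in> ball x r \<longrightarrow> v y = V y"
  proof eventually_elim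
   fix y assume y: "(\<lambda>k. indicator ?C y *\<^sub>R (u (r0 (s k)) y - v y)) \<longlonglongrightarrow> 0" "(\<lambda>k. u (r0 k) y) \<longlonglongrightarrow> V0 y"
   have "v y = V y" if "y \<in> ball x r"
   proof (rule LIMSEQ_unique)
    show "(\<lambda>k. u (r0 (s k)) y) \<longlonglongrightarrow> v y" using y(1) that LIM_zero_cancel by simp
    have "y \<in> \<Omega>" using that by (intro subsetD[OF r(2)]) simp
    then show "(\<lambda>k. u (r0 (s k)) y) \<longlonglongrightarrow> V y"
     using LIMSEQ_subseq_LIMSEQ[OF y(2) s(1)] by (simp add: V_def o_def)
   qed
   then show "y \<in> ball x r \<longrightarrow> v y = V y" ..
  qed
  then show "\<exists>U. open U \<and> x \<in> U \<and> (AE y in lborel. y \<in> U \<longrightarrow> v y = V y)" using r(1) by (intro exI[of _ "ball x r"]) simp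
 qed
 moreover have "V x = 0" if "x \<notin> \<Omega>" for x using that by (simp add: V_def)
 ultimately show ?thesis using Vm B(1,2) BW unfolding W_def by blast
qed

text \<open>Since \<open>(\<sigma> - 1) * q = - \<beta>\<close>, the integrand is the density of the
  mass; it is evaluated through the Borel representative \<open>V\<close>.\<close>

lemma Lp_norm_hs_weighted:
 assumes \<sigma>: "\<beta> = (1 - \<sigma>) * q" and v: "v \<in> homogeneous_sobolev p \<Omega>"
  and V: "V \<in> Borel" "\<And>x. x \<notin> \<Omega> \<Longrightarrow> V x = 0" "AE x in lborel. x \<in> \<Omega> \<longrightarrow> v x = V x"
  and B: "B \<ge> 0" "(\<integral>x. dens x (V x)) = ennreal B"
 shows "in_Lp q \<Omega> (hs_weighted \<sigma> v)" and "Lp_norm q \<Omega> (hs_weighted \<sigma> v) = B powr (1/q)"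
proof -
 have "locally_integrable \<Omega> v" using v by (auto simp: homogeneous_sobolev_def has_weak_gradient_def)
 from locally_integrable_measurable[OF open_\<Omega> this]
 have vm: "(\<lambda>x. indicator \<Omega> x *\<^sub>R v x) \<in> borel_measurable lebesgue" by (simp add: set_borel_measurable_def)
 have "(\<lambda>x :: 'a \<times> 'b. rad x powr (\<sigma> - 1)) \<in> borel_measurable lebesgue" by (intro measurable_completion) measurable
 from borel_measurable_times[OF this vm] have m: "set_borel_measurable lebesgue \<Omega> (hs_weighted \<sigma> v)"
  by (simp add: set_borel_measurable_def hs_weighted_def[abs_def] rad_def mult.left_commute)
 have pw: "norm (hs_weighted \<sigma> f x) powr q = dens x (f x)" for f x
 proof -
  have "(\<sigma> - 1) * q = - \<beta>" by (simp add: \<sigma> algebra_simps)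
  then show ?thesis by (simp add: hs_weighted_def wt_def rad_def abs_mult powr_mult powr_powr)
 qed
 have "(\<integral>\<^sup>+x. ennreal (norm (indicator \<Omega> x *\<^sub>R hs_weighted \<sigma> v x) powr q) \<partial>lebesgue) = (\<integral>x. dens x (V x))"
  unfolding nn_integral_completion
 proof (rule nn_integral_cong_AE, use V(3) in eventually_elim)
  fix x assume "x \<in> \<Omega> \<longrightarrow> v x = V x"
  then show "ennreal (norm (indicator \<Omega> x *\<^sub>R hs_weighted \<sigma> v x) powr q) = ennreal (dens x (V x))"
   using V(2)[of x] pw[of v x] by (cases "x \<in> \<Omega>") auto
 qed
 then have eq: "(\<integral>\<^sup>+x. ennreal (norm (indicator \<Omega> x *\<^sub>R hs_weighted \<sigma> v x) powr q) \<partial>lebesgue) = ennreal B" using B(2) by simp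
 show "in_Lp q \<Omega> (hs_weighted \<sigma> v)" unfolding in_Lp_iff_nn_integral(1)[OF q0 m] eq by simp
 show "Lp_norm q \<Omega> (hs_weighted \<sigma> v) = B powr (1/q)" by (rule in_Lp_iff_nn_integral(2)[OF q0 m B(1) eq])
qed

text \<open>The limit has mass exactly \<open>sharp\<close>. Its gradient norm is at most 1 by
  passage to the limit, and the inequality of the first part forces it to be at least 1, so equality
  holds. That the norm is positive is recorded because minimality of the constant depends on
  it.\<close>

lemma extremal:
 assumes \<sigma>: "\<beta> = (1 - \<sigma>) * q"
 defines "N \<equiv> sharp powr (1/q)" shows "\<And>v. v \<in> homogeneous_sobolev p \<Omega> \<Longrightarrow> in_Lp q \<Omega> (hs_weighted \<sigma> v) \<and>
   Lp_norm q \<Omega> (hs_weighted \<sigma> v) \<le> N * Lp_norm p \<Omega> (weak_gradient \<Omega> v)"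
  and "\<exists>V\<in>homogeneous_sobolev p \<Omega>. (\<forall>x\<in>\<Omega>. V x > 0) \<and> Lp_norm p \<Omega> (weak_gradient \<Omega> V) > 0 \<and>
   Lp_norm q \<Omega> (hs_weighted \<sigma> V) = N * Lp_norm p \<Omega> (weak_gradient \<Omega> V)"
proof -
 show ineq: "in_Lp q \<Omega> (hs_weighted \<sigma> v) \<and> Lp_norm q \<Omega> (hs_weighted \<sigma> v) \<le> N * Lp_norm p \<Omega> (weak_gradient \<Omega> v)"
  if v: "v \<in> homogeneous_sobolev p \<Omega>" for v
 proof -
  obtain V B where V: "V \<in> Borel" "\<And>x. x \<notin> \<Omega> \<Longrightarrow> V x = 0" "AE x in lborel. x \<in> \<Omega> \<longrightarrow> v x = V x"
   and B: "B \<ge> 0" "(\<integral>x. dens x (V x)) = ennreal B"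
   and le: "B powr (1/q) \<le> sharp powr (1/q) * Lp_norm p \<Omega> (weak_gradient \<Omega> v)"
   using sobolev_inequality[OF v] by blast
  show ?thesis using Lp_norm_hs_weighted[OF \<sigma> v V B] le by (simp add: N_def)
 qed
 obtain u V G where u: "\<And>k::nat. u k \<in> T" and V: "V \<in> Borel" and G: "G \<in> Borel"
  and pos: "\<And>x. x \<in> \<Omega> \<Longrightarrow> V x > 0" and off: "\<And>x. x \<notin> \<Omega> \<Longrightarrow> V x = 0"
  and VL: "\<And>e. e > 0 \<Longrightarrow> tail_le (\<lambda>k. \<integral>x. dens x (u k x - V x)) e"
  and GL: "\<And>e. e > 0 \<Longrightarrow> tail_le (\<lambda>k. \<integral>x. norm (gradient (u k) x - G x) powr p) e"
  and lim: "(\<lambda>k. mass UNIV (u k)) \<longlonglongrightarrow> sharp" and E1: "\<And>k. energy p (u k) \<le> 1" using extremal_limit by blast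
 note [measurable] = V G
 have hG: "has_weak_gradient \<Omega> V G" and VH: "V \<in> homogeneous_sobolev p \<Omega>"
  using sobolev_limitI[OF u V G VL GL] by blast+
 obtain B where B: "B \<ge> 0" "(\<integral>x. dens x (V x)) = ennreal B" "(\<lambda>k. mass UNIV (u k)) \<longlonglongrightarrow> B"
  using mass_tendsto[OF u V VL] by blast
 have "B = sharp" using LIMSEQ_unique[OF B(3) lim] .
 then have eqN: "Lp_norm q \<Omega> (hs_weighted \<sigma> V) = N"
  using Lp_norm_hs_weighted(2)[OF \<sigma> VH V off _ B(1,2)] by (simp add: N_def)
 let ?B = "(\<integral>x. norm (G x) powr p)"
 obtain E where E: "E \<ge> 0" "?B = ennreal E" "(\<lambda>k. energy p (u k)) \<longlonglongrightarrow> E" using energy_tendsto[OF u _ _ GL] G by auto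
 have "E \<le> 1" by (rule LIMSEQ_le_const2[OF E(3)]) (use E1 in blast)
 define W where "W = weak_gradient \<Omega> V"
 have hW: "has_weak_gradient \<Omega> V W" unfolding W_def weak_gradient_def by (rule someI[of "has_weak_gradient \<Omega> V", OF hG])
 have Wm: "set_borel_measurable lebesgue \<Omega> W"
  using hW by (intro locally_integrable_measurable open_\<Omega>) (simp add: has_weak_gradient_def)
 let ?A = "(\<integral>\<^sup>+x. ennreal (norm (indicator \<Omega> x *\<^sub>R W x) powr p) \<partial>lebesgue)"
 have le: "?A \<le> ?B" unfolding nn_integral_completion
  by (rule nn_integral_mono_AE, use has_weak_gradient_unique[OF open_\<Omega> hW hG] in eventually_elim)
   (use p0 in \<open>auto simp: indicator_def\<close>)
 then obtain D where D: "D \<ge> 0" "?A = ennreal D"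
  unfolding E(2) by (cases "\<integral>\<^sup>+x. ennreal (norm (indicator \<Omega> x *\<^sub>R W x) powr p) \<partial>lebesgue" rule: ennreal_cases) (auto simp: top_unique)
 have "D \<le> 1" using le \<open>E \<le> 1\<close> E(1) unfolding D(2) E(2) by (simp add: ennreal_le_iff)
 have LW: "Lp_norm p \<Omega> W = D powr (1/p)" by (rule in_Lp_iff_nn_integral(2)[OF p0 Wm D])
 have "D powr (1/p) \<le> 1 powr (1/p)" using D(1) \<open>D \<le> 1\<close> p0 by (intro powr_mono2) auto
 then have L1: "Lp_norm p \<Omega> W \<le> 1" by (simp add: LW)
 have N0: "N > 0" using sharp_pos by (simp add: N_def)
 have NL: "N \<le> N * Lp_norm p \<Omega> W" using ineq[OF VH] by (simp add: eqN W_def)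
 then have "Lp_norm p \<Omega> W \<ge> 1" using N0 by simp
 then have "Lp_norm p \<Omega> W = 1" using L1 by simp
 then show "\<exists>V\<in>homogeneous_sobolev p \<Omega>. (\<forall>x\<in>\<Omega>. V x > 0) \<and> Lp_norm p \<Omega> (weak_gradient \<Omega> V) > 0 \<and>
   Lp_norm q \<Omega> (hs_weighted \<sigma> V) = N * Lp_norm p \<Omega> (weak_gradient \<Omega> V)"
  using VH pos eqN unfolding W_def by (intro bexI[OF _ VH]) simp
qed

end

theorem theorem2p2:
  fixes n m :: nat and p \<sigma> :: real
    and K :: "(real ^ 'm) set" and \<Omega> :: "((real ^ 'm) \<times> (real ^ 'k)) set"
  assumes "3 \<le> n" and "2 \<le> m" and "m \<le> n - 1"
    and "CARD('m) = m" and "CARD('k) = n - m"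
    and "1 < p" and "0 < \<sigma>" and "\<sigma> < min 1 (real n / p)"
    and "open_cone K"
    and "p > real m \<and> \<sigma> \<le> real n * (p - real m) / (p * (real n - real m)) \<Longrightarrow> K \<noteq> UNIV"
    and "\<Omega> = K \<times> UNIV"
  shows "\<exists>N. is_sharp_constant n p \<sigma> \<Omega> N \<and>
    (\<exists>V \<in> homogeneous_sobolev p \<Omega>. (\<forall>x\<in>\<Omega>. V x > 0) \<and>
       Lp_norm (critical_exponent n p \<sigma>) \<Omega> (hs_weighted \<sigma> V)
         = N * Lp_norm p \<Omega> (weak_gradient \<Omega> V))"
proof -
 define q where "q = critical_exponent n p \<sigma>"
 have nm: "real m < real n" "real m \<ge> 2" using assms(1-3) by linarith+
 have \<sigma>: "\<sigma> < 1" "\<sigma> * p < real n" using assms(6,8) by (simp_all add: pos_less_divide_eq)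
 have den: "real n - \<sigma> * p > 0" using \<sigma> by simp
 have q: "q = real n * p / (real n - \<sigma> * p)" by (simp add: q_def critical_exponent_def)
 have q_pos: "q > 0" using q den nm assms(6) by simp
 have qp: "q / p = real n / (real n - \<sigma> * p)" using assms(6) by (simp add: q)
 \<comment> \<open>This identity shows that \<open>(1 - \<sigma>) * q\<close>, the exponent of the
   weight in the \<open>q\<close>-th power of the norm, is the \<open>\<beta>\<close> of the
   locale.\<close>
 have "q/p - 1 = \<sigma> * p / (real n - \<sigma> * p)" unfolding qp using den by (simp add: divide_simps)
 then have "real n * (q/p - 1) = \<sigma> * q" by (simp add: q)
 then have \<beta>: "q - real n * (q/p - 1) = (1 - \<sigma>) * q" by (simp add: algebra_simps)
 have card: "DIM((real^'m) \<times> (real^'k)) = n" using assms(3,4,5) by simp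
 interpret hs_problem K \<Omega> p q "real n" "(1 - \<sigma>) * q"
 proof
  show "open_cone K" "\<Omega> = K \<times> UNIV" "1 < p" using assms by auto
  show "real n = real DIM((real^'m) \<times> (real^'k))" unfolding card ..
  have "real n * p > (real n - \<sigma> * p) * p" using assms(6,7) by (simp add: algebra_simps)
  then show "p < q" unfolding q using den by (simp add: pos_less_divide_eq mult.commute)
  show "(1 - \<sigma>) * q = q - real n * (q/p - 1)" using \<beta> by simp
  show "0 < (1 - \<sigma>) * q" using \<sigma> q_pos by simp
  show "(1 - \<sigma>) * q < real DIM(real^'m) \<or> K \<noteq> UNIV"
  proof (cases "(1 - \<sigma>) * q < real m")
   case True
   then show ?thesis using assms(4) by simp
  next
   \<comment> \<open>\<open>(1 - \<sigma>) * q \<ge> m\<close>, solved for \<open>\<sigma>\<close>,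
     is the bound in the exceptional hypothesis, and \<open>\<sigma> > 0\<close> then yields
     \<open>p > m\<close>. So \<open>K \<noteq> UNIV\<close> is supplied exactly when the weight is
     too singular.\<close>
   case False
   then have "real m * (real n - \<sigma> * p) \<le> (1 - \<sigma>) * (real n * p)"
    unfolding q using den by (simp add: not_less pos_le_divide_eq)
   then have *: "\<sigma> * (p * (real n - real m)) \<le> real n * (p - real m)" by (simp add: algebra_simps)
   moreover have pn: "p * (real n - real m) > 0" using nm assms(6) by simp
   moreover have "\<sigma> * (p * (real n - real m)) > 0" using pn assms(7) by simp
   ultimately have "real n * (p - real m) > 0" by linarith
   then have "p > real m" using nm by (simp add: zero_less_mult_iff)
   moreover have "\<sigma> \<le> real n * (p - real m) / (p * (real n - real m))" using * pn by (simp only: pos_le_divide_eq)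
   ultimately show ?thesis using assms(10) by blast
  qed
 qed
 define N where "N = sharp powr (1/q)"
 note ext = extremal[where \<sigma>=\<sigma>, OF refl, folded N_def]
 obtain V where V: "V \<in> homogeneous_sobolev p \<Omega>" "\<forall>x\<in>\<Omega>. V x > 0" "Lp_norm p \<Omega> (weak_gradient \<Omega> V) > 0"
  "Lp_norm q \<Omega> (hs_weighted \<sigma> V) = N * Lp_norm p \<Omega> (weak_gradient \<Omega> V)" using ext(2) by blast
 have "hardy_sobolev_inequality n p \<sigma> \<Omega> N"
  unfolding hardy_sobolev_inequality_def q_def[symmetric] using ext(1) by blast
 \<comment> \<open>Any other constant is tested on \<open>V\<close>, whose gradient norm is positive
   and can be cancelled.\<close>
 moreover have "N \<le> N'" if "hardy_sobolev_inequality n p \<sigma> \<Omega> N'" for N'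
 proof -
  have "N * Lp_norm p \<Omega> (weak_gradient \<Omega> V) \<le> N' * Lp_norm p \<Omega> (weak_gradient \<Omega> V)"
   using that V(1,4) unfolding hardy_sobolev_inequality_def q_def[symmetric] by metis
  then show ?thesis using V(3) by simp
 qed
 ultimately show ?thesis unfolding is_sharp_constant_def q_def[symmetric] using V by blast
qed

end
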